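(* There exist nilmanifolds $M=\Gamma\backslash G$ endowed with an invariant nilpotent complex structure $J$ such that $(M,J)$ admits an SKT metric but $(M,J)$ admits no geometrically-Bott-Chern-formal metric.
   Context: A nilmanifold is a compact quotient $M=\Gamma\backslash G$ of a simply connected nilpotent Lie group $G$ by a lattice $\Gamma$. A complex structure on $M$ is invariant if it is induced by a left-invariant one on $G$; an invariant complex structure $J$ is nilpotent if there is a basis $\{\eta^1,\dots,\eta^n\}$ of left-invariant $(1,0)$-forms with $d\eta^1=0$ and, for each $j\ge2$, $d\eta^j\in\bigwedge^2\langle\eta^1,\dots,\eta^{j-1},\overline{\eta^1},\dots,\overline{\eta^{j-1}}\rangle$. A Hermitian metric with fundamental form $\omega$ is SKT if $\partial\overline\partial\omega=0$. On a compact complex manifold with Hermitian metric $g$, a $(p,q)$-form $\alpha$ is Bott-Chern harmonic if $d\alpha=0$ and $\partial\overline\partial *_g\alpha=0$ ($*_g$ the $\mathbb C$-antilinear Hodge operator); $g$ is geometrically-Bott-Chern-formal if the space of Bott-Chern harmonic forms is closed under the wedge product. Metrics are not required to be invariant. *)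

theory Defs
  imports "HOL-Analysis.Analysis" "HOL-Algebra.Generated_Groups"
begin

text \<open>
  The dimension is existentially quantified in the result, so points of $R^N$ are functions
  \<open>nat \<Rightarrow> real\<close> vanishing from index \<open>N\<close> on (the library's \<^const>\<open>Euclidean_space\<close>).
  A complexified tangent vector is a function \<open>nat \<Rightarrow> complex\<close> vanishing from index \<open>N\<close> on.
\<close>

type_synonym pt = "nat \<Rightarrow> real"
type_synonym cvec = "nat \<Rightarrow> complex"

abbreviation RN :: "nat \<Rightarrow> pt set" where
  "RN N \<equiv> topspace (Euclidean_space N)"

definition CN :: "nat \<Rightarrow> cvec set" where
  "CN N = {v. \<forall>i\<ge>N. v i = 0}"

definition complexify :: "pt \<Rightarrow> cvec" where
  "complexify v = (\<lambda>i. complex_of_real (v i))"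

definition conj_vec :: "cvec \<Rightarrow> cvec" where
  "conj_vec v = (\<lambda>i. cnj (v i))"


section \<open>Smooth functions\<close>

definition partial_deriv :: "nat \<Rightarrow> (pt \<Rightarrow> 'a::real_normed_vector) \<Rightarrow> pt \<Rightarrow> 'a" where
  "partial_deriv j f x = vector_derivative (\<lambda>t. f (x(j := t))) (at (x j))"

text \<open>\<open>C_diff k N U f\<close>: on the open set \<open>U\<close>, all partial derivatives of \<open>f\<close> of order at most \<open>k\<close>
  exist and are continuous.\<close>

primrec C_diff :: "nat \<Rightarrow> nat \<Rightarrow> pt set \<Rightarrow> (pt \<Rightarrow> 'a::real_normed_vector) \<Rightarrow> bool" where
  "C_diff 0 N U f \<longleftrightarrow> continuous_map (subtopology (Euclidean_space N) U) euclidean f"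
| "C_diff (Suc k) N U f \<longleftrightarrow>
     continuous_map (subtopology (Euclidean_space N) U) euclidean f \<and>
     (\<forall>j<N. (\<forall>x\<in>U. (\<lambda>t. f (x(j := t))) differentiable at (x j)) \<and> C_diff k N U (partial_deriv j f))"

definition smooth_on :: "nat \<Rightarrow> pt set \<Rightarrow> (pt \<Rightarrow> 'a::real_normed_vector) \<Rightarrow> bool" where
  "smooth_on N U f \<longleftrightarrow> (\<forall>k. C_diff k N U f)"

definition differential :: "nat \<Rightarrow> (pt \<Rightarrow> complex) \<Rightarrow> pt \<Rightarrow> cvec \<Rightarrow> complex" where
  "differential N f x v = (\<Sum>j<N. v j * partial_deriv j f x)"


section \<open>Simply connected nilpotent Lie groups and nilmanifolds\<close>

text \<open>A Lie group with underlying manifold $R^N$. Smoothness of the multiplication is smoothness on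
  $R^{2N} = R^N \times R^N$, a point of $R^{2N}$ being split into its two halves. The exponential map of a simply
  connected nilpotent Lie group is a diffeomorphism, so every such group is isomorphic to one of
  this kind, and every group of this kind is simply connected.\<close>

definition lie_group_on_RN :: "nat \<Rightarrow> pt monoid \<Rightarrow> bool" where
  "lie_group_on_RN N G \<longleftrightarrow>
     group G \<and> carrier G = RN N \<and>
     (\<forall>i<N. smooth_on (2 * N) (RN (2 * N))
        (\<lambda>z. ((\<lambda>j. if j < N then z j else 0) \<otimes>\<^bsub>G\<^esub> (\<lambda>j. if j < N then z (N + j) else 0)) i)) \<and>
     (\<forall>i<N. smooth_on N (RN N) (\<lambda>x. (inv\<^bsub>G\<^esub> x) i))"

primrec lower_central :: "('a, 'b) monoid_scheme \<Rightarrow> nat \<Rightarrow> 'a set" where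
  "lower_central G 0 = carrier G"
| "lower_central G (Suc k) =
     generate G {x \<otimes>\<^bsub>G\<^esub> y \<otimes>\<^bsub>G\<^esub> inv\<^bsub>G\<^esub> x \<otimes>\<^bsub>G\<^esub> inv\<^bsub>G\<^esub> y | x y. x \<in> carrier G \<and> y \<in> lower_central G k}"

definition nilpotent_group :: "('a, 'b) monoid_scheme \<Rightarrow> bool" where
  "nilpotent_group G \<longleftrightarrow> (\<exists>k. lower_central G k = {\<one>\<^bsub>G\<^esub>})"

text \<open>A discrete subgroup whose space of orbits \<open>\<Gamma> x\<close> is compact in the quotient topology.\<close>

definition lattice_in :: "nat \<Rightarrow> pt monoid \<Rightarrow> pt set \<Rightarrow> bool" where
  "lattice_in N G \<Gamma> \<longleftrightarrow>
     subgroup \<Gamma> G \<and>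
     subtopology (Euclidean_space N) \<Gamma> = discrete_topology \<Gamma> \<and>
     (\<exists>X. quotient_map (Euclidean_space N) X (\<lambda>x. \<Gamma> #>\<^bsub>G\<^esub> x) \<and> compact_space X)"

definition nilmanifold :: "nat \<Rightarrow> pt monoid \<Rightarrow> pt set \<Rightarrow> bool" where
  "nilmanifold N G \<Gamma> \<longleftrightarrow> lie_group_on_RN N G \<and> nilpotent_group G \<and> lattice_in N G \<Gamma>"

definition push_left :: "nat \<Rightarrow> pt monoid \<Rightarrow> pt \<Rightarrow> pt \<Rightarrow> cvec \<Rightarrow> cvec" where
  "push_left N G a x v = (\<lambda>i. \<Sum>j<N. complex_of_real (partial_deriv j (\<lambda>y. (a \<otimes>\<^bsub>G\<^esub> y) i) x) * v j)"


section \<open>Complex-valued differential forms\<close>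

text \<open>A form takes a point and a list of complexified tangent vectors. A form of degree \<open>k\<close> vanishes
  on lists of length other than \<open>k\<close>. Values at points outside \<open>RN N\<close> and on vectors outside \<open>CN N\<close>
  are irrelevant.\<close>

type_synonym form = "pt \<Rightarrow> cvec list \<Rightarrow> complex"

definition multilinear_alternating :: "nat \<Rightarrow> nat \<Rightarrow> (cvec list \<Rightarrow> complex) \<Rightarrow> bool" where
  "multilinear_alternating N k f \<longleftrightarrow>
     (\<forall>us\<in>lists (CN N). \<forall>ws\<in>lists (CN N). \<forall>v\<in>CN N. \<forall>w\<in>CN N. \<forall>a b.
        length us + length ws + 1 = k \<longrightarrow>
        f (us @ (\<lambda>i. a * v i + b * w i) # ws) = a * f (us @ v # ws) + b * f (us @ w # ws)) \<and>
     (\<forall>vs\<in>lists (CN N). length vs = k \<and> \<not> distinct vs \<longrightarrow> f vs = 0) \<and>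
     (\<forall>vs\<in>lists (CN N). length vs \<noteq> k \<longrightarrow> f vs = 0)"

definition is_form :: "nat \<Rightarrow> nat \<Rightarrow> form \<Rightarrow> bool" where
  "is_form N k \<alpha> \<longleftrightarrow>
     (\<forall>x\<in>RN N. multilinear_alternating N k (\<alpha> x)) \<and>
     (\<forall>vs\<in>lists (CN N). smooth_on N (RN N) (\<lambda>x. \<alpha> x vs))"

definition form_eq :: "nat \<Rightarrow> form \<Rightarrow> form \<Rightarrow> bool" where
  "form_eq N \<alpha> \<beta> \<longleftrightarrow> (\<forall>x\<in>RN N. \<forall>vs\<in>lists (CN N). \<alpha> x vs = \<beta> x vs)"

abbreviation zero_form :: form where
  "zero_form \<equiv> (\<lambda>x vs. 0)"

text \<open>Forms on \<open>\<Gamma>\G\<close> are the forms on \<open>G\<close> invariant under left translation by \<open>H = \<Gamma>\<close>;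
  left-invariant forms are those with \<open>H = carrier G\<close>.\<close>

definition invariant_form :: "nat \<Rightarrow> pt monoid \<Rightarrow> pt set \<Rightarrow> form \<Rightarrow> bool" where
  "invariant_form N G H \<alpha> \<longleftrightarrow>
     (\<forall>a\<in>H. \<forall>x\<in>RN N. \<forall>vs\<in>lists (CN N). \<alpha> (a \<otimes>\<^bsub>G\<^esub> x) (map (push_left N G a x) vs) = \<alpha> x vs)"

definition conj_form :: "form \<Rightarrow> form" where
  "conj_form \<alpha> = (\<lambda>x vs. cnj (\<alpha> x (map conj_vec vs)))"

definition shuffle_sign :: "nat \<Rightarrow> nat set \<Rightarrow> complex" where
  "shuffle_sign m S = (-1) ^ card {(i, j). i < j \<and> j < m \<and> i \<notin> S \<and> j \<in> S}"

text \<open>Sum over all shuffles. For \<open>\<alpha>\<close> of degree \<open>k\<close> only the sets \<open>S\<close> of cardinality \<open>k\<close> contribute.\<close>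

definition wedge :: "form \<Rightarrow> form \<Rightarrow> form" where
  "wedge \<alpha> \<beta> = (\<lambda>x vs. \<Sum>S\<in>Pow {..<length vs}.
     shuffle_sign (length vs) S * \<alpha> x (nths vs S) * \<beta> x (nths vs (- S)))"

primrec wedge_power :: "form \<Rightarrow> nat \<Rightarrow> form" where
  "wedge_power \<alpha> 0 = (\<lambda>x vs. if vs = [] then 1 else 0)"
| "wedge_power \<alpha> (Suc k) = wedge \<alpha> (wedge_power \<alpha> k)"

definition ext_deriv :: "nat \<Rightarrow> form \<Rightarrow> form" where
  "ext_deriv N \<alpha> = (\<lambda>x vs. \<Sum>i<length vs.
     (-1) ^ i * differential N (\<lambda>y. \<alpha> y (take i vs @ drop (Suc i) vs)) x (vs ! i))"


section \<open>Almost complex structures and bidegree\<close>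

text \<open>An almost complex structure is given by its matrix at each point.\<close>

type_synonym tensor2 = "pt \<Rightarrow> nat \<Rightarrow> nat \<Rightarrow> real"

definition apply_J :: "nat \<Rightarrow> tensor2 \<Rightarrow> pt \<Rightarrow> cvec \<Rightarrow> cvec" where
  "apply_J N J x v = (\<lambda>i. if i < N then \<Sum>j<N. complex_of_real (J x i j) * v j else 0)"

definition almost_complex :: "nat \<Rightarrow> tensor2 \<Rightarrow> bool" where
  "almost_complex N J \<longleftrightarrow>
     (\<forall>i<N. \<forall>j<N. smooth_on N (RN N) (\<lambda>x. J x i j)) \<and>
     (\<forall>x\<in>RN N. \<forall>v\<in>CN N. apply_J N J x (apply_J N J x v) = (\<lambda>i. - v i))"

text \<open>Around each point there are \<open>n\<close> smooth functions \<open>z\<^sub>0, \<dots>, z\<^sub>n\<^sub>-\<^sub>1\<close> that are holomorphic for \<open>J\<close> and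
  have linearly independent differentials. By the inverse function theorem they form, near the
  point, a chart with values in $C^n$ in which \<open>J\<close> is multiplication by the imaginary unit.\<close>

definition complex_structure :: "nat \<Rightarrow> tensor2 \<Rightarrow> bool" where
  "complex_structure n J \<longleftrightarrow>
     almost_complex (2 * n) J \<and>
     (\<forall>x\<in>RN (2 * n). \<exists>U (z :: nat \<Rightarrow> pt \<Rightarrow> complex).
        openin (Euclidean_space (2 * n)) U \<and> x \<in> U \<and>
        (\<forall>k<n. smooth_on (2 * n) U (z k)) \<and>
        (\<forall>y\<in>U. \<forall>k<n. \<forall>v\<in>CN (2 * n).
           differential (2 * n) (z k) y (apply_J (2 * n) J y v) = \<i> * differential (2 * n) (z k) y v) \<and>
        (\<forall>y\<in>U. \<forall>c. (\<forall>v\<in>CN (2 * n). (\<Sum>k<n. c k * differential (2 * n) (z k) y v) = 0)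
           \<longrightarrow> (\<forall>k<n. c k = 0)))"

definition left_invariant_J :: "nat \<Rightarrow> pt monoid \<Rightarrow> tensor2 \<Rightarrow> bool" where
  "left_invariant_J N G J \<longleftrightarrow>
     (\<forall>a\<in>carrier G. \<forall>x\<in>carrier G. \<forall>v\<in>CN N.
        push_left N G a x (apply_J N J x v) = apply_J N J (a \<otimes>\<^bsub>G\<^esub> x) (push_left N G a x v))"

definition invariant_complex_structure :: "nat \<Rightarrow> pt monoid \<Rightarrow> tensor2 \<Rightarrow> bool" where
  "invariant_complex_structure n G J \<longleftrightarrow> complex_structure n J \<and> left_invariant_J (2 * n) G J"

definition T10 :: "nat \<Rightarrow> tensor2 \<Rightarrow> pt \<Rightarrow> cvec set" where
  "T10 N J x = {v\<in>CN N. apply_J N J x v = (\<lambda>i. \<i> * v i)}"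

definition T01 :: "nat \<Rightarrow> tensor2 \<Rightarrow> pt \<Rightarrow> cvec set" where
  "T01 N J x = {v\<in>CN N. apply_J N J x v = (\<lambda>i. - \<i> * v i)}"

definition is_pq_form :: "nat \<Rightarrow> tensor2 \<Rightarrow> nat \<Rightarrow> nat \<Rightarrow> form \<Rightarrow> bool" where
  "is_pq_form N J p q \<alpha> \<longleftrightarrow>
     is_form N (p + q) \<alpha> \<and>
     (\<forall>x\<in>RN N. \<forall>us\<in>lists (T10 N J x). \<forall>ws\<in>lists (T01 N J x). length us \<noteq> p \<longrightarrow> \<alpha> x (us @ ws) = 0)"

definition proj10 :: "nat \<Rightarrow> tensor2 \<Rightarrow> pt \<Rightarrow> cvec \<Rightarrow> cvec" where
  "proj10 N J x v = (\<lambda>i. (v i - \<i> * apply_J N J x v i) / 2)"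

definition proj01 :: "nat \<Rightarrow> tensor2 \<Rightarrow> pt \<Rightarrow> cvec \<Rightarrow> cvec" where
  "proj01 N J x v = (\<lambda>i. (v i + \<i> * apply_J N J x v i) / 2)"

text \<open>The component of bidegree \<open>(p, q)\<close> of a form.\<close>

definition pq_part :: "nat \<Rightarrow> tensor2 \<Rightarrow> nat \<Rightarrow> nat \<Rightarrow> form \<Rightarrow> form" where
  "pq_part N J p q \<alpha> = (\<lambda>x vs.
     if length vs = p + q
     then \<Sum>S\<in>{S. S \<subseteq> {..<p + q} \<and> card S = p}.
            \<alpha> x (map (\<lambda>i. if i \<in> S then proj10 N J x (vs ! i) else proj01 N J x (vs ! i)) [0..<p + q])
     else 0)"

text \<open>\<open>del\<close> and \<open>delbar\<close> are the sums over all bidegrees \<open>(p, q)\<close> of the components of bidegree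
  \<open>(p + 1, q)\<close> and \<open>(p, q + 1)\<close> of \<open>d\<close> applied to the component of bidegree \<open>(p, q)\<close>; on a list of
  \<open>m\<close> vectors only \<open>p + q + 1 = m\<close> contributes.\<close>

definition del :: "nat \<Rightarrow> tensor2 \<Rightarrow> form \<Rightarrow> form" where
  "del N J \<alpha> = (\<lambda>x vs. \<Sum>p<length vs. let q = length vs - 1 - p in
     pq_part N J (p + 1) q (ext_deriv N (pq_part N J p q \<alpha>)) x vs)"

definition delbar :: "nat \<Rightarrow> tensor2 \<Rightarrow> form \<Rightarrow> form" where
  "delbar N J \<alpha> = (\<lambda>x vs. \<Sum>p<length vs. let q = length vs - 1 - p in
     pq_part N J p (q + 1) (ext_deriv N (pq_part N J p q \<alpha>)) x vs)"

text \<open>\<open>\<eta>\<close> is a basis of the left-invariant \<open>(1,0)\<close>-forms whose differentials satisfy the nilpotency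
  condition. Indices start at 0, so the condition for \<open>j = 0\<close> reads \<open>d \<eta>\<^sub>0 = 0\<close>.\<close>

definition nilpotent_complex_structure :: "nat \<Rightarrow> pt monoid \<Rightarrow> tensor2 \<Rightarrow> bool" where
  "nilpotent_complex_structure n G J \<longleftrightarrow> (let N = 2 * n in
     \<exists>\<eta> :: nat \<Rightarrow> form.
       (\<forall>j<n. is_pq_form N J 1 0 (\<eta> j) \<and> invariant_form N G (carrier G) (\<eta> j)) \<and>
       (\<forall>\<alpha>. is_pq_form N J 1 0 \<alpha> \<and> invariant_form N G (carrier G) \<alpha> \<longrightarrow>
          (\<exists>!c. c \<in> extensional {..<n} \<and> form_eq N \<alpha> (\<lambda>x vs. \<Sum>j<n. c j * \<eta> j x vs))) \<and>
       (\<forall>j<n. \<exists>A B C :: nat \<Rightarrow> nat \<Rightarrow> complex.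
          form_eq N (ext_deriv N (\<eta> j))
            (\<lambda>x vs. \<Sum>k<j. \<Sum>l<j.
                 A k l * wedge (\<eta> k) (\<eta> l) x vs
               + B k l * wedge (\<eta> k) (conj_form (\<eta> l)) x vs
               + C k l * wedge (conj_form (\<eta> k)) (conj_form (\<eta> l)) x vs)))"


section \<open>Hermitian metrics and the Hodge operator\<close>

text \<open>The complex bilinear extension of a metric with matrix \<open>g\<close>.\<close>

definition metric :: "nat \<Rightarrow> tensor2 \<Rightarrow> pt \<Rightarrow> cvec \<Rightarrow> cvec \<Rightarrow> complex" where
  "metric N g x v w = (\<Sum>i<N. \<Sum>j<N. complex_of_real (g x i j) * v i * w j)"

text \<open>Hermitian metrics on \<open>\<Gamma>\G\<close>: only invariance under \<open>\<Gamma>\<close> is required.\<close>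

definition hermitian_metric :: "nat \<Rightarrow> pt monoid \<Rightarrow> pt set \<Rightarrow> tensor2 \<Rightarrow> tensor2 \<Rightarrow> bool" where
  "hermitian_metric n G \<Gamma> J g \<longleftrightarrow> (let N = 2 * n in
     (\<forall>i<N. \<forall>j<N. smooth_on N (RN N) (\<lambda>x. g x i j)) \<and>
     (\<forall>x\<in>RN N. \<forall>i<N. \<forall>j<N. g x i j = g x j i) \<and>
     (\<forall>x\<in>RN N. \<forall>v\<in>RN N. v \<noteq> (\<lambda>i. 0) \<longrightarrow> 0 < (\<Sum>i<N. \<Sum>j<N. g x i j * v i * v j)) \<and>
     (\<forall>x\<in>RN N. \<forall>v\<in>CN N. \<forall>w\<in>CN N. metric N g x (apply_J N J x v) (apply_J N J x w) = metric N g x v w) \<and>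
     (\<forall>a\<in>\<Gamma>. \<forall>x\<in>RN N. \<forall>v\<in>CN N. \<forall>w\<in>CN N.
        metric N g (a \<otimes>\<^bsub>G\<^esub> x) (push_left N G a x v) (push_left N G a x w) = metric N g x v w))"

definition fundamental_form :: "nat \<Rightarrow> tensor2 \<Rightarrow> tensor2 \<Rightarrow> form" where
  "fundamental_form N J g = (\<lambda>x vs.
     if length vs = 2 then metric N g x (apply_J N J x (vs ! 0)) (vs ! 1) else 0)"

definition SKT :: "nat \<Rightarrow> tensor2 \<Rightarrow> tensor2 \<Rightarrow> bool" where
  "SKT n J g \<longleftrightarrow> (let N = 2 * n in
     form_eq N (del N J (delbar N J (fundamental_form N J g))) zero_form)"

definition orthonormal_frame :: "nat \<Rightarrow> tensor2 \<Rightarrow> pt \<Rightarrow> pt list \<Rightarrow> bool" where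
  "orthonormal_frame N g x e \<longleftrightarrow>
     length e = N \<and> set e \<subseteq> RN N \<and>
     (\<forall>i<N. \<forall>j<N. metric N g x (complexify (e ! i)) (complexify (e ! j)) = (if i = j then 1 else 0))"

text \<open>The Hermitian volume form $\omega^n / n!$.\<close>

definition volume_form :: "nat \<Rightarrow> tensor2 \<Rightarrow> tensor2 \<Rightarrow> form" where
  "volume_form n J g = (\<lambda>x vs. wedge_power (fundamental_form (2 * n) J g) n x vs / fact n)"

text \<open>The antilinear Hodge operator: \<open>\<alpha> \<and> *\<beta> = \<langle>\<alpha>, \<beta>\<rangle> vol\<close>, where for an orthonormal frame \<open>e\<close>
  $\langle\alpha, \beta\rangle = \sum_I \alpha(e_I) \overline{\beta(e_I)}$. Solving for \<open>*\<beta>\<close> gives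
  $({*}\beta)(v) = \sum_I \overline{\beta(e_I)} \, vol(e_I, v)$, independently of the frame.\<close>

definition hodge_star :: "nat \<Rightarrow> tensor2 \<Rightarrow> tensor2 \<Rightarrow> form \<Rightarrow> form" where
  "hodge_star n J g \<beta> = (\<lambda>x vs.
     let e = map complexify (SOME e. orthonormal_frame (2 * n) g x e) in
     \<Sum>I\<in>Pow {..<2 * n}. cnj (\<beta> x (nths e I)) * volume_form n J g x (nths e I @ vs))"


section \<open>Bott-Chern harmonic forms\<close>

definition bott_chern_harmonic ::
  "nat \<Rightarrow> pt monoid \<Rightarrow> pt set \<Rightarrow> tensor2 \<Rightarrow> tensor2 \<Rightarrow> nat \<Rightarrow> nat \<Rightarrow> form \<Rightarrow> bool" where
  "bott_chern_harmonic n G \<Gamma> J g p q \<alpha> \<longleftrightarrow> (let N = 2 * n in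
     is_pq_form N J p q \<alpha> \<and> invariant_form N G \<Gamma> \<alpha> \<and>
     form_eq N (ext_deriv N \<alpha>) zero_form \<and>
     form_eq N (del N J (delbar N J (hodge_star n J g \<alpha>))) zero_form)"

text \<open>The space of Bott-Chern harmonic forms is the direct sum over all bidegrees, and the wedge
  product is bilinear, so closedness under it is a condition on pairs of pure bidegree.\<close>

definition geometrically_BC_formal ::
  "nat \<Rightarrow> pt monoid \<Rightarrow> pt set \<Rightarrow> tensor2 \<Rightarrow> tensor2 \<Rightarrow> bool" where
  "geometrically_BC_formal n G \<Gamma> J g \<longleftrightarrow>
     (\<forall>p q r s \<alpha> \<beta>.
        bott_chern_harmonic n G \<Gamma> J g p q \<alpha> \<and> bott_chern_harmonic n G \<Gamma> J g r s \<beta> \<longrightarrow>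
        bott_chern_harmonic n G \<Gamma> J g (p + r) (q + s) (wedge \<alpha> \<beta>))"

end

(* The example is the product of two Kodaira-Thurston manifolds, with invariant (1,0)-coframe dz_k,
   dw_k - conj(z_k) dz_k for k = 1, 2; the invariant metric for which this coframe is unitary is SKT.

   Let g be any Hermitian metric, invariant under the lattice only. A closed 1-form theta among dz_k and
   conj(dz_k) is Bott-Chern harmonic, since del delbar *theta has degree 9 on an 8-dimensional manifold.
   If g were formal, then Omega = dz_1 dz_2 conj(dz_1) conj(dz_2) would be harmonic as well, so
   psi = *Omega would satisfy del delbar psi = 0. Evaluate this on the coordinate fields
   (Z_1, Z_2, W_2, conj Z_1, conj Z_2, conj W_1) and average over the unit cube. Lattice invariance makes the
   averages of the derivatives of most components vanish. The one exception is the component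
   psi(Z_1, W_2, conj Z_2, conj W_1), differentiated along Z_2 and conj Z_1: lattice translations add multiples
   of W_1 to Z_1 and of conj W_2 to conj Z_2, so its second derivative averages to a positive multiple of
   averages of psi(W_1, W_2, conj W_2, conj W_1) over fibres. The latter is minus the squared modulus of a
   nonzero determinant times the volume of a complex frame, so it is negative: a contradiction. *)
theory Submission
  imports Defs "Jordan_Normal_Form.Determinant"
begin

text \<open>Up to sign, Omega is del delbar of (dw_1 - conj(z_1) dz_1) wedge conj(dw_2 - conj(z_2)
  dz_2), so its Bott-Chern class is zero. A harmonic form of zero class must vanish, since Stokes
  makes the integral of Omega wedge *Omega zero, whereas Omega vanishes nowhere. The averages carry
  out this use of Stokes in coordinates: the six chosen fields omit exactly W_1 and conj W_2, the
  fields dual to the two coframe members in that primitive. The obstacle is that the metric is only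
  lattice invariant, so psi has non-constant components. On constant coordinate fields d has no
  bracket terms and the bidegree splitting is the same at every point; the price is that a component
  of psi is periodic in the base coordinates only up to other components, and only up to a shear of
  the fibre. Averaging over the fibre first removes the shear. The choice of two factors also serves
  the SKT side: one factor contributes only the square of dz_k wedge conj(dz_k), which is 0, while
  the product over different factors is the nonzero Omega.\<close>

declare in_listsD [rule del] in_listsI [rule del]

section \<open>Alternating multilinear functions on lists\<close>

text \<open>No degree is fixed, so that inserting a vector in front stays within the notion and
  inductions over argument lists go through. Only adjacent equal arguments are required to give 0;
  \<open>alt_not_distinct\<close> recovers the general case.\<close>

definition alt :: "nat \<Rightarrow> (cvec list \<Rightarrow> complex) \<Rightarrow> bool" where
  "alt N f \<longleftrightarrow>
     (\<forall>us\<in>lists (CN N). \<forall>ws\<in>lists (CN N). \<forall>v\<in>CN N. \<forall>w\<in>CN N. \<forall>a b.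
        f (us @ (\<lambda>i. a * v i + b * w i) # ws) = a * f (us @ v # ws) + b * f (us @ w # ws)) \<and>
     (\<forall>us\<in>lists (CN N). \<forall>ws\<in>lists (CN N). \<forall>v\<in>CN N. f (us @ v # v # ws) = 0)"

lemma CN_lincomb: "v \<in> CN N \<Longrightarrow> w \<in> CN N \<Longrightarrow> (\<lambda>i. a * v i + b * w i) \<in> CN N"
  by (simp add: CN_def)

lemma CN_zero: "(\<lambda>i. 0) \<in> CN N"
  by (simp add: CN_def)

lemma CN_scale: "v \<in> CN N \<Longrightarrow> (\<lambda>i. a * v i) \<in> CN N"
  by (simp add: CN_def)

lemma CN_sum: "(\<And>k. k \<in> A \<Longrightarrow> b k \<in> CN N) \<Longrightarrow> (\<lambda>i. \<Sum>k\<in>A. c k * b k i) \<in> CN N"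
  by (simp add: CN_def)

lemma altI:
  assumes "\<And>us ws v w a b. us \<in> lists (CN N) \<Longrightarrow> ws \<in> lists (CN N) \<Longrightarrow> v \<in> CN N \<Longrightarrow> w \<in> CN N \<Longrightarrow>
     f (us @ (\<lambda>i. a * v i + b * w i) # ws) = a * f (us @ v # ws) + b * f (us @ w # ws)"
    and "\<And>us ws v. us \<in> lists (CN N) \<Longrightarrow> ws \<in> lists (CN N) \<Longrightarrow> v \<in> CN N \<Longrightarrow> f (us @ v # v # ws) = 0"
  shows "alt N f"
  using assms unfolding alt_def by blast

lemma alt_lin:
  assumes "alt N f" "us \<in> lists (CN N)" "ws \<in> lists (CN N)" "v \<in> CN N" "w \<in> CN N"
  shows "f (us @ (\<lambda>i. a * v i + b * w i) # ws) = a * f (us @ v # ws) + b * f (us @ w # ws)"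
  using assms unfolding alt_def by blast

lemma alt_eq0:
  assumes "alt N f" "us \<in> lists (CN N)" "ws \<in> lists (CN N)" "v \<in> CN N"
  shows "f (us @ v # v # ws) = 0"
  using assms unfolding alt_def by blast

lemma alt_append: "alt N f \<Longrightarrow> ps \<in> lists (CN N) \<Longrightarrow> alt N (\<lambda>us. f (ps @ us))"
proof -
  assume f: "alt N f" and ps: "ps \<in> lists (CN N)"
  show ?thesis
  proof (rule altI)
    fix us ws v w a b
    assume "us \<in> lists (CN N)" "ws \<in> lists (CN N)" "v \<in> CN N" "w \<in> CN N"
    then show "f (ps @ us @ (\<lambda>i. a * v i + b * w i) # ws) = a * f (ps @ us @ v # ws) + b * f (ps @ us @ w # ws)"
      using alt_lin [OF f, of "ps @ us" ws v w a b] ps by simp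
  next
    fix us ws v
    assume "us \<in> lists (CN N)" "ws \<in> lists (CN N)" "v \<in> CN N"
    then show "f (ps @ us @ v # v # ws) = 0"
      using alt_eq0 [OF f, of "ps @ us" ws v] ps by simp
  qed
qed

lemma alt_Cons: "alt N f \<Longrightarrow> v \<in> CN N \<Longrightarrow> alt N (\<lambda>us. f (v # us))"
  using alt_append [of N f "[v]"] by simp

lemma alt_append_right: "alt N f \<Longrightarrow> ps \<in> lists (CN N) \<Longrightarrow> alt N (\<lambda>us. f (us @ ps))"
  unfolding alt_def by simp

lemma alt_cmult: "alt N f \<Longrightarrow> alt N (\<lambda>us. c * f us)"
  unfolding alt_def by (auto simp: algebra_simps)

text \<open>The factor depends only on the length of the list, which is the same for all lists in
  one identity of \<open>alt\<close>. This is the sign that \<open>wdg\<close> puts on its left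
  factor.\<close>

lemma alt_signed: "alt N f \<Longrightarrow> alt N (\<lambda>us. (-1) ^ length us * f us)"
  unfolding alt_def by (auto simp: algebra_simps)

lemma alt_add: "alt N f \<Longrightarrow> alt N g \<Longrightarrow> alt N (\<lambda>us. f us + g us)"
  unfolding alt_def by (auto simp: algebra_simps)

lemma alt_zero_fun: "alt N (\<lambda>us. 0)"
  unfolding alt_def by auto

lemma alt_cong:
  assumes "\<And>us. us \<in> lists (CN N) \<Longrightarrow> f us = g us"
  shows "alt N f \<longleftrightarrow> alt N g"
  unfolding alt_def using assms by (auto simp: CN_lincomb)

lemma alt_sum_fun:
  assumes "\<And>k. k \<in> A \<Longrightarrow> alt N (f k)" shows "alt N (\<lambda>us. \<Sum>k\<in>A. f k us)"
  using assms by (induction A rule: infinite_finite_induct) (auto simp: alt_zero_fun alt_add)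

lemma alt_zero:
  assumes "alt N f" "us \<in> lists (CN N)" "ws \<in> lists (CN N)"
  shows "f (us @ (\<lambda>i. 0) # ws) = 0"
  using alt_lin [OF assms CN_zero CN_zero, of 0 0] by simp

lemma alt_scale:
  assumes "alt N f" "us \<in> lists (CN N)" "ws \<in> lists (CN N)" "v \<in> CN N"
  shows "f (us @ (\<lambda>i. a * v i) # ws) = a * f (us @ v # ws)"
  using alt_lin [OF assms CN_zero, of a 0] by simp

lemma alt_sum:
  assumes "alt N f" "us \<in> lists (CN N)" "ws \<in> lists (CN N)" "finite A" "\<And>k. k \<in> A \<Longrightarrow> b k \<in> CN N"
  shows "f (us @ (\<lambda>i. \<Sum>k\<in>A. c k * b k i) # ws) = (\<Sum>k\<in>A. c k * f (us @ b k # ws))"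
  using assms(4,5)
proof (induction A rule: finite_induct)
  case empty
  then show ?case using alt_zero [OF assms(1-3)] by simp
next
  case (insert k A)
  have "f (us @ (\<lambda>i. c k * b k i + 1 * (\<Sum>k\<in>A. c k * b k i)) # ws) =
      c k * f (us @ b k # ws) + 1 * f (us @ (\<lambda>i. \<Sum>k\<in>A. c k * b k i) # ws)"
    using insert.prems by (intro alt_lin [OF assms(1-3)] CN_sum) auto
  then show ?case using insert by simp
qed

lemma alt_swap:
  assumes "alt N f" "us \<in> lists (CN N)" "ws \<in> lists (CN N)" "v \<in> CN N" "w \<in> CN N"
  shows "f (us @ v # w # ws) = - f (us @ w # v # ws)"
proof -
  let ?s = "\<lambda>i. 1 * v i + 1 * w i"
  have s: "?s \<in> CN N" using assms by (intro CN_lincomb)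
  have l1: "f (us @ ?s # z # ws) = f (us @ v # z # ws) + f (us @ w # z # ws)" if "z \<in> CN N" for z
    using alt_lin [OF assms(1,2) _ assms(4,5), of "z # ws" 1 1] that assms by simp
  have l2: "f (us @ z # ?s # ws) = f (us @ z # v # ws) + f (us @ z # w # ws)" if "z \<in> CN N" for z
    using alt_lin [OF assms(1) _ assms(3-5), of "us @ [z]" 1 1] that assms by simp
  have "0 = f (us @ ?s # ?s # ws)"
    using alt_eq0 [OF assms(1-3) s] by simp
  also have "\<dots> = f (us @ v # w # ws) + f (us @ w # v # ws)"
    using l1 [OF s] l2 [OF assms(4)] l2 [OF assms(5)] alt_eq0 [OF assms(1-3)] assms by simp
  finally show ?thesis by (simp add: eq_neg_iff_add_eq_0)
qed

lemma alt_move: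
  assumes "alt N f" "us \<in> lists (CN N)" "ws \<in> lists (CN N)" "v \<in> CN N"
  shows "f (us @ v # ws) = (-1) ^ length us * f (v # us @ ws)"
  using assms(2,3)
proof (induction us arbitrary: ws rule: rev_induct)
  case Nil
  then show ?case by simp
next
  case (snoc u us)
  have "f ((us @ [u]) @ v # ws) = - f (us @ v # u # ws)"
    using alt_swap [OF assms(1), of us ws u v] snoc.prems assms(4) by simp
  then show ?case using snoc assms(4) by simp
qed

lemma alt_not_distinct:
  assumes "alt N f" "vs \<in> lists (CN N)" "\<not> distinct vs"
  shows "f vs = 0"
proof -
  obtain us ms ws v where vs: "vs = us @ [v] @ ms @ [v] @ ws"
    using not_distinct_decomp [OF assms(3)] by blast
  have g: "alt N (\<lambda>xs. f ((us @ [v]) @ xs))"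
    by (rule alt_append [OF assms(1)]) (use vs assms(2) in auto)
  have "f ((us @ [v]) @ ms @ v # ws) = (-1) ^ length ms * f ((us @ [v]) @ v # ms @ ws)"
    by (rule alt_move [OF g]) (use vs assms(2) in auto)
  then show ?thesis using vs alt_eq0 [OF assms(1), of us "ms @ ws" v] assms(2) by simp
qed

lemma alt_repeated:
  assumes "alt N f" "us \<in> lists (CN N)" "ws \<in> lists (CN N)" "v \<in> set ws"
  shows "f (us @ v # ws) = 0"
proof (rule alt_not_distinct [OF assms(1)])
  have "v \<in> CN N" using assms(3,4) unfolding in_lists_conv_set by blast
  then show "us @ v # ws \<in> lists (CN N)" using assms(2,3) by (simp only: append_in_lists_conv Cons_in_lists_iff)
  show "\<not> distinct (us @ v # ws)" using assms(4) by (simp only: distinct_append distinct.simps) blast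
qed

text \<open>The degree enters only as vanishing on lists of other lengths, and on those lengths
  every term of the identities of \<open>alt\<close> is 0.\<close>

lemma multilinear_alternating_iff:
  "multilinear_alternating N k f \<longleftrightarrow>
     (alt N f \<and> (\<forall>vs\<in>lists (CN N). length vs \<noteq> k \<longrightarrow> f vs = 0))" (is "?L \<longleftrightarrow> ?R")
proof
  assume L: ?L
  show ?R
  proof (intro conjI altI)
    fix us ws v w a b
    assume "us \<in> lists (CN N)" "ws \<in> lists (CN N)" "v \<in> CN N" "w \<in> CN N"
    then show "f (us @ (\<lambda>i. a * v i + b * w i) # ws) = a * f (us @ v # ws) + b * f (us @ w # ws)"
      using L CN_lincomb unfolding multilinear_alternating_def
      by (cases "length us + length ws + 1 = k") auto
  next
    fix us ws v
    assume "us \<in> lists (CN N)" "ws \<in> lists (CN N)" "v \<in> CN N"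
    then show "f (us @ v # v # ws) = 0"
      using L unfolding multilinear_alternating_def
      by (cases "length us + length ws + 2 = k") auto
  qed (use L in \<open>auto simp: multilinear_alternating_def\<close>)
next
  assume R: ?R
  then show ?L
    unfolding multilinear_alternating_def using alt_lin alt_not_distinct by blast
qed

text \<open>Pigeonhole: expanding the vectors of \<open>us\<close> one by one moves basis vectors
  into \<open>bs\<close>, until \<open>bs\<close> holds more than \<open>m\<close> entries taken
  from \<open>m\<close> vectors and must repeat one.\<close>

lemma alt_span_basis:
  assumes "alt N f" and B: "\<And>k. k < m \<Longrightarrow> b k \<in> CN N"
    and "set us \<subseteq> range (\<lambda>c i. \<Sum>k<m. c k * b k i)" "ws \<in> lists (CN N)"
    and "set bs \<subseteq> b ` {..<m}" "length bs + length us > m"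
  shows "f (bs @ us @ ws) = 0"
  using assms(3,5,6)
proof (induction us arbitrary: bs rule: list.induct)
  case Nil
  have "card (set bs) \<le> card (b ` {..<m})"
    using Nil by (intro card_mono) auto
  also have "\<dots> \<le> m" using card_image_le [of "{..<m}" b] by simp
  finally have "\<not> distinct bs" using Nil distinct_card by fastforce
  moreover have "bs \<in> lists (CN N)" using Nil B by (auto simp: in_lists_conv_set)
  ultimately show ?case using alt_not_distinct [OF assms(1)] assms(4) by simp
next
  case (Cons u us)
  then obtain c where u: "u = (\<lambda>i. \<Sum>k<m. c k * b k i)" by auto
  have bs: "bs \<in> lists (CN N)" using Cons.prems B by (auto simp: in_lists_conv_set)
  have "us \<in> lists (CN N)"
    using Cons.prems B by (fastforce simp: in_lists_conv_set intro!: CN_sum)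
  then have "f (bs @ (\<lambda>i. \<Sum>k<m. c k * b k i) # us @ ws) = (\<Sum>k<m. c k * f (bs @ b k # us @ ws))"
    using B assms(4) bs by (intro alt_sum [OF assms(1)]) auto
  also have "\<dots> = (\<Sum>k<m. c k * 0)"
  proof (intro sum.cong refl arg_cong2 [of _ _ _ _ "(*)"])
    fix k assume "k \<in> {..<m}"
    then show "f (bs @ b k # us @ ws) = 0"
      using Cons.IH [of "bs @ [b k]"] Cons.prems by simp
  qed
  finally show ?case by (simp add: u)
qed

section \<open>Coordinate vectors and vanishing above the dimension\<close>

definition basis_vec :: "nat \<Rightarrow> cvec" where
  "basis_vec j = (\<lambda>i. if i = j then 1 else 0)"

lemma basis_vec_CN: "j < N \<Longrightarrow> basis_vec j \<in> CN N"
  by (auto simp: basis_vec_def CN_def)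

lemma CN_expand: "v \<in> CN N \<Longrightarrow> v = (\<lambda>i. \<Sum>j<N. v j * basis_vec j i)"
  by (rule ext) (auto simp: basis_vec_def CN_def if_distrib [of "\<lambda>x. _ * x"] cong: if_cong)

text \<open>This is what kills del delbar of the Hodge star of a 1-form, a form of degree one more
  than the dimension.\<close>

lemma alt_too_long:
  assumes "alt N f" "vs \<in> lists (CN N)" "length vs > N"
  shows "f vs = 0"
proof -
  have "v \<in> range (\<lambda>c i. \<Sum>k<N. c k * basis_vec k i)" if "v \<in> CN N" for v
    by (rule range_eqI [where x = v]) (rule CN_expand [OF that])
  then have "set vs \<subseteq> range (\<lambda>c i. \<Sum>k<N. c k * basis_vec k i)"
    using assms(2) by (auto simp: in_lists_conv_set)
  then show ?thesis
    using alt_span_basis [OF assms(1), of N basis_vec vs "[]" "[]"] assms(3) basis_vec_CN by simp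
qed

section \<open>The wedge product by recursion on the list of arguments\<close>

text \<open>Subsets are split by whether they contain 0, and the shift by \<open>Suc\<close> matches
  the passage from \<open>v # vs\<close> to \<open>vs\<close>. The sums defining
  \<open>wedge\<close>, \<open>hodge_star\<close> and \<open>pq_part\<close> are all turned into
  recursions this way.\<close>

lemma sum_Pow_Suc:
  "(\<Sum>S\<in>Pow {..<Suc m}. F S) = (\<Sum>S\<in>Pow {..<m}. F (insert 0 (Suc ` S)) + F (Suc ` S))"
proof -
  have inj: "inj_on (\<lambda>S. Suc ` S) X" "inj_on (\<lambda>S. insert 0 (Suc ` S)) X" for X
  proof -
    show "inj_on (\<lambda>S. Suc ` S) X" by (rule inj_onI) (simp add: inj_image_eq_iff)
    show "inj_on (\<lambda>S. insert 0 (Suc ` S)) X"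
    proof (rule inj_onI)
      fix x y assume "insert 0 (Suc ` x) = insert 0 (Suc ` y)"
      then have "Suc ` x = Suc ` y" by (metis Diff_insert_absorb image_iff nat.distinct(1))
      then show "x = y" by (simp add: inj_image_eq_iff)
    qed
  qed
  have "Pow {..<Suc m} = (\<lambda>S. insert 0 (Suc ` S)) ` Pow {..<m} \<union> (\<lambda>S. Suc ` S) ` Pow {..<m}"
  proof -
    have "Pow (Suc ` {..<m}) = (\<lambda>S. Suc ` S) ` Pow {..<m}"
      by (rule image_Pow_surj [symmetric]) simp
    then show ?thesis
      unfolding lessThan_Suc_eq_insert_0 Pow_insert by (simp add: image_image Un_commute)
  qed
  moreover have "(\<lambda>S. insert 0 (Suc ` S)) ` Pow {..<m} \<inter> (\<lambda>S. Suc ` S) ` Pow {..<m} = {}"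
  proof -
    have "insert 0 (Suc ` S) \<noteq> Suc ` S'" for S S' by (metis image_iff insertI1 nat.distinct(1))
    then show ?thesis by blast
  qed
  ultimately show ?thesis
    by (simp add: sum.union_disjoint sum.reindex [OF inj(1)] sum.reindex [OF inj(2)] sum.distrib)
qed

text \<open>The wedge product at one point, deciding for the first argument whether it goes to
  \<open>f\<close> or to \<open>g\<close>. If it goes to \<open>g\<close>, it has to pass every
  argument of \<open>f\<close>; their number is not yet known, so the sign is stored inside the left
  function.\<close>

primrec wdg :: "cvec list \<Rightarrow> (cvec list \<Rightarrow> complex) \<Rightarrow> (cvec list \<Rightarrow> complex) \<Rightarrow> complex" where
  "wdg [] f g = f [] * g []"
| "wdg (v # vs) f g = wdg vs (\<lambda>us. f (v # us)) g
     + wdg vs (\<lambda>us. (-1) ^ length us * f us) (\<lambda>us. g (v # us))"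

lemma shuffle_sign_insert_0: "shuffle_sign (Suc m) (insert 0 (Suc ` S)) = shuffle_sign m S"
proof -
  have "{(i, j). i < j \<and> j < Suc m \<and> i \<notin> insert 0 (Suc ` S) \<and> j \<in> insert 0 (Suc ` S)} =
      map_prod Suc Suc ` {(i, j). i < j \<and> j < m \<and> i \<notin> S \<and> j \<in> S}" (is "?A = ?f ` ?B")
  proof (intro equalityI subsetI)
    fix z assume "z \<in> ?A"
    moreover obtain i j where "z = (i, j)" by fastforce
    ultimately show "z \<in> ?f ` ?B"
      by (cases i; cases j) (auto intro!: image_eqI [where x = "(i - 1, j - 1)"])
  qed auto
  moreover have "inj_on ?f ?B" by (auto simp: inj_on_def)
  ultimately show ?thesis by (simp add: shuffle_sign_def card_image)
qed

text \<open>When 0 is left out of the set, the new inversions are exactly the pairs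
  \<open>(0, Suc j)\<close> with \<open>j\<close> in \<open>S\<close>.\<close>

lemma shuffle_sign_Suc:
  assumes "S \<subseteq> {..<m}"
  shows "shuffle_sign (Suc m) (Suc ` S) = (-1) ^ card S * shuffle_sign m S"
proof -
  let ?f = "map_prod Suc Suc" and ?B = "{(i, j). i < j \<and> j < m \<and> i \<notin> S \<and> j \<in> S}"
  have "{(i, j). i < j \<and> j < Suc m \<and> i \<notin> Suc ` S \<and> j \<in> Suc ` S} =
      ?f ` ?B \<union> (\<lambda>j. (0, Suc j)) ` S" (is "?A = _")
  proof (intro equalityI subsetI)
    fix z assume "z \<in> ?A"
    moreover obtain i j where "z = (i, j)" by fastforce
    ultimately show "z \<in> ?f ` ?B \<union> (\<lambda>j. (0, Suc j)) ` S"
      by (cases i; cases j) (auto intro!: image_eqI [where x = "(i - 1, j - 1)"])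
  qed (use assms in auto)
  moreover have "card (?f ` ?B \<union> (\<lambda>j. (0, Suc j)) ` S) = card (?f ` ?B) + card ((\<lambda>j. (0::nat, Suc j)) ` S)"
  proof (rule card_Un_disjoint)
    have "?B \<subseteq> {..<m} \<times> {..<m}" by auto
    then show "finite (?f ` ?B)" using finite_subset by blast
    show "finite ((\<lambda>j. (0::nat, Suc j)) ` S)" using assms finite_subset by blast
  qed auto
  moreover have "card (?f ` ?B) = card ?B" by (rule card_image) (auto simp: inj_on_def)
  moreover have "card ((\<lambda>j. (0::nat, Suc j)) ` S) = card S" by (rule card_image) (auto simp: inj_on_def)
  ultimately show ?thesis by (simp add: shuffle_sign_def power_add)
qed

lemma nths_insert_0: "nths (v # vs) (insert 0 (Suc ` S)) = v # nths vs S"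
  "nths (v # vs) (- insert 0 (Suc ` S)) = nths vs (- S)"
  "nths (v # vs) (Suc ` S) = nths vs S"
  "nths (v # vs) (- (Suc ` S)) = v # nths vs (- S)"
proof -
  have *: "{j. Suc j \<in> insert 0 (Suc ` S)} = S" "{j. Suc j \<in> - insert 0 (Suc ` S)} = - S"
    "{j. Suc j \<in> Suc ` S} = S" "{j. Suc j \<in> - Suc ` S} = - S"
    by auto
  have "0 \<notin> Suc ` S" by auto
  then show "nths (v # vs) (insert 0 (Suc ` S)) = v # nths vs S"
    "nths (v # vs) (- insert 0 (Suc ` S)) = nths vs (- S)"
    "nths (v # vs) (Suc ` S) = nths vs S"
    "nths (v # vs) (- (Suc ` S)) = v # nths vs (- S)"
    unfolding nths_Cons * by simp_all
qed

lemma length_nths_subset: "S \<subseteq> {..<length vs} \<Longrightarrow> length (nths vs S) = card S"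
  by (auto simp: length_nths intro!: arg_cong [of _ _ card])

lemma wdg_eq_sum:
  "(\<Sum>S\<in>Pow {..<length vs}. shuffle_sign (length vs) S * f (nths vs S) * g (nths vs (- S))) = wdg vs f g"
proof (induction vs arbitrary: f g rule: list.induct)
  case Nil
  then show ?case by (simp add: shuffle_sign_def)
next
  case (Cons v vs)
  show ?case
    by (simp only: length_Cons sum_Pow_Suc wdg.simps Cons.IH [symmetric] sum.distrib [symmetric])
       (intro sum.cong refl; simp add: nths_insert_0 shuffle_sign_insert_0 shuffle_sign_Suc length_nths_subset)
qed

lemma wedge_wdg: "wedge \<alpha> \<beta> x vs = wdg vs (\<alpha> x) (\<beta> x)"
  unfolding wedge_def by (rule wdg_eq_sum)

lemma wdg_cong:
  assumes "vs \<in> lists X" "\<And>us. us \<in> lists X \<Longrightarrow> f us = f' us" "\<And>us. us \<in> lists X \<Longrightarrow> g us = g' us"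
  shows "wdg vs f g = wdg vs f' g'"
  using assms
proof (induction vs arbitrary: f g f' g' rule: list.induct)
  case (Cons v vs)
  have "wdg vs (\<lambda>us. f (v # us)) g = wdg vs (\<lambda>us. f' (v # us)) g'"
    using Cons.prems by (intro Cons.IH) auto
  moreover have "wdg vs (\<lambda>us. (-1) ^ length us * f us) (\<lambda>us. g (v # us)) =
      wdg vs (\<lambda>us. (-1) ^ length us * f' us) (\<lambda>us. g' (v # us))"
    using Cons.prems by (intro Cons.IH) auto
  ultimately show ?case by simp
qed simp

lemma wdg_lin_left: "wdg vs (\<lambda>u. a * f u + b * f' u) g = a * wdg vs f g + b * wdg vs f' g"
proof (induction vs arbitrary: f f' g rule: list.induct)
  case (Cons v vs)
  have "(\<lambda>us. (-1) ^ length us * (a * f us + b * f' us)) =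
      (\<lambda>us. a * ((-1) ^ length us * f us) + b * ((-1) ^ length us * f' us))"
    by (simp add: algebra_simps)
  then show ?case by (simp add: Cons.IH algebra_simps)
qed (simp add: algebra_simps)

lemma wdg_lin_right: "wdg vs f (\<lambda>u. a * g u + b * g' u) = a * wdg vs f g + b * wdg vs f g'"
  by (induction vs arbitrary: f g g') (simp_all add: algebra_simps)

lemma wdg_scale_left: "wdg vs (\<lambda>u. a * f u) g = a * wdg vs f g"
  using wdg_lin_left [of vs a f 0 f g] by simp

lemma wdg_zero_left [simp]: "wdg vs (\<lambda>u. 0) g = 0"
  using wdg_scale_left [of vs 0] by simp

lemma wdg_zero_right [simp]: "wdg vs f (\<lambda>u. 0) = 0"
  using wdg_lin_right [of vs f 0 _ 0] by simp

lemma wdg_map: "wdg (map p vs) f g = wdg vs (\<lambda>us. f (map p us)) (\<lambda>us. g (map p us))"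
  by (induction vs arbitrary: f g) simp_all

lemma alt_wdg:
  assumes "alt N f" "alt N g"
  shows "alt N (\<lambda>vs. wdg vs f g)"
proof (rule altI)
  fix us ws v w a b
  assume us: "us \<in> lists (CN N)" and "ws \<in> lists (CN N)" "v \<in> CN N" "w \<in> CN N"
  note ws = this(2-)
  show "wdg (us @ (\<lambda>i. a * v i + b * w i) # ws) f g = a * wdg (us @ v # ws) f g + b * wdg (us @ w # ws) f g"
    using us assms
  proof (induction us arbitrary: f g rule: list.induct)
    case Nil
    have "wdg ws (\<lambda>us. f ((\<lambda>i. a * v i + b * w i) # us)) g
        = wdg ws (\<lambda>us. a * f (v # us) + b * f (w # us)) g"
      using alt_lin [OF Nil(2), of "[]"] ws by (intro wdg_cong [where X = "CN N"]) auto
    moreover have "wdg ws (\<lambda>us. (-1) ^ length us * f us) (\<lambda>us. g ((\<lambda>i. a * v i + b * w i) # us))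
        = wdg ws (\<lambda>us. (-1) ^ length us * f us) (\<lambda>us. a * g (v # us) + b * g (w # us))"
      using alt_lin [OF Nil(3), of "[]"] ws by (intro wdg_cong [where X = "CN N"]) auto
    ultimately show ?case by (simp add: wdg_lin_left wdg_lin_right algebra_simps)
  next
    case (Cons u us)
    then have "alt N (\<lambda>us. f (u # us))" "alt N (\<lambda>us. g (u # us))" "us \<in> lists (CN N)"
      by (auto intro: alt_Cons)
    note Cons.IH [OF this(3,1) Cons.prems(3)] Cons.IH [OF this(3) alt_signed [OF Cons.prems(2)] this(2)]
    then show ?case by (simp add: ring_distribs)
  qed
next
  fix us ws v
  assume us: "us \<in> lists (CN N)" and "ws \<in> lists (CN N)" "v \<in> CN N"
  note ws = this(2-)
  show "wdg (us @ v # v # ws) f g = 0"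
    using us assms
  proof (induction us arbitrary: f g rule: list.induct)
    case Nil
    have "wdg ws (\<lambda>us. f (v # v # us)) g = wdg ws (\<lambda>us. 0) g"
      using alt_eq0 [OF Nil(2), of "[]"] ws by (intro wdg_cong [where X = "CN N"]) auto
    moreover have "wdg ws F (\<lambda>us. g (v # v # us)) = wdg ws F (\<lambda>us. 0)" for F
      using alt_eq0 [OF Nil(3), of "[]"] ws by (intro wdg_cong [where X = "CN N"]) auto
    \<comment> \<open>One copy of \<open>v\<close> goes to each factor, in both orders. In one order
      the other copy of \<open>v\<close> is counted among the arguments of \<open>f\<close>, which
      reverses the sign, so the mixed terms cancel.\<close>
    moreover have "wdg ws (\<lambda>us. (-1) ^ length us * f (v # us)) G +
        wdg ws (\<lambda>us. (-1) ^ length (v # us) * f (v # us)) G = 0" for G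
      using wdg_scale_left [of ws "-1" "\<lambda>us. (-1) ^ length us * f (v # us)" G] by simp
    ultimately show ?case by simp
  next
    case (Cons u us)
    then show ?case by (simp add: alt_Cons alt_signed)
  qed
qed

lemma wdg_degree:
  assumes "vs \<in> lists X" "\<And>us. us \<in> lists X \<Longrightarrow> length us \<noteq> k \<Longrightarrow> f us = 0"
    "\<And>us. us \<in> lists X \<Longrightarrow> length us \<noteq> l \<Longrightarrow> g us = 0" "length vs \<noteq> k + l"
  shows "wdg vs f g = 0"
  using assms
proof (induction vs arbitrary: f g k l rule: list.induct)
  case Nil
  then show ?case by (cases "k = 0") auto
next
  case (Cons v vs)
  have "wdg vs (\<lambda>us. f (v # us)) g = 0"
  proof (cases k)
    case 0
    then have "wdg vs (\<lambda>us. f (v # us)) g = wdg vs (\<lambda>us. 0) g"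
      using Cons.prems by (intro wdg_cong [where X = X]) auto
    then show ?thesis by simp
  next
    case (Suc k')
    then show ?thesis using Cons.prems by (intro Cons.IH [where k = k' and l = l]) auto
  qed
  moreover have "wdg vs (\<lambda>us. (-1) ^ length us * f us) (\<lambda>us. g (v # us)) = 0"
  proof (cases l)
    case 0
    then have "wdg vs (\<lambda>us. (-1) ^ length us * f us) (\<lambda>us. g (v # us)) =
        wdg vs (\<lambda>us. (-1) ^ length us * f us) (\<lambda>us. 0)"
      using Cons.prems by (intro wdg_cong [where X = X]) auto
    then show ?thesis by simp
  next
    case (Suc l')
    then show ?thesis using Cons.prems by (intro Cons.IH [where k = k and l = l']) auto
  qed
  ultimately show ?case by simp
qed

lemma wdg_0form:
  assumes "vs \<in> lists X" "\<And>us. us \<in> lists X \<Longrightarrow> length us \<noteq> 0 \<Longrightarrow> f us = 0"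
  shows "wdg vs f g = f [] * g vs"
  using assms
proof (induction vs arbitrary: f g rule: list.induct)
  case (Cons v vs)
  have "wdg vs (\<lambda>us. f (v # us)) g = wdg vs (\<lambda>us. 0) g"
    using Cons.prems by (intro wdg_cong [where X = X]) auto
  moreover have "wdg vs (\<lambda>us. (-1) ^ length us * f us) (\<lambda>us. g (v # us)) = f [] * g (v # vs)"
    using Cons.prems by (subst Cons.IH) auto
  ultimately show ?case by simp
qed simp

text \<open>Contraction with \<open>v\<close> is an antiderivation of the exterior algebra.\<close>

lemma wdg_1form:
  assumes "v \<in> X" "vs \<in> lists X" "\<And>us. us \<in> lists X \<Longrightarrow> length us \<noteq> 1 \<Longrightarrow> f us = 0"
  shows "wdg (v # vs) f g = f [v] * g vs - wdg vs f (\<lambda>us. g (v # us))"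
proof -
  have "wdg vs (\<lambda>us. f (v # us)) g = f [v] * g vs"
    using assms by (intro wdg_0form [where X = X]) auto
  moreover have "wdg vs (\<lambda>us. (-1) ^ length us * f us) (\<lambda>us. g (v # us)) =
      wdg vs (\<lambda>us. (-1) * f us) (\<lambda>us. g (v # us))"
  proof (rule wdg_cong [OF assms(2)])
    fix us assume "us \<in> lists X"
    then show "(-1) ^ length us * f us = -1 * f us"
      using assms(3) by (cases "length us = 1") auto
  qed simp
  ultimately show ?thesis by (simp only: wdg.simps wdg_scale_left) simp
qed

lemma wdg_1form_zero:
  assumes "vs \<in> lists X" "\<And>us. us \<in> lists X \<Longrightarrow> length us \<noteq> 1 \<Longrightarrow> f us = 0" "\<And>v. v \<in> set vs \<Longrightarrow> f [v] = 0"
  shows "wdg vs f g = 0"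
proof -
  have "wdg vs f g = wdg vs (\<lambda>us. 0) g"
  proof (rule wdg_cong [where X = "set vs"])
    fix us assume us: "us \<in> lists (set vs)"
    then have "us \<in> lists X" using assms(1) by (auto simp: in_lists_conv_set)
    then show "f us = 0"
      using assms(2,3) us by (cases "length us = 1") (auto simp: length_Suc_conv in_lists_conv_set)
  qed (auto simp: in_lists_conv_set)
  then show ?thesis by simp
qed

text \<open>Either \<open>f\<close> takes both \<open>a\<close> and \<open>b\<close> or
  \<open>g\<close> takes both: a mixed term would have to evaluate \<open>f\<close> on one of them
  and a later argument, where it is 0.\<close>

lemma wdg_2form_pair:
  assumes "a \<in> X" "b \<in> X" "vs \<in> lists X" "\<And>us. us \<in> lists X \<Longrightarrow> length us \<noteq> 2 \<Longrightarrow> f us = 0"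
    and "\<And>v. v \<in> set vs \<Longrightarrow> f [a, v] = 0" "\<And>v. v \<in> set vs \<Longrightarrow> f [b, v] = 0"
  shows "wdg (a # b # vs) f g = f [a, b] * g vs + wdg vs f (\<lambda>us. g (a # b # us))"
proof -
  have "wdg (b # vs) (\<lambda>us. f (a # us)) g = f [a, b] * g vs - wdg vs (\<lambda>us. f (a # us)) (\<lambda>us. g (b # us))"
    using assms by (subst wdg_1form [where X = X]) auto
  moreover have "wdg vs (\<lambda>us. f (a # us)) (\<lambda>us. g (b # us)) = 0"
    using assms by (intro wdg_1form_zero [where X = X]) auto
  moreover have sgn: "wdg us (\<lambda>us. (-1) ^ length us * f us) G = wdg us f G" if "us \<in> lists X" for us G
  proof (rule wdg_cong [OF that])
    fix us assume "us \<in> lists X"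
    then show "(-1) ^ length us * f us = f us"
      using assms(4) by (cases "length us = 2") auto
  qed simp
  moreover have "wdg vs (\<lambda>us. f (b # us)) (\<lambda>us. g (a # us)) = 0"
    using assms by (intro wdg_1form_zero [where X = X]) auto
  moreover have "wdg vs (\<lambda>us. - ((-1) ^ length us * f (b # us))) (\<lambda>us. g (a # us)) = wdg vs (\<lambda>us. f (b # us)) (\<lambda>us. g (a # us))"
  proof (rule wdg_cong [OF assms(3)])
    fix us assume "us \<in> lists X"
    then show "- ((-1) ^ length us * f (b # us)) = f (b # us)"
      using assms(2,4) by (cases "length us = 1") auto
  qed simp
  ultimately show ?thesis using assms by simp
qed

section \<open>Powers of a 2-form on an orthogonal list of pairs\<close>

definition flat :: "(cvec \<times> cvec) list \<Rightarrow> cvec list" where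
  "flat ps = concat (map (\<lambda>p. [fst p, snd p]) ps)"

lemma flat_simps [simp]: "flat [] = []" "flat (p # ps) = fst p # snd p # flat ps"
  "flat (ps @ qs) = flat ps @ flat qs"
  by (simp_all add: flat_def)

lemma set_flat: "set (flat ps) = fst ` set ps \<union> snd ` set ps"
  by (auto simp: flat_def)

definition pair_orth :: "(cvec list \<Rightarrow> complex) \<Rightarrow> cvec \<times> cvec \<Rightarrow> cvec \<times> cvec \<Rightarrow> bool" where
  "pair_orth f p q \<longleftrightarrow> f [fst p, fst q] = 0 \<and> f [fst p, snd q] = 0 \<and> f [snd p, fst q] = 0 \<and> f [snd p, snd q] = 0"

lemma wdg_2form_flat:
  assumes "flat ps \<in> lists X" "\<And>us. us \<in> lists X \<Longrightarrow> length us \<noteq> 2 \<Longrightarrow> f us = 0"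
    and "sorted_wrt (pair_orth f) ps"
  shows "wdg (flat ps) f g =
    (\<Sum>i<length ps. f [fst (ps ! i), snd (ps ! i)] * g (flat (take i ps @ drop (Suc i) ps)))"
  using assms(1,3)
proof (induction ps arbitrary: g rule: list.induct)
  case Nil
  then show ?case using assms(2) [of "[]"] by simp
next
  case (Cons p ps)
  have "wdg (fst p # snd p # flat ps) f g = f [fst p, snd p] * g (flat ps)
      + wdg (flat ps) f (\<lambda>us. g (fst p # snd p # us))"
    using Cons.prems assms(2)
    by (intro wdg_2form_pair [where X = X]) (auto simp: in_lists_conv_set set_flat pair_orth_def)
  then show ?case
    using Cons by (simp add: sum.lessThan_Suc_shift del: sum.lessThan_Suc wdg.simps)
qed

text \<open>Every factor consumes one whole pair. The factorial counts the orders in which the pairs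
  are consumed, all with the same sign because pairs have even length.\<close>

lemma wedge_power_flat:
  assumes "flat ps \<in> lists X" "\<And>us. us \<in> lists X \<Longrightarrow> length us \<noteq> 2 \<Longrightarrow> \<omega> x us = 0"
    and "sorted_wrt (pair_orth (\<omega> x)) ps"
  shows "wedge_power \<omega> (length ps) x (flat ps) = fact (length ps) * (\<Prod>p\<leftarrow>ps. \<omega> x [fst p, snd p])"
  using assms(1,3)
proof (induction "length ps" arbitrary: ps)
  case 0
  then show ?case by simp
next
  case (Suc k)
  have "wedge_power \<omega> (Suc k) x (flat ps) =
      (\<Sum>i<length ps. \<omega> x [fst (ps ! i), snd (ps ! i)] * wedge_power \<omega> k x (flat (take i ps @ drop (Suc i) ps)))"
    using Suc.prems assms(2) unfolding wedge_power.simps wedge_wdg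
    by (intro wdg_2form_flat) auto
  also have "\<dots> = (\<Sum>i<length ps. fact k * (\<Prod>p\<leftarrow>ps. \<omega> x [fst p, snd p]))"
  proof (rule sum.cong [OF refl])
    fix i assume "i \<in> {..<length ps}"
    then have i: "i < length ps" by simp
    let ?qs = "take i ps @ drop (Suc i) ps"
    have ps: "ps = take i ps @ ps ! i # drop (Suc i) ps" using id_take_nth_drop [OF i] .
    have len: "length ?qs = k" using i Suc.hyps(2) by simp
    have "sorted_wrt (pair_orth (\<omega> x)) ?qs"
      using Suc.prems(2) by (subst (asm) ps) (auto simp: sorted_wrt_append)
    moreover have "set ?qs \<subseteq> set ps" using set_take_subset [of i ps] set_drop_subset [of "Suc i" ps] by auto
    then have "set (flat ?qs) \<subseteq> set (flat ps)" unfolding set_flat by (intro Un_mono image_mono)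
    then have "flat ?qs \<in> lists X" using Suc.prems(1) by (auto simp: in_lists_conv_set)
    ultimately have "wedge_power \<omega> k x (flat ?qs) = fact k * (\<Prod>p\<leftarrow>?qs. \<omega> x [fst p, snd p])"
      using Suc.hyps(1) [of ?qs] len by simp
    moreover have "(\<Prod>p\<leftarrow>ps. \<omega> x [fst p, snd p]) =
        \<omega> x [fst (ps ! i), snd (ps ! i)] * (\<Prod>p\<leftarrow>?qs. \<omega> x [fst p, snd p])"
      using arg_cong [OF ps, of "\<lambda>ps. \<Prod>p\<leftarrow>ps. \<omega> x [fst p, snd p]"] by (simp add: mult_ac)
    ultimately show "\<omega> x [fst (ps ! i), snd (ps ! i)] * wedge_power \<omega> k x (flat ?qs) =
        fact k * (\<Prod>p\<leftarrow>ps. \<omega> x [fst p, snd p])"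
      by (simp add: mult_ac)
  qed
  finally show ?case using Suc.hyps(2) [symmetric] by (simp add: mult_ac)
qed

section \<open>Contraction over a frame\<close>

text \<open>The sum over index sets in \<open>hodge_star\<close>, deciding for the first frame
  vector whether it belongs to the index set.\<close>

primrec pairing :: "cvec list \<Rightarrow> (cvec list \<Rightarrow> complex) \<Rightarrow> (cvec list \<Rightarrow> complex) \<Rightarrow> complex" where
  "pairing [] f V = cnj (f []) * V []"
| "pairing (e # es) f V = pairing es (\<lambda>us. f (e # us)) (\<lambda>us. V (e # us)) + pairing es f V"

lemma pairing_eq_sum:
  "(\<Sum>I\<in>Pow {..<length es}. cnj (f (nths es I)) * V (nths es I)) = pairing es f V"
proof (induction es arbitrary: f V rule: list.induct)
  case (Cons e es)
  show ?case
    by (simp only: length_Cons sum_Pow_Suc pairing.simps Cons.IH [symmetric] sum.distrib [symmetric] nths_insert_0)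
qed simp

lemma pairing_cong:
  assumes "es \<in> lists X" "\<And>us. us \<in> lists X \<Longrightarrow> f us = f' us" "\<And>us. us \<in> lists X \<Longrightarrow> V us = V' us"
  shows "pairing es f V = pairing es f' V'"
  using assms
proof (induction es arbitrary: f V f' V' rule: list.induct)
  case (Cons e es)
  have "pairing es (\<lambda>us. f (e # us)) (\<lambda>us. V (e # us)) = pairing es (\<lambda>us. f' (e # us)) (\<lambda>us. V' (e # us))"
    using Cons.prems by (intro Cons.IH) auto
  moreover have "pairing es f V = pairing es f' V'" using Cons.prems by (intro Cons.IH) auto
  ultimately show ?case by simp
qed simp

lemma pairing_lin_left:
  "pairing es (\<lambda>u. a * f u + b * f' u) V = cnj a * pairing es f V + cnj b * pairing es f' V"
  by (induction es arbitrary: f f' V) (simp_all add: algebra_simps)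

lemma pairing_lin_right:
  "pairing es f (\<lambda>u. a * V u + b * V' u) = a * pairing es f V + b * pairing es f V'"
  by (induction es arbitrary: f V V') (simp_all add: algebra_simps)

text \<open>For a real orthonormal frame this is the vector that represents the conjugate of
  \<open>\<theta>\<close> with respect to the bilinear metric; see
  \<open>metric_dual_vec\<close>.\<close>

definition dual_vec :: "(cvec list \<Rightarrow> complex) \<Rightarrow> cvec list \<Rightarrow> cvec" where
  "dual_vec \<theta> es = (\<lambda>i. \<Sum>e\<leftarrow>es. cnj (\<theta> [e]) * e i)"

lemma dual_vec_Nil: "dual_vec \<theta> [] = (\<lambda>i. 0)"
  by (simp add: dual_vec_def)

lemma dual_vec_Cons: "dual_vec \<theta> (e # es) = (\<lambda>i. cnj (\<theta> [e]) * e i + 1 * dual_vec \<theta> es i)"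
  by (simp add: dual_vec_def)

lemma dual_vec_CN: "es \<in> lists (CN N) \<Longrightarrow> dual_vec \<theta> es \<in> CN N"
  by (induction es) (auto simp: dual_vec_Nil dual_vec_Cons CN_zero CN_def)

lemma pairing_0form:
  assumes "es \<in> lists X" "\<And>us. us \<in> lists X \<Longrightarrow> length us \<noteq> 0 \<Longrightarrow> f us = 0"
  shows "pairing es f V = cnj (f []) * V []"
  using assms
proof (induction es arbitrary: f V rule: list.induct)
  case (Cons e es)
  have "pairing es (\<lambda>us. f (e # us)) (\<lambda>us. V (e # us)) = 0"
    using Cons.prems by (subst Cons.IH) auto
  moreover have "pairing es f V = cnj (f []) * V []"
    using Cons.prems by (intro Cons.IH) auto
  ultimately show ?case by simp
qed simp

lemma pairing_1form:
  assumes "es \<in> lists (CN N)" "\<And>us. us \<in> lists (CN N) \<Longrightarrow> length us \<noteq> 1 \<Longrightarrow> \<theta> us = 0" "alt N V"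
  shows "pairing es \<theta> V = V [dual_vec \<theta> es]"
  using assms(1)
proof (induction es rule: list.induct)
  case Nil
  then show ?case using assms(2) [of "[]"] alt_zero [OF assms(3), of "[]" "[]"] by (simp add: dual_vec_Nil)
next
  case (Cons e es)
  have "pairing es (\<lambda>us. \<theta> (e # us)) (\<lambda>us. V (e # us)) = cnj (\<theta> [e]) * V [e]"
    using Cons.prems assms(2) by (subst pairing_0form [where X = "CN N"]) auto
  moreover have "V [dual_vec \<theta> (e # es)] = cnj (\<theta> [e]) * V [e] + 1 * V [dual_vec \<theta> es]"
    unfolding dual_vec_Cons
    using alt_lin [OF assms(3), of "[]" "[]" e "dual_vec \<theta> es" "cnj (\<theta> [e])" 1] dual_vec_CN Cons.prems by simp
  ultimately show ?case using Cons by simp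
qed

text \<open>Contraction against \<open>\<theta> \<and> \<beta>\<close> is insertion of the dual vector of \<open>\<theta>\<close> followed by contraction
  against \<open>\<beta>\<close>; hence the Hodge star of a product of 1-forms is the volume form with their dual vectors
  inserted, which does not mention the frame any more.\<close>

lemma pairing_wdg:
  assumes "es \<in> lists (CN N)" "\<And>us. us \<in> lists (CN N) \<Longrightarrow> length us \<noteq> 1 \<Longrightarrow> \<theta> us = 0"
    and "alt N V"
  shows "pairing es (\<lambda>us. wdg us \<theta> f) V = pairing es f (\<lambda>us. V (dual_vec \<theta> es # us))"
  using assms(1,3)
proof (induction es arbitrary: f V rule: list.induct)
  case Nil
  then show ?case
    using assms(2) [of "[]"] alt_zero [of N V "[]" "[]"] by (simp add: dual_vec_Nil)
next
  case (Cons e es)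
  then have e: "e \<in> CN N" and es: "es \<in> lists (CN N)" by auto
  let ?x = "dual_vec \<theta> es" and ?c = "cnj (\<theta> [e])"
  have x: "?x \<in> CN N" using dual_vec_CN es .
  have "pairing es (\<lambda>us. wdg (e # us) \<theta> f) (\<lambda>us. V (e # us))
      = pairing es (\<lambda>us. \<theta> [e] * f us + (-1) * wdg us \<theta> (\<lambda>us. f (e # us))) (\<lambda>us. V (e # us))"
    using wdg_1form [OF e _ assms(2)] by (intro pairing_cong [OF es]) (auto simp del: wdg.simps)
  also have "\<dots> = ?c * pairing es f (\<lambda>us. V (e # us)) -
      pairing es (\<lambda>us. wdg us \<theta> (\<lambda>us. f (e # us))) (\<lambda>us. V (e # us))"
    by (simp only: pairing_lin_left) simp
  also have "pairing es (\<lambda>us. wdg us \<theta> (\<lambda>us. f (e # us))) (\<lambda>us. V (e # us)) =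
      pairing es (\<lambda>us. f (e # us)) (\<lambda>us. V (e # ?x # us))"
    using Cons.IH [OF es alt_Cons [OF Cons.prems(2) e]] .
  finally have 1: "pairing es (\<lambda>us. wdg (e # us) \<theta> f) (\<lambda>us. V (e # us)) =
      ?c * pairing es f (\<lambda>us. V (e # us)) - pairing es (\<lambda>us. f (e # us)) (\<lambda>us. V (e # ?x # us))" .
  have lin: "V (dual_vec \<theta> (e # es) # us) = ?c * V (e # us) + 1 * V (?x # us)" if "us \<in> lists (CN N)" for us
    unfolding dual_vec_Cons
    using alt_lin [OF Cons.prems(2), of "[]" us e "dual_vec \<theta> es" "cnj (\<theta> [e])" 1] that e x by simp
  have "pairing es (\<lambda>us. f (e # us)) (\<lambda>us. V (dual_vec \<theta> (e # es) # e # us))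
      = pairing es (\<lambda>us. f (e # us)) (\<lambda>us. (-1) * V (e # ?x # us) + 0 * V us)"
  proof (rule pairing_cong [OF es refl])
    fix us assume us: "us \<in> lists (CN N)"
    show "V (dual_vec \<theta> (e # es) # e # us) = -1 * V (e # ?x # us) + 0 * V us"
      using lin [of "e # us"] alt_eq0 [OF Cons.prems(2), of "[]" us e]
        alt_swap [OF Cons.prems(2), of "[]" us ?x e] us e x by simp
  qed
  also have "\<dots> = - pairing es (\<lambda>us. f (e # us)) (\<lambda>us. V (e # ?x # us))"
    by (simp only: pairing_lin_right) simp
  finally have 2: "pairing es (\<lambda>us. f (e # us)) (\<lambda>us. V (dual_vec \<theta> (e # es) # e # us)) =
      - pairing es (\<lambda>us. f (e # us)) (\<lambda>us. V (e # ?x # us))" .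
  have "pairing es f (\<lambda>us. V (dual_vec \<theta> (e # es) # us))
      = pairing es f (\<lambda>us. ?c * V (e # us) + 1 * V (?x # us))"
    using lin by (intro pairing_cong [OF es]) auto
  also have "\<dots> = ?c * pairing es f (\<lambda>us. V (e # us)) + pairing es f (\<lambda>us. V (?x # us))"
    by (simp only: pairing_lin_right) simp
  finally show ?case
    using 1 2 Cons.IH [OF es Cons.prems(2), of f] by (simp del: wdg.simps)
qed

section \<open>Smooth functions\<close>

lemma RN_iff: "x \<in> RN N \<longleftrightarrow> (\<forall>i\<ge>N. x i = 0)"
  by (simp add: topspace_Euclidean_space)

lemma RN_upd: "x \<in> RN N \<Longrightarrow> j < N \<Longrightarrow> x(j := t) \<in> RN N"
  by (auto simp: RN_iff)

lemma C_diff_0: "C_diff 0 N (RN N) f \<longleftrightarrow> continuous_on (RN N) f"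
  by (simp add: subtopology_topspace continuous_map_Euclidean_space_iff)

lemma C_diff_Suc: "C_diff (Suc k) N (RN N) f \<longleftrightarrow> continuous_on (RN N) f \<and>
     (\<forall>j<N. (\<forall>x\<in>RN N. (\<lambda>t. f (x(j := t))) differentiable at (x j)) \<and> C_diff k N (RN N) (partial_deriv j f))"
  by (simp add: subtopology_topspace continuous_map_Euclidean_space_iff)

declare C_diff.simps [simp del]

lemma partial_deriv_cong:
  assumes "\<And>x. x \<in> RN N \<Longrightarrow> f x = g x" "x \<in> RN N" "j < N"
  shows "partial_deriv j f x = partial_deriv j g x"
proof -
  have "(\<lambda>t. f (x(j := t))) = (\<lambda>t. g (x(j := t)))"
    using assms by (simp add: RN_upd)
  then show ?thesis by (simp add: partial_deriv_def)
qed

lemma C_diff_cong: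
  assumes "\<And>x. x \<in> RN N \<Longrightarrow> f x = g x" "C_diff k N (RN N) f"
  shows "C_diff k N (RN N) g"
  using assms
proof (induction k arbitrary: f g)
  case 0
  then show ?case using continuous_on_cong [of "RN N" "RN N" f g] by (simp add: C_diff_0)
next
  case (Suc k)
  have "(\<lambda>t. f (x(j := t))) = (\<lambda>t. g (x(j := t)))" if "x \<in> RN N" "j < N" for x j
    by (rule ext) (rule Suc.prems(1) [OF RN_upd [OF that]])
  moreover have "C_diff k N (RN N) (partial_deriv j g)" if "j < N" for j
    using Suc.IH [of "partial_deriv j f"] Suc.prems partial_deriv_cong [OF Suc.prems(1)] that
    by (simp add: C_diff_Suc)
  moreover have "continuous_on (RN N) g"
    using Suc.prems continuous_on_cong [of "RN N" "RN N" f g] by (simp add: C_diff_Suc)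
  ultimately show ?case using Suc.prems(2) by (simp add: C_diff_Suc)
qed

lemma C_diff_mono: "C_diff (Suc k) N (RN N) f \<Longrightarrow> C_diff k N (RN N) f"
  by (induction k arbitrary: f) (auto simp: C_diff_0 C_diff_Suc)

lemma C_diff_continuous: "C_diff k N (RN N) f \<Longrightarrow> continuous_on (RN N) f"
  by (cases k) (auto simp: C_diff_0 C_diff_Suc)

lemma C_diff_has_vector_derivative:
  assumes "C_diff (Suc k) N (RN N) f" "j < N" "x \<in> RN N"
  shows "((\<lambda>t. f (x(j := t))) has_vector_derivative partial_deriv j f (x(j := s))) (at s)"
proof -
  have "x(j := s) \<in> RN N" using assms RN_upd by blast
  then have "(\<lambda>t. f ((x(j := s))(j := t))) differentiable at ((x(j := s)) j)"
    using assms unfolding C_diff_Suc by blast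
  then show ?thesis
    unfolding partial_deriv_def by (simp add: vector_derivative_works)
qed

lemma C_diff_has_vector_derivative':
  assumes "C_diff (Suc k) N (RN N) f" "j < N" "x \<in> RN N"
  shows "((\<lambda>t. f (x(j := t))) has_vector_derivative partial_deriv j f x) (at (x j))"
  using C_diff_has_vector_derivative [OF assms, of "x j"] by (simp only: fun_upd_triv)

lemma partial_deriv_eqI:
  "((\<lambda>t. f (x(j := t))) has_vector_derivative D) (at (x j)) \<Longrightarrow> partial_deriv j f x = D"
  unfolding partial_deriv_def by (rule vector_derivative_at)

text \<open>The derivatives are supplied as explicit candidates \<open>D\<close>, so that an
  induction on the order only has to recognise them as built from functions already covered.\<close>

lemma C_diff_SucI:
  assumes "continuous_on (RN N) f"
    and "\<And>j x. j < N \<Longrightarrow> x \<in> RN N \<Longrightarrow> ((\<lambda>t. f (x(j := t))) has_vector_derivative D j x) (at (x j))"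
    and "\<And>j. j < N \<Longrightarrow> C_diff k N (RN N) (D j)"
  shows "C_diff (Suc k) N (RN N) f"
  unfolding C_diff_Suc
proof (intro conjI allI impI ballI)
  fix j assume j: "j < N"
  show "C_diff k N (RN N) (partial_deriv j f)"
    by (rule C_diff_cong [OF _ assms(3) [OF j]]) (simp add: partial_deriv_eqI [OF assms(2)] j)
  show "(\<lambda>t. f (x(j := t))) differentiable at (x j)" if "x \<in> RN N" for x
    using assms(2) [OF j that] by (auto simp: differentiableI_vector)
qed fact

lemma C_diff_const: "C_diff k N (RN N) (\<lambda>x. c)"
  by (induction k arbitrary: c)
     (auto simp: C_diff_0 intro!: C_diff_SucI [where D = "\<lambda>j x. 0"] continuous_intros)

lemma C_diff_coord: "C_diff k N (RN N) (\<lambda>x. x i)"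
proof (cases k)
  case 0
  then show ?thesis by (simp add: C_diff_0 continuous_on_product_coordinates continuous_on_subset [OF _ subset_UNIV])
next
  case (Suc k)
  show ?thesis
    unfolding Suc
  proof (rule C_diff_SucI [where D = "\<lambda>j x. if i = j then 1 else 0"])
    show "((\<lambda>t. (x(j := t)) i) has_vector_derivative (if i = j then 1 else 0)) (at (x j))" for j and x :: pt
      by (cases "i = j") (auto simp: has_vector_derivative_id)
  qed (auto simp: C_diff_const intro: continuous_on_subset [OF continuous_on_product_coordinates])
qed

lemma C_diff_bounded_linear:
  assumes "bounded_linear h" "C_diff k N (RN N) f"
  shows "C_diff k N (RN N) (\<lambda>x. h (f x))"
  using assms(2)
proof (induction k arbitrary: f)
  case 0
  then show ?case by (simp add: C_diff_0 bounded_linear.continuous_on [OF assms(1)])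
next
  case (Suc k)
  show ?case
  proof (rule C_diff_SucI [where D = "\<lambda>j x. h (partial_deriv j f x)"])
    show "continuous_on (RN N) (\<lambda>x. h (f x))"
      using Suc.prems C_diff_continuous bounded_linear.continuous_on [OF assms(1)] by blast
    show "((\<lambda>t. h (f (x(j := t)))) has_vector_derivative h (partial_deriv j f x)) (at (x j))"
      if "j < N" "x \<in> RN N" for j x
      by (rule bounded_linear.has_vector_derivative [OF assms(1) C_diff_has_vector_derivative' [OF Suc.prems that]])
  qed (use Suc in \<open>auto simp: C_diff_Suc\<close>)
qed

lemma C_diff_add:
  assumes "C_diff k N (RN N) f" "C_diff k N (RN N) g"
  shows "C_diff k N (RN N) (\<lambda>x. f x + g x)"
  using assms
proof (induction k arbitrary: f g)
  case 0
  then show ?case by (simp add: C_diff_0 continuous_on_add)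
next
  case (Suc k)
  show ?case
  proof (rule C_diff_SucI [where D = "\<lambda>j x. partial_deriv j f x + partial_deriv j g x"])
    show "continuous_on (RN N) (\<lambda>x. f x + g x)"
      using Suc.prems C_diff_continuous continuous_on_add by blast
    show "((\<lambda>t. f (x(j := t)) + g (x(j := t))) has_vector_derivative partial_deriv j f x + partial_deriv j g x) (at (x j))"
      if "j < N" "x \<in> RN N" for j x
      by (rule has_vector_derivative_add [OF C_diff_has_vector_derivative' [OF Suc.prems(1) that]
         C_diff_has_vector_derivative' [OF Suc.prems(2) that]])
  qed (use Suc in \<open>auto simp: C_diff_Suc\<close>)
qed

lemma C_diff_mult:
  fixes f g :: "pt \<Rightarrow> 'a::real_normed_algebra"
  assumes "C_diff k N (RN N) f" "C_diff k N (RN N) g"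
  shows "C_diff k N (RN N) (\<lambda>x. f x * g x)"
  using assms
proof (induction k arbitrary: f g)
  case 0
  then show ?case by (simp add: C_diff_0 continuous_on_mult)
next
  case (Suc k)
  show ?case
  proof (rule C_diff_SucI [where D = "\<lambda>j x. f x * partial_deriv j g x + partial_deriv j f x * g x"])
    show "continuous_on (RN N) (\<lambda>x. f x * g x)"
      using Suc.prems C_diff_continuous continuous_on_mult by blast
    show "((\<lambda>t. f (x(j := t)) * g (x(j := t))) has_vector_derivative
        f x * partial_deriv j g x + partial_deriv j f x * g x) (at (x j))"
      if "j < N" "x \<in> RN N" for j x
      using has_vector_derivative_mult [OF C_diff_has_vector_derivative' [OF Suc.prems(1) that]
         C_diff_has_vector_derivative' [OF Suc.prems(2) that]]
      by (simp only: fun_upd_triv)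
    show "C_diff k N (RN N) (\<lambda>x. f x * partial_deriv j g x + partial_deriv j f x * g x)" if "j < N" for j
      using Suc.prems that C_diff_mono by (intro C_diff_add Suc.IH) (auto simp: C_diff_Suc)
  qed
qed

text \<open>The derivative is written with two factors \<open>inverse (f x)\<close>, so that the
  induction hypothesis for the inverse itself applies, one order lower.\<close>

lemma C_diff_inverse:
  fixes f :: "pt \<Rightarrow> real"
  assumes "C_diff k N (RN N) f" "\<And>x. x \<in> RN N \<Longrightarrow> f x \<noteq> 0"
  shows "C_diff k N (RN N) (\<lambda>x. inverse (f x))"
  using assms
proof (induction k arbitrary: f)
  case 0
  then show ?case by (simp add: C_diff_0 continuous_on_inverse)
next
  case (Suc k)
  show ?case
  proof (rule C_diff_SucI [where D = "\<lambda>j x. (-1) * (inverse (f x) * partial_deriv j f x * inverse (f x))"])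
    show "continuous_on (RN N) (\<lambda>x. inverse (f x))"
      using Suc.prems C_diff_continuous by (intro continuous_on_inverse) auto
    show "((\<lambda>t. inverse (f (x(j := t)))) has_vector_derivative
        (-1) * (inverse (f x) * partial_deriv j f x * inverse (f x))) (at (x j))"
      if "j < N" "x \<in> RN N" for j x
      using DERIV_inverse' [OF C_diff_has_vector_derivative' [OF Suc.prems(1) that,
            folded has_real_derivative_iff_has_vector_derivative]] Suc.prems(2) that
      unfolding has_real_derivative_iff_has_vector_derivative by (simp only: fun_upd_triv mult_minus1 not_False_eq_True True_implies_equals)
    show "C_diff k N (RN N) (\<lambda>x. (-1) * (inverse (f x) * partial_deriv j f x * inverse (f x)))" if "j < N" for j
      using Suc.prems that C_diff_mono
      by (intro C_diff_mult C_diff_const Suc.IH) (auto simp: C_diff_Suc)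
  qed
qed

section \<open>Closure properties of smoothness and rules for directional derivatives\<close>

abbreviation smooth :: "nat \<Rightarrow> (pt \<Rightarrow> 'a::real_normed_vector) \<Rightarrow> bool" where
  "smooth N f \<equiv> smooth_on N (RN N) f"

named_theorems smooth_intros

lemma smooth_cong: "smooth N f \<Longrightarrow> (\<And>x. x \<in> RN N \<Longrightarrow> f x = g x) \<Longrightarrow> smooth N g"
  unfolding smooth_on_def using C_diff_cong by blast

lemma smooth_const [smooth_intros]: "smooth N (\<lambda>x. c)"
  by (simp add: smooth_on_def C_diff_const)

lemma smooth_coord [smooth_intros]: "smooth N (\<lambda>x. x i)"
  by (simp add: smooth_on_def C_diff_coord)

lemma smooth_add [smooth_intros]: "smooth N f \<Longrightarrow> smooth N g \<Longrightarrow> smooth N (\<lambda>x. f x + g x)"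
  by (simp add: smooth_on_def C_diff_add)

lemma smooth_mult [smooth_intros]:
  fixes f g :: "pt \<Rightarrow> 'a::real_normed_algebra"
  shows "smooth N f \<Longrightarrow> smooth N g \<Longrightarrow> smooth N (\<lambda>x. f x * g x)"
  by (simp add: smooth_on_def C_diff_mult)

lemma smooth_inverse:
  fixes f :: "pt \<Rightarrow> real"
  shows "smooth N f \<Longrightarrow> (\<And>x. x \<in> RN N \<Longrightarrow> f x \<noteq> 0) \<Longrightarrow> smooth N (\<lambda>x. inverse (f x))"
  by (simp add: smooth_on_def C_diff_inverse)

lemma smooth_divide:
  fixes f :: "pt \<Rightarrow> real"
  shows "smooth N f \<Longrightarrow> smooth N g \<Longrightarrow> (\<And>x. x \<in> RN N \<Longrightarrow> g x \<noteq> 0) \<Longrightarrow> smooth N (\<lambda>x. f x / g x)"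
  unfolding divide_inverse by (intro smooth_mult smooth_inverse)

lemma smooth_bounded_linear: "bounded_linear h \<Longrightarrow> smooth N f \<Longrightarrow> smooth N (\<lambda>x. h (f x))"
  by (simp add: smooth_on_def C_diff_bounded_linear)

lemma smooth_minus [smooth_intros]: "smooth N f \<Longrightarrow> smooth N (\<lambda>x. - f x)"
  by (rule smooth_bounded_linear [OF bounded_linear_minus [OF bounded_linear_ident]])

lemma smooth_diff [smooth_intros]: "smooth N f \<Longrightarrow> smooth N g \<Longrightarrow> smooth N (\<lambda>x. f x - g x)"
  using smooth_add [OF _ smooth_minus] by fastforce

lemma smooth_of_real [smooth_intros]: "smooth N f \<Longrightarrow> smooth N (\<lambda>x. complex_of_real (f x))"
  by (rule smooth_bounded_linear [OF bounded_linear_of_real])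

lemma smooth_cnj [smooth_intros]: "smooth N f \<Longrightarrow> smooth N (\<lambda>x. cnj (f x))"
  by (rule smooth_bounded_linear [OF bounded_linear_cnj])

lemma smooth_sum [smooth_intros]: "(\<And>k. k \<in> A \<Longrightarrow> smooth N (f k)) \<Longrightarrow> smooth N (\<lambda>x. \<Sum>k\<in>A. f k x)"
  by (induction A rule: infinite_finite_induct) (auto intro: smooth_intros)

lemma smooth_partial_deriv [smooth_intros]: "smooth N f \<Longrightarrow> j < N \<Longrightarrow> smooth N (partial_deriv j f)"
  unfolding smooth_on_def using C_diff_Suc by blast

lemma smooth_differential [smooth_intros]: "smooth N f \<Longrightarrow> smooth N (\<lambda>x. differential N f x v)"
  unfolding differential_def by (intro smooth_intros) auto

lemma smooth_continuous: "smooth N f \<Longrightarrow> continuous_on (RN N) f"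
  unfolding smooth_on_def using C_diff_continuous by blast

lemma smooth_has_vector_derivative:
  "smooth N f \<Longrightarrow> j < N \<Longrightarrow> x \<in> RN N \<Longrightarrow>
     ((\<lambda>t. f (x(j := t))) has_vector_derivative partial_deriv j f (x(j := s))) (at s)"
  unfolding smooth_on_def using C_diff_has_vector_derivative by blast

lemma smooth_has_vector_derivative':
  "smooth N f \<Longrightarrow> j < N \<Longrightarrow> x \<in> RN N \<Longrightarrow>
     ((\<lambda>t. f (x(j := t))) has_vector_derivative partial_deriv j f x) (at (x j))"
  unfolding smooth_on_def using C_diff_has_vector_derivative' by blast

lemma partial_deriv_lin:
  fixes f g :: "pt \<Rightarrow> complex"
  assumes "smooth N f" "smooth N g" "j < N" "x \<in> RN N"
  shows "partial_deriv j (\<lambda>y. a * f y + b * g y) x = a * partial_deriv j f x + b * partial_deriv j g x"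
  using assms
  by (intro partial_deriv_eqI has_vector_derivative_add has_vector_derivative_mult_right
      smooth_has_vector_derivative')

lemma partial_deriv_const: "partial_deriv j (\<lambda>y. c) x = 0"
  by (rule partial_deriv_eqI) simp

lemma differential_cong:
  assumes "\<And>y. y \<in> RN N \<Longrightarrow> f y = g y" "x \<in> RN N"
  shows "differential N f x v = differential N g x v"
  unfolding differential_def using partial_deriv_cong [OF assms(1,2)] by simp

lemma differential_lin:
  assumes "smooth N f" "smooth N g" "x \<in> RN N"
  shows "differential N (\<lambda>y. a * f y + b * g y) x v = a * differential N f x v + b * differential N g x v"
  using assms partial_deriv_lin
  by (simp add: differential_def sum_distrib_left sum.distrib algebra_simps)

lemma differential_lin_vec:
  "differential N f x (\<lambda>i. a * v i + b * w i) = a * differential N f x v + b * differential N f x w"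
  by (simp add: differential_def sum_distrib_left sum.distrib algebra_simps)

lemma differential_const: "differential N (\<lambda>y. c) x v = 0"
  by (simp add: differential_def partial_deriv_const)

lemma differential_add:
  "smooth N f \<Longrightarrow> smooth N g \<Longrightarrow> x \<in> RN N \<Longrightarrow>
    differential N (\<lambda>y. f y + g y) x v = differential N f x v + differential N g x v"
  using differential_lin [of N f g x 1 1 v] by simp

lemma differential_cmult:
  "smooth N f \<Longrightarrow> x \<in> RN N \<Longrightarrow> differential N (\<lambda>y. a * f y) x v = a * differential N f x v"
  using differential_lin [of N f f x a 0 v] by simp

lemma differential_mult:
  assumes "smooth N f" "smooth N g" "x \<in> RN N"
  shows "differential N (\<lambda>y. f y * g y) x v = differential N f x v * g x + f x * differential N g x v"
proof -
  have "partial_deriv j (\<lambda>y. f y * g y) x = f x * partial_deriv j g x + partial_deriv j f x * g x" if "j < N" for j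
    using has_vector_derivative_mult [OF smooth_has_vector_derivative' [OF assms(1) that assms(3)]
        smooth_has_vector_derivative' [OF assms(2) that assms(3)]]
    by (intro partial_deriv_eqI) (simp only: fun_upd_triv)
  then show ?thesis
    by (simp add: differential_def sum_distrib_left sum_distrib_right sum.distrib algebra_simps)
qed

lemma differential_sum:
  assumes "finite A" "\<And>k. k \<in> A \<Longrightarrow> smooth N (f k)" "x \<in> RN N"
  shows "differential N (\<lambda>y. \<Sum>k\<in>A. f k y) x v = (\<Sum>k\<in>A. differential N (f k) x v)"
  using assms(1,2)
proof (induction A rule: finite_induct)
  case (insert k A)
  then show ?case
    using differential_add [of N "f k" "\<lambda>y. \<Sum>k\<in>A. f k y" x v] assms(3) by (auto intro: smooth_sum)
qed (simp add: differential_const)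

section \<open>Exterior derivative and bidegree for a constant complex structure\<close>

text \<open>Smooth forms without a fixed degree, closed under insertion of a constant vector;
  \<open>is_form_iff\<close> adds the degree.\<close>

definition sform :: "nat \<Rightarrow> form \<Rightarrow> bool" where
  "sform N \<alpha> \<longleftrightarrow> (\<forall>x\<in>RN N. alt N (\<alpha> x)) \<and> (\<forall>vs\<in>lists (CN N). smooth N (\<lambda>x. \<alpha> x vs))"

definition has_degree :: "nat \<Rightarrow> nat \<Rightarrow> form \<Rightarrow> bool" where
  "has_degree N k \<alpha> \<longleftrightarrow> (\<forall>x\<in>RN N. \<forall>vs\<in>lists (CN N). length vs \<noteq> k \<longrightarrow> \<alpha> x vs = 0)"

lemma is_form_iff: "is_form N k \<alpha> \<longleftrightarrow> sform N \<alpha> \<and> has_degree N k \<alpha>"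
  unfolding is_form_def sform_def has_degree_def multilinear_alternating_iff by blast

lemma sform_alt: "sform N \<alpha> \<Longrightarrow> x \<in> RN N \<Longrightarrow> alt N (\<alpha> x)"
  by (simp add: sform_def)

lemma sform_smooth: "sform N \<alpha> \<Longrightarrow> vs \<in> lists (CN N) \<Longrightarrow> smooth N (\<lambda>x. \<alpha> x vs)"
  by (simp add: sform_def)

lemma form_eqD: "form_eq N \<alpha> \<beta> \<Longrightarrow> x \<in> RN N \<Longrightarrow> vs \<in> lists (CN N) \<Longrightarrow> \<alpha> x vs = \<beta> x vs"
  by (simp add: form_eq_def)

lemma form_eq_sym: "form_eq N \<alpha> \<beta> \<Longrightarrow> form_eq N \<beta> \<alpha>"
  by (simp add: form_eq_def)

lemma sform_cong:
  assumes "form_eq N \<alpha> \<beta>" "sform N \<alpha>"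
  shows "sform N \<beta>"
  unfolding sform_def
proof (intro conjI ballI)
  show "alt N (\<beta> x)" if "x \<in> RN N" for x
    using alt_cong [of N "\<alpha> x" "\<beta> x"] form_eqD [OF assms(1) that] sform_alt [OF assms(2) that] by simp
  show "smooth N (\<lambda>x. \<beta> x vs)" if "vs \<in> lists (CN N)" for vs
    by (rule smooth_cong [OF sform_smooth [OF assms(2) that]]) (simp add: form_eqD [OF assms(1) _ that])
qed

lemma is_form_cong: "form_eq N \<alpha> \<beta> \<Longrightarrow> is_form N k \<alpha> \<Longrightarrow> is_form N k \<beta>"
  unfolding is_form_iff using sform_cong by (auto simp: has_degree_def form_eq_def)

lemma sform_insert: "sform N \<alpha> \<Longrightarrow> v \<in> CN N \<Longrightarrow> sform N (\<lambda>x vs. \<alpha> x (v # vs))"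
  unfolding sform_def by (auto simp: alt_Cons)

lemma sform_lin: "sform N \<alpha> \<Longrightarrow> sform N \<beta> \<Longrightarrow> sform N (\<lambda>x vs. a * \<alpha> x vs + b * \<beta> x vs)"
  unfolding sform_def by (auto intro!: alt_add alt_cmult smooth_intros)

lemma sform_sum: "(\<And>k. k \<in> A \<Longrightarrow> sform N (\<alpha> k)) \<Longrightarrow> sform N (\<lambda>x vs. \<Sum>k\<in>A. \<alpha> k x vs)"
  unfolding sform_def by (auto intro!: alt_sum_fun smooth_intros)

text \<open>Smoothness of a form is known on constant vectors only, so the field is expanded in the
  coordinate vectors.\<close>

lemma sform_insert_field:
  assumes "sform N \<alpha>" "\<And>i. smooth N (\<lambda>x. \<xi> x i)" "\<And>x. x \<in> RN N \<Longrightarrow> \<xi> x \<in> CN N"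
  shows "sform N (\<lambda>x vs. \<alpha> x (\<xi> x # vs))"
  unfolding sform_def
proof (intro conjI ballI)
  show "alt N (\<lambda>vs. \<alpha> x (\<xi> x # vs))" if "x \<in> RN N" for x
    using assms that by (intro alt_Cons) (auto simp: sform_def)
  fix vs assume vs: "vs \<in> lists (CN N)"
  have "smooth N (\<lambda>x. \<Sum>j<N. \<xi> x j * \<alpha> x (basis_vec j # vs))"
    using assms vs basis_vec_CN by (intro smooth_sum smooth_mult sform_smooth [OF assms(1)]) auto
  then show "smooth N (\<lambda>x. \<alpha> x (\<xi> x # vs))"
  proof (rule smooth_cong)
    fix x assume x: "x \<in> RN N"
    have "\<alpha> x ([] @ (\<lambda>i. \<Sum>j<N. \<xi> x j * basis_vec j i) # vs) = (\<Sum>j<N. \<xi> x j * \<alpha> x ([] @ basis_vec j # vs))"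
      using sform_alt [OF assms(1) x] vs basis_vec_CN by (intro alt_sum) auto
    then show "(\<Sum>j<N. \<xi> x j * \<alpha> x (basis_vec j # vs)) = \<alpha> x (\<xi> x # vs)"
      using CN_expand [OF assms(3) [OF x]] by simp
  qed
qed

lemma smooth_wdg:
  assumes "vs \<in> lists (CN N)" "\<And>us. us \<in> lists (CN N) \<Longrightarrow> smooth N (\<lambda>x. f x us)"
    "\<And>us. us \<in> lists (CN N) \<Longrightarrow> smooth N (\<lambda>x. g x us)"
  shows "smooth N (\<lambda>x. wdg vs (f x) (g x))"
  using assms
proof (induction vs arbitrary: f g rule: list.induct)
  case Nil
  then show ?case by (auto intro!: smooth_intros)
next
  case (Cons v vs)
  then show ?case
    by (auto intro!: smooth_intros Cons.IH)
qed

lemma sform_wedge: "sform N \<alpha> \<Longrightarrow> sform N \<beta> \<Longrightarrow> sform N (wedge \<alpha> \<beta>)"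
  unfolding sform_def wedge_wdg by (auto intro!: alt_wdg smooth_wdg)

lemma has_degree_wedge:
  assumes "has_degree N k \<alpha>" "has_degree N l \<beta>"
  shows "has_degree N (k + l) (wedge \<alpha> \<beta>)"
  unfolding has_degree_def wedge_wdg
proof (intro ballI impI)
  fix x vs assume "x \<in> RN N" "vs \<in> lists (CN N)" "length vs \<noteq> k + l"
  then show "wdg vs (\<alpha> x) (\<beta> x) = 0"
    using assms unfolding has_degree_def by (intro wdg_degree [where X = "CN N" and k = k and l = l]) blast+
qed

lemma is_form_wedge: "is_form N k \<alpha> \<Longrightarrow> is_form N l \<beta> \<Longrightarrow> is_form N (k + l) (wedge \<alpha> \<beta>)"
  unfolding is_form_iff by (auto intro: sform_wedge has_degree_wedge)

lemma ext_deriv_Nil: "ext_deriv N \<alpha> x [] = 0"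
  by (simp add: ext_deriv_def)

text \<open>Cartan's formula for contraction with a constant field: the Lie derivative is the
  directional derivative of the components.\<close>

lemma ext_deriv_Cons:
  "ext_deriv N \<alpha> x (v # vs) = differential N (\<lambda>y. \<alpha> y vs) x v - ext_deriv N (\<lambda>y us. \<alpha> y (v # us)) x vs"
  by (simp add: ext_deriv_def sum.lessThan_Suc_shift sum_negf del: sum.lessThan_Suc)

lemma ext_deriv_cong:
  assumes "form_eq N \<alpha> \<beta>" "x \<in> RN N" "vs \<in> lists (CN N)"
  shows "ext_deriv N \<alpha> x vs = ext_deriv N \<beta> x vs"
  using assms(1,3)
proof (induction vs arbitrary: \<alpha> \<beta> rule: list.induct)
  case (Cons v vs)
  have "form_eq N (\<lambda>y us. \<alpha> y (v # us)) (\<lambda>y us. \<beta> y (v # us))"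
    using Cons.prems by (auto simp: form_eq_def)
  then have "ext_deriv N (\<lambda>y us. \<alpha> y (v # us)) x vs = ext_deriv N (\<lambda>y us. \<beta> y (v # us)) x vs"
    using Cons by auto
  moreover have "differential N (\<lambda>y. \<alpha> y vs) x v = differential N (\<lambda>y. \<beta> y vs) x v"
    by (rule differential_cong [OF _ assms(2)]) (use Cons.prems in \<open>auto simp: form_eq_def\<close>)
  ultimately show ?case by (simp add: ext_deriv_Cons)
qed (simp add: ext_deriv_Nil)

lemma ext_deriv_lin:
  assumes "sform N \<alpha>" "sform N \<beta>" "x \<in> RN N" "vs \<in> lists (CN N)"
  shows "ext_deriv N (\<lambda>y us. a * \<alpha> y us + b * \<beta> y us) x vs = a * ext_deriv N \<alpha> x vs + b * ext_deriv N \<beta> x vs"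
  using assms(1,2,4)
proof (induction vs arbitrary: \<alpha> \<beta> rule: list.induct)
  case (Cons v vs)
  then have v: "v \<in> CN N" and vs: "vs \<in> lists (CN N)" by auto
  show ?case
    using Cons.IH [OF sform_insert [OF Cons.prems(1) v] sform_insert [OF Cons.prems(2) v] vs]
      differential_lin [OF sform_smooth [OF Cons.prems(1) vs] sform_smooth [OF Cons.prems(2) vs] assms(3), of a b v]
    by (simp add: ext_deriv_Cons algebra_simps)
qed (simp add: ext_deriv_Nil)

lemma ext_deriv_zero: "ext_deriv N zero_form x vs = 0"
  by (simp add: ext_deriv_def differential_const)

text \<open>For a repeated front argument, two applications of \<open>ext_deriv_Cons\<close> produce
  the same derivative term with opposite signs.\<close>

lemma alt_ext_deriv:
  assumes "sform N \<alpha>" "x \<in> RN N"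
  shows "alt N (ext_deriv N \<alpha> x)"
proof (rule altI)
  fix us ws v w a b
  assume us: "us \<in> lists (CN N)" and ws: "ws \<in> lists (CN N)" and v: "v \<in> CN N" and w: "w \<in> CN N"
  let ?z = "\<lambda>i. a * v i + b * w i"
  show "ext_deriv N \<alpha> x (us @ ?z # ws) = a * ext_deriv N \<alpha> x (us @ v # ws) + b * ext_deriv N \<alpha> x (us @ w # ws)"
    using us assms(1)
  proof (induction us arbitrary: \<alpha> rule: list.induct)
    case Nil
    have "form_eq N (\<lambda>y us. \<alpha> y (?z # us)) (\<lambda>y us. a * \<alpha> y (v # us) + b * \<alpha> y (w # us))"
      unfolding form_eq_def
    proof (intro ballI)
      fix y us assume "y \<in> RN N" "us \<in> lists (CN N)"
      then show "\<alpha> y (?z # us) = a * \<alpha> y (v # us) + b * \<alpha> y (w # us)"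
        using alt_lin [OF sform_alt [OF Nil(2)], of y "[]" us v w a b] v w by simp
    qed
    then have "ext_deriv N (\<lambda>y us. \<alpha> y (?z # us)) x ws =
        ext_deriv N (\<lambda>y us. a * \<alpha> y (v # us) + b * \<alpha> y (w # us)) x ws"
      using assms(2) ws by (rule ext_deriv_cong)
    then show ?case
      using ext_deriv_lin [OF sform_insert [OF Nil(2) v] sform_insert [OF Nil(2) w] assms(2) ws]
      by (simp add: ext_deriv_Cons differential_lin_vec algebra_simps)
  next
    case (Cons u us)
    then have u: "u \<in> CN N" and us: "us \<in> lists (CN N)" by auto
    have "differential N (\<lambda>y. \<alpha> y (us @ ?z # ws)) x u =
        differential N (\<lambda>y. a * \<alpha> y (us @ v # ws) + b * \<alpha> y (us @ w # ws)) x u"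
    proof (rule differential_cong [OF _ assms(2)])
      fix y assume "y \<in> RN N"
      then show "\<alpha> y (us @ ?z # ws) = a * \<alpha> y (us @ v # ws) + b * \<alpha> y (us @ w # ws)"
        using alt_lin [OF sform_alt [OF Cons.prems(2)]] us ws v w by blast
    qed
    also have "\<dots> = a * differential N (\<lambda>y. \<alpha> y (us @ v # ws)) x u + b * differential N (\<lambda>y. \<alpha> y (us @ w # ws)) x u"
      using us ws v w by (intro differential_lin sform_smooth [OF Cons.prems(2)] assms(2)) auto
    finally show ?case
      using Cons.IH [OF us sform_insert [OF Cons.prems(2) u]] by (simp add: ext_deriv_Cons algebra_simps)
  qed
next
  fix us ws v
  assume us: "us \<in> lists (CN N)" and ws: "ws \<in> lists (CN N)" and v: "v \<in> CN N"
  show "ext_deriv N \<alpha> x (us @ v # v # ws) = 0"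
    using us assms(1)
  proof (induction us arbitrary: \<alpha> rule: list.induct)
    case Nil
    have "form_eq N (\<lambda>y us. \<alpha> y (v # v # us)) zero_form"
      unfolding form_eq_def
      using alt_eq0 [OF sform_alt [OF Nil(2)], where us = "[]"] v by simp
    then have "ext_deriv N (\<lambda>y us. \<alpha> y (v # v # us)) x ws = 0"
      by (simp add: ext_deriv_cong [OF _ assms(2) ws] ext_deriv_zero)
    then show ?case by (simp add: ext_deriv_Cons)
  next
    case (Cons u us)
    then have u: "u \<in> CN N" and us: "us \<in> lists (CN N)" by auto
    have "differential N (\<lambda>y. \<alpha> y (us @ v # v # ws)) x u = differential N (\<lambda>y. 0) x u"
      by (rule differential_cong [OF _ assms(2)])
         (rule alt_eq0 [OF sform_alt [OF Cons.prems(2)] us ws v])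
    then show ?case
      using Cons.IH [OF us sform_insert [OF Cons.prems(2) u]] by (simp add: ext_deriv_Cons differential_const)
  qed
qed

lemma nth_removed_CN:
  assumes "vs \<in> lists X" shows "take i vs @ drop (Suc i) vs \<in> lists X"
  using assms set_take_subset [of i vs] set_drop_subset [of "Suc i" vs] by (auto simp: in_lists_conv_set)

lemma is_form_ext_deriv:
  assumes "is_form N k \<alpha>"
  shows "is_form N (Suc k) (ext_deriv N \<alpha>)"
  unfolding is_form_iff sform_def has_degree_def
proof (intro conjI ballI impI)
  have s: "sform N \<alpha>" and d: "has_degree N k \<alpha>" using assms by (auto simp: is_form_iff)
  show "alt N (ext_deriv N \<alpha> x)" if "x \<in> RN N" for x
    using alt_ext_deriv [OF s that] .
  show "smooth N (\<lambda>x. ext_deriv N \<alpha> x vs)" if "vs \<in> lists (CN N)" for vs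
    unfolding ext_deriv_def
    by (intro smooth_intros sform_smooth [OF s] nth_removed_CN that)
  fix x vs assume x: "x \<in> RN N" and vs: "vs \<in> lists (CN N)" "length vs \<noteq> Suc k"
  have "differential N (\<lambda>y. \<alpha> y (take i vs @ drop (Suc i) vs)) x (vs ! i) = 0" if i: "i < length vs" for i
  proof -
    have "differential N (\<lambda>y. \<alpha> y (take i vs @ drop (Suc i) vs)) x (vs ! i) = differential N (\<lambda>y. 0) x (vs ! i)"
    proof (rule differential_cong [OF _ x])
      fix y assume "y \<in> RN N"
      moreover have "length (take i vs @ drop (Suc i) vs) \<noteq> k" using i vs by simp
      ultimately show "\<alpha> y (take i vs @ drop (Suc i) vs) = 0"
        using d nth_removed_CN [OF vs(1)] unfolding has_degree_def by blast
    qed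
    then show ?thesis by (simp add: differential_const)
  qed
  then show "ext_deriv N \<alpha> x vs = 0" by (simp add: ext_deriv_def)
qed

text \<open>The standard complex structure on $R^{2n} = C^n$, the coordinates of $C^n$ being $x_{2k} + i x_{2k+1}$.\<close>

definition stdJ :: tensor2 where
  "stdJ x i j = (if even i then if j = Suc i then -1 else 0 else if i = Suc j then 1 else 0)"

text \<open>The action of \<open>stdJ\<close>, polymorphic because the Gram-Schmidt process needs it
  on real vectors and the type decomposition on complex ones.\<close>

definition Jv :: "(nat \<Rightarrow> 'a::uminus) \<Rightarrow> nat \<Rightarrow> 'a" where
  "Jv v = (\<lambda>i. if even i then - v (Suc i) else v (i - 1))"

lemma Jv_CN: "v \<in> CN (2 * n) \<Longrightarrow> Jv v \<in> CN (2 * n)"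
  by (auto simp: CN_def Jv_def elim!: oddE)

lemma apply_stdJ:
  assumes "v \<in> CN (2 * n)" shows "apply_J (2 * n) stdJ x v = Jv v"
proof
  fix i
  have "(\<Sum>j<2 * n. complex_of_real (stdJ x i j) * v j) = Jv v i" if "i < 2 * n"
  proof (cases "even i")
    case True
    then have "(\<Sum>j<2 * n. complex_of_real (stdJ x i j) * v j) = (\<Sum>j<2 * n. if j = Suc i then - v j else 0)"
      by (intro sum.cong) (auto simp: stdJ_def)
    moreover have "Suc i < 2 * n" using True that by presburger
    ultimately show ?thesis using True by (simp add: Jv_def)
  next
    case False
    then have "(\<Sum>j<2 * n. complex_of_real (stdJ x i j) * v j) = (\<Sum>j<2 * n. if j = i - 1 then v j else 0)"
      by (intro sum.cong) (auto simp: stdJ_def elim!: oddE)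
    then show ?thesis using False that by (simp add: Jv_def)
  qed
  moreover have "Jv v i = 0" if "\<not> i < 2 * n" using Jv_CN [OF assms] that by (simp add: CN_def)
  ultimately show "apply_J (2 * n) stdJ x v i = Jv v i" by (simp add: apply_J_def)
qed

text \<open>\<open>stdJ\<close> is constant, so the types do not depend on the point, and constant
  vectors of pure type can be inserted into a form before it is differentiated.\<close>

definition t10 :: "nat \<Rightarrow> cvec set" where
  "t10 N = {v\<in>CN N. Jv v = (\<lambda>i. \<i> * v i)}"

definition t01 :: "nat \<Rightarrow> cvec set" where
  "t01 N = {v\<in>CN N. Jv v = (\<lambda>i. - \<i> * v i)}"

lemma T10_stdJ: "T10 (2 * n) stdJ x = t10 (2 * n)"
  by (auto simp: T10_def t10_def apply_stdJ)

lemma T01_stdJ: "T01 (2 * n) stdJ x = t01 (2 * n)"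
  by (auto simp: T01_def t01_def apply_stdJ)

lemma t10_CN: "v \<in> t10 N \<Longrightarrow> v \<in> CN N"
  by (simp add: t10_def)

lemma t01_CN: "v \<in> t01 N \<Longrightarrow> v \<in> CN N"
  by (simp add: t01_def)

lemma lists_t10: "us \<in> lists (t10 N) \<Longrightarrow> us \<in> lists (CN N)"
  by (auto simp: in_lists_conv_set t10_CN)

lemma lists_t01: "us \<in> lists (t01 N) \<Longrightarrow> us \<in> lists (CN N)"
  by (auto simp: in_lists_conv_set t01_CN)

definition p10 :: "cvec \<Rightarrow> cvec" where
  "p10 v = (\<lambda>i. (v i - \<i> * Jv v i) / 2)"

definition p01 :: "cvec \<Rightarrow> cvec" where
  "p01 v = (\<lambda>i. (v i + \<i> * Jv v i) / 2)"

lemma proj_stdJ: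
  "v \<in> CN (2 * n) \<Longrightarrow> proj10 (2 * n) stdJ x v = p10 v"
  "v \<in> CN (2 * n) \<Longrightarrow> proj01 (2 * n) stdJ x v = p01 v"
  by (simp_all add: proj10_def proj01_def p10_def p01_def apply_stdJ)

lemma Jv_Jv: "Jv (Jv v) = (\<lambda>i. - (v i :: complex))"
  by (rule ext) (auto simp: Jv_def)

lemma p10_t10: "v \<in> CN (2 * n) \<Longrightarrow> p10 v \<in> t10 (2 * n)"
  using Jv_CN [of v n] by (auto simp: t10_def p10_def CN_def Jv_def field_simps fun_eq_iff)

lemma p01_t01: "v \<in> CN (2 * n) \<Longrightarrow> p01 v \<in> t01 (2 * n)"
  using Jv_CN [of v n] by (auto simp: t01_def p01_def CN_def Jv_def field_simps fun_eq_iff)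

lemma p10_id: "v \<in> t10 N \<Longrightarrow> p10 v = v" "v \<in> t10 N \<Longrightarrow> p01 v = (\<lambda>i. 0)"
  by (auto simp: t10_def p10_def p01_def fun_eq_iff field_simps)

lemma p01_id: "v \<in> t01 N \<Longrightarrow> p01 v = v" "v \<in> t01 N \<Longrightarrow> p10 v = (\<lambda>i. 0)"
  by (auto simp: t01_def p10_def p01_def fun_eq_iff field_simps)

lemma p10_p01: "v = (\<lambda>i. 1 * p10 v i + 1 * p01 v i)"
  by (auto simp: p10_def p01_def fun_eq_iff field_simps)

lemma p10_lin: "p10 (\<lambda>i. a * v i + b * w i) = (\<lambda>i. a * p10 v i + b * p10 w i)"
  by (auto simp: p10_def Jv_def fun_eq_iff field_simps)

lemma p01_lin: "p01 (\<lambda>i. a * v i + b * w i) = (\<lambda>i. a * p01 v i + b * p01 w i)"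
  by (auto simp: p01_def Jv_def fun_eq_iff field_simps)

lemma p10_CN: "v \<in> CN (2 * n) \<Longrightarrow> p10 v \<in> CN (2 * n)"
  using p10_t10 t10_CN by blast

lemma p01_CN: "v \<in> CN (2 * n) \<Longrightarrow> p01 v \<in> CN (2 * n)"
  using p01_t01 t01_CN by blast

text \<open>The terms of \<^const>\<open>pq_part\<close> with \<open>p\<close> vectors projected to type $(1,0)$, by recursion on the arguments.\<close>

primrec pqr :: "cvec list \<Rightarrow> nat \<Rightarrow> (cvec list \<Rightarrow> complex) \<Rightarrow> complex" where
  "pqr [] p f = (if p = 0 then f [] else 0)"
| "pqr (v # vs) p f = (case p of 0 \<Rightarrow> 0 | Suc p' \<Rightarrow> pqr vs p' (\<lambda>us. f (p10 v # us)))
     + pqr vs p (\<lambda>us. f (p01 v # us))"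

lemma pqr_eq_sum:
  "(\<Sum>S\<in>Pow {..<length vs}. if card S = p
      then f (map (\<lambda>i. if i \<in> S then p10 (vs ! i) else p01 (vs ! i)) [0..<length vs]) else 0) = pqr vs p f"
proof (induction vs arbitrary: p f)
  case Nil
  then show ?case by auto
next
  case (Cons v vs)
  let ?m = "\<lambda>S vs. map (\<lambda>i. if i \<in> S then p10 (vs ! i) else p01 (vs ! i)) [0..<length vs]"
  have m: "?m (insert 0 (Suc ` S)) (v # vs) = p10 v # ?m S vs"
    "?m (Suc ` S) (v # vs) = p01 v # ?m S vs" for S
    by (simp_all add: upt_rec [of 0] map_Suc_upt [symmetric] comp_def image_iff del: upt_Suc)
  have c: "card (insert 0 (Suc ` S)) = Suc (card S)" "card (Suc ` S) = card S" if "S \<in> Pow {..<length vs}" for S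
    using that finite_subset [of S "{..<length vs}"] by (auto simp: card_image image_iff)
  have "(\<Sum>S\<in>Pow {..<length (v # vs)}. if card S = p then f (?m S (v # vs)) else 0) =
      (\<Sum>S\<in>Pow {..<length vs}. (if Suc (card S) = p then f (p10 v # ?m S vs) else 0) +
        (if card S = p then f (p01 v # ?m S vs) else 0))"
    unfolding length_Cons sum_Pow_Suc by (intro sum.cong refl) (simp only: m [unfolded length_Cons] c)
  also have "\<dots> = pqr (v # vs) p f"
    by (cases p) (simp_all add: sum.distrib Cons.IH [symmetric])
  finally show ?case .
qed

lemma pq_part_stdJ:
  assumes "vs \<in> lists (CN (2 * n))"
  shows "pq_part (2 * n) stdJ p q \<alpha> x vs = (if length vs = p + q then pqr vs p (\<alpha> x) else 0)"
proof (cases "length vs = p + q")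
  case True
  have "(\<Sum>S\<in>{S. S \<subseteq> {..<p + q} \<and> card S = p}.
      \<alpha> x (map (\<lambda>i. if i \<in> S then proj10 (2 * n) stdJ x (vs ! i) else proj01 (2 * n) stdJ x (vs ! i)) [0..<p + q]))
    = (\<Sum>S\<in>{S\<in>Pow {..<length vs}. card S = p}.
        \<alpha> x (map (\<lambda>i. if i \<in> S then p10 (vs ! i) else p01 (vs ! i)) [0..<length vs]))"
    using True assms by (intro sum.cong arg_cong [of _ _ "\<alpha> x"] map_cong) (auto simp: proj_stdJ in_lists_conv_set)
  also have "\<dots> = pqr vs p (\<alpha> x)"
    unfolding pqr_eq_sum [symmetric] by (rule sum.inter_filter) simp
  finally show ?thesis using True by (simp add: pq_part_def)
qed (simp add: pq_part_def)

lemma pqr_cong: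
  assumes "vs \<in> lists (CN (2 * n))"
    "\<And>us. us \<in> lists (CN (2 * n)) \<Longrightarrow> length us = length vs \<Longrightarrow> f us = g us"
  shows "pqr vs p f = pqr vs p g"
  using assms
proof (induction vs arbitrary: p f g rule: list.induct)
  case (Cons v vs)
  have "pqr vs p' (\<lambda>us. f (p10 v # us)) = pqr vs p' (\<lambda>us. g (p10 v # us))" for p'
    using Cons.prems p10_CN by (intro Cons.IH) auto
  moreover have "pqr vs p (\<lambda>us. f (p01 v # us)) = pqr vs p (\<lambda>us. g (p01 v # us))"
    using Cons.prems p01_CN by (intro Cons.IH) auto
  ultimately show ?case by (cases p) auto
qed auto

lemma pqr_lin: "pqr vs p (\<lambda>u. a * f u + b * g u) = a * pqr vs p f + b * pqr vs p g"
  by (induction vs arbitrary: p f g) (auto simp: algebra_simps split: nat.split)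

lemma pqr_zero [simp]: "pqr vs p (\<lambda>u. 0) = 0"
  using pqr_lin [of vs p 0 _ 0] by simp

lemma alt_pqr:
  assumes "alt (2 * n) f"
  shows "alt (2 * n) (\<lambda>vs. pqr vs p f)"
proof (rule altI)
  fix us ws v w a b
  assume us: "us \<in> lists (CN (2 * n))" and ws: "ws \<in> lists (CN (2 * n))" and v: "v \<in> CN (2 * n)" and w: "w \<in> CN (2 * n)"
  show "pqr (us @ (\<lambda>i. a * v i + b * w i) # ws) p f = a * pqr (us @ v # ws) p f + b * pqr (us @ w # ws) p f"
    using us assms
  proof (induction us arbitrary: p f rule: list.induct)
    case Nil
    have l: "pqr ws p (\<lambda>us. f ((\<lambda>i. a * v' i + b * w' i) # us)) = pqr ws p (\<lambda>us. a * f (v' # us) + b * f (w' # us))"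
      if "v' \<in> CN (2 * n)" "w' \<in> CN (2 * n)" for p v' w'
      using alt_lin [OF Nil(2), where us = "[]"] that by (intro pqr_cong [OF ws]) simp
    show ?case
      using v w p10_CN p01_CN by (cases p) (simp_all add: p10_lin p01_lin l pqr_lin algebra_simps)
  next
    case (Cons u us)
    then have u: "u \<in> CN (2 * n)" and us: "us \<in> lists (CN (2 * n))" by auto
    show ?case
      using Cons.IH [OF us alt_Cons [OF Cons.prems(2) p10_CN [OF u]]]
        Cons.IH [OF us alt_Cons [OF Cons.prems(2) p01_CN [OF u]]]
      by (cases p) (simp_all add: algebra_simps)
  qed
next
  fix us ws v
  assume us: "us \<in> lists (CN (2 * n))" and ws: "ws \<in> lists (CN (2 * n))" and v: "v \<in> CN (2 * n)"
  show "pqr (us @ v # v # ws) p f = 0"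
    using us assms
  proof (induction us arbitrary: p f rule: list.induct)
    case Nil
    have z: "pqr ws p (\<lambda>us. f (z # z # us)) = 0" if "z \<in> CN (2 * n)" for p z
    proof -
      have "pqr ws p (\<lambda>us. f (z # z # us)) = pqr ws p (\<lambda>us. 0)"
        using alt_eq0 [OF Nil(2), where us = "[]"] that by (intro pqr_cong [OF ws]) simp
      then show ?thesis by simp
    qed
    \<comment> \<open>For a repeated \<open>v\<close>, the terms that project one copy to each type
      occur in both orders and cancel.\<close>
    have "pqr ws p (\<lambda>us. f (p01 v # p10 v # us)) = pqr ws p (\<lambda>us. (-1) * f (p10 v # p01 v # us) + 0 * f us)" for p
    proof (rule pqr_cong [OF ws])
      fix us assume "us \<in> lists (CN (2 * n))"
      then show "f (p01 v # p10 v # us) = (-1) * f (p10 v # p01 v # us) + 0 * f us"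
        using alt_swap [OF Nil(2), of "[]" us "p01 v" "p10 v"] v p10_CN p01_CN by simp
    qed
    then have s: "pqr ws p (\<lambda>us. f (p01 v # p10 v # us)) = - pqr ws p (\<lambda>us. f (p10 v # p01 v # us))" for p
      unfolding pqr_lin by simp
    show ?case
      using v p10_CN p01_CN z s by (auto split: nat.split)
  next
    case (Cons u us)
    then have u: "u \<in> CN (2 * n)" and us: "us \<in> lists (CN (2 * n))" by auto
    show ?case
      using Cons.IH [OF us alt_Cons [OF Cons.prems(2) p10_CN [OF u]]]
        Cons.IH [OF us alt_Cons [OF Cons.prems(2) p01_CN [OF u]]]
      by (cases p) simp_all
  qed
qed

lemma smooth_pqr:
  assumes "vs \<in> lists (CN (2 * n))" "\<And>us. us \<in> lists (CN (2 * n)) \<Longrightarrow> smooth N (\<lambda>x. f x us)"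
  shows "smooth N (\<lambda>x. pqr vs p (f x))"
  using assms
proof (induction vs arbitrary: p f rule: list.induct)
  case Nil
  then show ?case by (cases p) (auto intro: smooth_intros)
next
  case (Cons v vs)
  then have "smooth N (\<lambda>x. pqr vs p' (\<lambda>us. f x (p10 v # us)))"
    "smooth N (\<lambda>x. pqr vs p' (\<lambda>us. f x (p01 v # us)))" for p'
    using p10_CN p01_CN by auto
  then show ?case by (cases p) (auto intro: smooth_intros)
qed

lemma is_form_pq_part:
  assumes "sform (2 * n) \<alpha>"
  shows "is_form (2 * n) (p + q) (pq_part (2 * n) stdJ p q \<alpha>)"
  unfolding is_form_iff sform_def has_degree_def
proof (intro conjI ballI impI)
  fix x assume x: "x \<in> RN (2 * n)"
  have a: "multilinear_alternating (2 * n) (p + q) (\<lambda>vs. if length vs = p + q then pqr vs p (\<alpha> x) else 0)"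
    using alt_pqr [OF sform_alt [OF assms x], of p]
    unfolding multilinear_alternating_iff alt_def by simp
  show "alt (2 * n) (pq_part (2 * n) stdJ p q \<alpha> x)"
    using a alt_cong [of "2 * n" "pq_part (2 * n) stdJ p q \<alpha> x" "\<lambda>vs. if length vs = p + q then pqr vs p (\<alpha> x) else 0"]
    by (simp add: multilinear_alternating_iff pq_part_stdJ)
next
  fix vs assume vs: "vs \<in> lists (CN (2 * n))"
  have "smooth (2 * n) (\<lambda>x. pqr vs p (\<alpha> x))"
    by (rule smooth_pqr [OF vs sform_smooth [OF assms]])
  then show "smooth (2 * n) (\<lambda>x. pq_part (2 * n) stdJ p q \<alpha> x vs)"
    by (cases "length vs = p + q") (simp_all add: pq_part_stdJ [OF vs] smooth_const)
qed (simp add: pq_part_stdJ)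

text \<open>On arguments of pure type a single choice of projections survives: each projection is
  the identity on its own type and 0 on the other.\<close>

lemma pqr_typed:
  assumes "us \<in> lists (t10 (2 * n))" "ws \<in> lists (t01 (2 * n))" "alt (2 * n) f"
  shows "pqr (us @ ws) p f = (if length us = p then f (us @ ws) else 0)"
  using assms
proof (induction us arbitrary: p f rule: list.induct)
  case Nil
  have "pqr ws p f = (if p = 0 then f ws else 0)"
    using Nil(2,3)
  proof (induction ws arbitrary: p f rule: list.induct)
    case (Cons w ws)
    then have w: "w \<in> t01 (2 * n)" and ws: "ws \<in> lists (t01 (2 * n))" by auto
    have "pqr ws p (\<lambda>us. f ((\<lambda>i. 0) # us)) = pqr ws p (\<lambda>us. 0)" for p
      using alt_zero [OF Cons.prems(2), where us = "[]"] by (intro pqr_cong [OF lists_t01 [OF ws]]) simp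
    then show ?case
      using Cons.IH [OF ws alt_Cons [OF Cons.prems(2) t01_CN [OF w]]] p01_id [OF w] by (auto split: nat.split)
  qed auto
  then show ?case by simp
next
  case (Cons u us)
  then have u: "u \<in> t10 (2 * n)" and us: "us \<in> lists (t10 (2 * n))" by auto
  have l: "us @ ws \<in> lists (CN (2 * n))" using lists_t10 [OF us] lists_t01 [OF assms(2)] by simp
  have "pqr (us @ ws) p (\<lambda>us. f ((\<lambda>i. 0) # us)) = pqr (us @ ws) p (\<lambda>us. 0)" for p
    using alt_zero [OF Cons.prems(3), where us = "[]"] by (intro pqr_cong [OF l]) simp
  then show ?case
    using Cons.IH [OF us assms(2) alt_Cons [OF Cons.prems(3) t10_CN [OF u]]] p10_id [OF u] by (auto split: nat.split)
qed

lemma pq_part_typed: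
  assumes "us \<in> lists (t10 (2 * n))" "ws \<in> lists (t01 (2 * n))" "sform (2 * n) \<alpha>" "x \<in> RN (2 * n)"
  shows "pq_part (2 * n) stdJ p q \<alpha> x (us @ ws) = (if length us = p \<and> length ws = q then \<alpha> x (us @ ws) else 0)"
proof -
  have "us @ ws \<in> lists (CN (2 * n))" using lists_t10 lists_t01 assms by auto
  then show ?thesis
    by (auto simp: pq_part_stdJ pqr_typed [OF assms(1,2) sform_alt [OF assms(3,4)]])
qed

lemma pq_part_cong:
  assumes "form_eq (2 * n) \<alpha> \<beta>"
  shows "form_eq (2 * n) (pq_part (2 * n) stdJ p q \<alpha>) (pq_part (2 * n) stdJ p q \<beta>)"
  unfolding form_eq_def
proof (intro ballI)
  fix x vs assume x: "x \<in> RN (2 * n)" and vs: "vs \<in> lists (CN (2 * n))"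
  have "pqr vs p (\<alpha> x) = pqr vs p (\<beta> x)"
    by (rule pqr_cong [OF vs]) (rule form_eqD [OF assms x])
  then show "pq_part (2 * n) stdJ p q \<alpha> x vs = pq_part (2 * n) stdJ p q \<beta> x vs"
    by (simp add: pq_part_stdJ [OF vs])
qed

lemma form_eq_ext_deriv: "form_eq N \<alpha> \<beta> \<Longrightarrow> form_eq N (ext_deriv N \<alpha>) (ext_deriv N \<beta>)"
  using ext_deriv_cong by (simp add: form_eq_def)

lemma del_cong:
  assumes "form_eq (2 * n) \<alpha> \<beta>"
  shows "form_eq (2 * n) (del (2 * n) stdJ \<alpha>) (del (2 * n) stdJ \<beta>)"
  unfolding form_eq_def del_def Let_def
  by (intro ballI sum.cong refl form_eqD [OF pq_part_cong [OF form_eq_ext_deriv [OF pq_part_cong [OF assms]]]])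

lemma delbar_cong:
  assumes "form_eq (2 * n) \<alpha> \<beta>"
  shows "form_eq (2 * n) (delbar (2 * n) stdJ \<alpha>) (delbar (2 * n) stdJ \<beta>)"
  unfolding form_eq_def delbar_def Let_def
  by (intro ballI sum.cong refl form_eqD [OF pq_part_cong [OF form_eq_ext_deriv [OF pq_part_cong [OF assms]]]])

lemma is_form_sum: "(\<And>k. k \<in> A \<Longrightarrow> is_form N m (\<alpha> k)) \<Longrightarrow> is_form N m (\<lambda>x vs. \<Sum>k\<in>A. \<alpha> k x vs)"
  by (auto simp: is_form_iff has_degree_def intro!: sform_sum)

text \<open>In \<open>del\<close> and \<open>delbar\<close> the range of bidegrees depends on the
  length of the argument list. For a form of degree \<open>k\<close> only \<open>p + q = k\<close>
  contributes, which makes the index set fixed and the result visibly a form.\<close>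

lemma del_eq_sum:
  assumes "is_form (2 * n) k \<alpha>" "x \<in> RN (2 * n)" "vs \<in> lists (CN (2 * n))"
  shows "del (2 * n) stdJ \<alpha> x vs = (\<Sum>p<Suc k. pq_part (2 * n) stdJ (p + 1) (k - p)
     (ext_deriv (2 * n) (pq_part (2 * n) stdJ p (k - p) \<alpha>)) x vs)"
    and "delbar (2 * n) stdJ \<alpha> x vs = (\<Sum>p<Suc k. pq_part (2 * n) stdJ p (k - p + 1)
     (ext_deriv (2 * n) (pq_part (2 * n) stdJ p (k - p) \<alpha>)) x vs)"
proof -
  have *: "pq_part (2 * n) stdJ p' q' (ext_deriv (2 * n) (pq_part (2 * n) stdJ p q \<alpha>)) x vs = 0"
    if "p + q \<noteq> k" for p q p' q'
  proof -
    have "form_eq (2 * n) (pq_part (2 * n) stdJ p q \<alpha>) zero_form"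
      unfolding form_eq_def
    proof (intro ballI)
      fix y us assume y: "y \<in> RN (2 * n)" and us: "us \<in> lists (CN (2 * n))"
      show "pq_part (2 * n) stdJ p q \<alpha> y us = 0"
      proof (cases "length us = p + q")
        case True
        have "pqr us p (\<alpha> y) = pqr us p (\<lambda>us. 0)"
          using assms(1) that True y by (intro pqr_cong [OF us]) (auto simp: is_form_iff has_degree_def)
        then show ?thesis by (simp add: pq_part_stdJ [OF us])
      qed (simp add: pq_part_stdJ [OF us])
    qed
    then have "form_eq (2 * n) (ext_deriv (2 * n) (pq_part (2 * n) stdJ p q \<alpha>)) zero_form"
      using form_eq_ext_deriv [of "2 * n" _ zero_form] by (simp add: form_eq_def ext_deriv_zero)
    then show ?thesis
      using form_eqD [OF pq_part_cong assms(2,3)] by (simp add: pq_part_stdJ [OF assms(3)])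
  qed
  have "del (2 * n) stdJ \<alpha> x vs = (\<Sum>p<Suc k. pq_part (2 * n) stdJ (p + 1) (k - p)
     (ext_deriv (2 * n) (pq_part (2 * n) stdJ p (k - p) \<alpha>)) x vs) \<and>
     delbar (2 * n) stdJ \<alpha> x vs = (\<Sum>p<Suc k. pq_part (2 * n) stdJ p (k - p + 1)
     (ext_deriv (2 * n) (pq_part (2 * n) stdJ p (k - p) \<alpha>)) x vs)"
  proof (cases "length vs = Suc k")
    case True
    then show ?thesis by (simp add: del_def delbar_def Let_def)
  next
    case False
    have "del (2 * n) stdJ \<alpha> x vs = 0" "delbar (2 * n) stdJ \<alpha> x vs = 0"
      unfolding del_def delbar_def Let_def using False by (auto intro!: sum.neutral *)
    moreover have "(\<Sum>p<Suc k. pq_part (2 * n) stdJ (p + 1) (k - p)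
     (ext_deriv (2 * n) (pq_part (2 * n) stdJ p (k - p) \<alpha>)) x vs) = 0"
     "(\<Sum>p<Suc k. pq_part (2 * n) stdJ p (k - p + 1)
     (ext_deriv (2 * n) (pq_part (2 * n) stdJ p (k - p) \<alpha>)) x vs) = 0"
      using False by (auto intro!: sum.neutral simp: pq_part_stdJ [OF assms(3)] simp del: sum.lessThan_Suc)
    ultimately show ?thesis by (simp del: sum.lessThan_Suc)
  qed
  then show "del (2 * n) stdJ \<alpha> x vs = (\<Sum>p<Suc k. pq_part (2 * n) stdJ (p + 1) (k - p)
     (ext_deriv (2 * n) (pq_part (2 * n) stdJ p (k - p) \<alpha>)) x vs)"
    "delbar (2 * n) stdJ \<alpha> x vs = (\<Sum>p<Suc k. pq_part (2 * n) stdJ p (k - p + 1)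
     (ext_deriv (2 * n) (pq_part (2 * n) stdJ p (k - p) \<alpha>)) x vs)"
    by blast+
qed

lemma is_form_ext_deriv_pq:
  assumes "is_form (2 * n) k \<alpha>" "p < Suc k"
  shows "is_form (2 * n) (Suc k) (ext_deriv (2 * n) (pq_part (2 * n) stdJ p (k - p) \<alpha>))"
  using is_form_ext_deriv [OF is_form_pq_part, of n \<alpha> p "k - p"] assms by (simp add: is_form_iff)

lemma is_form_del:
  assumes "is_form (2 * n) k \<alpha>"
  shows "is_form (2 * n) (Suc k) (del (2 * n) stdJ \<alpha>)"
proof (rule is_form_cong)
  show "form_eq (2 * n) (\<lambda>x vs. \<Sum>p<Suc k. pq_part (2 * n) stdJ (p + 1) (k - p)
     (ext_deriv (2 * n) (pq_part (2 * n) stdJ p (k - p) \<alpha>)) x vs) (del (2 * n) stdJ \<alpha>)"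
    unfolding form_eq_def by (intro ballI del_eq_sum(1) [OF assms, symmetric])
  show "is_form (2 * n) (Suc k) (\<lambda>x vs. \<Sum>p<Suc k. pq_part (2 * n) stdJ (p + 1) (k - p)
     (ext_deriv (2 * n) (pq_part (2 * n) stdJ p (k - p) \<alpha>)) x vs)"
  proof (rule is_form_sum)
    fix p assume "p \<in> {..<Suc k}"
    then show "is_form (2 * n) (Suc k) (pq_part (2 * n) stdJ (p + 1) (k - p)
        (ext_deriv (2 * n) (pq_part (2 * n) stdJ p (k - p) \<alpha>)))"
      using is_form_pq_part [of n "ext_deriv (2 * n) (pq_part (2 * n) stdJ p (k - p) \<alpha>)" "p + 1" "k - p"]
        is_form_ext_deriv_pq [OF assms, of p] by (simp add: is_form_iff)
  qed
qed

lemma is_form_delbar: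
  assumes "is_form (2 * n) k \<alpha>"
  shows "is_form (2 * n) (Suc k) (delbar (2 * n) stdJ \<alpha>)"
proof (rule is_form_cong)
  show "form_eq (2 * n) (\<lambda>x vs. \<Sum>p<Suc k. pq_part (2 * n) stdJ p (k - p + 1)
     (ext_deriv (2 * n) (pq_part (2 * n) stdJ p (k - p) \<alpha>)) x vs) (delbar (2 * n) stdJ \<alpha>)"
    unfolding form_eq_def by (intro ballI del_eq_sum(2) [OF assms, symmetric])
  show "is_form (2 * n) (Suc k) (\<lambda>x vs. \<Sum>p<Suc k. pq_part (2 * n) stdJ p (k - p + 1)
     (ext_deriv (2 * n) (pq_part (2 * n) stdJ p (k - p) \<alpha>)) x vs)"
  proof (rule is_form_sum)
    fix p assume "p \<in> {..<Suc k}"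
    then show "is_form (2 * n) (Suc k) (pq_part (2 * n) stdJ p (k - p + 1)
        (ext_deriv (2 * n) (pq_part (2 * n) stdJ p (k - p) \<alpha>)))"
      using is_form_pq_part [of n "ext_deriv (2 * n) (pq_part (2 * n) stdJ p (k - p) \<alpha>)" p "k - p + 1"]
        is_form_ext_deriv_pq [OF assms, of p] by (simp add: is_form_iff)
  qed
qed

section \<open>The operators del and delbar on constant vectors of pure type\<close>

lemma sum_lessThan_add: "(\<Sum>i<a + b. F i) = (\<Sum>i<a. F i) + (\<Sum>i<b. F (a + i))"
  for F :: "nat \<Rightarrow> complex"
  by (induction b) simp_all

lemma ext_deriv_append:
  "ext_deriv N \<alpha> x (us @ ws) =
     (\<Sum>i<length us. (-1) ^ i * differential N (\<lambda>y. \<alpha> y ((take i us @ drop (Suc i) us) @ ws)) x (us ! i)) +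
     (\<Sum>i<length ws. (-1) ^ (length us + i) *
        differential N (\<lambda>y. \<alpha> y (us @ take i ws @ drop (Suc i) ws)) x (ws ! i))"
  unfolding ext_deriv_def length_append sum_lessThan_add
  by (intro arg_cong2 [of _ _ _ _ "(+)"] sum.cong refl) (auto simp: nth_append)

text \<open>On vectors of pure type, del is the part of d that differentiates along the (1,0)
  vectors. Removing a (0,1) vector instead leaves too many (1,0) arguments for the component of
  bidegree \<open>(p, k - p)\<close> concerned, which is 0 there.\<close>

lemma del_typed:
  assumes "is_form (2 * n) k \<alpha>" "us \<in> lists (t10 (2 * n))" "ws \<in> lists (t01 (2 * n))"
    and x: "x \<in> RN (2 * n)" and len: "length us + length ws = Suc k"
  shows "del (2 * n) stdJ \<alpha> x (us @ ws) = (\<Sum>i<length us. (-1) ^ i *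
      differential (2 * n) (\<lambda>y. \<alpha> y ((take i us @ drop (Suc i) us) @ ws)) x (us ! i))"
proof -
  let ?E = "\<lambda>p. ext_deriv (2 * n) (pq_part (2 * n) stdJ p (k - p) \<alpha>)"
  have l: "us @ ws \<in> lists (CN (2 * n))" using lists_t10 lists_t01 assms by auto
  have s: "sform (2 * n) \<alpha>" using assms(1) by (simp add: is_form_iff)
  have "del (2 * n) stdJ \<alpha> x (us @ ws) =
      (\<Sum>p<Suc k. if length us = p + 1 \<and> length ws = k - p then ?E p x (us @ ws) else 0)"
    unfolding del_eq_sum(1) [OF assms(1) x l]
    using is_form_ext_deriv_pq [OF assms(1)]
    by (intro sum.cong refl pq_part_typed [OF assms(2,3) _ x]) (auto simp: is_form_iff)
  also have "\<dots> = (\<Sum>i<length us. (-1) ^ i *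
      differential (2 * n) (\<lambda>y. \<alpha> y ((take i us @ drop (Suc i) us) @ ws)) x (us ! i))"
  proof (cases "length us")
    case 0
    then show ?thesis by simp
  next
    case (Suc p)
    have "(\<Sum>q<Suc k. if length us = q + 1 \<and> length ws = k - q then ?E q x (us @ ws) else 0) =
        (\<Sum>q<Suc k. if q = p then ?E q x (us @ ws) else 0)"
      using Suc len by (intro sum.cong) auto
    also have "\<dots> = ?E p x (us @ ws)"
      using Suc len by (subst sum.delta) auto
    also have "\<dots> = (\<Sum>i<length us. (-1) ^ i *
      differential (2 * n) (\<lambda>y. \<alpha> y ((take i us @ drop (Suc i) us) @ ws)) x (us ! i)) +
      (\<Sum>i<length ws. (-1) ^ (length us + i) * 0)"
      unfolding ext_deriv_append
    proof (intro arg_cong2 [of _ _ _ _ "(+)"] sum.cong refl arg_cong2 [of _ _ _ _ "(*)"])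
      fix i assume i: "i \<in> {..<length us}"
      show "differential (2 * n) (\<lambda>y. pq_part (2 * n) stdJ p (k - p) \<alpha> y ((take i us @ drop (Suc i) us) @ ws)) x (us ! i)
          = differential (2 * n) (\<lambda>y. \<alpha> y ((take i us @ drop (Suc i) us) @ ws)) x (us ! i)"
      proof (rule differential_cong [OF _ x])
        fix y assume "y \<in> RN (2 * n)"
        then show "pq_part (2 * n) stdJ p (k - p) \<alpha> y ((take i us @ drop (Suc i) us) @ ws)
            = \<alpha> y ((take i us @ drop (Suc i) us) @ ws)"
          using i Suc len pq_part_typed [OF nth_removed_CN [OF assms(2)] assms(3) s, of y] by simp
      qed
    next
      fix i assume i: "i \<in> {..<length ws}"
      have "differential (2 * n) (\<lambda>y. pq_part (2 * n) stdJ p (k - p) \<alpha> y (us @ take i ws @ drop (Suc i) ws)) x (ws ! i)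
          = differential (2 * n) (\<lambda>y. 0) x (ws ! i)"
      proof (rule differential_cong [OF _ x])
        fix y assume "y \<in> RN (2 * n)"
        then show "pq_part (2 * n) stdJ p (k - p) \<alpha> y (us @ take i ws @ drop (Suc i) ws) = 0"
          using Suc pq_part_typed [OF assms(2) nth_removed_CN [OF assms(3)] s, of y] by simp
      qed
      then show "differential (2 * n) (\<lambda>y. pq_part (2 * n) stdJ p (k - p) \<alpha> y (us @ take i ws @ drop (Suc i) ws)) x (ws ! i) = 0"
        by (simp add: differential_const)
    qed
    finally show ?thesis by simp
  qed
  finally show ?thesis .
qed

lemma delbar_typed:
  assumes "is_form (2 * n) k \<alpha>" "us \<in> lists (t10 (2 * n))" "ws \<in> lists (t01 (2 * n))"
    and x: "x \<in> RN (2 * n)" and len: "length us + length ws = Suc k"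
  shows "delbar (2 * n) stdJ \<alpha> x (us @ ws) = (\<Sum>i<length ws. (-1) ^ (length us + i) *
      differential (2 * n) (\<lambda>y. \<alpha> y (us @ take i ws @ drop (Suc i) ws)) x (ws ! i))"
proof -
  let ?E = "\<lambda>p. ext_deriv (2 * n) (pq_part (2 * n) stdJ p (k - p) \<alpha>)"
  have l: "us @ ws \<in> lists (CN (2 * n))" using lists_t10 lists_t01 assms by auto
  have s: "sform (2 * n) \<alpha>" using assms(1) by (simp add: is_form_iff)
  have "delbar (2 * n) stdJ \<alpha> x (us @ ws) =
      (\<Sum>p<Suc k. if length us = p \<and> length ws = k - p + 1 then ?E p x (us @ ws) else 0)"
    unfolding del_eq_sum(2) [OF assms(1) x l]
    using is_form_ext_deriv_pq [OF assms(1)]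
    by (intro sum.cong refl pq_part_typed [OF assms(2,3) _ x]) (auto simp: is_form_iff)
  also have "\<dots> = (\<Sum>i<length ws. (-1) ^ (length us + i) *
      differential (2 * n) (\<lambda>y. \<alpha> y (us @ take i ws @ drop (Suc i) ws)) x (ws ! i))"
  proof (cases "length ws")
    case 0
    then show ?thesis by simp
  next
    case (Suc q)
    let ?p = "length us"
    have "(\<Sum>q<Suc k. if length us = q \<and> length ws = k - q + 1 then ?E q x (us @ ws) else 0) =
        (\<Sum>q<Suc k. if q = ?p then ?E q x (us @ ws) else 0)"
      using Suc len by (intro sum.cong) auto
    also have "\<dots> = ?E ?p x (us @ ws)"
      using Suc len by (subst sum.delta) auto
    also have "\<dots> = (\<Sum>i<length us. (-1) ^ i * 0) + (\<Sum>i<length ws. (-1) ^ (length us + i) *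
      differential (2 * n) (\<lambda>y. \<alpha> y (us @ take i ws @ drop (Suc i) ws)) x (ws ! i))"
      unfolding ext_deriv_append
    proof (intro arg_cong2 [of _ _ _ _ "(+)"] sum.cong refl arg_cong2 [of _ _ _ _ "(*)"])
      fix i assume i: "i \<in> {..<length us}"
      have "differential (2 * n) (\<lambda>y. pq_part (2 * n) stdJ ?p (k - ?p) \<alpha> y ((take i us @ drop (Suc i) us) @ ws)) x (us ! i)
          = differential (2 * n) (\<lambda>y. 0) x (us ! i)"
      proof (rule differential_cong [OF _ x])
        fix y assume "y \<in> RN (2 * n)"
        then show "pq_part (2 * n) stdJ ?p (k - ?p) \<alpha> y ((take i us @ drop (Suc i) us) @ ws) = 0"
          using i Suc pq_part_typed [OF nth_removed_CN [OF assms(2)] assms(3) s, of y] by auto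
      qed
      then show "differential (2 * n) (\<lambda>y. pq_part (2 * n) stdJ ?p (k - ?p) \<alpha> y ((take i us @ drop (Suc i) us) @ ws)) x (us ! i) = 0"
        by (simp add: differential_const)
    next
      fix i assume i: "i \<in> {..<length ws}"
      show "differential (2 * n) (\<lambda>y. pq_part (2 * n) stdJ ?p (k - ?p) \<alpha> y (us @ take i ws @ drop (Suc i) ws)) x (ws ! i)
          = differential (2 * n) (\<lambda>y. \<alpha> y (us @ take i ws @ drop (Suc i) ws)) x (ws ! i)"
      proof (rule differential_cong [OF _ x])
        fix y assume "y \<in> RN (2 * n)"
        then show "pq_part (2 * n) stdJ ?p (k - ?p) \<alpha> y (us @ take i ws @ drop (Suc i) ws)
            = \<alpha> y (us @ take i ws @ drop (Suc i) ws)"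
          using i Suc len pq_part_typed [OF assms(2) nth_removed_CN [OF assms(3)] s, of y] by simp
      qed
    qed
    finally show ?thesis by simp
  qed
  finally show ?thesis .
qed

text \<open>Each argument is split by \<open>p10_p01\<close>; its (1,0) part is moved to the front
  past the (0,1) vectors collected so far, which costs only a sign.\<close>

lemma alt_zero_of_typed:
  assumes "alt (2 * n) f" "\<And>us ws. us \<in> lists (t10 (2 * n)) \<Longrightarrow> ws \<in> lists (t01 (2 * n)) \<Longrightarrow> f (us @ ws) = 0"
    and "vs \<in> lists (CN (2 * n))"
  shows "f vs = 0"
proof -
  have "f (us @ ws @ vs) = 0" if "us \<in> lists (t10 (2 * n))" "ws \<in> lists (t01 (2 * n))" for us ws
    using assms(3) that
  proof (induction vs arbitrary: us ws rule: list.induct)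
    case Nil
    then show ?case using assms(2) by simp
  next
    case (Cons v vs)
    then have v: "v \<in> CN (2 * n)" and vs: "vs \<in> lists (CN (2 * n))"
      and us: "us \<in> lists (CN (2 * n))" and ws: "ws \<in> lists (CN (2 * n))"
      using lists_t10 lists_t01 by auto
    have "f ((us @ ws) @ (\<lambda>i. 1 * p10 v i + 1 * p01 v i) # vs) =
        1 * f ((us @ ws) @ p10 v # vs) + 1 * f ((us @ ws) @ p01 v # vs)"
      using us ws vs v p10_CN p01_CN by (intro alt_lin [OF assms(1)]) auto
    moreover have "f ((us @ ws) @ p01 v # vs) = 0"
      using Cons.IH [OF vs Cons.prems(2), of "ws @ [p01 v]"] Cons.prems(3) p01_t01 [OF v] by simp
    moreover have "f (us @ (ws @ p10 v # vs)) = (-1) ^ length ws * f (us @ (p10 v # ws @ vs))"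
      using alt_move [OF alt_append [OF assms(1) us] ws vs p10_CN [OF v]] .
    then have "f ((us @ ws) @ p10 v # vs) = 0"
      using Cons.IH [OF vs _ Cons.prems(3), of "us @ [p10 v]"] Cons.prems(2) p10_t10 [OF v] by simp
    ultimately show ?case using p10_p01 [of v] by simp
  qed
  from this [of "[]" "[]"] show ?thesis by simp
qed

section \<open>Hermitian metrics: adapted frames, dual vectors and the volume form\<close>

definition rmetric :: "nat \<Rightarrow> tensor2 \<Rightarrow> pt \<Rightarrow> pt \<Rightarrow> pt \<Rightarrow> real" where
  "rmetric N g x v w = (\<Sum>i<N. \<Sum>j<N. g x i j * v i * w j)"

definition runit :: "nat \<Rightarrow> pt" where
  "runit j = (\<lambda>i. if i = j then 1 else 0)"

text \<open>Gram-Schmidt over $C$: the vectors \<open>gs k\<close> and \<open>Jv (gs k)\<close> are pairwise orthogonal, and they depend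
  smoothly on the point.\<close>

fun gs :: "nat \<Rightarrow> tensor2 \<Rightarrow> nat \<Rightarrow> pt \<Rightarrow> pt" where
  "gs N g k x = (\<lambda>i. runit (2 * k) i - (\<Sum>l<k.
      rmetric N g x (runit (2 * k)) (gs N g l x) / rmetric N g x (gs N g l x) (gs N g l x) * gs N g l x i
    + rmetric N g x (runit (2 * k)) (Jv (gs N g l x)) / rmetric N g x (gs N g l x) (gs N g l x) * Jv (gs N g l x) i))"

declare gs.simps [simp del]

lemma complexify_CN: "v \<in> RN N \<longleftrightarrow> complexify v \<in> CN N"
  by (auto simp: RN_iff CN_def complexify_def)

lemma Jv_RN: "v \<in> RN (2 * n) \<Longrightarrow> Jv v \<in> RN (2 * n)"
  by (auto simp: RN_iff Jv_def elim!: oddE)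

lemma Jv_complexify: "Jv (complexify v) = complexify (Jv v)"
  by (auto simp: Jv_def complexify_def)

lemma Jv_Jv_real: "Jv (Jv v) = (\<lambda>i. - (v i :: real))"
  by (rule ext) (auto simp: Jv_def)

lemma conj_vec_CN: "v \<in> CN N \<Longrightarrow> conj_vec v \<in> CN N"
  by (auto simp: CN_def conj_vec_def)

lemma conj_vec_conj_vec [simp]: "conj_vec (conj_vec v) = v"
  by (simp add: conj_vec_def)

lemma metric_complexify: "metric N g x (complexify v) (complexify w) = complex_of_real (rmetric N g x v w)"
  by (simp add: metric_def rmetric_def complexify_def)

lemma metric_lin_left:
  "metric N g x (\<lambda>i. a * v i + b * w i) u = a * metric N g x v u + b * metric N g x w u"
  by (simp add: metric_def sum_distrib_left sum.distrib algebra_simps)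

lemma metric_lin_right:
  "metric N g x u (\<lambda>i. a * v i + b * w i) = a * metric N g x u v + b * metric N g x u w"
  by (simp add: metric_def sum_distrib_left sum.distrib algebra_simps)

lemma metric_sum_left: "metric N g x (\<lambda>i. \<Sum>k\<in>A. c k * v k i) u = (\<Sum>k\<in>A. c k * metric N g x (v k) u)"
proof (induction A rule: infinite_finite_induct)
  case (insert k A)
  then show ?case using metric_lin_left [of N g x "c k" "v k" 1 "\<lambda>i. \<Sum>k\<in>A. c k * v k i" u] by simp
qed (simp_all add: metric_def)

lemma rmetric_lin_left:
  "rmetric N g x (\<lambda>i. a * v i + b * w i) u = a * rmetric N g x v u + b * rmetric N g x w u"
  by (simp add: rmetric_def sum_distrib_left sum.distrib algebra_simps)

lemma rmetric_diff_left: "rmetric N g x (\<lambda>i. v i - w i) u = rmetric N g x v u - rmetric N g x w u"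
  using rmetric_lin_left [of N g x 1 v "-1" w u] by simp

lemma rmetric_sum_left: "rmetric N g x (\<lambda>i. \<Sum>k\<in>A. v k i) u = (\<Sum>k\<in>A. rmetric N g x (v k) u)"
proof (induction A rule: infinite_finite_induct)
  case (insert k A)
  then show ?case using rmetric_lin_left [of N g x 1 "v k" 1 "\<lambda>i. \<Sum>k\<in>A. v k i" u] by simp
qed (simp_all add: rmetric_def)

lemma metric_conj: "cnj (metric N g x v w) = metric N g x (conj_vec v) (conj_vec w)"
  by (simp add: metric_def conj_vec_def)

text \<open>Orthonormality says that the transposed frame matrix times \<open>g\<close> is a left
  inverse of the frame matrix \<open>?E\<close>. For square matrices it is then a right inverse as
  well, and this is the expansion.\<close>

lemma orthonormal_frame_expand:
  assumes e: "orthonormal_frame N g x e" and v: "v \<in> CN N"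
  shows "v = (\<lambda>a. \<Sum>i<N. metric N g x (complexify (e ! i)) v * complexify (e ! i) a)"
proof
  fix a
  let ?E = "mat N N (\<lambda>(a, i). (e ! i) a)" and ?F = "mat N N (\<lambda>(i, c). \<Sum>b<N. g x b c * (e ! i) b)"
  have eRN: "e ! i \<in> RN N" if "i < N" for i
    using e that by (auto simp: orthonormal_frame_def)
  have FE: "?F * ?E = 1\<^sub>m N"
  proof (rule eq_matI)
    fix i j assume ij: "i < dim_row (1\<^sub>m N :: real mat)" "j < dim_col (1\<^sub>m N :: real mat)"
    have "complex_of_real ((?F * ?E) $$ (i, j)) = metric N g x (complexify (e ! i)) (complexify (e ! j))"
      using ij unfolding metric_complexify rmetric_def
      by (subst sum.swap) (simp add: scalar_prod_def sum_distrib_right sum_distrib_left atLeast0LessThan mult_ac)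
    also have "\<dots> = complex_of_real ((1\<^sub>m N) $$ (i, j))"
      using e ij by (simp add: orthonormal_frame_def)
    finally show "(?F * ?E) $$ (i, j) = (1\<^sub>m N) $$ (i, j)" by simp
  qed auto
  have EF: "?E * ?F = 1\<^sub>m N"
    by (rule mat_mult_left_right_inverse [OF _ _ FE]) auto
  show "v a = (\<Sum>i<N. metric N g x (complexify (e ! i)) v * complexify (e ! i) a)"
  proof (cases "a < N")
    case True
    have "(\<Sum>i<N. (e ! i) a * (\<Sum>b<N. g x b c * (e ! i) b)) = (if a = c then 1 else 0)" if "c < N" for c
      using arg_cong [OF EF, of "\<lambda>M. M $$ (a, c)"] True that by (simp add: scalar_prod_def atLeast0LessThan)
    then have "complex_of_real (\<Sum>i<N. (e ! i) a * (\<Sum>b<N. g x b c * (e ! i) b)) = (if a = c then 1 else 0)"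
      if "c < N" for c
      using that by simp
    then have 1: "(\<Sum>i<N. complex_of_real ((e ! i) a) * (\<Sum>b<N. complex_of_real (g x b c) * complex_of_real ((e ! i) b))) =
        (if a = c then 1 else 0)" if "c < N" for c
      using that by (simp only: of_real_sum of_real_mult)
    have "(\<Sum>i<N. metric N g x (complexify (e ! i)) v * complexify (e ! i) a) =
        (\<Sum>i<N. \<Sum>c<N. complex_of_real ((e ! i) a) * (\<Sum>b<N. complex_of_real (g x b c) * complex_of_real ((e ! i) b)) * v c)"
    proof (rule sum.cong [OF refl])
      fix i
      show "metric N g x (complexify (e ! i)) v * complexify (e ! i) a =
        (\<Sum>c<N. complex_of_real ((e ! i) a) * (\<Sum>b<N. complex_of_real (g x b c) * complex_of_real ((e ! i) b)) * v c)"
        unfolding metric_def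
        by (subst sum.swap) (simp add: complexify_def sum_distrib_right sum_distrib_left mult_ac)
    qed
    also have "\<dots> = (\<Sum>c<N. (\<Sum>i<N. complex_of_real ((e ! i) a) * (\<Sum>b<N. complex_of_real (g x b c) * complex_of_real ((e ! i) b))) * v c)"
      by (subst sum.swap) (simp add: sum_distrib_right)
    also have "\<dots> = (\<Sum>c<N. (if a = c then 1 else 0) * v c)"
      using 1 by (intro sum.cong) auto
    also have "\<dots> = v a" using True by (simp add: if_distrib [of "\<lambda>z. z * _"] cong: if_cong)
    finally show ?thesis by simp
  next
    case False
    then have "v a = 0" "(e ! i) a = 0" if "i < N" for i
      using v eRN [OF that] by (auto simp: CN_def RN_iff)
    moreover have "v a = 0" using v False by (auto simp: CN_def)
    ultimately show ?thesis by (simp add: complexify_def)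
  qed
qed

text \<open>The pointwise properties of a Hermitian metric for \<open>stdJ\<close>, with no lattice
  involved. The locale serves both the explicit invariant metric and an arbitrary one.\<close>

locale herm =
  fixes n :: nat and g :: tensor2
  assumes smooth_g: "i < 2 * n \<Longrightarrow> j < 2 * n \<Longrightarrow> smooth (2 * n) (\<lambda>x. g x i j)"
    and sym_g: "x \<in> RN (2 * n) \<Longrightarrow> i < 2 * n \<Longrightarrow> j < 2 * n \<Longrightarrow> g x i j = g x j i"
    and pos_g: "x \<in> RN (2 * n) \<Longrightarrow> u \<in> RN (2 * n) \<Longrightarrow> u \<noteq> (\<lambda>i. 0) \<Longrightarrow> 0 < rmetric (2 * n) g x u u"
    and J_g: "x \<in> RN (2 * n) \<Longrightarrow> v \<in> CN (2 * n) \<Longrightarrow> w \<in> CN (2 * n) \<Longrightarrow>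
      metric (2 * n) g x (Jv v) (Jv w) = metric (2 * n) g x v w"
begin

abbreviation N where "N \<equiv> 2 * n"
abbreviation m where "m \<equiv> metric N g"
abbreviation r where "r \<equiv> rmetric N g"
abbreviation e where "e \<equiv> gs N g"
abbreviation q where "q k x \<equiv> r x (e k x) (e k x)"

lemma m_sym: assumes "x \<in> RN N" shows "m x v w = m x w v"
proof -
  have "m x v w = (\<Sum>j<N. \<Sum>i<N. complex_of_real (g x i j) * v i * w j)"
    unfolding metric_def by (rule sum.swap)
  also have "\<dots> = m x w v"
    unfolding metric_def using sym_g [OF assms] by (intro sum.cong refl) (simp add: mult_ac)
  finally show ?thesis .
qed

lemma r_sym: "x \<in> RN N \<Longrightarrow> r x v w = r x w v"
  using m_sym [of x "complexify v" "complexify w"] by (simp add: metric_complexify)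

lemma r_J:
  assumes "x \<in> RN N" "v \<in> RN N" "w \<in> RN N" shows "r x (Jv v) (Jv w) = r x v w"
proof -
  have "m x (Jv (complexify v)) (Jv (complexify w)) = m x (complexify v) (complexify w)"
    using assms by (intro J_g) (simp_all flip: complexify_CN)
  then show ?thesis by (simp add: Jv_complexify metric_complexify)
qed

lemma r_J_left:
  assumes "x \<in> RN N" "v \<in> RN N" "w \<in> RN N" shows "r x (Jv v) w = - r x v (Jv w)"
proof -
  have "r x (Jv v) w = r x (Jv (Jv v)) (Jv w)" using r_J [of x "Jv v" w] assms Jv_RN by simp
  also have "\<dots> = - r x v (Jv w)" by (simp add: Jv_Jv_real rmetric_def sum_negf)
  finally show ?thesis .
qed

lemma r_J_self: "x \<in> RN N \<Longrightarrow> v \<in> RN N \<Longrightarrow> r x v (Jv v) = 0"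
  using r_J_left [of x v v] r_sym [of x "Jv v" v] by simp

text \<open>With \<open>a\<close> and \<open>b\<close> the real and imaginary parts of
  \<open>v\<close>, the mixed terms cancel by symmetry and the value is
  \<open>r x a a + r x b b\<close>.\<close>

lemma m_pos:
  assumes x: "x \<in> RN N" and v: "v \<in> CN N" "v \<noteq> (\<lambda>i. 0)"
  shows "m x v (conj_vec v) \<noteq> 0"
proof -
  define a where "a = (\<lambda>i. Re (v i))"
  define b where "b = (\<lambda>i. Im (v i))"
  have ab: "a \<in> RN N" "b \<in> RN N" using v(1) by (auto simp: a_def b_def RN_iff CN_def)
  have v_eq: "v = (\<lambda>i. 1 * complexify a i + \<i> * complexify b i)"
    "conj_vec v = (\<lambda>i. 1 * complexify a i + (- \<i>) * complexify b i)"
    by (auto simp: a_def b_def complexify_def conj_vec_def complex_eq_iff)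
  have "m x v (conj_vec v) = m x (complexify a) (complexify a) + m x (complexify b) (complexify b)
      + \<i> * (m x (complexify b) (complexify a) - m x (complexify a) (complexify b))"
    unfolding v_eq(2) metric_lin_right by (subst (1 2) v_eq(1)) (simp only: metric_lin_left, simp add: algebra_simps)
  also have "\<dots> = complex_of_real (r x a a + r x b b)"
    by (simp add: r_sym [OF x, of b a] metric_complexify)
  finally have 1: "m x v (conj_vec v) = complex_of_real (r x a a + r x b b)" .
  have nn: "0 \<le> r x c c" if "c \<in> RN N" for c
    using pos_g [OF x that] by (cases "c = (\<lambda>i. 0)") (auto simp: rmetric_def)
  have "a \<noteq> (\<lambda>i. 0) \<or> b \<noteq> (\<lambda>i. 0)"
    using v(2) by (auto simp: a_def b_def fun_eq_iff complex_eq_iff)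
  then have "0 < r x a a + r x b b"
    using pos_g [OF x ab(1)] pos_g [OF x ab(2)] nn [OF ab(1)] nn [OF ab(2)] by linarith
  then show ?thesis unfolding 1 of_real_eq_0_iff by linarith
qed

lemma m_nondeg:
  assumes "x \<in> RN N" "v \<in> CN N" "w \<in> CN N" "\<And>u. u \<in> CN N \<Longrightarrow> m x v u = m x w u"
  shows "v = w"
proof -
  define z where "z = (\<lambda>i. 1 * v i + (-1) * w i)"
  have z: "z \<in> CN N" unfolding z_def by (rule CN_lincomb [OF assms(2,3)])
  have "m x z (conj_vec z) = 0"
    using assms(4) [OF conj_vec_CN [OF z]] unfolding z_def metric_lin_left by simp
  then have "z = (\<lambda>i. 0)" using m_pos [OF assms(1) z] by blast
  then show ?thesis by (auto simp: z_def fun_eq_iff)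
qed

text \<open>Triangularity: the vectors subtracted at stage \<open>k\<close> live on indices below
  \<open>2 * k\<close>. Hence \<open>e k x\<close> is never zero, which is what makes the
  denominators of the process positive.\<close>

lemma gs_support_diag: "(\<forall>i>2 * k. e k x i = 0) \<and> e k x (2 * k) = 1"
proof (induction k rule: less_induct)
  case (less k)
  have "(\<Sum>l<k. r x (runit (2 * k)) (e l x) / q l x * e l x i + r x (runit (2 * k)) (Jv (e l x)) / q l x * Jv (e l x) i) = 0"
    if "2 * k \<le> i" for i
  proof (rule sum.neutral, rule ballI)
    fix l assume l: "l \<in> {..<k}"
    have z: "e l x i' = 0" if "2 * l < i'" for i' using less.IH [of l] l that by simp
    have "e l x i = 0" using z l that by simp
    moreover have "Jv (e l x) i = 0"
      using z [of "Suc i"] z [of "i - 1"] l that by (auto simp: Jv_def)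
    ultimately show "r x (runit (2 * k)) (e l x) / q l x * e l x i + r x (runit (2 * k)) (Jv (e l x)) / q l x * Jv (e l x) i = 0"
      by simp
  qed
  then show ?case
    by (simp add: gs.simps [of _ _ k] runit_def)
qed

lemma gs_support: "2 * k < i \<Longrightarrow> e k x i = 0" and gs_diag: "e k x (2 * k) = 1"
  using gs_support_diag by auto

lemma gs_RN: "k < n \<Longrightarrow> e k x \<in> RN N"
  using gs_support by (auto simp: RN_iff)

lemma q_pos: "x \<in> RN N \<Longrightarrow> k < n \<Longrightarrow> 0 < q k x"
  by (rule pos_g [OF _ gs_RN]) (use gs_diag [of k x] in auto)

lemma gs_orth:
  assumes x: "x \<in> RN N" and "k < n" "l < k"
  shows "r x (e k x) (e l x) = 0 \<and> r x (e k x) (Jv (e l x)) = 0"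
  using assms(2,3)
proof (induction k arbitrary: l rule: less_induct)
  case (less k)
  have orth: "r x (e a x) (e b x) = 0" "r x (e a x) (Jv (e b x)) = 0" "r x (Jv (e a x)) (e b x) = 0"
    if ab: "a < k" "b < k" "a \<noteq> b" for a b
  proof -
    have RN: "e a x \<in> RN N" "e b x \<in> RN N" using gs_RN ab less.prems by auto
    consider "a < b" | "b < a" using ab by linarith
    then have "r x (e a x) (e b x) = 0 \<and> r x (e a x) (Jv (e b x)) = 0"
    proof cases
      case 1
      then show ?thesis
        using less.IH [of b a] ab less.prems r_sym [OF x, of "e a x"] r_J_left [OF x RN(2,1)] by simp
    next
      case 2
      then show ?thesis using less.IH [of a b] ab less.prems by simp
    qed
    then show "r x (e a x) (e b x) = 0" "r x (e a x) (Jv (e b x)) = 0" "r x (Jv (e a x)) (e b x) = 0"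
      using r_J_left [OF x RN] by auto
  qed
  let ?u = "runit (2 * k)"
  have RN: "e a x \<in> RN N" if "a < k" for a using gs_RN that less.prems by auto
  have q: "q a x \<noteq> 0" if "a < k" for a using q_pos [OF x, of a] that less.prems by auto
  have ek: "r x (e k x) w = r x ?u w - (\<Sum>a<k. r x ?u (e a x) / q a x * r x (e a x) w
      + r x ?u (Jv (e a x)) / q a x * r x (Jv (e a x)) w)" for w
    by (subst gs.simps) (simp only: rmetric_diff_left rmetric_sum_left rmetric_lin_left)
  have "r x (e k x) (e l x) = r x ?u (e l x) - (\<Sum>a<k. if a = l then r x ?u (e l x) else 0)"
    unfolding ek
  proof (intro arg_cong2 [of _ _ _ _ "(-)"] sum.cong refl)
    fix a assume "a \<in> {..<k}"
    then show "r x ?u (e a x) / q a x * r x (e a x) (e l x) + r x ?u (Jv (e a x)) / q a x * r x (Jv (e a x)) (e l x)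
        = (if a = l then r x ?u (e l x) else 0)"
      using orth [of a l] less.prems q [of a] r_J_self [OF x RN, of a] r_J_left [OF x RN RN, of a a] by auto
  qed
  moreover have "r x (e k x) (Jv (e l x)) = r x ?u (Jv (e l x)) - (\<Sum>a<k. if a = l then r x ?u (Jv (e l x)) else 0)"
    unfolding ek
  proof (intro arg_cong2 [of _ _ _ _ "(-)"] sum.cong refl)
    fix a assume "a \<in> {..<k}"
    then show "r x ?u (e a x) / q a x * r x (e a x) (Jv (e l x)) + r x ?u (Jv (e a x)) / q a x * r x (Jv (e a x)) (Jv (e l x))
        = (if a = l then r x ?u (Jv (e l x)) else 0)"
      using orth [of a l] less.prems q [of a] r_J_self [OF x RN, of a] r_J [OF x RN RN, of a l] by auto
  qed
  ultimately show ?case using less.prems by simp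
qed

lemma gs_orth':
  assumes x: "x \<in> RN N" and "k < n" "l < n" "k \<noteq> l"
  shows "r x (e k x) (e l x) = 0" "r x (e k x) (Jv (e l x)) = 0"
    "r x (Jv (e k x)) (e l x) = 0" "r x (Jv (e k x)) (Jv (e l x)) = 0"
proof -
  have RN: "e k x \<in> RN N" "e l x \<in> RN N" using gs_RN assms by auto
  consider "k < l" | "l < k" using assms by linarith
  then have "r x (e k x) (e l x) = 0 \<and> r x (e k x) (Jv (e l x)) = 0"
  proof cases
    case 1
    then show ?thesis
      using gs_orth [OF x, of l k] assms r_sym [OF x, of "e k x"] r_J_left [OF x RN(2,1)] by simp
  next
    case 2
    then show ?thesis using gs_orth [OF x, of k l] assms by simp
  qed
  then show "r x (e k x) (e l x) = 0" "r x (e k x) (Jv (e l x)) = 0"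
    "r x (Jv (e k x)) (e l x) = 0" "r x (Jv (e k x)) (Jv (e l x)) = 0"
    using r_J_left [OF x RN] r_J [OF x RN] by auto
qed

lemma smooth_r:
  assumes "\<And>i. smooth N (\<lambda>x. v x i)" "\<And>i. smooth N (\<lambda>x. w x i)"
  shows "smooth N (\<lambda>x. r x (v x) (w x))"
  unfolding rmetric_def
  apply (intro smooth_sum smooth_mult)
    apply (rule smooth_g; simp)
   apply (rule assms)+
  done

lemma smooth_Jv: "(\<And>i. smooth N (\<lambda>x. v x i :: real)) \<Longrightarrow> smooth N (\<lambda>x. Jv (v x) i)"
  by (cases "even i") (auto simp: Jv_def intro: smooth_minus)

lemma smooth_gs: "k < n \<Longrightarrow> smooth N (\<lambda>x. e k x i)"
proof (induction k arbitrary: i rule: less_induct)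
  case (less k)
  have s: "smooth N (\<lambda>x. e l x i)" "smooth N (\<lambda>x. Jv (e l x) i)" if "l < k" for l i
    using less that by (auto intro: smooth_Jv)
  have qs: "smooth N (\<lambda>x. q l x)" if "l < k" for l using s that by (intro smooth_r)
  have q0: "q l x \<noteq> 0" if "l < k" "x \<in> RN N" for l x using q_pos [of x l] that less.prems by auto
  have rs: "smooth N (\<lambda>x. r x (runit (2 * k)) (e l x))" "smooth N (\<lambda>x. r x (runit (2 * k)) (Jv (e l x)))" if "l < k" for l
    using s that by (auto intro!: smooth_r smooth_const)
  show ?case
    unfolding gs.simps [of _ _ k]
    using s qs q0 rs by (intro smooth_diff smooth_const smooth_sum smooth_add smooth_mult smooth_divide) auto
qed

section \<open>Orthonormal frames and dual vectors\<close>

definition fr :: "nat \<Rightarrow> pt \<Rightarrow> pt" where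
  "fr i x = (if even i then e (i div 2) x else Jv (e (i div 2) x))"

definition nfr :: "pt \<Rightarrow> pt list" where
  "nfr x = map (\<lambda>i a. fr i x a / sqrt (q (i div 2) x)) [0..<N]"

lemma fr_RN: "i < N \<Longrightarrow> fr i x \<in> RN N"
  using gs_RN [of "i div 2" x] Jv_RN by (auto simp: fr_def)

lemma fr_orth:
  assumes "x \<in> RN N" "i < N" "j < N"
  shows "r x (fr i x) (fr j x) = (if i = j then q (i div 2) x else 0)"
proof (cases "i div 2 = j div 2")
  case True
  then have RN: "e (j div 2) x \<in> RN N" using gs_RN assms by simp
  have "i = j \<longleftrightarrow> even i = even j" using True by (metis even_two_times_div_two odd_two_times_div_two_succ)
  then show ?thesis
    using True r_J_self [OF assms(1) RN] r_J_left [OF assms(1) RN RN] r_J [OF assms(1) RN RN]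
    by (auto simp: fr_def)
next
  case False
  moreover have "i div 2 < n" "j div 2 < n" using assms by auto
  ultimately show ?thesis using gs_orth' [OF assms(1)] by (auto simp: fr_def)
qed

lemma nfr_orthonormal: assumes "x \<in> RN N" shows "orthonormal_frame N g x (nfr x)"
  unfolding orthonormal_frame_def
proof (intro conjI allI impI)
  show "length (nfr x) = N" by (simp add: nfr_def)
  show "set (nfr x) \<subseteq> RN N" using fr_RN by (fastforce simp: nfr_def RN_iff)
  fix i j assume ij: "i < N" "j < N"
  have "r x (\<lambda>a. fr i x a / c) (\<lambda>a. fr j x a / d) = r x (fr i x) (fr j x) / (c * d)" for c d
    by (simp add: rmetric_def sum_divide_distrib)
  then have "r x (nfr x ! i) (nfr x ! j) = (if i = j then q (i div 2) x else 0) / (sqrt (q (i div 2) x) * sqrt (q (j div 2) x))"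
    using ij by (simp add: nfr_def fr_orth [OF assms ij])
  moreover have "0 < q (i div 2) x" using q_pos [OF assms, of "i div 2"] ij by auto
  ultimately have "r x (nfr x ! i) (nfr x ! j) = (if i = j then 1 else 0)" by auto
  then show "m x (complexify (nfr x ! i)) (complexify (nfr x ! j)) = (if i = j then 1 else 0)"
    unfolding metric_complexify by simp
qed

text \<open>The frame chosen inside \<open>hodge_star\<close>. Nothing but orthonormality is known
  of it, not even continuity in the point, so it is used only through \<open>sharp\<close>, which
  the metric determines.\<close>

definition frame :: "pt \<Rightarrow> cvec list" where
  "frame x = map complexify (SOME e. orthonormal_frame N g x e)"

lemma some_frame: "x \<in> RN N \<Longrightarrow> orthonormal_frame N g x (SOME e. orthonormal_frame N g x e)"
  using nfr_orthonormal by (rule someI)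

lemma frame_CN: "x \<in> RN N \<Longrightarrow> frame x \<in> lists (CN N)"
proof -
  assume "x \<in> RN N"
  then have "set (SOME e. orthonormal_frame N g x e) \<subseteq> RN N"
    using some_frame unfolding orthonormal_frame_def by blast
  then show ?thesis using complexify_CN by (auto simp: frame_def in_lists_conv_set)
qed

lemma length_frame: "x \<in> RN N \<Longrightarrow> length (frame x) = N"
  using some_frame [of x] by (simp add: frame_def orthonormal_frame_def)

text \<open>The frame is real, so conjugating the frame expansion of \<open>v\<close> conjugates
  only the coefficients.\<close>

lemma metric_dual_vec:
  assumes x: "x \<in> RN N" and f: "orthonormal_frame N g x f" and \<theta>: "alt N \<theta>" and v: "v \<in> CN N"
  shows "m x (dual_vec \<theta> (map complexify f)) v = cnj (\<theta> [conj_vec v])"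
proof -
  have len: "length f = N" using f by (simp add: orthonormal_frame_def)
  have fCN: "complexify (f ! i) \<in> CN N" if "i < N" for i
    using f that subsetD [OF _ nth_mem] unfolding complexify_CN [symmetric] orthonormal_frame_def by metis
  have "dual_vec \<theta> (map complexify f) = (\<lambda>i. \<Sum>k<N. cnj (\<theta> [complexify (f ! k)]) * complexify (f ! k) i)"
    unfolding dual_vec_def by (simp add: comp_def sum_list_sum_nth len atLeast0LessThan)
  then have 1: "m x (dual_vec \<theta> (map complexify f)) v =
      (\<Sum>k<N. cnj (\<theta> [complexify (f ! k)]) * m x (complexify (f ! k)) v)"
    by (simp add: metric_sum_left)
  have "conj_vec v = (\<lambda>a. \<Sum>i<N. cnj (m x (complexify (f ! i)) v) * complexify (f ! i) a)"
    using arg_cong [OF orthonormal_frame_expand [OF f v], of conj_vec] by (simp add: conj_vec_def complexify_def)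
  then have "\<theta> [conj_vec v] = (\<Sum>i<N. cnj (m x (complexify (f ! i)) v) * \<theta> [complexify (f ! i)])"
    using alt_sum [OF \<theta>, of "[]" "[]" "{..<N}" "\<lambda>i. complexify (f ! i)" "\<lambda>i. cnj (m x (complexify (f ! i)) v)"] fCN
    by simp
  then show ?thesis unfolding 1 by (simp add: mult_ac)
qed

definition sharp :: "form \<Rightarrow> pt \<Rightarrow> cvec" where
  "sharp \<theta> x = dual_vec (\<theta> x) (frame x)"

lemma sharp_CN: "x \<in> RN N \<Longrightarrow> sharp \<theta> x \<in> CN N"
  unfolding sharp_def by (rule dual_vec_CN [OF frame_CN])

lemma m_sharp:
  "x \<in> RN N \<Longrightarrow> alt N (\<theta> x) \<Longrightarrow> v \<in> CN N \<Longrightarrow> m x (sharp \<theta> x) v = cnj (\<theta> x [conj_vec v])"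
  unfolding sharp_def frame_def by (rule metric_dual_vec [OF _ some_frame])

lemma sharp_unique:
  "x \<in> RN N \<Longrightarrow> alt N (\<theta> x) \<Longrightarrow> w \<in> CN N \<Longrightarrow> (\<And>v. v \<in> CN N \<Longrightarrow> m x w v = cnj (\<theta> x [conj_vec v])) \<Longrightarrow> sharp \<theta> x = w"
  using m_nondeg [of x "sharp \<theta> x" w] sharp_CN m_sharp by simp

text \<open>By uniqueness the arbitrary frame may be replaced by the normalised Gram-Schmidt frame.
  Its square roots occur in pairs, so only the inverses of \<open>q\<close> have to be
  smooth.\<close>

lemma smooth_sharp:
  assumes \<theta>: "sform N \<theta>"
  shows "smooth N (\<lambda>x. sharp \<theta> x i)"
proof -
  let ?f = "\<lambda>j x. complexify (fr j x)"
  have fs: "smooth N (\<lambda>x. fr j x i)" if "j < N" for j i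
    using smooth_gs [of "j div 2"] that by (cases "even j") (auto simp: fr_def intro: smooth_Jv)
  have s: "smooth N (\<lambda>x. \<theta> x [?f j x])" if "j < N" for j
  proof -
    have "sform N (\<lambda>x vs. \<theta> x (?f j x # vs))"
    proof (rule sform_insert_field [OF \<theta>])
      show "smooth N (\<lambda>x. ?f j x i)" for i
        unfolding complexify_def by (intro smooth_of_real fs that)
      show "?f j x \<in> CN N" for x using fr_RN [OF that] complexify_CN by blast
    qed
    from sform_smooth [OF this, of "[]"] show ?thesis by simp
  qed
  have qs: "smooth N (\<lambda>x. complex_of_real (inverse (q (j div 2) x)))" if "j < N" for j
  proof (intro smooth_of_real smooth_inverse)
    show "smooth N (q (j div 2))" using smooth_gs that by (intro smooth_r) auto
    have "j div 2 < n" using that by simp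
    then show "q (j div 2) x \<noteq> 0" if "x \<in> RN N" for x using q_pos [OF that, of "j div 2"] by auto
  qed
  have "smooth N (\<lambda>x. \<Sum>j<N. complex_of_real (inverse (q (j div 2) x)) * (cnj (\<theta> x [?f j x]) * ?f j x i))"
    using s qs fs by (intro smooth_sum smooth_mult smooth_cnj) (auto simp: complexify_def intro: smooth_of_real)
  then show ?thesis
  proof (rule smooth_cong)
    fix x assume x: "x \<in> RN N"
    let ?s = "\<lambda>j. complex_of_real (1 / sqrt (q (j div 2) x))"
    have sh: "sharp \<theta> x = dual_vec (\<theta> x) (map complexify (nfr x))"
    proof (rule sharp_unique [where \<theta> = \<theta>, OF x sform_alt [OF \<theta> x]])
      have "map complexify (nfr x) \<in> lists (CN N)"
        using nfr_orthonormal [OF x] complexify_CN by (fastforce simp: orthonormal_frame_def in_lists_conv_set)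
      then show "dual_vec (\<theta> x) (map complexify (nfr x)) \<in> CN N" by (rule dual_vec_CN)
    qed (rule metric_dual_vec [OF x nfr_orthonormal [OF x] sform_alt [OF \<theta> x]])
    have "sharp \<theta> x i = (\<Sum>j<N. cnj (\<theta> x [\<lambda>a. ?s j * ?f j x a]) * (?s j * ?f j x i))"
      unfolding sh dual_vec_def nfr_def
      by (simp add: comp_def interv_sum_list_conv_sum_set_nat atLeast0LessThan complexify_def)
    also have "\<dots> = (\<Sum>j<N. complex_of_real (inverse (q (j div 2) x)) * (cnj (\<theta> x [?f j x]) * ?f j x i))"
    proof (rule sum.cong [OF refl])
      fix j assume "j \<in> {..<N}"
      then have j: "j < N" by simp
      have "\<theta> x [\<lambda>a. ?s j * ?f j x a] = ?s j * \<theta> x [?f j x]"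
        using alt_scale [OF sform_alt [OF \<theta> x], of "[]" "[]" "?f j x" "?s j"] fr_RN [OF j] complexify_CN by simp
      moreover have "?s j * ?s j = complex_of_real (inverse (q (j div 2) x))"
      proof -
        have "j div 2 < n" using j by simp
        then have "0 < q (j div 2) x" by (rule q_pos [OF x])
        then show ?thesis by (simp add: inverse_eq_divide flip: of_real_mult)
      qed
      moreover have "cnj (complex_of_real c * t) * (complex_of_real c * u) = (complex_of_real c * complex_of_real c) * (cnj t * u)"
        for c t u by simp
      ultimately show "cnj (\<theta> x [\<lambda>a. ?s j * ?f j x a]) * (?s j * ?f j x i) =
          complex_of_real (inverse (q (j div 2) x)) * (cnj (\<theta> x [?f j x]) * ?f j x i)"
        by (simp only:)
    qed
    finally show "(\<Sum>j<N. complex_of_real (inverse (q (j div 2) x)) * (cnj (\<theta> x [?f j x]) * ?f j x i)) = sharp \<theta> x i"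
      by simp
  qed
qed

end

text \<open>The coordinate field d/dx - i d/dy, which is twice d/dz in the \<open>k\<close>-th
  complex coordinate. On the example, \<open>k\<close> = 0, 1, 2, 3 gives Z_1, Z_2, W_1,
  W_2.\<close>

definition cpl :: "nat \<Rightarrow> cvec" where
  "cpl k = (\<lambda>i. 1 * basis_vec (2 * k) i + (- \<i>) * basis_vec (2 * k + 1) i)"

lemma cpl_CN: "k < n \<Longrightarrow> cpl k \<in> CN (2 * n)"
  unfolding cpl_def by (intro CN_lincomb basis_vec_CN) auto

lemma conj_cpl: "conj_vec (cpl k) = (\<lambda>i. 1 * basis_vec (2 * k) i + \<i> * basis_vec (2 * k + 1) i)"
  by (simp add: cpl_def conj_vec_def basis_vec_def fun_eq_iff)

lemma Jv_lin: "Jv (\<lambda>i. a * v i + b * w i) = (\<lambda>i. a * Jv v i + b * Jv w i)" for a b :: complex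
  by (auto simp: Jv_def fun_eq_iff)

lemma Jv_basis: "Jv (basis_vec (2 * k)) = basis_vec (2 * k + 1)"
  unfolding Jv_def basis_vec_def by (rule ext) (auto; presburger)

lemma Jv_basis': "Jv (basis_vec (2 * k + 1)) = (\<lambda>i. - basis_vec (2 * k) i)"
  using Jv_Jv [of "basis_vec (2 * k)"] unfolding Jv_basis .

lemma cpl_t10: "k < n \<Longrightarrow> cpl k \<in> t10 (2 * n)"
proof -
  assume k: "k < n"
  have "Jv (cpl k) = (\<lambda>i. \<i> * cpl k i)"
    unfolding cpl_def Jv_lin Jv_basis Jv_basis' by (simp add: algebra_simps)
  then show ?thesis using cpl_CN [OF k] by (simp add: t10_def)
qed

lemma Jv_conj: "Jv (conj_vec v) = conj_vec (Jv v)"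
  by (auto simp: Jv_def conj_vec_def)

lemma conj_t01: "v \<in> t10 N \<Longrightarrow> conj_vec v \<in> t01 N"
  by (simp add: t10_def t01_def conj_vec_CN Jv_conj) (simp add: conj_vec_def)

text \<open>Origin of the factor: (u - i w) wedge (u + i w) = 2 i u wedge w.\<close>

lemma alt_cpl:
  assumes f: "alt (2 * n) f" and "k < n" "us \<in> lists (CN (2 * n))" "ws \<in> lists (CN (2 * n))"
  shows "f (us @ cpl k # conj_vec (cpl k) # ws) = 2 * \<i> * f (us @ basis_vec (2 * k) # basis_vec (2 * k + 1) # ws)"
proof -
  let ?u = "basis_vec (2 * k)" and ?w = "basis_vec (2 * k + 1)"
  have uw: "?u \<in> CN (2 * n)" "?w \<in> CN (2 * n)" using assms(2) by (auto intro: basis_vec_CN)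
  have c: "conj_vec (cpl k) \<in> CN (2 * n)" using cpl_CN [OF assms(2)] by (rule conj_vec_CN)
  have 1: "f (us @ cpl k # conj_vec (cpl k) # ws) =
      f (us @ ?u # conj_vec (cpl k) # ws) - \<i> * f (us @ ?w # conj_vec (cpl k) # ws)"
    using alt_lin [OF f assms(3), of "conj_vec (cpl k) # ws" ?u ?w 1 "- \<i>"] uw c assms(4) by (simp add: cpl_def)
  have 2: "f (us @ v # conj_vec (cpl k) # ws) = f (us @ v # ?u # ws) + \<i> * f (us @ v # ?w # ws)"
    if "v \<in> CN (2 * n)" for v
    using alt_lin [OF f, of "us @ [v]" ws ?u ?w 1 \<i>] uw that assms(3,4) by (simp add: conj_cpl)
  have 3: "f (us @ ?w # ?u # ws) = - f (us @ ?u # ?w # ws)"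
    by (rule alt_swap [OF f assms(3,4) uw(2,1)])
  show ?thesis
    unfolding 1 2 [OF uw(1)] 2 [OF uw(2)] 3 alt_eq0 [OF f assms(3,4) uw(1)] alt_eq0 [OF f assms(3,4) uw(2)]
    by simp
qed

lemma alt_cpl_flat:
  assumes f: "alt (2 * n) f"
  shows "f (flat (map (\<lambda>k. (cpl k, conj_vec (cpl k))) [0..<n])) =
    (2 * \<i>) ^ n * f (flat (map (\<lambda>k. (basis_vec (2 * k), basis_vec (2 * k + 1))) [0..<n]))"
proof -
  let ?C = "\<lambda>j. flat (map (\<lambda>k. (cpl k, conj_vec (cpl k))) [0..<j])"
    and ?B = "\<lambda>j. flat (map (\<lambda>k. (basis_vec (2 * k), basis_vec (2 * k + 1))) [j..<n])"
  have "j \<le> n \<Longrightarrow> f (?C j @ ?B j) = (2 * \<i>) ^ j * f (?B 0)" for j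
  proof (induction j)
    case (Suc j)
    have "?C j \<in> lists (CN (2 * n))" "?B (Suc j) \<in> lists (CN (2 * n))"
      using Suc.prems cpl_CN conj_vec_CN basis_vec_CN by (auto simp: in_lists_conv_set set_flat)
    then have "f (?C j @ cpl j # conj_vec (cpl j) # ?B (Suc j)) =
        2 * \<i> * f (?C j @ basis_vec (2 * j) # basis_vec (2 * j + 1) # ?B (Suc j))"
      using Suc.prems by (intro alt_cpl [OF f]) auto
    then show ?case using Suc by (simp add: upt_conv_Cons)
  qed simp
  from this [of n] show ?thesis by simp
qed

section \<open>Fundamental form, volume form and Hodge star\<close>

context herm
begin

abbreviation om where "om \<equiv> fundamental_form N stdJ g"
abbreviation vol where "vol \<equiv> volume_form n stdJ g"

lemma fundamental_form_pair: "v \<in> CN N \<Longrightarrow> om x [v, w] = m x (Jv v) w"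
  by (simp add: fundamental_form_def apply_stdJ)

lemma smooth_metric: "smooth N (\<lambda>x. m x v w)"
  unfolding metric_def using smooth_g by (intro smooth_sum smooth_mult smooth_const smooth_of_real) auto

lemma m_J_self: "x \<in> RN N \<Longrightarrow> v \<in> CN N \<Longrightarrow> m x (Jv v) v = 0"
proof -
  assume x: "x \<in> RN N" and v: "v \<in> CN N"
  have "m x (Jv v) v = m x (Jv (Jv v)) (Jv v)" using J_g [OF x Jv_CN [OF v] v] by simp
  also have "\<dots> = - m x v (Jv v)" by (simp add: Jv_Jv metric_def sum_negf)
  finally show ?thesis using m_sym [OF x, of v "Jv v"] by simp
qed

lemma is_form_fundamental_form: "is_form N 2 om"
  unfolding is_form_iff sform_def has_degree_def
proof (intro conjI ballI impI altI)
  fix x us ws v w a b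
  assume "x \<in> RN N" "us \<in> lists (CN N)" "ws \<in> lists (CN N)" "v \<in> CN N" "w \<in> CN N"
  then have vs: "us \<in> lists (CN N)" "ws \<in> lists (CN N)" "v \<in> CN N" "w \<in> CN N" by auto
  let ?z = "\<lambda>i. a * v i + b * w i"
  have z: "?z \<in> CN N" using vs by (intro CN_lincomb)
  consider "length us + length ws \<noteq> 1" | u where "us = []" "ws = [u]" | u where "us = [u]" "ws = []"
    by (cases us; cases ws) (auto simp: Suc_eq_plus1 [symmetric])
  then show "om x (us @ ?z # ws) = a * om x (us @ v # ws) + b * om x (us @ w # ws)"
  proof cases
    case 1
    then show ?thesis by (auto simp: fundamental_form_def)
  next
    case 2
    then show ?thesis using vs z by (simp add: fundamental_form_pair Jv_lin metric_lin_left)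
  next
    case 3
    then show ?thesis using vs z by (simp add: fundamental_form_pair metric_lin_right)
  qed
next
  fix x us ws v
  assume "x \<in> RN N" "us \<in> lists (CN N)" "ws \<in> lists (CN N)" "v \<in> CN N"
  then show "om x (us @ v # v # ws) = 0"
    using m_J_self [of x v] by (cases "us = [] \<and> ws = []") (auto simp: fundamental_form_def apply_stdJ)
next
  fix vs assume vs: "vs \<in> lists (CN N)"
  show "smooth N (\<lambda>x. om x vs)"
  proof (cases "length vs = 2")
    case True
    then obtain v w where "vs = [v, w]" by (auto simp: numeral_2_eq_2 length_Suc_conv)
    then show ?thesis using vs smooth_metric by (simp add: fundamental_form_pair)
  qed (simp add: fundamental_form_def smooth_const)
qed (auto simp: fundamental_form_def)

lemma is_form_wedge_power: "is_form N (2 * k) (wedge_power om k)"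
proof (induction k)
  case 0
  show ?case
    by (auto simp: is_form_iff sform_def has_degree_def alt_def intro: smooth_const)
next
  case (Suc k)
  then show ?case
    using is_form_wedge [OF is_form_fundamental_form Suc] by simp
qed

lemma is_form_vol: "is_form N N vol"
proof -
  have "sform N (\<lambda>x vs. (1 / fact n) * wedge_power om n x vs + 0 * wedge_power om n x vs)"
    using is_form_wedge_power [of n] by (intro sform_lin) (auto simp: is_form_iff)
  then show ?thesis
    using is_form_wedge_power [of n]
    unfolding volume_form_def by (simp add: is_form_iff has_degree_def)
qed

lemmas vol_alt = sform_alt [OF conjunct1 [OF is_form_vol [unfolded is_form_iff]]]

definition gsp :: "nat \<Rightarrow> pt \<Rightarrow> cvec \<times> cvec" where
  "gsp k x = (complexify (e k x), complexify (Jv (e k x)))"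

lemma gsp_CN: "k < n \<Longrightarrow> fst (gsp k x) \<in> CN N" "k < n \<Longrightarrow> snd (gsp k x) \<in> CN N"
  using gs_RN Jv_RN by (auto simp: gsp_def simp flip: complexify_CN)

lemma om_complexify: "v \<in> RN N \<Longrightarrow> om x [complexify v, complexify w] = complex_of_real (r x (Jv v) w)"
  by (simp add: fundamental_form_pair Jv_complexify metric_complexify flip: complexify_CN)

text \<open>The pairs formed by \<open>e k x\<close> and its image under \<open>Jv\<close> are
  mutually orthogonal for \<open>om\<close>, and \<open>om\<close> takes the value
  \<open>q k x\<close> on each; the factorial of \<open>wedge_power_flat\<close> cancels against the
  one in the volume form.\<close>

lemma vol_gs:
  assumes x: "x \<in> RN N"
  shows "vol x (flat (map (\<lambda>k. gsp k x) [0..<n])) = complex_of_real (\<Prod>k<n. q k x)"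
proof -
  let ?ps = "map (\<lambda>k. gsp k x) [0..<n]"
  have "wedge_power om (length ?ps) x (flat ?ps) = fact (length ?ps) * (\<Prod>p\<leftarrow>?ps. om x [fst p, snd p])"
  proof (rule wedge_power_flat [where X = "CN N"])
    show "flat ?ps \<in> lists (CN N)" using gsp_CN by (auto simp: in_lists_conv_set set_flat)
    show "sorted_wrt (pair_orth (om x)) ?ps"
      unfolding sorted_wrt_iff_nth_less
    proof (intro allI impI)
      fix k l assume kl: "k < l" "l < length ?ps"
      then have RN: "e k x \<in> RN N" "Jv (e k x) \<in> RN N" using gs_RN Jv_RN by auto
      show "pair_orth (om x) (?ps ! k) (?ps ! l)"
        using kl gs_orth' [OF x, of k l] RN
        by (simp add: pair_orth_def gsp_def om_complexify Jv_Jv_real)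
           (simp add: rmetric_def sum_negf)
    qed
  qed (simp add: fundamental_form_def)
  moreover have "(\<Prod>p\<leftarrow>?ps. om x [fst p, snd p]) = (\<Prod>k<n. om x [fst (gsp k x), snd (gsp k x)])"
    by (simp add: comp_def prod.distinct_set_conv_list [symmetric] atLeast0LessThan)
  moreover have "\<dots> = (\<Prod>k<n. complex_of_real (q k x))"
  proof (rule prod.cong [OF refl])
    fix k assume "k \<in> {..<n}"
    then have "e k x \<in> RN N" using gs_RN by simp
    then show "om x [fst (gsp k x), snd (gsp k x)] = complex_of_real (q k x)"
      by (simp add: gsp_def om_complexify r_J [OF x])
  qed
  ultimately show ?thesis by (simp add: volume_form_def)
qed

text \<open>The Gram-Schmidt process is unitriangular over the complex numbers, so it has
  determinant 1 and changes no alternating value on the full frame.\<close>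

lemma alt_gs:
  assumes f: "alt N f"
  shows "f (flat (map (\<lambda>k. (basis_vec (2 * k), basis_vec (2 * k + 1))) [0..<n])) =
    f (flat (map (\<lambda>k. gsp k x) [0..<n]))"
proof -
  let ?E = "\<lambda>j. flat (map (\<lambda>k. gsp k x) [0..<j])"
    and ?B = "\<lambda>j. flat (map (\<lambda>k. (basis_vec (2 * k), basis_vec (2 * k + 1))) [j..<n])"
  have "j \<le> n \<Longrightarrow> f (?E j @ ?B j) = f (?B 0)" for j
  proof (induction j)
    case (Suc j)
    then have j: "j < n" by simp
    define c where "c l = - complex_of_real (r x (runit (2 * j)) (e l x) / q l x)" for l
    define d where "d l = - complex_of_real (r x (runit (2 * j)) (Jv (e l x)) / q l x)" for l
    let ?z = "\<lambda>c d l i. c l * fst (gsp l x) i + d l * snd (gsp l x) i"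
    have E: "?E j \<in> lists (CN N)" and B: "?B (Suc j) \<in> lists (CN N)"
      using j gsp_CN basis_vec_CN by (auto simp: in_lists_conv_set set_flat)
    have bCN: "basis_vec (2 * j) \<in> CN N" "basis_vec (2 * j + 1) \<in> CN N" using j by (auto intro: basis_vec_CN)
    have eCN: "complexify (e j x) \<in> CN N" "complexify (Jv (e j x)) \<in> CN N" using gsp_CN [OF j] by (simp_all add: gsp_def)
    have e1: "complexify (e j x) = (\<lambda>i. 1 * basis_vec (2 * j) i + 1 * (\<Sum>l<j. 1 * ?z c d l i))"
      by (subst gs.simps) (simp add: complexify_def runit_def basis_vec_def c_def d_def gsp_def fun_eq_iff
        sum_negf [symmetric] sum.distrib [symmetric] algebra_simps)
    have e2: "complexify (Jv (e j x)) = (\<lambda>i. 1 * basis_vec (2 * j + 1) i + 1 * (\<Sum>l<j. 1 * ?z (\<lambda>l. - d l) c l i))"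
    proof -
      have "Jv (?z c d l) i = ?z (\<lambda>l. - d l) c l i" if "l < j" for l i
        by (simp add: Jv_lin gsp_def Jv_complexify [symmetric] Jv_Jv)
      then have "Jv (\<lambda>i. 1 * basis_vec (2 * j) i + 1 * (\<Sum>l<j. 1 * ?z c d l i)) =
          (\<lambda>i. 1 * basis_vec (2 * j + 1) i + 1 * (\<Sum>l<j. 1 * ?z (\<lambda>l. - d l) c l i))"
        unfolding Jv_lin Jv_basis
        by (intro ext arg_cong2 [of _ _ _ _ "(+)"] refl)
           (simp add: Jv_def sum_negf [symmetric] if_distrib if_distribR cong: if_cong)
      then show ?thesis by (simp only: Jv_complexify [symmetric] e1)
    qed
    have zCN: "?z a b l \<in> CN N" if "l < j" for a b l using gsp_CN [of l x] that j by (intro CN_lincomb) auto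
    \<comment> \<open>The correction terms are combinations of vectors that already stand in
      \<open>?E j\<close>, so they contribute repeated arguments only.\<close>
    have drop: "f (?E j @ (\<lambda>i. 1 * v i + 1 * (\<Sum>l<j. 1 * ?z a b l i)) # ws) = f (?E j @ v # ws)"
      if v: "v \<in> CN N" and ws: "ws \<in> lists (CN N)" for v a b ws
    proof -
      have "f (?E j @ ?z a b l # ws) = 0" if l: "l < j" for l
      proof -
        have "gsp l x \<in> set (map (\<lambda>k. gsp k x) [0..<j])" using l by auto
        then have "\<not> distinct (?E j @ fst (gsp l x) # ws)" "\<not> distinct (?E j @ snd (gsp l x) # ws)"
          by (force simp: set_flat)+
        moreover have g: "fst (gsp l x) \<in> CN N" "snd (gsp l x) \<in> CN N" using gsp_CN l j by auto
        ultimately show ?thesis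
          using alt_lin [OF f E ws g, of "a l" "b l"] alt_not_distinct [OF f] E ws by simp
      qed
      then have "f (?E j @ (\<lambda>i. \<Sum>l<j. 1 * ?z a b l i) # ws) = 0"
        using zCN by (subst alt_sum [OF f E ws]) auto
      moreover have "(\<lambda>i. \<Sum>l<j. 1 * ?z a b l i) \<in> CN N" using zCN by (intro CN_sum) auto
      ultimately show ?thesis
        using alt_lin [OF f E ws v, of "\<lambda>i. \<Sum>l<j. 1 * ?z a b l i" 1 1] by simp
    qed
    have "f (?E j @ complexify (e j x) # complexify (Jv (e j x)) # ?B (Suc j)) =
        f (?E j @ basis_vec (2 * j) # complexify (Jv (e j x)) # ?B (Suc j))"
      by (subst e1) (rule drop, use bCN eCN B in auto)
    also have "\<dots> = - f (?E j @ complexify (Jv (e j x)) # basis_vec (2 * j) # ?B (Suc j))"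
      by (rule alt_swap [OF f E B bCN(1) eCN(2)])
    also have "f (?E j @ complexify (Jv (e j x)) # basis_vec (2 * j) # ?B (Suc j)) =
        f (?E j @ basis_vec (2 * j + 1) # basis_vec (2 * j) # ?B (Suc j))"
      by (subst e2) (rule drop, use bCN B in auto)
    also have "- \<dots> = f (?E j @ basis_vec (2 * j) # basis_vec (2 * j + 1) # ?B (Suc j))"
      by (rule alt_swap [OF f E B bCN, symmetric])
    finally show ?case using Suc by (simp add: upt_conv_Cons gsp_def)
  qed simp
  from this [of n] show ?thesis by simp
qed

text \<open>Makes the value of the volume form on the complex frame explicit. Its sign decides the
  final contradiction.\<close>

lemma vol_cpl:
  assumes x: "x \<in> RN N"
  shows "vol x (flat (map (\<lambda>k. (cpl k, conj_vec (cpl k))) [0..<n])) = (2 * \<i>) ^ n * complex_of_real (\<Prod>k<n. q k x)"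
  using alt_cpl_flat [OF vol_alt [OF x]] alt_gs [OF vol_alt [OF x]] vol_gs [OF x] by simp

lemma hodge_star_pairing:
  assumes "x \<in> RN N"
  shows "hodge_star n stdJ g \<beta> x vs = pairing (frame x) (\<beta> x) (\<lambda>us. vol x (us @ vs))"
  using pairing_eq_sum [of "\<beta> x" "frame x" "\<lambda>us. vol x (us @ vs)"] length_frame [OF assms]
  by (simp add: hodge_star_def frame_def Let_def)

lemma star_1form:
  assumes "is_form N 1 \<theta>" "x \<in> RN N" "vs \<in> lists (CN N)"
  shows "hodge_star n stdJ g \<theta> x vs = vol x (sharp \<theta> x # vs)"
  unfolding hodge_star_pairing [OF assms(2)] sharp_def
  using assms pairing_1form [OF frame_CN [OF assms(2)], of "\<theta> x" "\<lambda>us. vol x (us @ vs)"]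
    alt_append_right [OF vol_alt [OF assms(2)] assms(3)]
  by (simp add: is_form_iff has_degree_def)

lemma pairing_wedge:
  assumes "is_form N 1 \<theta>" "x \<in> RN N" "alt N V"
  shows "pairing (frame x) (wedge \<theta> \<beta> x) V = pairing (frame x) (\<beta> x) (\<lambda>us. V (sharp \<theta> x # us))"
proof -
  have "wedge \<theta> \<beta> x = (\<lambda>us. wdg us (\<theta> x) (\<beta> x))" by (rule ext) (rule wedge_wdg)
  then show ?thesis
    using assms pairing_wdg [OF frame_CN [OF assms(2)], of "\<theta> x" V "\<beta> x"]
    by (simp add: is_form_iff has_degree_def sharp_def)
qed

lemma star_wedge4:
  assumes \<theta>: "is_form N 1 \<theta>1" "is_form N 1 \<theta>2" "is_form N 1 \<theta>3" "is_form N 1 \<theta>4"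
    and x: "x \<in> RN N" and vs: "vs \<in> lists (CN N)"
  shows "hodge_star n stdJ g (wedge \<theta>1 (wedge \<theta>2 (wedge \<theta>3 \<theta>4))) x vs =
    vol x (sharp \<theta>1 x # sharp \<theta>2 x # sharp \<theta>3 x # sharp \<theta>4 x # vs)"
proof -
  note s = sharp_CN [OF x]
  have a0: "alt N (\<lambda>us. vol x (us @ vs))" by (rule alt_append_right [OF vol_alt [OF x] vs])
  have a1: "alt N (\<lambda>us. vol x ((sharp \<theta>1 x # us) @ vs))"
    by (rule alt_Cons [OF a0 s])
  have a2: "alt N (\<lambda>us. vol x ((sharp \<theta>1 x # sharp \<theta>2 x # us) @ vs))"
    by (rule alt_Cons [OF a1 s])
  have a3: "alt N (\<lambda>us. vol x ((sharp \<theta>1 x # sharp \<theta>2 x # sharp \<theta>3 x # us) @ vs))"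
    by (rule alt_Cons [OF a2 s])
  have "pairing (frame x) (\<theta>4 x) (\<lambda>us. vol x ((sharp \<theta>1 x # sharp \<theta>2 x # sharp \<theta>3 x # us) @ vs)) =
      vol x ((sharp \<theta>1 x # sharp \<theta>2 x # sharp \<theta>3 x # [sharp \<theta>4 x]) @ vs)"
    using \<theta>(4) x pairing_1form [OF frame_CN [OF x] _ a3, of "\<theta>4 x"] by (simp add: is_form_iff has_degree_def sharp_def)
  then show ?thesis
    unfolding hodge_star_pairing [OF x] pairing_wedge [OF \<theta>(1) x a0] pairing_wedge [OF \<theta>(2) x a1]
      pairing_wedge [OF \<theta>(3) x a2]
    by simp
qed

lemma is_form_insert_sharp:
  assumes "is_form N (Suc k) \<alpha>" "sform N \<theta>"
  shows "is_form N k (\<lambda>x vs. \<alpha> x (sharp \<theta> x # vs))"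
  using assms sform_insert_field [of N \<alpha> "sharp \<theta>"] smooth_sharp sharp_CN
  by (auto simp: is_form_iff has_degree_def)

lemma del_delbar_star_1form:
  assumes \<theta>: "is_form N 1 \<theta>" and n: "0 < n"
  shows "form_eq N (del N stdJ (delbar N stdJ (hodge_star n stdJ g \<theta>))) zero_form"
proof -
  let ?\<sigma> = "\<lambda>x vs. vol x (sharp \<theta> x # vs)"
  have "form_eq N (hodge_star n stdJ g \<theta>) ?\<sigma>"
    unfolding form_eq_def using star_1form [OF \<theta>] by blast
  from del_cong [OF delbar_cong [OF this]]
  have eq: "form_eq N (del N stdJ (delbar N stdJ (hodge_star n stdJ g \<theta>))) (del N stdJ (delbar N stdJ ?\<sigma>))" .
  have "is_form N (Suc (N - 1)) vol" using is_form_vol n by simp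
  then have "is_form N (N - 1) ?\<sigma>" using \<theta> by (intro is_form_insert_sharp) (auto simp: is_form_iff)
  then have "is_form N (Suc (Suc (N - 1))) (del N stdJ (delbar N stdJ ?\<sigma>))"
    by (intro is_form_del is_form_delbar)
  then have F: "is_form N (Suc N) (del N stdJ (delbar N stdJ ?\<sigma>))" using n by simp
  have "form_eq N (del N stdJ (delbar N stdJ ?\<sigma>)) zero_form"
    unfolding form_eq_def
  proof (intro ballI)
    fix x vs assume x: "x \<in> RN N" and vs: "vs \<in> lists (CN N)"
    show "del N stdJ (delbar N stdJ ?\<sigma>) x vs = 0"
      using F x vs alt_too_long [of N _ vs]
      by (cases "length vs = Suc N") (auto simp: is_form_iff has_degree_def sform_def)
  qed
  then show ?thesis using eq by (auto simp: form_eq_def)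
qed

end

section \<open>Averaging over the unit cube\<close>

text \<open>One coordinate at a time: the result is again a function on the whole space, constant in
  the averaged coordinate, so averages can be iterated using integrals over an interval
  alone.\<close>

definition avg :: "nat \<Rightarrow> (pt \<Rightarrow> complex) \<Rightarrow> pt \<Rightarrow> complex" where
  "avg j h x = integral {0..1} (\<lambda>t. h (x(j := t)))"

lemma continuous_on_upd:
  assumes "continuous_on (RN N) h" "j < N" "continuous_on S p" "continuous_on S s" "\<And>z. z \<in> S \<Longrightarrow> p z \<in> RN N"
  shows "continuous_on S (\<lambda>z. h ((p z)(j := s z)))"
proof (rule continuous_on_compose2 [OF assms(1)])
  show "continuous_on S (\<lambda>z. (p z)(j := s z))"
  proof (rule continuous_on_coordinatewise_then_product)
    show "continuous_on S (\<lambda>z. ((p z)(j := s z)) i)" for i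
      using assms(4) continuous_on_product_then_coordinatewise [OF assms(3), of i] by (cases "i = j") auto
  qed
  show "(\<lambda>z. (p z)(j := s z)) ` S \<subseteq> RN N" using assms(2,5) RN_upd by fastforce
qed

lemma continuous_on_upd_const:
  fixes x :: pt
  assumes "continuous_on S s" shows "continuous_on S (\<lambda>z. x(i := s z))"
proof (rule continuous_on_coordinatewise_then_product)
  show "continuous_on S (\<lambda>z. (x(i := s z)) k)" for k
    using assms by (cases "k = i") auto
qed

lemma continuous_on_slice:
  "continuous_on (RN N) h \<Longrightarrow> j < N \<Longrightarrow> x \<in> RN N \<Longrightarrow> continuous_on S (\<lambda>t. h (x(j := t)))"
  by (rule continuous_on_upd [where p = "\<lambda>z. x"]) (auto intro: continuous_intros)

lemma integrable_slice:
  fixes h :: "pt \<Rightarrow> complex"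
  assumes "continuous_on (RN N) h" "j < N" "x \<in> RN N"
  shows "(\<lambda>t. h (x(j := t))) integrable_on {0..1}"
  using continuous_on_slice [OF assms] by (rule integrable_continuous_interval)

lemma continuous_on_avg:
  assumes "continuous_on (RN N) h" "j < N" shows "continuous_on (RN N) (avg j h)"
proof -
  have "continuous_on (RN N \<times> cbox 0 1) (\<lambda>z. h ((fst z)(j := snd z)))"
    by (rule continuous_on_upd [OF assms]) (auto intro: continuous_intros)
  then have "continuous_on (RN N \<times> cbox 0 1) (\<lambda>(x, t). h (x(j := t)))" by (simp add: case_prod_unfold)
  from integral_continuous_on_param [OF this] show ?thesis
    unfolding avg_def [abs_def] by simp
qed

lemma avg_cong: "(\<And>x. x \<in> RN N \<Longrightarrow> h x = k x) \<Longrightarrow> j < N \<Longrightarrow> x \<in> RN N \<Longrightarrow> avg j h x = avg j k x"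
  unfolding avg_def using RN_upd by (metis (mono_tags, lifting) Henstock_Kurzweil_Integration.integral_cong)

lemma avg_upd [simp]: "avg j h (x(j := s)) = avg j h x"
  by (simp add: avg_def)

lemma avg_lin:
  assumes "continuous_on (RN N) h" "continuous_on (RN N) k" "j < N" "x \<in> RN N"
  shows "avg j (\<lambda>x. a * h x + b * k x) x = a * avg j h x + b * avg j k x"
  unfolding avg_def
  using Henstock_Kurzweil_Integration.integral_add
    [OF integrable_on_mult_right [OF integrable_slice [OF assms(1,3,4)], of a]
        integrable_on_mult_right [OF integrable_slice [OF assms(2,3,4)], of b]]
  by simp

lemma avg_has_vector_derivative:
  assumes h: "C_diff (Suc k) N (RN N) h" and ij: "j < N" "i < N" "i \<noteq> j" and x: "x \<in> RN N"
  shows "((\<lambda>s. avg j h (x(i := s))) has_vector_derivative avg j (partial_deriv i h) x) (at (x i))"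
proof -
  let ?h' = "partial_deriv i h"
  have "continuous_on (RN N) ?h'" using h ij by (auto simp: C_diff_Suc intro: C_diff_continuous)
  from continuous_on_upd [OF this ij(1), of "UNIV \<times> cbox (0::real) 1" "\<lambda>z. x(i := fst z)" snd]
  have "continuous_on (UNIV \<times> cbox (0::real) 1) (\<lambda>z. ?h' ((x(i := fst z))(j := snd z)))"
    using RN_upd [OF x ij(2)]
      continuous_on_upd_const [OF continuous_on_fst [OF continuous_on_id], of "UNIV \<times> cbox (0::real) 1" x i]
      continuous_on_snd [OF continuous_on_id, of "UNIV \<times> cbox (0::real) 1"]
    by blast
  then have c: "continuous_on (UNIV \<times> cbox (0::real) 1) (\<lambda>(s, t). ?h' (x(i := s, j := t)))"
    by (simp add: case_prod_unfold)
  have "((\<lambda>s. integral (cbox 0 1) (\<lambda>t. h (x(i := s, j := t)))) has_vector_derivative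
      integral (cbox 0 1) (\<lambda>t. ?h' (x(i := x i, j := t)))) (at (x i) within UNIV)"
  proof (rule leibniz_rule_vector_derivative [where f = "\<lambda>s t. h (x(i := s, j := t))"
        and fx = "\<lambda>s t. ?h' (x(i := s, j := t))" and ?x0.0 = "x i", OF _ _ c])
    fix s t :: real
    have "((\<lambda>s. h ((x(j := t))(i := s))) has_vector_derivative ?h' ((x(j := t))(i := s))) (at s)"
      by (rule C_diff_has_vector_derivative [OF h ij(2) RN_upd [OF x ij(1)]])
    then show "((\<lambda>s. h (x(i := s, j := t))) has_vector_derivative ?h' (x(i := s, j := t))) (at s within UNIV)"
      using ij(3) by (simp add: fun_upd_twist)
  next
    fix s :: real
    show "(\<lambda>t. h (x(i := s, j := t))) integrable_on cbox 0 1"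
      using integrable_slice [OF C_diff_continuous [OF h] ij(1) RN_upd [OF x ij(2)]] by simp
  qed auto
  then show ?thesis by (simp add: avg_def)
qed

lemma C_diff_avg:
  assumes "C_diff k N (RN N) h" "j < N"
  shows "C_diff k N (RN N) (avg j h)"
  using assms(1)
proof (induction k arbitrary: h)
  case 0
  then show ?case using continuous_on_avg assms(2) by (simp add: C_diff_0)
next
  case (Suc k)
  show ?case
  proof (rule C_diff_SucI [where D = "\<lambda>i x. if i = j then 0 else avg j (partial_deriv i h) x"])
    show "continuous_on (RN N) (avg j h)"
      using Suc.prems by (intro continuous_on_avg assms(2)) (auto intro: C_diff_continuous)
    show "((\<lambda>s. avg j h (x(i := s))) has_vector_derivative (if i = j then 0 else avg j (partial_deriv i h) x)) (at (x i))"
      if "i < N" "x \<in> RN N" for i x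
      using avg_has_vector_derivative [OF Suc.prems assms(2), of i x] that by (cases "i = j") auto
    show "C_diff k N (RN N) (\<lambda>x. if i = j then 0 else avg j (partial_deriv i h) x)" if "i < N" for i
      using Suc that by (cases "i = j") (auto simp: C_diff_const C_diff_Suc)
  qed
qed

lemma smooth_avg: "smooth N h \<Longrightarrow> j < N \<Longrightarrow> smooth N (avg j h)"
  by (simp add: smooth_on_def C_diff_avg)

lemma partial_deriv_avg:
  assumes "smooth N h" "j < N" "i < N" "i \<noteq> j" "x \<in> RN N"
  shows "partial_deriv i (avg j h) x = avg j (partial_deriv i h) x"
  by (rule partial_deriv_eqI, rule avg_has_vector_derivative [where k = 0])
     (use assms in \<open>simp_all add: smooth_on_def del: One_nat_def\<close>)

lemma avg_swap:
  assumes "continuous_on (RN N) h" "i < N" "j < N" "x \<in> RN N"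
  shows "avg i (avg j h) x = avg j (avg i h) x"
proof (cases "i = j")
  case False
  have "continuous_on (cbox (0, 0) (1, 1)) (\<lambda>z. h ((x(i := fst z))(j := snd z)))"
    using assms(2-4)
    by (intro continuous_on_upd [OF assms(1)] continuous_on_upd_const continuous_on_fst continuous_on_snd continuous_on_id RN_upd)
  then have "continuous_on (cbox (0::real, 0::real) (1, 1)) (\<lambda>(s, t). h (x(i := s, j := t)))"
    by (simp add: case_prod_unfold)
  from integral_swap_continuous [OF this]
  show ?thesis using False by (simp add: avg_def fun_upd_twist)
qed simp

lemma avg_partial_deriv:
  assumes "smooth N h" "j < N" "x \<in> RN N"
  shows "avg j (partial_deriv j h) x = h (x(j := 1)) - h (x(j := 0))"
proof -
  have "((\<lambda>t. partial_deriv j h (x(j := t))) has_integral (h (x(j := 1)) - h (x(j := 0)))) {0..1}"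
    by (rule fundamental_theorem_of_calculus, simp,
        rule has_vector_derivative_at_within, rule smooth_has_vector_derivative [OF assms])
  then show ?thesis unfolding avg_def by (rule integral_unique)
qed

section \<open>Periodic functions and iterated averages\<close>

definition per :: "nat \<Rightarrow> nat \<Rightarrow> (pt \<Rightarrow> complex) \<Rightarrow> bool" where
  "per N j h \<longleftrightarrow> (\<forall>x\<in>RN N. h (x(j := x j + 1)) = h x)"

text \<open>Only the fractional part \<open>u\<close> of the shift matters. The interval from
  \<open>u\<close> to \<open>1 + u\<close> is cut at 1 and its right piece is moved back by one
  period.\<close>

lemma integral_periodic_shift:
  fixes \<phi> :: "real \<Rightarrow> complex"
  assumes c: "continuous_on UNIV \<phi>" and p: "\<And>t. \<phi> (t + 1) = \<phi> t"
  shows "integral {0..1} (\<lambda>t. \<phi> (t + s)) = integral {0..1} \<phi>"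
proof -
  have pn: "\<phi> (t + real k) = \<phi> t" for t k
  proof (induction k)
    case (Suc k)
    then show ?case using p [of "t + real k"] by (simp add: add_ac)
  qed simp
  have pz: "\<phi> (t + of_int k) = \<phi> t" for t k
  proof (cases "k \<ge> 0")
    case True
    then show ?thesis using pn [of t "nat k"] by simp
  next
    case False
    then show ?thesis using pn [of "t + of_int k" "nat (- k)"] by simp
  qed
  define u where "u = frac s"
  have u: "0 \<le> u" "u \<le> 1" by (auto simp: u_def frac_lt_1 less_imp_le)
  have int: "\<phi> integrable_on {a..b}" for a b
    by (rule integrable_continuous_interval) (rule continuous_on_subset [OF c subset_UNIV])
  have "(\<lambda>t. \<phi> (t + s)) = \<phi> \<circ> (+) u"
  proof
    fix t show "\<phi> (t + s) = (\<phi> \<circ> (+) u) t" using pz [of "t + u" "\<lfloor>s\<rfloor>"] by (simp add: u_def frac_def add.commute)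
  qed
  then have "integral {0..1} (\<lambda>t. \<phi> (t + s)) = integral {u..1 + u} \<phi>"
    using integral_shift_Icc_real [of 0 1 \<phi> u] by simp
  also have "\<dots> = integral {u..1} \<phi> + integral {1..1 + u} \<phi>"
    using u int by (intro Henstock_Kurzweil_Integration.integral_combine [symmetric]) auto
  also have "integral {1..1 + u} \<phi> = integral {0..u} \<phi>"
    using integral_shift_Icc_real [of 0 u \<phi> 1] p by (simp add: comp_def add.commute)
  also have "integral {u..1} \<phi> + integral {0..u} \<phi> = integral {0..1} \<phi>"
    using Henstock_Kurzweil_Integration.integral_combine [OF u int] by (simp add: add_ac)
  finally show ?thesis .
qed

text \<open>The shift may vary with the other coordinates; independence of the averaged one
  suffices. This allows fibre shifts that depend on the base point.\<close>

lemma avg_shift: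
  assumes h: "continuous_on (RN N) h" "per N j h" and s: "\<And>t. s (x(j := t)) = s x"
    and "j < N" "x \<in> RN N"
  shows "avg j (\<lambda>x. h (x(j := x j + s x))) x = avg j h x"
proof -
  have "h (x(j := t + 1)) = h (x(j := t))" for t
    using h(2) RN_upd [OF assms(5,4), of t] unfolding per_def by fastforce
  then show ?thesis
    unfolding avg_def using integral_periodic_shift [of "\<lambda>t. h (x(j := t))" "s x"]
      continuous_on_slice [OF h(1) assms(4,5)] by (simp add: s)
qed

lemma per_partial_deriv:
  assumes h: "smooth N h" "per N i h" and "i < N" "j < N"
  shows "per N i (partial_deriv j h)"
  unfolding per_def
proof
  fix x assume x: "x \<in> RN N"
  have p: "h (y(i := y i + 1)) = h y" if "y \<in> RN N" for y using h(2) that by (simp add: per_def)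
  show "partial_deriv j h (x(i := x i + 1)) = partial_deriv j h x"
  proof (cases "i = j")
    case True
    have "((\<lambda>t. h (x(j := t))) has_vector_derivative partial_deriv j h (x(j := x j + 1))) (at (x j + 1))"
      by (rule smooth_has_vector_derivative [OF h(1) assms(4) x])
    moreover have "((\<lambda>t. t + 1) has_vector_derivative 1) (at (x j))"
      by (auto intro!: derivative_eq_intros simp: has_vector_derivative_def)
    ultimately have "((\<lambda>t. h (x(j := t))) \<circ> (\<lambda>t. t + 1) has_vector_derivative
        1 *\<^sub>R partial_deriv j h (x(j := x j + 1))) (at (x j))"
      by (intro vector_diff_chain_at) auto
    moreover have "(\<lambda>t. h (x(j := t))) \<circ> (\<lambda>t. t + 1) = (\<lambda>t. h (x(j := t)))"
      using p [OF RN_upd [OF x assms(3)]] True by (auto simp: comp_def)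
    ultimately show ?thesis
      using partial_deriv_eqI [of h x j "partial_deriv j h (x(j := x j + 1))"] True by simp
  next
    case False
    have "(\<lambda>t. h (x(i := x i + 1, j := t))) = (\<lambda>t. h (x(j := t)))"
      using p [OF RN_upd [OF x assms(4)]] False by (auto simp: fun_upd_twist)
    then show ?thesis using False by (simp add: partial_deriv_def)
  qed
qed

primrec avgs :: "nat list \<Rightarrow> (pt \<Rightarrow> complex) \<Rightarrow> pt \<Rightarrow> complex" where
  "avgs [] h = h"
| "avgs (j # js) h = avg j (avgs js h)"

lemma avgs_append: "avgs (is @ js) h = avgs is (avgs js h)"
  by (induction "is") auto

lemma avgs_cong:
  "js \<in> lists {..<N} \<Longrightarrow> (\<And>x. x \<in> RN N \<Longrightarrow> h x = k x) \<Longrightarrow> x \<in> RN N \<Longrightarrow> avgs js h x = avgs js k x"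
proof (induction js arbitrary: x rule: list.induct)
  case (Cons j js)
  then show ?case by (auto intro!: avg_cong)
qed simp

lemma continuous_on_avgs: "continuous_on (RN N) h \<Longrightarrow> js \<in> lists {..<N} \<Longrightarrow> continuous_on (RN N) (avgs js h)"
  by (induction js rule: list.induct) (auto intro: continuous_on_avg)

lemma smooth_avgs: "smooth N h \<Longrightarrow> js \<in> lists {..<N} \<Longrightarrow> smooth N (avgs js h)"
  by (induction js rule: list.induct) (auto intro: smooth_avg)

lemma avgs_lin:
  assumes "continuous_on (RN N) h" "continuous_on (RN N) k"
  shows "js \<in> lists {..<N} \<Longrightarrow> x \<in> RN N \<Longrightarrow> avgs js (\<lambda>x. a * h x + b * k x) x = a * avgs js h x + b * avgs js k x"
proof (induction js arbitrary: x rule: list.induct)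
  case (Cons j js)
  then have j: "j < N" and js: "js \<in> lists {..<N}" by auto
  have "avg j (avgs js (\<lambda>x. a * h x + b * k x)) x = avg j (\<lambda>x. a * avgs js h x + b * avgs js k x) x"
    using Cons.IH [OF js] j Cons.prems(2) by (intro avg_cong)
  then show ?case
    using avg_lin [OF continuous_on_avgs [OF assms(1) js] continuous_on_avgs [OF assms(2) js] j Cons.prems(2)] by simp
qed simp

lemma partial_deriv_avgs:
  assumes "smooth N h" "i < N" "i \<notin> set js"
  shows "js \<in> lists {..<N} \<Longrightarrow> x \<in> RN N \<Longrightarrow> partial_deriv i (avgs js h) x = avgs js (partial_deriv i h) x"
  using assms(3)
proof (induction js arbitrary: x rule: list.induct)
  case (Cons j js)
  then have j: "j < N" and js: "js \<in> lists {..<N}" by auto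
  have "partial_deriv i (avg j (avgs js h)) x = avg j (partial_deriv i (avgs js h)) x"
    using Cons.prems j js assms by (intro partial_deriv_avg smooth_avgs) auto
  also have "\<dots> = avg j (avgs js (partial_deriv i h)) x"
    using Cons.IH [OF js] Cons.prems j by (intro avg_cong) auto
  finally show ?case by simp
qed simp

lemma avg_avgs:
  assumes "continuous_on (RN N) h" "i < N"
  shows "js \<in> lists {..<N} \<Longrightarrow> x \<in> RN N \<Longrightarrow> avg i (avgs js h) x = avgs js (avg i h) x"
proof (induction js arbitrary: x rule: list.induct)
  case (Cons j js)
  then have j: "j < N" and js: "js \<in> lists {..<N}" by auto
  have "avg i (avg j (avgs js h)) x = avg j (avg i (avgs js h)) x"
    using continuous_on_avgs [OF assms(1) js] assms(2) j Cons.prems(2) by (rule avg_swap)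
  also have "\<dots> = avg j (avgs js (avg i h)) x"
    using Cons.IH [OF js] j Cons.prems(2) by (intro avg_cong)
  finally show ?case by simp
qed simp

text \<open>Fubini: any of the averaged coordinates may be taken innermost, where the fundamental
  theorem of calculus or a shift can act on it.\<close>

lemma avgs_inner:
  assumes h: "continuous_on (RN N) h" and js: "js \<in> lists {..<N}" "j \<in> set js" and x: "x \<in> RN N"
  shows "avgs js h x = avgs (remove1 j js) (avg j h) x"
proof -
  obtain as bs where jsd: "js = as @ j # bs" "j \<notin> set as" using split_list_first [OF js(2)] by blast
  have j: "j < N" and as: "as \<in> lists {..<N}" and bs: "bs \<in> lists {..<N}" using js(1) jsd by auto
  have "avgs as (avg j (avgs bs h)) x = avgs as (avgs bs (avg j h)) x"
    by (rule avgs_cong [OF as _ x]) (rule avg_avgs [OF h j bs])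
  then show ?thesis using jsd by (simp add: avgs_append remove1_append)
qed

lemma remove1_lists: "js \<in> lists X \<Longrightarrow> remove1 j js \<in> lists X"
  using set_remove1_subset [of j js] by (auto simp: in_lists_conv_set)

lemma avgs_cong_inner:
  assumes "continuous_on (RN N) h" "continuous_on (RN N) k" "js \<in> lists {..<N}" "j \<in> set js" "x \<in> RN N"
    and "\<And>y. y \<in> RN N \<Longrightarrow> avg j h y = avg j k y"
  shows "avgs js h x = avgs js k x"
  unfolding avgs_inner [OF assms(1,3-5)] avgs_inner [OF assms(2,3-5)]
  by (rule avgs_cong [OF remove1_lists [OF assms(3)] assms(6,5)])

lemma avgs_zero: "js \<in> lists {..<N} \<Longrightarrow> x \<in> RN N \<Longrightarrow> avgs js (\<lambda>x. 0) x = 0"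
  using avgs_lin [of N "\<lambda>x. 0" "\<lambda>x. 0" js x 0 0] by simp

text \<open>By the fundamental theorem of calculus, a derivative integrates to 0 over a
  period.\<close>

lemma avgs_partial_deriv_per:
  assumes h: "smooth N h" "per N j h" and js: "js \<in> lists {..<N}" "j \<in> set js" and x: "x \<in> RN N"
  shows "avgs js (partial_deriv j h) x = 0"
proof -
  have j: "j < N" using js by (auto simp: in_lists_conv_set)
  have "avgs js (partial_deriv j h) x = avgs js (\<lambda>x. 0) x"
  proof (rule avgs_cong_inner [OF _ _ js x])
    fix y assume y: "y \<in> RN N"
    have "h (y(j := 1)) = h (y(j := 0))"
      using h(2) RN_upd [OF y j, of 0] by (force simp: per_def)
    then show "avg j (partial_deriv j h) y = avg j (\<lambda>x. 0) y"
      using avg_partial_deriv [OF h(1) j y] by (simp add: avg_def)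
  qed (rule smooth_continuous [OF smooth_partial_deriv [OF h(1) j]], rule continuous_on_const)
  then show ?thesis using avgs_zero [OF js(1) x] by simp
qed

lemma avgs_shift:
  assumes h: "continuous_on (RN N) h" "per N j h" and js: "js \<in> lists {..<N}" "j \<in> set js" and x: "x \<in> RN N"
    and s: "\<And>x t. s (x(j := t)) = s x" "continuous_on (RN N) s"
  shows "avgs js (\<lambda>x. h (x(j := x j + s x))) x = avgs js h x"
proof (rule avgs_cong_inner [OF _ h(1) js x])
  have j: "j < N" using js by (auto simp: in_lists_conv_set)
  show "continuous_on (RN N) (\<lambda>x. h (x(j := x j + s x)))"
    by (rule continuous_on_upd [OF h(1) j continuous_on_id],
        rule continuous_on_add [OF continuous_on_subset [OF continuous_on_product_coordinates subset_UNIV] s(2)], simp)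
  show "avg j (\<lambda>x. h (x(j := x j + s x))) y = avg j h y" if "y \<in> RN N" for y
    by (rule avg_shift [where s = s, OF h s(1) j that])
qed

text \<open>A positive continuous function on the compact interval is bounded below by a positive
  constant, its minimum.\<close>

lemma avg_pos:
  assumes h: "continuous_on (RN N) h" "\<And>x. x \<in> RN N \<Longrightarrow> 0 < Re (h x)" and j: "j < N" and x: "x \<in> RN N"
  shows "0 < Re (avg j h x)"
proof -
  let ?f = "\<lambda>t. h (x(j := t))"
  have c: "continuous_on {0..1} (\<lambda>t. Re (?f t))"
    by (intro continuous_on_Re continuous_on_slice [OF h(1) j x])
  have "\<exists>t0\<in>{0..1}. \<forall>t\<in>{0..1}. Re (?f t0) \<le> Re (?f t)"
    by (rule continuous_attains_inf [OF compact_Icc _ c]) simp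
  then obtain t0 where t0: "t0 \<in> {0..1}" "\<And>t. t \<in> {0..1} \<Longrightarrow> Re (?f t0) \<le> Re (?f t)" by blast
  have "Re (avg j h x) = integral {0..1} (\<lambda>t. Re (?f t))"
    unfolding avg_def
    using integral_linear [OF integrable_slice [OF h(1) j x] bounded_linear_Re] by (simp add: comp_def)
  moreover have "integral {0..1} (\<lambda>t::real. Re (?f t0)) \<le> integral {0..1} (\<lambda>t. Re (?f t))"
    using t0 by (intro integral_le integrable_continuous_interval c continuous_on_const) auto
  ultimately show ?thesis using h(2) [OF RN_upd [OF x j], of t0] by simp
qed

lemma avgs_pos:
  assumes h: "continuous_on (RN N) h" "\<And>x. x \<in> RN N \<Longrightarrow> 0 < Re (h x)"
  shows "js \<in> lists {..<N} \<Longrightarrow> x \<in> RN N \<Longrightarrow> 0 < Re (avgs js h x)"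
proof (induction js arbitrary: x rule: list.induct)
  case (Cons j js)
  then show ?case using continuous_on_avgs [OF h(1)] by (auto intro!: avg_pos)
qed (use h in auto)

lemma avgs_cmult:
  assumes "continuous_on (RN N) h" "js \<in> lists {..<N}" "x \<in> RN N"
  shows "avgs js (\<lambda>x. c * h x) x = c * avgs js h x"
  using avgs_lin [OF assms(1,1,2,3), of c 0] by simp

lemma avgs_sum:
  assumes f: "\<And>k. k \<in> A \<Longrightarrow> continuous_on (RN N) (f k)" and js: "js \<in> lists {..<N}" and x: "x \<in> RN N"
  shows "avgs js (\<lambda>x. \<Sum>k\<in>A. c k * f k x) x = (\<Sum>k\<in>A. c k * avgs js (f k) x)"
  using f
proof (induction A rule: infinite_finite_induct)
  case (insert k A)
  have "continuous_on (RN N) (\<lambda>x. \<Sum>k\<in>A. c k * f k x)"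
    using insert.prems by (intro continuous_intros) auto
  from avgs_lin [OF insert.prems [OF insertI1] this js x, of "c k" 1] insert show ?case by simp
qed (use avgs_zero [OF js x] in auto)

lemma avgs_differential_differential:
  assumes h: "smooth N h" and js: "js \<in> lists {..<N}" and x: "x \<in> RN N"
  shows "avgs js (\<lambda>x. differential N (\<lambda>y. differential N h y w) x v) x =
    (\<Sum>k<N. w k * (\<Sum>l<N. v l * avgs js (partial_deriv l (partial_deriv k h)) x))"
proof -
  have s: "smooth N (partial_deriv k h)" if "k \<in> {..<N}" for k using smooth_partial_deriv [OF h] that by simp
  have c: "continuous_on (RN N) (partial_deriv l (partial_deriv k h))" if "k \<in> {..<N}" "l \<in> {..<N}" for k l
    by (rule smooth_continuous [OF smooth_partial_deriv [OF s [OF that(1)]]]) (use that(2) in simp)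
  have "differential N (\<lambda>y. differential N h y w) x v = (\<Sum>k<N. w k * (\<Sum>l<N. v l * partial_deriv l (partial_deriv k h) x))"
    if x: "x \<in> RN N" for x
  proof -
    have "differential N (\<lambda>y. differential N h y w) x v = (\<Sum>k<N. differential N (\<lambda>y. w k * partial_deriv k h y) x v)"
      unfolding differential_def [of N h] by (rule differential_sum) (use s x in \<open>auto intro: smooth_intros\<close>)
    also have "\<dots> = (\<Sum>k<N. w k * differential N (partial_deriv k h) x v)"
      by (rule sum.cong [OF refl differential_cmult [OF s x]])
    finally show ?thesis unfolding differential_def .
  qed
  then have "avgs js (\<lambda>x. differential N (\<lambda>y. differential N h y w) x v) x =
      avgs js (\<lambda>x. \<Sum>k<N. w k * (\<Sum>l<N. v l * partial_deriv l (partial_deriv k h) x)) x"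
    by (rule avgs_cong [OF js _ x])
  also have "\<dots> = (\<Sum>k<N. w k * avgs js (\<lambda>x. \<Sum>l<N. v l * partial_deriv l (partial_deriv k h) x) x)"
    by (rule avgs_sum [OF _ js x]) (intro continuous_intros c; simp)
  also have "\<dots> = (\<Sum>k<N. w k * (\<Sum>l<N. v l * avgs js (partial_deriv l (partial_deriv k h)) x))"
    by (intro sum.cong refl arg_cong2 [where f = "(*)"] avgs_sum [OF _ js x] c)
  finally show ?thesis .
qed

lemma avgs_second_deriv_outer:
  assumes "smooth N h" "per N l h" "l \<in> set js" "k < N" "js \<in> lists {..<N}" "x \<in> RN N"
  shows "avgs js (partial_deriv l (partial_deriv k h)) x = 0"
proof (rule avgs_partial_deriv_per [OF _ _ assms(5,3,6)])
  have l: "l < N" using assms(3,5) by (auto simp: in_lists_conv_set)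
  show "smooth N (partial_deriv k h)" using assms by (intro smooth_intros)
  show "per N l (partial_deriv k h)" by (rule per_partial_deriv [OF assms(1,2) l assms(4)])
qed

text \<open>The two derivatives are never interchanged. Since \<open>l\<close> is not averaged by
  \<open>js\<close>, the derivative along \<open>l\<close> passes outside that average, and the
  average of the inner derivative is identically 0.\<close>

lemma avgs_second_deriv_inner:
  assumes h: "smooth N h" "per N k h" and l: "l < N" "l \<notin> set js" and k: "k \<in> set js"
    and "is": "is \<in> lists {..<N}" and js: "js \<in> lists {..<N}" and x: "x \<in> RN N"
  shows "avgs (is @ js) (partial_deriv l (partial_deriv k h)) x = 0"
proof -
  have "k < N" using k js by (auto simp: in_lists_conv_set)
  then have s: "smooth N (partial_deriv k h)" using h by (intro smooth_intros)
  have "avgs js (partial_deriv l (partial_deriv k h)) y = 0" if y: "y \<in> RN N" for y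
  proof -
    have "avgs js (partial_deriv l (partial_deriv k h)) y = partial_deriv l (avgs js (partial_deriv k h)) y"
      by (rule partial_deriv_avgs [OF s l js y, symmetric])
    also have "\<dots> = partial_deriv l (\<lambda>y. 0) y"
      by (rule partial_deriv_cong [OF avgs_partial_deriv_per [OF h js k] y l(1)])
    finally show ?thesis by (simp only: partial_deriv_const)
  qed
  then have "avgs is (avgs js (partial_deriv l (partial_deriv k h))) x = avgs is (\<lambda>y. 0) x"
    by (rule avgs_cong [OF "is" _ x])
  then show ?thesis by (simp only: avgs_append avgs_zero [OF "is" x])
qed

lemma avgs_second_deriv_append:
  assumes h: "smooth N h" and l: "l < N" "l \<notin> set js" and k: "k < N" "k \<notin> set js"
    and "is": "is \<in> lists {..<N}" and js: "js \<in> lists {..<N}" and x: "x \<in> RN N"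
  shows "avgs (is @ js) (partial_deriv l (partial_deriv k h)) x = avgs is (partial_deriv l (partial_deriv k (avgs js h))) x"
  unfolding avgs_append
proof (rule avgs_cong [OF "is" _ x])
  fix y assume y: "y \<in> RN N"
  have "avgs js (partial_deriv l (partial_deriv k h)) y = partial_deriv l (avgs js (partial_deriv k h)) y"
    using smooth_partial_deriv [OF h k(1)] by (rule partial_deriv_avgs [OF _ l js y, symmetric])
  also have "\<dots> = partial_deriv l (partial_deriv k (avgs js h)) y"
    by (rule partial_deriv_cong [OF partial_deriv_avgs [OF h k js, symmetric] y l(1)])
  finally show "avgs js (partial_deriv l (partial_deriv k h)) y = partial_deriv l (partial_deriv k (avgs js h)) y" .
qed

text \<open>The fundamental theorem of calculus twice. Averaging along \<open>l\<close> turns the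
  outer derivative into the defect \<open>d * S\<close> of periodicity of \<open>F\<close>;
  averaging the remaining derivative along \<open>k\<close> leaves the defect \<open>b * W\<close>
  of \<open>S\<close>. The two integrated coordinates end at their lower limit 0.\<close>

lemma avgs_second_deriv:
  assumes F: "smooth N F" and S: "smooth N S" and W: "smooth N W"
    and l: "l \<in> set js" and k: "k \<in> set js" and lk: "l \<noteq> k" and js: "js \<in> lists {..<N}" and x: "x \<in> RN N"
    and FS: "\<And>y. y \<in> RN N \<Longrightarrow> F (y(l := y l + 1)) = F y + d * S y"
    and SW: "\<And>y. y \<in> RN N \<Longrightarrow> S (y(k := y k + 1)) = S y + b * W y"
  shows "avgs js (partial_deriv l (partial_deriv k F)) x =
    d * b * avgs (remove1 k (remove1 l js)) (\<lambda>y. W (y(l := 0, k := 0))) x"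
proof -
  have lN: "l < N" "k < N" using l k js by (auto simp: in_lists_conv_set)
  let ?js = "remove1 l js"
  have js1: "?js \<in> lists {..<N}" "remove1 k ?js \<in> lists {..<N}" by (intro remove1_lists js)+
  have k1: "k \<in> set ?js" using k lk by (simp add: in_set_remove1)
  have sF: "smooth N (partial_deriv k F)" "smooth N (partial_deriv l (partial_deriv k F))"
    and sS: "smooth N (partial_deriv k S)" using F S lN by (auto intro: smooth_intros)
  have cu: "continuous_on (RN N) (\<lambda>y. h (y(i := 0)))" if "continuous_on (RN N) h" "i < N"
    for h :: "pt \<Rightarrow> complex" and i
    by (rule continuous_on_upd [where p = "\<lambda>y. y", OF that continuous_on_id continuous_on_const])
  let ?q = "\<lambda>y. partial_deriv k S (y(l := 0))"
  have cq: "continuous_on (RN N) ?q" by (rule cu [OF smooth_continuous [OF sS] lN(1)])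
  have "avgs js (partial_deriv l (partial_deriv k F)) x = avgs ?js (avg l (partial_deriv l (partial_deriv k F))) x"
    by (rule avgs_inner [OF smooth_continuous [OF sF(2)] js l x])
  also have "\<dots> = avgs ?js (\<lambda>y. d * ?q y) x"
  proof (rule avgs_cong [OF js1(1) _ x])
    fix y assume y: "y \<in> RN N"
    let ?z = "y(l := 0)"
    have z: "?z \<in> RN N" by (rule RN_upd [OF y lN(1)])
    have "partial_deriv k F (?z(l := ?z l + 1)) = partial_deriv k (\<lambda>u. F (u(l := u l + 1))) ?z"
      unfolding partial_deriv_def using lk by (simp add: fun_upd_twist [OF lk])
    also have "\<dots> = partial_deriv k (\<lambda>u. 1 * F u + d * S u) ?z"
      by (rule partial_deriv_cong [OF _ z lN(2)]) (simp add: FS)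
    also have "\<dots> = 1 * partial_deriv k F ?z + d * partial_deriv k S ?z"
      by (rule partial_deriv_lin [OF F S lN(2) z])
    finally show "avg l (partial_deriv l (partial_deriv k F)) y = d * ?q y"
      unfolding avg_partial_deriv [OF sF(1) lN(1) y] by simp
  qed
  also have "\<dots> = d * avgs ?js ?q x" by (rule avgs_cmult [OF cq js1(1) x])
  also have "avgs ?js ?q x = avgs (remove1 k ?js) (avg k ?q) x"
    by (rule avgs_inner [OF cq js1(1) k1 x])
  also have "\<dots> = avgs (remove1 k ?js) (\<lambda>y. b * W (y(l := 0, k := 0))) x"
  proof (rule avgs_cong [OF js1(2) _ x])
    fix y assume y: "y \<in> RN N"
    let ?z = "y(l := 0)"
    have z: "?z \<in> RN N" "?z(k := 0) \<in> RN N" by (intro RN_upd y lN)+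
    have "avg k ?q y = avg k (partial_deriv k S) ?z"
      unfolding avg_def fun_upd_twist [OF lk [symmetric]] ..
    also have "\<dots> = S (?z(k := 1)) - S (?z(k := 0))" by (rule avg_partial_deriv [OF S lN(2) z(1)])
    also have "\<dots> = b * W (?z(k := 0))" using SW [OF z(2)] by simp
    finally show "avg k ?q y = b * W (?z(k := 0))" .
  qed
  also have "\<dots> = b * avgs (remove1 k ?js) (\<lambda>y. W (y(l := 0, k := 0))) x"
    by (rule avgs_cmult [OF cu [OF cu [OF smooth_continuous [OF W] lN(2)] lN(1)] js1(2) x])
  finally show ?thesis by (simp only: mult.assoc)
qed

lemma avgs_upd_outside:
  "l \<notin> set js \<Longrightarrow> avgs js (\<lambda>z. h (z(l := z l + c))) x = avgs js h (x(l := x l + c))"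
proof (induction js arbitrary: x)
  case (Cons j js)
  then have lj: "l \<noteq> j" and "l \<notin> set js" by auto
  note IH = Cons.IH [OF this(2)]
  have "(x(j := t))(l := (x(j := t)) l + c) = (x(l := x l + c))(j := t)" for t
    using lj by (simp add: fun_upd_twist [OF lj])
  then show ?case by (simp only: avgs.simps avg_def IH)
qed simp

lemma avgs_fibre_step:
  assumes h: "continuous_on (RN N) h" "\<And>j. j \<in> set js \<Longrightarrow> per N j h"
    and js: "js \<in> lists {..<N}" "k \<in> set js" and x: "x \<in> RN N"
    and s: "continuous_on (RN N) s" "\<And>j x t. j \<in> set js \<Longrightarrow> s (x(j := t)) = s x"
  defines "h' \<equiv> \<lambda>x. h (x(k := x k + s x))"
  shows "continuous_on (RN N) h'" "\<And>j. j \<in> set js \<Longrightarrow> per N j h'" "avgs js h' x = avgs js h x"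
proof -
  have N: "j < N" if "j \<in> set js" for j using js(1) that by (auto simp: in_lists_conv_set)
  show "continuous_on (RN N) h'"
    unfolding h'_def using N [OF js(2)] h(1) s(1)
    by (intro continuous_on_upd [where p = "\<lambda>z. z"] continuous_intros)
       (auto intro: continuous_on_subset [OF continuous_on_product_coordinates])
  show "per N j h'" if j: "j \<in> set js" for j
    unfolding per_def h'_def
  proof
    fix x assume x: "x \<in> RN N"
    let ?z = "x(k := x k + s x)"
    have z: "?z \<in> RN N" by (rule RN_upd [OF x N [OF js(2)]])
    have e: "(x(j := x j + 1))(k := (x(j := x j + 1)) k + s (x(j := x j + 1))) = ?z(j := ?z j + 1)"
      unfolding s(2) [OF j] by (cases "j = k") (simp_all add: fun_upd_twist add_ac)
    show "h ((x(j := x j + 1))(k := (x(j := x j + 1)) k + s (x(j := x j + 1)))) = h ?z"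
      unfolding e by (rule bspec [OF h(2) [OF j, unfolded per_def] z])
  qed
  show "avgs js h' x = avgs js h x"
    unfolding h'_def by (rule avgs_shift [OF h(1) h(2) [OF js(2)] js x s(2) [OF js(2)] s(1)])
qed

text \<open>A shear of several coordinates, performed one coordinate at a time. Continuity and
  periodicity belong to the conclusion because the next single shift needs them.\<close>

lemma avgs_fibre_shift:
  fixes s :: "nat \<Rightarrow> pt \<Rightarrow> real"
  assumes h: "continuous_on (RN N) h" "\<And>j. j \<in> set js \<Longrightarrow> per N j h" and js: "js \<in> lists {..<N}" and x: "x \<in> RN N"
    and s: "\<And>i. continuous_on (RN N) (s i)" "\<And>i j x t. j \<in> set js \<Longrightarrow> s i (x(j := t)) = s i x"
  shows "set ks \<subseteq> set js \<Longrightarrow> distinct ks \<Longrightarrow>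
    continuous_on (RN N) (\<lambda>x. h (\<lambda>i. if i \<in> set ks then x i + s i x else x i)) \<and>
    (\<forall>j\<in>set js. per N j (\<lambda>x. h (\<lambda>i. if i \<in> set ks then x i + s i x else x i))) \<and>
    avgs js (\<lambda>x. h (\<lambda>i. if i \<in> set ks then x i + s i x else x i)) x = avgs js h x"
proof (induction ks)
  case (Cons k ks)
  let ?h = "\<lambda>x. h (\<lambda>i. if i \<in> set ks then x i + s i x else x i)"
  have k: "k \<in> set js" "k \<notin> set ks" using Cons.prems by auto
  have IH: "continuous_on (RN N) ?h" "\<And>j. j \<in> set js \<Longrightarrow> per N j ?h" "avgs js ?h x = avgs js h x"
    using Cons by auto
  \<comment> \<open>The amounts \<open>s\<close> do not see the sheared coordinates, so the shift of
    coordinate \<open>k\<close> can be split off without changing the others.\<close>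
  have "(\<lambda>i. if i \<in> set (k # ks) then x i + s i x else x i) =
      (\<lambda>i. if i \<in> set ks then (x(k := x k + s k x)) i + s i (x(k := x k + s k x)) else (x(k := x k + s k x)) i)" for x
    unfolding s(2) [OF k(1)] using k(2) by (auto simp: fun_eq_iff)
  then have e: "(\<lambda>x. h (\<lambda>i. if i \<in> set (k # ks) then x i + s i x else x i)) = (\<lambda>x. ?h (x(k := x k + s k x)))"
    by (simp only:)
  show ?case
    unfolding e
  proof (intro conjI ballI)
    show "continuous_on (RN N) (\<lambda>x. ?h (x(k := x k + s k x)))"
      by (rule avgs_fibre_step(1) [OF IH(1,2) js k(1) x s])
    show "per N j (\<lambda>x. ?h (x(k := x k + s k x)))" if "j \<in> set js" for j
      by (rule avgs_fibre_step(2) [OF IH(1,2) js k(1) x s that])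
    show "avgs js (\<lambda>x. ?h (x(k := x k + s k x))) x = avgs js h x"
      by (rule trans [OF avgs_fibre_step(3) [OF IH(1,2) js k(1) x s] IH(3)])
  qed
qed (use h in \<open>simp add: fun_upd_triv\<close>)

lemma avgs_neg:
  assumes h: "continuous_on (RN N) h" "\<And>x. x \<in> RN N \<Longrightarrow> Re (h x) < 0" and js: "js \<in> lists {..<N}" and x: "x \<in> RN N"
  shows "Re (avgs js h x) < 0"
proof -
  have "0 < Re (avgs js (\<lambda>x. (- 1) * h x) x)"
    by (rule avgs_pos [OF _ _ js x]) (use h in \<open>auto intro!: continuous_intros\<close>)
  then show ?thesis unfolding avgs_cmult [OF h(1) js x] by simp
qed

text \<open>\<open>del_typed\<close> and \<open>delbar_typed\<close> combined and averaged term by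
  term. The exponent starts at \<open>length us - 1\<close>, the number of (1,0) arguments left once
  del has used one for its derivative.\<close>

lemma avgs_del_delbar:
  assumes \<alpha>: "is_form (2 * n) k \<alpha>" and us: "us \<in> lists (t10 (2 * n))" and ws: "ws \<in> lists (t01 (2 * n))"
    and len: "length us + length ws = Suc (Suc k)"
    and z: "form_eq (2 * n) (del (2 * n) stdJ (delbar (2 * n) stdJ \<alpha>)) zero_form"
    and js: "js \<in> lists {..<2 * n}" and x: "x \<in> RN (2 * n)"
  shows "(\<Sum>i<length us. (-1) ^ i * (\<Sum>j<length ws. (-1) ^ (length us - 1 + j) *
    avgs js (\<lambda>x. differential (2 * n) (\<lambda>y. differential (2 * n)
      (\<lambda>z. \<alpha> z ((take i us @ drop (Suc i) us) @ take j ws @ drop (Suc j) ws)) y (ws ! j)) x (us ! i)) x)) = 0"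
    (is "(\<Sum>i<_. _ * (\<Sum>j<_. _ * avgs js (?DD i j) x)) = 0")
proof -
  let ?us = "\<lambda>i. take i us @ drop (Suc i) us" and ?ws = "\<lambda>j. take j ws @ drop (Suc j) ws"
  have us': "?us i \<in> lists (t10 (2 * n))" for i
    using us by (auto simp: in_lists_conv_set dest: in_set_takeD in_set_dropD)
  have ws': "?ws j \<in> lists (t01 (2 * n))" for j
    using ws by (auto simp: in_lists_conv_set dest: in_set_takeD in_set_dropD)
  have CN: "?us i @ ?ws j \<in> lists (CN (2 * n))" for i j
    unfolding append_in_lists_conv [of "?us i"] using lists_t10 [OF us'] lists_t01 [OF ws'] by blast
  have s: "smooth (2 * n) (\<lambda>z. \<alpha> z (?us i @ ?ws j))" for i j
    using \<alpha> CN by (simp add: is_form_iff sform_smooth)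
  have c: "continuous_on (RN (2 * n)) (?DD i j)" for i j
    by (intro smooth_continuous smooth_differential s)
  have 1: "del (2 * n) stdJ (delbar (2 * n) stdJ \<alpha>) x (us @ ws) =
      (\<Sum>i<length us. (-1) ^ i * (\<Sum>j<length ws. (-1) ^ (length us - 1 + j) * ?DD i j x))"
    if x: "x \<in> RN (2 * n)" for x
    unfolding del_typed [OF is_form_delbar [OF \<alpha>] us ws x len]
  proof (intro sum.cong refl arg_cong2 [where f = "(*)"])
    fix i assume "i \<in> {..<length us}"
    then have li: "length (?us i) = length us - 1" "length (?us i) + length ws = Suc k" using len by auto
    have "delbar (2 * n) stdJ \<alpha> y (?us i @ ws) = (\<Sum>j<length ws. (-1) ^ (length us - 1 + j) *
        differential (2 * n) (\<lambda>z. \<alpha> z (?us i @ ?ws j)) y (ws ! j))" if y: "y \<in> RN (2 * n)" for y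
      by (rule delbar_typed [OF \<alpha> us' ws y li(2), unfolded li(1)])
    from differential_cong [OF this x]
    have "differential (2 * n) (\<lambda>y. delbar (2 * n) stdJ \<alpha> y (?us i @ ws)) x (us ! i) =
        differential (2 * n) (\<lambda>y. \<Sum>j<length ws. (-1) ^ (length us - 1 + j) *
          differential (2 * n) (\<lambda>z. \<alpha> z (?us i @ ?ws j)) y (ws ! j)) x (us ! i)" .
    also have "\<dots> = (\<Sum>j<length ws. differential (2 * n) (\<lambda>y. (-1) ^ (length us - 1 + j) *
          differential (2 * n) (\<lambda>z. \<alpha> z (?us i @ ?ws j)) y (ws ! j)) x (us ! i))"
      by (intro differential_sum smooth_mult smooth_const smooth_differential s x) simp
    also have "\<dots> = (\<Sum>j<length ws. (-1) ^ (length us - 1 + j) * ?DD i j x)"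
      by (intro sum.cong refl differential_cmult smooth_differential s x)
    finally show "differential (2 * n) (\<lambda>y. delbar (2 * n) stdJ \<alpha> y (?us i @ ws)) x (us ! i) =
        (\<Sum>j<length ws. (-1) ^ (length us - 1 + j) * ?DD i j x)" .
  qed
  have 2: "us @ ws \<in> lists (CN (2 * n))"
    unfolding append_in_lists_conv using lists_t10 [OF us] lists_t01 [OF ws] by blast
  have "(\<Sum>i<length us. (-1) ^ i * (\<Sum>j<length ws. (-1) ^ (length us - 1 + j) * ?DD i j x)) = 0"
    if x: "x \<in> RN (2 * n)" for x
    by (rule trans [OF 1 [OF x, symmetric] form_eqD [OF z x 2]])
  then have "avgs js (\<lambda>x. \<Sum>i<length us. (-1) ^ i * (\<Sum>j<length ws. (-1) ^ (length us - 1 + j) * ?DD i j x)) x =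
      avgs js (\<lambda>x. 0) x"
    by (rule avgs_cong [OF js _ x])
  also have "\<dots> = 0" by (rule avgs_zero [OF js x])
  also have "avgs js (\<lambda>x. \<Sum>i<length us. (-1) ^ i * (\<Sum>j<length ws. (-1) ^ (length us - 1 + j) * ?DD i j x)) x =
      (\<Sum>i<length us. (-1) ^ i * avgs js (\<lambda>x. \<Sum>j<length ws. (-1) ^ (length us - 1 + j) * ?DD i j x) x)"
    by (rule avgs_sum [OF _ js x], intro continuous_on_sum continuous_on_mult continuous_on_const c)
  also have "\<dots> = (\<Sum>i<length us. (-1) ^ i * (\<Sum>j<length ws. (-1) ^ (length us - 1 + j) * avgs js (?DD i j) x))"
    by (intro sum.cong refl arg_cong2 [where f = "(*)"] avgs_sum [OF _ js x] c)
  finally show ?thesis .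
qed

section \<open>The product of two Kodaira-Thurston manifolds\<close>

text \<open>In global holomorphic coordinates $(z_1, z_2, w_1, w_2)$ the group law is
  $(z, w) (z', w') = (z + z', w_k + w'_k + \bar z_k z'_k)$. The coordinates 0, \<dots>, 7 are the real and
  imaginary parts of $z_1, z_2, w_1, w_2$, and \<open>kap\<close> is the quadratic term.\<close>

definition kap :: "nat \<Rightarrow> (nat \<Rightarrow> 'a::comm_ring) \<Rightarrow> (nat \<Rightarrow> 'a) \<Rightarrow> 'a" where
  "kap i a b = (if i = 4 then a 0 * b 0 + a 1 * b 1 else if i = 5 then a 0 * b 1 - a 1 * b 0
     else if i = 6 then a 2 * b 2 + a 3 * b 3 else if i = 7 then a 2 * b 3 - a 3 * b 2 else 0)"

definition KT :: "pt monoid" where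
  "KT = \<lparr>carrier = RN (2 * 4), mult = (\<lambda>a b i. a i + b i + kap i a b), one = (\<lambda>i. 0)\<rparr>"

definition KT_inv :: "pt \<Rightarrow> pt" where
  "KT_inv a = (\<lambda>i. - a i + kap i a a)"

definition KT_lattice :: "pt set" where
  "KT_lattice = {x \<in> RN (2 * 4). \<forall>i. x i \<in> \<int>}"

lemma KT_simps: "carrier KT = RN (2 * 4)" "a \<otimes>\<^bsub>KT\<^esub> b = (\<lambda>i. a i + b i + kap i a b)" "\<one>\<^bsub>KT\<^esub> = (\<lambda>i. 0)"
  by (simp_all add: KT_def)

lemma kap_large: "i < 4 \<or> 8 \<le> i \<Longrightarrow> kap i a b = 0"
  by (auto simp: kap_def)

lemma KT_mult_RN: "a \<in> RN (2 * 4) \<Longrightarrow> b \<in> RN (2 * 4) \<Longrightarrow> (\<lambda>i. a i + b i + kap i a b) \<in> RN (2 * 4)"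
  by (simp add: RN_iff kap_large)

lemma KT_inv_RN: "a \<in> RN (2 * 4) \<Longrightarrow> KT_inv a \<in> RN (2 * 4)"
  by (simp add: RN_iff KT_inv_def kap_large)

lemma KT_inv_left: "(\<lambda>i. KT_inv a i + a i + kap i (KT_inv a) a) = (\<lambda>i. 0)"
  by (rule ext) (simp add: KT_inv_def kap_def)

lemma group_KT: "group KT"
proof (rule groupI)
  fix x y z assume "x \<in> carrier KT" "y \<in> carrier KT" "z \<in> carrier KT"
  show "x \<otimes>\<^bsub>KT\<^esub> y \<otimes>\<^bsub>KT\<^esub> z = x \<otimes>\<^bsub>KT\<^esub> (y \<otimes>\<^bsub>KT\<^esub> z)"
    by (rule ext) (simp add: KT_simps kap_def algebra_simps)
next
  fix x assume "x \<in> carrier KT"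
  then show "\<exists>y\<in>carrier KT. y \<otimes>\<^bsub>KT\<^esub> x = \<one>\<^bsub>KT\<^esub>"
    using KT_inv_RN KT_inv_left by (intro bexI [of _ "KT_inv x"]) (auto simp: KT_simps)
qed (auto simp: KT_simps KT_mult_RN RN_iff kap_def)

lemma inv_KT: "a \<in> RN (2 * 4) \<Longrightarrow> inv\<^bsub>KT\<^esub> a = KT_inv a"
  using KT_inv_RN KT_inv_left by (intro group.inv_equality [OF group_KT]) (auto simp: KT_simps)

lemma smooth_kap:
  fixes a b :: "pt \<Rightarrow> nat \<Rightarrow> real"
  assumes "\<And>j. smooth N (\<lambda>x. a x j)" "\<And>j. smooth N (\<lambda>x. b x j)"
  shows "smooth N (\<lambda>x. kap i (a x) (b x))"
proof -
  have ab: "smooth N (\<lambda>x. a x j * b x k)" for j k by (rule smooth_mult [OF assms])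
  show ?thesis
    by (cases "i = 4"; cases "i = 5"; cases "i = 6"; cases "i = 7")
       (simp_all add: kap_def smooth_const smooth_add [OF ab ab] smooth_diff [OF ab ab])
qed

lemma lie_group_KT: "lie_group_on_RN (2 * 4) KT"
  unfolding lie_group_on_RN_def
proof (intro conjI allI impI)
  fix i :: nat
  have s: "smooth N (\<lambda>z. if j < 2 * 4 then z (k + j) else (0 :: real))" for j k N
    by (cases "j < 2 * 4") (simp_all add: smooth_coord smooth_const)
  have s': "smooth N (\<lambda>z. if j < 2 * 4 then z j else (0 :: real))" for j N
    by (cases "j < 2 * 4") (simp_all add: smooth_coord smooth_const)
  show "smooth (2 * (2 * 4)) (\<lambda>z. ((\<lambda>j. if j < 2 * 4 then z j else 0) \<otimes>\<^bsub>KT\<^esub> (\<lambda>j. if j < 2 * 4 then z (2 * 4 + j) else 0)) i)"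
    unfolding KT_simps by (rule smooth_add [OF smooth_add [OF s' s] smooth_kap [OF s' s]])
  have "smooth (2 * 4) (\<lambda>x. KT_inv x i)"
    unfolding KT_inv_def by (rule smooth_add [OF smooth_minus [OF smooth_coord] smooth_kap [OF smooth_coord smooth_coord]])
  then show "smooth (2 * 4) (\<lambda>x. (inv\<^bsub>KT\<^esub> x) i)"
    by (rule smooth_cong) (simp add: inv_KT)
qed (simp_all add: group_KT KT_simps)

text \<open>\<open>kap\<close> reads only the coordinates below 4 and writes only the coordinates 4
  to 7. Hence commutators lie in the fibre, and the fibre is central.\<close>

lemma KT_commutator:
  assumes "x \<in> RN (2 * 4)" "y \<in> RN (2 * 4)"
  shows "i < 4 \<Longrightarrow> (x \<otimes>\<^bsub>KT\<^esub> y \<otimes>\<^bsub>KT\<^esub> inv\<^bsub>KT\<^esub> x \<otimes>\<^bsub>KT\<^esub> inv\<^bsub>KT\<^esub> y) i = 0"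
    and "(\<And>i. i < 4 \<Longrightarrow> y i = 0) \<Longrightarrow> x \<otimes>\<^bsub>KT\<^esub> y \<otimes>\<^bsub>KT\<^esub> inv\<^bsub>KT\<^esub> x \<otimes>\<^bsub>KT\<^esub> inv\<^bsub>KT\<^esub> y = \<one>\<^bsub>KT\<^esub>"
proof -
  assume "i < 4"
  then show "(x \<otimes>\<^bsub>KT\<^esub> y \<otimes>\<^bsub>KT\<^esub> inv\<^bsub>KT\<^esub> x \<otimes>\<^bsub>KT\<^esub> inv\<^bsub>KT\<^esub> y) i = 0"
    unfolding inv_KT [OF assms(1)] inv_KT [OF assms(2)] KT_simps by (simp add: KT_inv_def kap_large)
next
  assume "\<And>i. i < 4 \<Longrightarrow> y i = 0"
  then have "y 0 = 0" "y 1 = 0" "y 2 = 0" "y 3 = 0" by auto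
  then show "x \<otimes>\<^bsub>KT\<^esub> y \<otimes>\<^bsub>KT\<^esub> inv\<^bsub>KT\<^esub> x \<otimes>\<^bsub>KT\<^esub> inv\<^bsub>KT\<^esub> y = \<one>\<^bsub>KT\<^esub>"
    unfolding inv_KT [OF assms(1)] inv_KT [OF assms(2)] KT_simps
    by (intro ext) (simp add: KT_inv_def kap_def)
qed

lemma nilpotent_KT: "nilpotent_group KT"
proof -
  let ?C = "\<lambda>k. {x \<otimes>\<^bsub>KT\<^esub> y \<otimes>\<^bsub>KT\<^esub> inv\<^bsub>KT\<^esub> x \<otimes>\<^bsub>KT\<^esub> inv\<^bsub>KT\<^esub> y | x y. x \<in> carrier KT \<and> y \<in> lower_central KT k}"
  interpret group KT by (rule group_KT)
  have z: "c \<in> RN (2 * 4) \<and> (\<forall>i<4. c i = 0)" if "c \<in> generate KT (?C 0)" for c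
    using that
  proof induction
    case one
    then show ?case by (simp add: KT_simps RN_iff)
  next
    case (incl h)
    then obtain x y where xy: "x \<in> carrier KT" "y \<in> carrier KT"
      "h = x \<otimes>\<^bsub>KT\<^esub> y \<otimes>\<^bsub>KT\<^esub> inv\<^bsub>KT\<^esub> x \<otimes>\<^bsub>KT\<^esub> inv\<^bsub>KT\<^esub> y" by auto
    moreover have "h \<in> carrier KT" using xy by simp
    ultimately show ?case using KT_commutator(1) [of x y] unfolding KT_simps(1) by simp
  next
    case (inv h)
    then obtain x y where xy: "x \<in> carrier KT" "y \<in> carrier KT"
      "h = x \<otimes>\<^bsub>KT\<^esub> y \<otimes>\<^bsub>KT\<^esub> inv\<^bsub>KT\<^esub> x \<otimes>\<^bsub>KT\<^esub> inv\<^bsub>KT\<^esub> y" by auto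
    moreover have h: "h \<in> carrier KT" using xy by simp
    ultimately have "\<forall>i<4. h i = 0" using KT_commutator(1) [of x y] unfolding KT_simps(1) by simp
    then show ?case using h inv_closed [OF h] unfolding KT_simps(1) by (simp add: inv_KT KT_inv_def kap_large)
  next
    case (eng h1 h2)
    then show ?case using KT_mult_RN [of h1 h2] by (simp add: KT_simps kap_large)
  qed
  have one: "h = \<one>\<^bsub>KT\<^esub>" if h: "h \<in> ?C (Suc 0)" for h
  proof -
    obtain x y where x: "x \<in> carrier KT" and "y \<in> lower_central KT (Suc 0)"
      and h_eq: "h = x \<otimes>\<^bsub>KT\<^esub> y \<otimes>\<^bsub>KT\<^esub> inv\<^bsub>KT\<^esub> x \<otimes>\<^bsub>KT\<^esub> inv\<^bsub>KT\<^esub> y"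
      using h by blast
    then have y: "y \<in> generate KT (?C 0)" by (simp only: lower_central.simps(2))
    show ?thesis unfolding h_eq using x z [OF y] by (intro KT_commutator(2)) (auto simp: KT_simps(1))
  qed
  have "c = \<one>\<^bsub>KT\<^esub>" if "c \<in> generate KT (?C (Suc 0))" for c
    using that
  proof induction
    case (incl h)
    then show ?case by (rule one)
  next
    case (inv h)
    then have "h = \<one>\<^bsub>KT\<^esub>" by (rule one)
    then show ?case by simp
  qed auto
  then have "generate KT (?C (Suc 0)) = {\<one>\<^bsub>KT\<^esub>}"
    using generate.one [of KT "?C (Suc 0)"] by blast
  then have "lower_central KT (Suc (Suc 0)) = {\<one>\<^bsub>KT\<^esub>}"
    by (simp only: lower_central.simps(2) [of KT "Suc 0"])
  then show ?thesis unfolding nilpotent_group_def by blast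
qed

lemma subgroup_KT_lattice: "subgroup KT_lattice KT"
proof -
  have k: "kap i a b \<in> \<int>" if "\<And>i. a i \<in> \<int>" "\<And>i. b i \<in> \<int>" for i and a b :: pt
    using that by (auto simp: kap_def)
  show ?thesis
  proof (rule group.subgroupI [OF group_KT])
    show "KT_lattice \<subseteq> carrier KT" by (auto simp: KT_lattice_def KT_simps)
    show "KT_lattice \<noteq> {}" by (auto simp: KT_lattice_def RN_iff intro!: exI [of _ "\<lambda>i. 0"])
    show "inv\<^bsub>KT\<^esub> a \<in> KT_lattice" if "a \<in> KT_lattice" for a
    proof -
      have a: "a \<in> RN (2 * 4)" "\<And>i. a i \<in> \<int>" using that by (auto simp: KT_lattice_def)
      have "KT_inv a i \<in> \<int>" for i
        unfolding KT_inv_def by (intro Ints_add Ints_minus a(2) k)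
      then show ?thesis using KT_inv_RN [OF a(1)] by (simp add: inv_KT [OF a(1)] KT_lattice_def)
    qed
    show "a \<otimes>\<^bsub>KT\<^esub> b \<in> KT_lattice" if "a \<in> KT_lattice" "b \<in> KT_lattice" for a b
    proof -
      have ab: "a \<in> RN (2 * 4)" "b \<in> RN (2 * 4)" "\<And>i. a i \<in> \<int>" "\<And>i. b i \<in> \<int>" using that by (auto simp: KT_lattice_def)
      have "a i + b i + kap i a b \<in> \<int>" for i by (intro Ints_add ab(3,4) k)
      then show ?thesis using KT_mult_RN [OF ab(1,2)] by (simp add: KT_lattice_def KT_simps)
    qed
  qed
qed

lemma openin_Euclidean_space_Int:
  assumes "open V"
  shows "openin (Euclidean_space N) (V \<inter> {x. \<forall>i\<ge>N. x i = 0})"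
proof -
  have "openin (powertop_real UNIV) V"
    by (simp only: euclidean_product_topology) (simp only: assms open_openin [symmetric])
  then show ?thesis unfolding Euclidean_space_def by (rule openin_subtopology_Int)
qed

lemma discrete_KT_lattice: "subtopology (Euclidean_space (2 * 4)) KT_lattice = discrete_topology KT_lattice"
proof -
  have sub: "KT_lattice \<subseteq> RN (2 * 4)" by (auto simp: KT_lattice_def)
  have "openin (subtopology (Euclidean_space (2 * 4)) KT_lattice) {x}" if x: "x \<in> KT_lattice" for x
  proof -
    let ?V = "\<Inter>i\<in>{..<2 * 4}. {y::pt. \<bar>y i - x i\<bar> < 1}"
    have "open {y::pt. \<bar>y i - x i\<bar> < 1}" for i
      by (rule open_Collect_less; intro continuous_on_rabs continuous_on_diff continuous_on_const continuous_on_product_coordinates)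
    then have "open ?V" by (intro open_INT) auto
    then have o: "openin (Euclidean_space (2 * 4)) (?V \<inter> {x. \<forall>i\<ge>2 * 4. x i = 0})"
      by (rule openin_Euclidean_space_Int)
    have eq: "{x} = (?V \<inter> {x. \<forall>i\<ge>2 * 4. x i = 0}) \<inter> KT_lattice"
    proof (rule equalityI; rule subsetI)
      fix y assume y: "y \<in> (?V \<inter> {x. \<forall>i\<ge>2 * 4. x i = 0}) \<inter> KT_lattice"
      have "y i = x i" for i
      proof (cases "i < 2 * 4")
        case True
        obtain m k where "y i = of_int m" "x i = of_int k"
        proof -
          have "y \<in> KT_lattice" using y by blast
          then have "y i \<in> \<int>" "x i \<in> \<int>" using x unfolding KT_lattice_def by blast+
          then show ?thesis using that unfolding Ints_def by blast
        qed
        moreover have "\<bar>y i - x i\<bar> < 1" using y True by simp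
        ultimately have "\<bar>m - k\<bar> < 1" by (simp flip: of_int_diff of_int_abs)
        then show ?thesis using \<open>y i = of_int m\<close> \<open>x i = of_int k\<close> by simp
      next
        case False
        then show ?thesis using x y by (auto simp: KT_lattice_def RN_iff)
      qed
      then show "y \<in> {x}" by auto
    qed (use x in \<open>auto simp: KT_lattice_def RN_iff\<close>)
    show ?thesis by (subst eq) (rule openin_subtopology_Int [OF o])
  qed
  moreover have "topspace (subtopology (Euclidean_space (2 * 4)) KT_lattice) = KT_lattice"
    by (simp only: topspace_subtopology Int_absorb1 [OF sub])
  ultimately have "discrete_topology KT_lattice = subtopology (Euclidean_space (2 * 4)) KT_lattice"
    unfolding discrete_topology_unique by blast
  then show ?thesis by (rule sym)
qed

text \<open>The quotient topology: its open sets are the subsets of the image with open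
  preimage.\<close>

lemma quotient_map_exists: "\<exists>X. quotient_map E X q"
proof -
  let ?P = "\<lambda>U. U \<subseteq> q ` topspace E \<and> openin E {x \<in> topspace E. q x \<in> U}"
  have t: "istopology ?P"
    unfolding istopology_def
  proof (intro conjI allI impI)
    fix S T assume "?P S" "?P T"
    then have "openin E ({x \<in> topspace E. q x \<in> S} \<inter> {x \<in> topspace E. q x \<in> T})" by (intro openin_Int) auto
    moreover have "{x \<in> topspace E. q x \<in> S} \<inter> {x \<in> topspace E. q x \<in> T} = {x \<in> topspace E. q x \<in> S \<inter> T}" by auto
    ultimately show "openin E {x \<in> topspace E. q x \<in> S \<inter> T}" by simp
    show "S \<inter> T \<subseteq> q ` topspace E" using \<open>?P S\<close> by auto
  next
    fix K assume K: "\<forall>S\<in>K. ?P S"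
    have "openin E (\<Union>S\<in>K. {x \<in> topspace E. q x \<in> S})" using K by (intro openin_Union) auto
    moreover have "(\<Union>S\<in>K. {x \<in> topspace E. q x \<in> S}) = {x \<in> topspace E. q x \<in> \<Union>K}" by auto
    ultimately show "openin E {x \<in> topspace E. q x \<in> \<Union>K}" by simp
    show "\<Union>K \<subseteq> q ` topspace E" using K by auto
  qed
  then have o: "openin (topology ?P) U \<longleftrightarrow> ?P U" for U by (simp add: topology_inverse')
  have "{x \<in> topspace E. q x \<in> q ` topspace E} = topspace E" by auto
  then have "openin (topology ?P) (q ` topspace E)" unfolding o by simp
  then have "q ` topspace E \<subseteq> topspace (topology ?P)" by (rule openin_subset)
  moreover have "topspace (topology ?P) \<subseteq> q ` topspace E"
    using o [of "topspace (topology ?P)"] openin_topspace by blast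
  ultimately have top: "topspace (topology ?P) = q ` topspace E" by blast
  have "quotient_map E (topology ?P) q"
    unfolding quotient_map_def top o by auto
  then show ?thesis by blast
qed

lemma lattice_KT: "lattice_in (2 * 4) KT KT_lattice"
proof -
  interpret group KT by (rule group_KT)
  let ?E = "Euclidean_space (2 * 4)" and ?q = "\<lambda>x. KT_lattice #>\<^bsub>KT\<^esub> x"
  obtain X where X: "quotient_map ?E X ?q" using quotient_map_exists by blast
  let ?K = "PiE UNIV (\<lambda>i::nat. if i < 2 * 4 then {0..1} else {0::real})"
  have KRN: "?K \<subseteq> RN (2 * 4)"
  proof
    fix x assume x: "x \<in> ?K"
    have "x i = 0" if "i \<ge> 2 * 4" for i using PiE_mem [OF x, of i] that by simp
    then show "x \<in> RN (2 * 4)" by (simp add: RN_iff)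
  qed
  have "compactin (powertop_real UNIV) ?K" unfolding compactin_PiE by auto
  then have "compactin ?E ?K"
    using KRN unfolding Euclidean_space_def compactin_subtopology by (simp only: topspace_subtopology) simp
  then have "compactin X (?q ` ?K)"
    using image_compactin quotient_imp_continuous_map [OF X] by blast
  moreover have "topspace X = ?q ` ?K"
  proof -
    have "?q x \<in> ?q ` ?K" if x: "x \<in> RN (2 * 4)" for x
    proof -
      \<comment> \<open>\<open>c\<close> brings the base coordinates into the unit interval. This
        already shifts the fibre by \<open>kap i c x\<close>, so the integer parts for the fibre
        coordinates of \<open>b\<close> are taken after that shift; \<open>b\<close> and
        \<open>c\<close> agree on the base, hence have the same \<open>kap\<close>.\<close>
      define c :: pt where "c i = (if i < 4 then - of_int \<lfloor>x i\<rfloor> else 0)" for i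
      define b :: pt where "b i = (if i < 4 then c i else if i < 2 * 4 then - of_int \<lfloor>x i + kap i c x\<rfloor> else 0)" for i
      have kb: "kap i b x = kap i c x" for i by (simp add: kap_def b_def)
      have b: "b \<in> KT_lattice"
        by (auto simp: KT_lattice_def RN_iff b_def c_def)
      have "(b \<otimes>\<^bsub>KT\<^esub> x) i \<in> (if i < 2 * 4 then {0..1} else {0})" for i
      proof -
        consider "i < 4" | "4 \<le> i" "i < 2 * 4" | "2 * 4 \<le> i" by linarith
        then show ?thesis
        proof cases
          case 1
          then show ?thesis by (simp add: KT_simps b_def c_def kap_large) linarith
        next
          case 2
          then show ?thesis by (simp add: KT_simps kb) (simp add: b_def, linarith)
        next
          case 3
          then show ?thesis using x by (simp add: KT_simps RN_iff b_def kap_large)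
        qed
      qed
      then have K: "b \<otimes>\<^bsub>KT\<^esub> x \<in> ?K" by auto
      have "b \<otimes>\<^bsub>KT\<^esub> x \<in> ?q x" using b by (auto simp: r_coset_def)
      then have "?q x = ?q (b \<otimes>\<^bsub>KT\<^esub> x)"
        using repr_independence [OF _ _ subgroup_KT_lattice] x by (simp add: KT_simps(1))
      then show ?thesis using K by blast
    qed
    then have "?q ` RN (2 * 4) = ?q ` ?K" using image_mono [OF KRN, of ?q] by (intro equalityI image_subsetI) auto
    moreover have "?q ` RN (2 * 4) = topspace X" using X unfolding quotient_map_def by (rule conjunct1)
    ultimately show ?thesis by simp
  qed
  ultimately have "compact_space X" by (simp add: compact_space_def)
  then show ?thesis
    unfolding lattice_in_def using X subgroup_KT_lattice discrete_KT_lattice by blast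
qed

lemma nilmanifold_KT: "nilmanifold (2 * 4) KT KT_lattice"
  unfolding nilmanifold_def using lie_group_KT nilpotent_KT lattice_KT by blast

section \<open>Differentials of left translations and the invariant complex structure\<close>

definition pl :: "pt \<Rightarrow> cvec \<Rightarrow> cvec" where
  "pl a v = (\<lambda>i. v i + kap i (complexify a) v)"

lemma lessThan_8: "{..<2 * 4} = {0, 1, 2, 3, 4, 5, 6, 7::nat}"
  by auto

lemma kap_lin: "kap i a (\<lambda>k. c * u k + d * w k) = c * kap i a u + d * kap i a w"
  by (simp add: kap_def algebra_simps)

text \<open>Left multiplication by \<open>a\<close> is affine in the other factor, so its
  differential is the same linear map at every point.\<close>

lemma push_left_KT:
  assumes "v \<in> CN (2 * 4)"
  shows "push_left (2 * 4) KT a x v = pl a v"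
proof
  fix i
  have pd: "partial_deriv j (\<lambda>y. (a \<otimes>\<^bsub>KT\<^esub> y) i) x = runit j i + kap i a (runit j)" for j
  proof (rule partial_deriv_eqI)
    have "(a \<otimes>\<^bsub>KT\<^esub> x(j := t)) i = (a \<otimes>\<^bsub>KT\<^esub> x) i + (t - x j) * (runit j i + kap i a (runit j))" for t
    proof -
      have upd: "x(j := t) = (\<lambda>k. 1 * x k + (t - x j) * runit j k)" by (auto simp: runit_def)
      show ?thesis unfolding upd KT_simps kap_lin by (simp add: algebra_simps)
    qed
    moreover have "((\<lambda>t. (a \<otimes>\<^bsub>KT\<^esub> x) i + (t - x j) * (runit j i + kap i a (runit j))) has_vector_derivative
        (runit j i + kap i a (runit j))) (at (x j))"
      unfolding has_real_derivative_iff_has_vector_derivative [symmetric]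
      by (auto intro!: derivative_eq_intros)
    ultimately show "((\<lambda>t. (a \<otimes>\<^bsub>KT\<^esub> x(j := t)) i) has_vector_derivative (runit j i + kap i a (runit j))) (at (x j))"
      by simp
  qed
  have "(\<Sum>j<2 * 4. complex_of_real (runit j i) * v j) = v i"
    using assms by (auto simp: runit_def CN_def if_distrib [of "\<lambda>x. x * _"] if_distrib [of complex_of_real] cong: if_cong)
  moreover have "(\<Sum>j<2 * 4. complex_of_real (kap i a (runit j)) * v j) = kap i (complexify a) v"
    unfolding lessThan_8 by (simp add: kap_def runit_def complexify_def)
  ultimately show "push_left (2 * 4) KT a x v i = pl a v i"
    unfolding push_left_def pd pl_def by (simp add: distrib_right sum.distrib)
qed

lemma pl_CN: "v \<in> CN (2 * 4) \<Longrightarrow> pl a v \<in> CN (2 * 4)"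
  by (simp add: CN_def pl_def kap_large)

lemma map_push_left_KT: "vs \<in> lists (CN (2 * 4)) \<Longrightarrow> map (push_left (2 * 4) KT a x) vs = map (pl a) vs"
  by (rule map_cong [OF refl], rule push_left_KT) (simp add: in_lists_conv_set)

text \<open>In complex coordinates \<open>pl a\<close> adds conj(z_k(a)) times the z_k-component of
  \<open>v\<close> to its w_k-component, which is complex linear in \<open>v\<close>. For this the
  conjugate in the group law must fall on the left factor.\<close>

lemma Jv_pl: "Jv (pl a v) = pl a (Jv v)"
proof
  fix i :: nat
  have eight: "i = 0 \<or> i = 1 \<or> i = 2 \<or> i = 3 \<or> i = 4 \<or> i = 5 \<or> i = 6 \<or> i = 7 \<or> 8 \<le> i" by arith
  then consider "i < 8" | "8 \<le> i" by linarith
  then show "Jv (pl a v) i = pl a (Jv v) i"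
  proof cases
    case 1
    with eight show ?thesis by (elim disjE) (simp_all add: Jv_def pl_def kap_def)
  next
    case 2
    then have "even i \<or> 8 \<le> i - 1" by presburger
    then show ?thesis using 2 by (auto simp: Jv_def pl_def kap_large)
  qed
qed

lemma complex_structure_stdJ: "complex_structure n stdJ"
  unfolding complex_structure_def
proof (intro conjI ballI)
  show "almost_complex (2 * n) stdJ"
    unfolding almost_complex_def
  proof (intro conjI allI impI ballI)
    show "smooth (2 * n) (\<lambda>x. stdJ x i j)" for i j
      unfolding stdJ_def by (rule smooth_const)
  qed (simp only: apply_stdJ Jv_CN Jv_Jv)
  let ?z = "\<lambda>k x. complex_of_real (x (2 * k)) + \<i> * complex_of_real (x (2 * k + 1))"
  have sc: "smooth (2 * n) (\<lambda>x. complex_of_real (x j))" for j by (intro smooth_of_real smooth_coord)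
  have dc: "differential (2 * n) (\<lambda>x. complex_of_real (x j)) y v = v j" if "j < 2 * n" for j y v
  proof -
    have "partial_deriv i (\<lambda>x. complex_of_real (x j)) y = (if j = i then 1 else 0)" for i
      by (rule partial_deriv_eqI) (cases "j = i", auto intro!: derivative_eq_intros)
    then show ?thesis using that by (simp add: differential_def if_distrib [of "\<lambda>x. _ * x"] cong: if_cong)
  qed
  have dz: "differential (2 * n) (?z k) y v = v (2 * k) + \<i> * v (2 * k + 1)" if "k < n" "y \<in> RN (2 * n)" for k y v
    using differential_lin [OF sc sc that(2), of 1 "2 * k" \<i> "2 * k + 1" v] that by (simp add: dc)
  fix x assume x: "x \<in> RN (2 * n)"
  show "\<exists>U (z :: nat \<Rightarrow> pt \<Rightarrow> complex).
        openin (Euclidean_space (2 * n)) U \<and> x \<in> U \<and>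
        (\<forall>k<n. smooth_on (2 * n) U (z k)) \<and>
        (\<forall>y\<in>U. \<forall>k<n. \<forall>v\<in>CN (2 * n).
           differential (2 * n) (z k) y (apply_J (2 * n) stdJ y v) = \<i> * differential (2 * n) (z k) y v) \<and>
        (\<forall>y\<in>U. \<forall>c. (\<forall>v\<in>CN (2 * n). (\<Sum>k<n. c k * differential (2 * n) (z k) y v) = 0)
           \<longrightarrow> (\<forall>k<n. c k = 0))"
  proof (intro exI [of _ "RN (2 * n)"] exI [of _ ?z] conjI ballI allI impI)
    show "smooth (2 * n) (?z k)" for k by (intro smooth_intros)
    show "differential (2 * n) (?z k) y (apply_J (2 * n) stdJ y v) = \<i> * differential (2 * n) (?z k) y v"
      if "k < n" "y \<in> RN (2 * n)" "v \<in> CN (2 * n)" for k y v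
      using that by (simp only: dz apply_stdJ) (simp add: Jv_def algebra_simps)
    fix y c k
    assume y: "y \<in> RN (2 * n)" and k: "k < n"
      and c: "\<forall>v\<in>CN (2 * n). (\<Sum>k<n. c k * differential (2 * n) (?z k) y v) = 0"
    have "basis_vec (2 * k) \<in> CN (2 * n)" using k by (intro basis_vec_CN) simp
    then have "0 = (\<Sum>l<n. c l * differential (2 * n) (?z l) y (basis_vec (2 * k)))" using c by simp
    also have "\<dots> = (\<Sum>l<n. if l = k then c k else 0)"
    proof (rule sum.cong [OF refl])
      fix l assume "l \<in> {..<n}"
      moreover have "2 * l + 1 \<noteq> 2 * k" by presburger
      ultimately show "c l * differential (2 * n) (?z l) y (basis_vec (2 * k)) = (if l = k then c k else 0)"
        using dz [of l y "basis_vec (2 * k)"] y by (simp add: basis_vec_def)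
    qed
    also have "\<dots> = c k" using k by simp
    finally show "c k = 0" by simp
  qed (use x in auto)
qed

lemma invariant_complex_structure_KT: "invariant_complex_structure 4 KT stdJ"
  unfolding invariant_complex_structure_def left_invariant_J_def
  using complex_structure_stdJ by (auto simp only: KT_simps apply_stdJ push_left_KT pl_CN Jv_CN Jv_pl)

section \<open>The invariant coframe and the nilpotency condition\<close>

definition zeta :: "nat \<Rightarrow> cvec \<Rightarrow> complex" where
  "zeta k v = v (2 * k) + \<i> * v (2 * k + 1)"

text \<open>The conjugate covector, still complex linear in \<open>v\<close>, so conjugation passes
  through \<open>conj_vec\<close>. On \<open>complexify x\<close>, \<open>zeta\<close> and
  \<open>zbar\<close> give the coordinate functions z_k and conj(z_k).\<close>

definition zbar :: "nat \<Rightarrow> cvec \<Rightarrow> complex" where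
  "zbar k v = v (2 * k) - \<i> * v (2 * k + 1)"

lemma cnj_zeta: "cnj (zeta k v) = zbar k (conj_vec v)" "cnj (zbar k v) = zeta k (conj_vec v)"
  by (simp_all add: zeta_def zbar_def conj_vec_def)

lemma conj_complexify [simp]: "conj_vec (complexify x) = complexify x"
  by (simp add: conj_vec_def complexify_def)

lemma zeta_lin: "zeta k (\<lambda>i. a * v i + b * w i) = a * zeta k v + b * zeta k w"
  "zbar k (\<lambda>i. a * v i + b * w i) = a * zbar k v + b * zbar k w"
  by (simp_all add: zeta_def zbar_def algebra_simps)

lemma zeta_Jv: "zeta k (Jv v) = \<i> * zeta k v" "zbar k (Jv v) = - \<i> * zbar k v"
  by (simp_all add: zeta_def zbar_def Jv_def algebra_simps)

lemma zeta_t01: "w \<in> t01 N \<Longrightarrow> zeta k w = 0" and zbar_t10: "u \<in> t10 N \<Longrightarrow> zbar k u = 0"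
proof -
  assume "w \<in> t01 N"
  then have "\<i> * zeta k w = zeta k (\<lambda>i. (- \<i>) * w i + 0 * w i)"
    using zeta_Jv(1) [of k w] by (simp add: t01_def)
  then show "zeta k w = 0" by (simp only: zeta_lin) simp
next
  assume "u \<in> t10 N"
  then have "- \<i> * zbar k u = zbar k (\<lambda>i. \<i> * u i + 0 * u i)"
    using zeta_Jv(2) [of k u] by (simp add: t10_def)
  then show "zbar k u = 0" by (simp only: zeta_lin) simp
qed

lemma zeta_cpl: "zeta j (cpl k) = (if j = k then 2 else 0)"
proof -
  have "2 * j + 1 \<noteq> 2 * k" "2 * j \<noteq> 2 * k + 1" by presburger+
  then show ?thesis by (simp add: zeta_def cpl_def basis_vec_def)
qed

text \<open>The factor 1/2 compensates the normalisation of \<open>cpl\<close> as twice the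
  coordinate field, recorded in \<open>zeta_cpl\<close>.\<close>

lemma p10_expand:
  assumes "u \<in> CN (2 * n)"
  shows "p10 u = (\<lambda>i. \<Sum>j<n. (zeta j u / 2) * cpl j i)"
proof
  fix i
  show "p10 u i = (\<Sum>j<n. (zeta j u / 2) * cpl j i)"
  proof (cases "i < 2 * n")
    case True
    have "(\<Sum>j<n. (zeta j u / 2) * cpl j i) = (\<Sum>j<n. if j = i div 2 then zeta j u / 2 * cpl j i else 0)"
      by (intro sum.cong refl) (auto simp: cpl_def basis_vec_def)
    also have "\<dots> = zeta (i div 2) u / 2 * cpl (i div 2) i" using True by simp
    also have "\<dots> = p10 u i"
    proof (cases "even i")
      case True
      then obtain k where "i = 2 * k" by blast
      then show ?thesis by (simp add: p10_def Jv_def zeta_def cpl_def basis_vec_def)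
    next
      case False
      then obtain k where "i = 2 * k + 1" by (elim oddE)
      then show ?thesis by (simp add: p10_def Jv_def zeta_def cpl_def basis_vec_def algebra_simps)
    qed
    finally show ?thesis by simp
  next
    case False
    have "cpl j i = 0" if "j < n" for j using cpl_CN [OF that] False by (simp add: CN_def)
    then show ?thesis using p10_CN [OF assms] False by (simp add: CN_def)
  qed
qed

lemma differential_coord:
  assumes "j < N" shows "differential N (\<lambda>x. complex_of_real (x j)) y v = v j"
proof -
  have "partial_deriv i (\<lambda>x. complex_of_real (x j)) y = (if j = i then 1 else 0)" for i
    by (rule partial_deriv_eqI) (cases "j = i", auto intro!: derivative_eq_intros)
  then show ?thesis using assms by (simp add: differential_def if_distrib [of "\<lambda>x. _ * x"] cong: if_cong)
qed

lemma smooth_zeta: "smooth N (\<lambda>x. zeta k (complexify x))" "smooth N (\<lambda>x. zbar k (complexify x))"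
  unfolding zeta_def zbar_def complexify_def by (intro smooth_intros)+

lemma differential_zeta:
  assumes "2 * k + 1 < N" "y \<in> RN N"
  shows "differential N (\<lambda>x. zeta k (complexify x)) y v = zeta k v"
    "differential N (\<lambda>x. zbar k (complexify x)) y v = zbar k v"
proof -
  have s: "smooth N (\<lambda>x. complex_of_real (x j))" for j by (intro smooth_intros)
  show "differential N (\<lambda>x. zeta k (complexify x)) y v = zeta k v"
    "differential N (\<lambda>x. zbar k (complexify x)) y v = zbar k v"
    using differential_lin [OF s s assms(2), of 1 "2 * k" \<i> "2 * k + 1" v]
      differential_lin [OF s s assms(2), of 1 "2 * k" "- \<i>" "2 * k + 1" v] assms(1)
    by (simp_all add: zeta_def zbar_def complexify_def differential_coord)
qed

text \<open>The left-invariant $(1,0)$-coframe $dz_1, dz_2, dw_1 - \bar z_1 dz_1, dw_2 - \bar z_2 dz_2$ and its conjugate.\<close>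

definition cf :: "nat \<Rightarrow> pt \<Rightarrow> cvec \<Rightarrow> complex" where
  "cf j x v = zeta j v - (if 2 \<le> j then zbar (j - 2) (complexify x) * zeta (j - 2) v else 0)"

definition cfb :: "nat \<Rightarrow> pt \<Rightarrow> cvec \<Rightarrow> complex" where
  "cfb j x v = zbar j v - (if 2 \<le> j then zeta (j - 2) (complexify x) * zbar (j - 2) v else 0)"

lemma cnj_cf: "cnj (cf j x v) = cfb j x (conj_vec v)" "cnj (cfb j x v) = cf j x (conj_vec v)"
  by (simp_all add: cf_def cfb_def cnj_zeta)

lemma cf_lin: "cf j x (\<lambda>i. a * v i + b * w i) = a * cf j x v + b * cf j x w"
  "cfb j x (\<lambda>i. a * v i + b * w i) = a * cfb j x v + b * cfb j x w"
  by (simp_all add: cf_def cfb_def zeta_lin algebra_simps)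

lemma cf_Jv: "cf j x (Jv v) = \<i> * cf j x v" "cfb j x (Jv v) = - \<i> * cfb j x v"
  by (simp_all add: cf_def cfb_def zeta_Jv algebra_simps)

lemma cf_t01: "w \<in> t01 N \<Longrightarrow> cf j x w = 0" and cfb_t10: "u \<in> t10 N \<Longrightarrow> cfb j x u = 0"
  by (simp_all add: cf_def cfb_def zeta_t01 zbar_t10)

lemma smooth_cf: "smooth N (\<lambda>x. cf j x v)" "smooth N (\<lambda>x. cfb j x v)"
proof -
  have "smooth N (\<lambda>x. zeta j v - (if 2 \<le> j then zbar (j - 2) (complexify x) * zeta (j - 2) v else 0))"
    "smooth N (\<lambda>x. zbar j v - (if 2 \<le> j then zeta (j - 2) (complexify x) * zbar (j - 2) v else 0))"
    by (cases "2 \<le> j"; simp; intro smooth_diff smooth_mult smooth_const smooth_zeta)+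
  then show "smooth N (\<lambda>x. cf j x v)" "smooth N (\<lambda>x. cfb j x v)" by (simp_all add: cf_def cfb_def)
qed

lemma differential_cf:
  assumes "j < 4" "y \<in> RN (2 * 4)"
  shows "differential (2 * 4) (\<lambda>x. cf j x v) y u = - (if 2 \<le> j then zbar (j - 2) u * zeta (j - 2) v else 0)"
    "differential (2 * 4) (\<lambda>x. cfb j x v) y u = - (if 2 \<le> j then zeta (j - 2) u * zbar (j - 2) v else 0)"
proof -
  have l: "2 * (j - 2) + 1 < 2 * 4" using assms(1) by simp
  have "differential (2 * 4) (\<lambda>x. zeta j v * 1 + (- zeta (j - 2) v) * zbar (j - 2) (complexify x)) y u =
      - (zbar (j - 2) u * zeta (j - 2) v)"
    using differential_lin [OF smooth_const smooth_zeta(2) assms(2), of "zeta j v" 1 "- zeta (j - 2) v" "j - 2" u]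
      differential_zeta(2) [OF l assms(2)]
    by (simp add: differential_const)
  then show "differential (2 * 4) (\<lambda>x. cf j x v) y u = - (if 2 \<le> j then zbar (j - 2) u * zeta (j - 2) v else 0)"
    by (cases "2 \<le> j") (simp_all add: cf_def differential_const mult.commute)
  have "differential (2 * 4) (\<lambda>x. zbar j v * 1 + (- zbar (j - 2) v) * zeta (j - 2) (complexify x)) y u =
      - (zeta (j - 2) u * zbar (j - 2) v)"
    using differential_lin [OF smooth_const smooth_zeta(1) assms(2), of "zbar j v" 1 "- zbar (j - 2) v" "j - 2" u]
      differential_zeta(1) [OF l assms(2)]
    by (simp add: differential_const)
  then show "differential (2 * 4) (\<lambda>x. cfb j x v) y u = - (if 2 \<le> j then zeta (j - 2) u * zbar (j - 2) v else 0)"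
    by (cases "2 \<le> j") (simp_all add: cfb_def differential_const mult.commute)
qed

lemma less_4: "j < 4 \<longleftrightarrow> j = 0 \<or> j = 1 \<or> j = 2 \<or> j = (3::nat)"
  by auto

lemma zeta_num:
  "zeta 0 v = v 0 + \<i> * v 1" "zeta 1 v = v 2 + \<i> * v 3"
  "zeta 2 v = v 4 + \<i> * v 5" "zeta 3 v = v 6 + \<i> * v 7"
  "zbar 0 v = v 0 - \<i> * v 1" "zbar 1 v = v 2 - \<i> * v 3"
  "zbar 2 v = v 4 - \<i> * v 5" "zbar 3 v = v 6 - \<i> * v 7"
  by (simp_all add: zeta_def zbar_def)

lemma zeta_pl:
  "zeta 0 (pl a v) = zeta 0 v" "zeta 1 (pl a v) = zeta 1 v"
  "zeta 2 (pl a v) = zeta 2 v + zbar 0 (complexify a) * zeta 0 v"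
  "zeta 3 (pl a v) = zeta 3 v + zbar 1 (complexify a) * zeta 1 v"
  unfolding zeta_num pl_def kap_def by (simp_all add: algebra_simps)

lemma zeta_KT_mult:
  "k < 2 \<Longrightarrow> zbar k (complexify (a \<otimes>\<^bsub>KT\<^esub> x)) = zbar k (complexify a) + zbar k (complexify x)"
  by (cases "k = 0"; cases "k = 1"; simp add: zbar_def complexify_def KT_simps kap_def algebra_simps)

text \<open>A left translation adds conj(z(a)) dz to dw and conj(z(a)) to the coefficient conj(z) of
  dz; the two changes cancel.\<close>

lemma cf_pl: "j < 4 \<Longrightarrow> cf j (a \<otimes>\<^bsub>KT\<^esub> x) (pl a v) = cf j x v"
  unfolding less_4 by (elim disjE) (simp_all add: cf_def zeta_pl [simplified] zeta_KT_mult [simplified] algebra_simps)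

lemma pl_conj: "conj_vec (pl a v) = pl a (conj_vec v)"
  by (rule ext) (simp add: conj_vec_def pl_def kap_def complexify_def)

lemma cfb_pl: "j < 4 \<Longrightarrow> cfb j (a \<otimes>\<^bsub>KT\<^esub> x) (pl a v) = cfb j x v"
  using arg_cong [OF cf_pl [of j a x "conj_vec v"], of cnj] by (simp add: cnj_cf pl_conj)

lemma is_form_1I:
  assumes "\<And>x v w a b. x \<in> RN N \<Longrightarrow> v \<in> CN N \<Longrightarrow> w \<in> CN N \<Longrightarrow> L x (\<lambda>i. a * v i + b * w i) = a * L x v + b * L x w"
    and "\<And>v. v \<in> CN N \<Longrightarrow> smooth N (\<lambda>x. L x v)"
  shows "is_form N 1 (\<lambda>x vs. if length vs = 1 then L x (hd vs) else 0)"
  unfolding is_form_iff sform_def has_degree_def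
proof (intro conjI ballI impI altI)
  fix x us ws v w a b
  assume "x \<in> RN N" "us \<in> lists (CN N)" "ws \<in> lists (CN N)" "v \<in> CN N" "w \<in> CN N"
  then show "(if length (us @ (\<lambda>i. a * v i + b * w i) # ws) = 1 then L x (hd (us @ (\<lambda>i. a * v i + b * w i) # ws)) else 0) =
      a * (if length (us @ v # ws) = 1 then L x (hd (us @ v # ws)) else 0) +
      b * (if length (us @ w # ws) = 1 then L x (hd (us @ w # ws)) else 0)"
    using assms(1) by simp
next
  fix vs assume vs: "vs \<in> lists (CN N)"
  show "smooth N (\<lambda>x. if length vs = 1 then L x (hd vs) else 0)"
  proof (cases "length vs = 1")
    case True
    then have "hd vs \<in> CN N" using vs by (cases vs) auto
    then show ?thesis using True assms(2) by simp
  qed (simp add: smooth_const)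
qed auto

definition eta :: "nat \<Rightarrow> form" where
  "eta j = (\<lambda>x vs. if length vs = 1 then cf j x (hd vs) else 0)"

lemma is_form_eta: "is_form N 1 (eta j)"
  unfolding eta_def by (rule is_form_1I) (simp_all add: cf_lin smooth_cf)

lemma conj_eta: "conj_form (eta j) = (\<lambda>x vs. if length vs = 1 then cfb j x (hd vs) else 0)"
proof (intro ext)
  fix x vs
  show "conj_form (eta j) x vs = (if length vs = 1 then cfb j x (hd vs) else 0)"
    by (cases vs) (simp_all add: conj_form_def eta_def cnj_cf)
qed

lemma is_form_conj_eta: "is_form N 1 (conj_form (eta j))"
  unfolding conj_eta by (rule is_form_1I) (simp_all add: cf_lin smooth_cf)

lemma is_pq_eta: "is_pq_form (2 * n) stdJ 1 0 (eta j)"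
  unfolding is_pq_form_def T10_stdJ T01_stdJ
proof (intro conjI ballI impI)
  show "is_form (2 * n) (1 + 0) (eta j)" using is_form_eta by simp
  fix x us ws assume "us \<in> lists (t10 (2 * n))" "ws \<in> lists (t01 (2 * n))" "length us \<noteq> 1"
  then show "eta j x (us @ ws) = 0"
    by (cases us; cases ws) (auto simp: eta_def cf_t01)
qed

lemma is_pq_conj_eta: "is_pq_form (2 * n) stdJ 0 1 (conj_form (eta j))"
  unfolding is_pq_form_def T10_stdJ T01_stdJ
proof (intro conjI ballI impI)
  show "is_form (2 * n) (0 + 1) (conj_form (eta j))" using is_form_conj_eta by simp
  fix x us ws assume "us \<in> lists (t10 (2 * n))" "ws \<in> lists (t01 (2 * n))" "length us \<noteq> 0"
  then show "conj_form (eta j) x (us @ ws) = 0"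
    by (cases us; cases ws) (auto simp: conj_eta cfb_t10)
qed

lemma invariant_eta: "j < 4 \<Longrightarrow> invariant_form (2 * 4) KT H (eta j)"
  unfolding invariant_form_def
proof (intro ballI)
  fix a x vs assume j: "j < 4" and "x \<in> RN (2 * 4)" and vs: "vs \<in> lists (CN (2 * 4))"
  show "eta j (a \<otimes>\<^bsub>KT\<^esub> x) (map (push_left (2 * 4) KT a x) vs) = eta j x vs"
    unfolding map_push_left_KT [OF vs] by (cases vs) (auto simp: eta_def cf_pl [OF j])
qed

lemma invariant_conj_eta: "j < 4 \<Longrightarrow> invariant_form (2 * 4) KT H (conj_form (eta j))"
  unfolding invariant_form_def
proof (intro ballI)
  fix a x vs assume j: "j < 4" and "x \<in> RN (2 * 4)" and vs: "vs \<in> lists (CN (2 * 4))"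
  show "conj_form (eta j) (a \<otimes>\<^bsub>KT\<^esub> x) (map (push_left (2 * 4) KT a x) vs) = conj_form (eta j) x vs"
    unfolding map_push_left_KT [OF vs] conj_eta by (cases vs) (auto simp: cfb_pl [OF j])
qed

lemma ext_deriv_pair:
  "ext_deriv N \<alpha> x [u, v] = differential N (\<lambda>y. \<alpha> y [v]) x u - differential N (\<lambda>y. \<alpha> y [u]) x v"
  by (simp add: ext_deriv_Cons ext_deriv_Nil)

lemma wedge_eta_pair:
  "wedge (eta k) (conj_form (eta l)) x [u, v] = cf k x u * cfb l x v - cf k x v * cfb l x u"
  by (simp add: wedge_wdg conj_eta) (simp add: eta_def)

text \<open>The structure equations: d(dw_k - conj(z_k) dz_k) = dz_k wedge conj(dz_k), while dz_1
  and dz_2 are closed.\<close>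

lemma ext_deriv_eta:
  assumes "j < 4"
  shows "form_eq (2 * 4) (ext_deriv (2 * 4) (eta j))
    (\<lambda>x vs. if 2 \<le> j then wedge (eta (j - 2)) (conj_form (eta (j - 2))) x vs else 0)"
  unfolding form_eq_def
proof (intro ballI)
  fix x vs assume x: "x \<in> RN (2 * 4)" and vs: "vs \<in> lists (CN (2 * 4))"
  show "ext_deriv (2 * 4) (eta j) x vs = (if 2 \<le> j then wedge (eta (j - 2)) (conj_form (eta (j - 2))) x vs else 0)"
  proof (cases "length vs = 2")
    case True
    then obtain u v where vs_eq: "vs = [u, v]" by (auto simp: numeral_2_eq_2 length_Suc_conv)
    have "j - 2 < 2" using assms by simp
    then have "cf (j - 2) x w = zeta (j - 2) w" "cfb (j - 2) x w = zbar (j - 2) w" for w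
      by (simp_all add: cf_def cfb_def)
    then show ?thesis
      unfolding vs_eq ext_deriv_pair wedge_eta_pair
      using differential_cf(1) [OF assms x] by (simp add: eta_def algebra_simps)
  next
    case False
    have "ext_deriv (2 * 4) (eta j) x vs = 0"
      using is_form_ext_deriv [OF is_form_eta] x vs False unfolding is_form_iff has_degree_def by (simp add: numeral_2_eq_2)
    moreover have "wedge (eta (j - 2)) (conj_form (eta (j - 2))) x vs = 0"
      using is_form_wedge [OF is_form_eta is_form_conj_eta] x vs False unfolding is_form_iff has_degree_def
      by (simp add: numeral_2_eq_2)
    ultimately show ?thesis by simp
  qed
qed

text \<open>\<open>pl a\<close> is unipotent: \<open>kap\<close> reads only base components, which
  \<open>pl a\<close> does not change, so the inverse subtracts the same term.\<close>

lemma pl_surj: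
  assumes "v \<in> CN (2 * 4)"
  obtains u where "u \<in> CN (2 * 4)" "pl a u = v"
proof
  let ?u = "\<lambda>i. v i - kap i (complexify a) v"
  show "?u \<in> CN (2 * 4)" using assms by (simp add: CN_def kap_large)
  have "kap i (complexify a) ?u = kap i (complexify a) v" for i by (simp add: kap_def)
  then show "pl a ?u = v" by (simp add: pl_def)
qed

lemma KT_mult_zero: "a \<otimes>\<^bsub>KT\<^esub> (\<lambda>i. 0) = a"
  by (rule ext) (simp add: KT_simps kap_def)

lemma zero_RN: "(\<lambda>i. 0) \<in> RN N"
  by (simp add: RN_iff)

text \<open>An invariant form is determined by its value at the identity, where the invariant
  coframe reduces to dz_k, dw_k. The coefficients are read there on \<open>cpl j\<close>, with the
  factor 1/2 of \<open>p10_expand\<close>.\<close>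

lemma invariant_10_form_expand:
  assumes "is_pq_form (2 * 4) stdJ 1 0 \<alpha>" "invariant_form (2 * 4) KT (carrier KT) \<alpha>"
  shows "form_eq (2 * 4) \<alpha> (\<lambda>x vs. \<Sum>j<4. (\<alpha> (\<lambda>i. 0) [cpl j] / 2) * eta j x vs)"
  unfolding form_eq_def
proof (intro ballI)
  fix x vs assume x: "x \<in> RN (2 * 4)" and vs: "vs \<in> lists (CN (2 * 4))"
  let ?o = "\<lambda>i::nat. 0::real"
  have f: "is_form (2 * 4) 1 \<alpha>" using assms(1) unfolding is_pq_form_def by simp
  show "\<alpha> x vs = (\<Sum>j<4. (\<alpha> ?o [cpl j] / 2) * eta j x vs)"
  proof (cases "length vs = 1")
    case True
    then obtain v where vs_eq: "vs = [v]" by (auto simp: length_Suc_conv)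
    then have v: "v \<in> CN (2 * 4)" using vs by simp
    obtain u where u: "u \<in> CN (2 * 4)" "pl x u = v" using pl_surj [OF v] by blast
    have "\<alpha> (x \<otimes>\<^bsub>KT\<^esub> ?o) (map (push_left (2 * 4) KT x ?o) [u]) = \<alpha> ?o [u]"
      by (rule bspec [OF bspec [OF bspec [OF assms(2) [unfolded invariant_form_def KT_simps(1)] x] zero_RN]])
         (use u(1) in simp)
    then have 1: "\<alpha> x [v] = \<alpha> ?o [u]"
      using u by (simp only: KT_mult_zero list.map push_left_KT)
    have alt: "alt (2 * 4) (\<alpha> ?o)" using f zero_RN by (simp only: is_form_iff sform_def)
    have "\<alpha> ?o [p01 u] = 0"
      using assms(1) zero_RN p01_t01 [OF u(1)] unfolding is_pq_form_def T10_stdJ T01_stdJ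
      by (metis append_Nil lists.Cons lists.Nil list.size(3) zero_neq_one)
    moreover have "\<alpha> ?o [p10 u] = (\<Sum>j<4. (zeta j u / 2) * \<alpha> ?o [cpl j])"
      using alt_sum [OF alt, of "[]" "[]" "{..<4}" cpl "\<lambda>j. zeta j u / 2"] cpl_CN [of _ 4] p10_expand [OF u(1)] by simp
    moreover have "\<alpha> ?o [u] = \<alpha> ?o [p10 u] + \<alpha> ?o [p01 u]"
      using alt_lin [OF alt, of "[]" "[]" "p10 u" "p01 u" 1 1] p10_CN [OF u(1)] p01_CN [OF u(1)] p10_p01 [of u] by simp
    moreover have "cf j x v = zeta j u" if "j < 4" for j
      using cf_pl [OF that, of x ?o u] u(2) KT_mult_zero [of x]
      by (simp add: cf_def [of j ?o] complexify_def zbar_def)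
    ultimately show ?thesis
      using 1 unfolding vs_eq by (simp add: eta_def mult_ac)
  next
    case False
    then show ?thesis using f x vs unfolding is_form_iff has_degree_def by (simp add: eta_def)
  qed
qed

lemma nilpotent_complex_structure_KT: "nilpotent_complex_structure 4 KT stdJ"
  unfolding nilpotent_complex_structure_def Let_def
proof (intro exI [of _ eta] conjI allI impI)
  fix \<alpha> assume \<alpha>: "is_pq_form (2 * 4) stdJ 1 0 \<alpha> \<and> invariant_form (2 * 4) KT (carrier KT) \<alpha>"
  let ?o = "\<lambda>i::nat. 0::real"
  let ?c = "restrict (\<lambda>j. \<alpha> ?o [cpl j] / 2) {..<4}"
  show "\<exists>!c. c \<in> extensional {..<4} \<and> form_eq (2 * 4) \<alpha> (\<lambda>x vs. \<Sum>j<4. c j * eta j x vs)"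
  proof (rule ex1I [of _ ?c])
    have "(\<lambda>x vs. \<Sum>j<4. ?c j * eta j x vs) = (\<lambda>x vs. \<Sum>j<4. (\<alpha> ?o [cpl j] / 2) * eta j x vs)"
      by (intro ext sum.cong) auto
    then show "?c \<in> extensional {..<4} \<and> form_eq (2 * 4) \<alpha> (\<lambda>x vs. \<Sum>j<4. ?c j * eta j x vs)"
      using invariant_10_form_expand \<alpha> by simp
  next
    fix c assume c: "c \<in> extensional {..<4} \<and> form_eq (2 * 4) \<alpha> (\<lambda>x vs. \<Sum>j<4. c j * eta j x vs)"
    show "c = ?c"
    proof (rule extensionalityI [of _ "{..<4}"])
      fix k :: nat assume k: "k \<in> {..<4}"
      then have "\<alpha> ?o [cpl k] = (\<Sum>j<4. c j * eta j ?o [cpl k])"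
        using form_eqD [OF conjunct2 [OF c] zero_RN] cpl_CN [of k 4] by auto
      also have "\<dots> = (\<Sum>j<4. if j = k then c j * 2 else 0)"
        by (intro sum.cong refl) (auto simp: eta_def cf_def zeta_cpl complexify_def zbar_def)
      also have "\<dots> = c k * 2" using k by simp
      finally show "c k = ?c k" using k by simp
    qed (use c in auto)
  qed
next
  fix j :: nat assume j: "j < 4"
  \<comment> \<open>The only nonzero structure constant stands at the mixed term with both indices
    \<open>j - 2\<close>; for \<open>j\<close> = 0 and 1 there is none, and the guard also excludes
    the truncated subtraction.\<close>
  let ?B = "\<lambda>k l. if 2 \<le> j \<and> k = j - 2 \<and> l = j - 2 then 1 else 0 :: complex"
  have "(\<lambda>x vs. \<Sum>k<j. \<Sum>l<j. 0 * wedge (eta k) (eta l) x vs + ?B k l * wedge (eta k) (conj_form (eta l)) x vs +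
      0 * wedge (conj_form (eta k)) (conj_form (eta l)) x vs) =
    (\<lambda>x vs. if 2 \<le> j then wedge (eta (j - 2)) (conj_form (eta (j - 2))) x vs else 0)"
  proof (intro ext)
    fix x vs
    have "(\<Sum>k<j. \<Sum>l<j. ?B k l * wedge (eta k) (conj_form (eta l)) x vs) =
        (\<Sum>k<j. if k = j - 2 then (\<Sum>l<j. if l = j - 2 then
           (if 2 \<le> j then wedge (eta k) (conj_form (eta l)) x vs else 0) else 0) else 0)"
    proof (rule sum.cong [OF refl])
      fix k
      have "?B k l * w = (if k = j - 2 then if l = j - 2 then if 2 \<le> j then w else 0 else 0 else 0)" for l w
        by simp
      then show "(\<Sum>l<j. ?B k l * wedge (eta k) (conj_form (eta l)) x vs) =
          (if k = j - 2 then (\<Sum>l<j. if l = j - 2 then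
           (if 2 \<le> j then wedge (eta k) (conj_form (eta l)) x vs else 0) else 0) else 0)"
        by (cases "k = j - 2") (simp_all only: if_True if_False sum.neutral_const simp_thms)
    qed
    also have "\<dots> = (if 2 \<le> j then wedge (eta (j - 2)) (conj_form (eta (j - 2))) x vs else 0)" by simp
    finally show "(\<Sum>k<j. \<Sum>l<j. 0 * wedge (eta k) (eta l) x vs + ?B k l * wedge (eta k) (conj_form (eta l)) x vs +
      0 * wedge (conj_form (eta k)) (conj_form (eta l)) x vs) =
      (if 2 \<le> j then wedge (eta (j - 2)) (conj_form (eta (j - 2))) x vs else 0)"
      by (simp only: mult_zero_left add_0_left add_0_right)
  qed
  then have "form_eq (2 * 4) (ext_deriv (2 * 4) (eta j))
    (\<lambda>x vs. \<Sum>k<j. \<Sum>l<j. 0 * wedge (eta k) (eta l) x vs + ?B k l * wedge (eta k) (conj_form (eta l)) x vs +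
      0 * wedge (conj_form (eta k)) (conj_form (eta l)) x vs)"
    using ext_deriv_eta [OF j] by simp
  then show "\<exists>A B C. form_eq (2 * 4) (ext_deriv (2 * 4) (eta j))
            (\<lambda>x vs. \<Sum>k<j. \<Sum>l<j.
                 A k l * wedge (eta k) (eta l) x vs
               + B k l * wedge (eta k) (conj_form (eta l)) x vs
               + C k l * wedge (conj_form (eta k)) (conj_form (eta l)) x vs)"
    by (intro exI)
qed (rule is_pq_eta, rule invariant_eta)

section \<open>An invariant SKT metric\<close>

definition gKT :: tensor2 where
  "gKT x i j = (\<Sum>k<4. Re (cf k x (basis_vec i) * cnj (cf k x (basis_vec j))))"

lemma cf_expand:
  assumes "v \<in> CN N"
  shows "cf k x v = (\<Sum>i<N. v i * cf k x (basis_vec i))" "cfb k x v = (\<Sum>i<N. v i * cnj (cf k x (basis_vec i)))"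
proof -
  have s: "cf k x (\<lambda>i. \<Sum>j\<in>A. c j * b j i) = (\<Sum>j\<in>A. c j * cf k x (b j))"
    "cfb k x (\<lambda>i. \<Sum>j\<in>A. c j * b j i) = (\<Sum>j\<in>A. c j * cfb k x (b j))" if "finite A" for A :: "nat set" and c b
    using that
  proof (induction A rule: finite_induct)
    case empty
    show "cf k x (\<lambda>i. \<Sum>j\<in>{}. c j * b j i) = (\<Sum>j\<in>{}. c j * cf k x (b j))"
      "cfb k x (\<lambda>i. \<Sum>j\<in>{}. c j * b j i) = (\<Sum>j\<in>{}. c j * cfb k x (b j))"
      by (simp_all add: cf_def cfb_def zeta_def zbar_def)
  next
    case (insert j A)
    then show "cf k x (\<lambda>i. \<Sum>j\<in>insert j A. c j * b j i) = (\<Sum>j\<in>insert j A. c j * cf k x (b j))"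
      "cfb k x (\<lambda>i. \<Sum>j\<in>insert j A. c j * b j i) = (\<Sum>j\<in>insert j A. c j * cfb k x (b j))"
      using cf_lin [of k x "c j" "b j" 1 "\<lambda>i. \<Sum>j\<in>A. c j * b j i"] by simp_all
  qed
  have "conj_vec (basis_vec i) = basis_vec i" for i by (simp add: conj_vec_def basis_vec_def fun_eq_iff)
  then have c: "cfb k x (basis_vec i) = cnj (cf k x (basis_vec i))" for i by (simp add: cnj_cf)
  show "cf k x v = (\<Sum>i<N. v i * cf k x (basis_vec i))"
    by (subst CN_expand [OF assms]) (rule s(1), simp)
  have "cfb k x v = (\<Sum>i<N. v i * cfb k x (basis_vec i))"
    by (subst CN_expand [OF assms]) (rule s(2), simp)
  then show "cfb k x v = (\<Sum>i<N. v i * cnj (cf k x (basis_vec i)))" by (simp add: c)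
qed

lemma metric_gKT:
  assumes "v \<in> CN N" "w \<in> CN N"
  shows "metric N gKT x v w = (\<Sum>k<4. (cf k x v * cfb k x w + cfb k x v * cf k x w) / 2)"
proof -
  let ?a = "\<lambda>k i. cf k x (basis_vec i)"
  have Re2: "complex_of_real (Re z) = (z + cnj z) / 2" for z by (simp add: complex_add_cnj)
  have "metric N gKT x v w = (\<Sum>i<N. \<Sum>j<N. \<Sum>k<4. ((v i * ?a k i) * (w j * cnj (?a k j)) + (v i * cnj (?a k i)) * (w j * ?a k j)) / 2)"
    unfolding metric_def gKT_def of_real_sum sum_distrib_right Re2
    by (intro sum.cong refl) (simp add: field_simps)
  also have "\<dots> = (\<Sum>i<N. \<Sum>k<4. \<Sum>j<N. ((v i * ?a k i) * (w j * cnj (?a k j)) + (v i * cnj (?a k i)) * (w j * ?a k j)) / 2)"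
    by (rule sum.cong [OF refl]) (rule sum.swap)
  also have "\<dots> = (\<Sum>k<4. \<Sum>i<N. \<Sum>j<N. ((v i * ?a k i) * (w j * cnj (?a k j)) + (v i * cnj (?a k i)) * (w j * ?a k j)) / 2)"
    by (rule sum.swap)
  also have "\<dots> = (\<Sum>k<4. (cf k x v * cfb k x w + cfb k x v * cf k x w) / 2)"
    unfolding cf_expand [OF assms(1)] cf_expand [OF assms(2)] sum_product
    by (intro sum.cong refl) (simp add: sum.distrib sum_divide_distrib [symmetric])
  finally show ?thesis .
qed

lemma hermitian_gKT: "hermitian_metric 4 KT KT_lattice stdJ gKT"
  unfolding hermitian_metric_def Let_def
proof (intro conjI allI impI ballI)
  fix i j :: nat
  have "smooth (2 * 4) (\<lambda>x. Re (cf k x (basis_vec i) * cnj (cf k x (basis_vec j))))" for k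
    by (intro smooth_bounded_linear [OF bounded_linear_Re] smooth_mult smooth_cnj smooth_cf)
  then show "smooth (2 * 4) (\<lambda>x. gKT x i j)" unfolding gKT_def by (rule smooth_sum)
  show "gKT x i j = gKT x j i" for x unfolding gKT_def by (intro sum.cong refl) (simp add: algebra_simps)
next
  fix x v :: pt
  assume x: "x \<in> RN (2 * 4)" and v: "v \<in> RN (2 * 4)" "v \<noteq> (\<lambda>i. 0)"
  let ?c = "complexify v"
  have c: "?c \<in> CN (2 * 4)" using v(1) complexify_CN by blast
  have "cfb k x ?c = cnj (cf k x ?c)" for k using cnj_cf(1) [of k x ?c] by simp
  then have "complex_of_real (rmetric (2 * 4) gKT x v v) = (\<Sum>k<4. cf k x ?c * cnj (cf k x ?c))"
    unfolding metric_complexify [symmetric] metric_gKT [OF c c] by simp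
  also have "\<dots> = complex_of_real (\<Sum>k<4. (cmod (cf k x ?c))\<^sup>2)"
    by (simp only: of_real_sum complex_norm_square)
  finally have eq: "rmetric (2 * 4) gKT x v v = (\<Sum>k<4. (cmod (cf k x ?c))\<^sup>2)" by (simp only: of_real_eq_iff)
  \<comment> \<open>The coframe is triangular: once dz_1 and dz_2 vanish on the vector, the last two
    covectors reduce to dw_1 and dw_2.\<close>
  have "\<exists>k<4. cf k x ?c \<noteq> 0"
  proof (rule ccontr)
    assume "\<not> (\<exists>k<4. cf k x ?c \<noteq> 0)"
    then have z: "cf k x ?c = 0" if "k < 4" for k using that by blast
    have z01: "zeta 0 ?c = 0" "zeta 1 ?c = 0" using z [of 0] z [of 1] by (simp_all add: cf_def)
    then have "zeta 2 ?c = 0" "zeta 3 ?c = 0" using z [of 2] z [of 3] by (simp_all add: cf_def)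
    with z01 have "zeta k ?c = 0" if "k < 4" for k
      using less_4 [THEN iffD1, OF that] by (elim disjE) simp_all
    then have v0: "v (2 * k) = 0 \<and> v (2 * k + 1) = 0" if "k < 4" for k
      using that by (simp add: zeta_def complexify_def complex_eq_iff)
    have "v i = 0" if "i < 2 * 4" for i
    proof -
      have "i div 2 < 4" using that by simp
      from v0 [OF this] show ?thesis by (cases "even i") (simp_all add: odd_two_times_div_two_succ)
    qed
    then have "v i = 0" for i using v(1) by (cases "i < 2 * 4") (auto simp: RN_iff)
    then show False using v(2) by auto
  qed
  then obtain k where "k < 4" "cf k x ?c \<noteq> 0" by blast
  then have "0 < (\<Sum>k<4. (cmod (cf k x ?c))\<^sup>2)"
    by (intro sum_pos2 [of "{..<4}" k]) auto
  then show "0 < (\<Sum>i<2 * 4. \<Sum>j<2 * 4. gKT x i j * v i * v j)"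
    unfolding eq [symmetric] rmetric_def .
next
  fix x v w assume vw: "v \<in> CN (2 * 4)" "w \<in> CN (2 * 4)"
  show "metric (2 * 4) gKT x (apply_J (2 * 4) stdJ x v) (apply_J (2 * 4) stdJ x w) = metric (2 * 4) gKT x v w"
    unfolding apply_stdJ [OF vw(1)] apply_stdJ [OF vw(2)] metric_gKT [OF vw] metric_gKT [OF Jv_CN [OF vw(1)] Jv_CN [OF vw(2)]]
    by (intro sum.cong refl) (simp add: cf_Jv mult_ac)
  fix a
  show "metric (2 * 4) gKT (a \<otimes>\<^bsub>KT\<^esub> x) (push_left (2 * 4) KT a x v) (push_left (2 * 4) KT a x w) = metric (2 * 4) gKT x v w"
    unfolding push_left_KT [OF vw(1)] push_left_KT [OF vw(2)] metric_gKT [OF vw] metric_gKT [OF pl_CN [OF vw(1)] pl_CN [OF vw(2)]]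
    by (intro sum.cong refl) (simp add: cf_pl cfb_pl)
qed

lemma hermI: "hermitian_metric n G H stdJ g \<Longrightarrow> herm n g"
  unfolding hermitian_metric_def Let_def herm_def rmetric_def by (simp add: apply_stdJ)

interpretation KT: herm 4 gKT
  by (rule hermI [OF hermitian_gKT])

lemma length_2_conv: "length xs = 2 \<longleftrightarrow> (\<exists>v w. xs = [v, w])"
  by (auto simp: numeral_2_eq_2 length_Suc_conv)

lemma length_1_conv: "length xs = 1 \<longleftrightarrow> (\<exists>v. xs = [v])"
  by (auto simp: length_Suc_conv)

text \<open>Each summand of the metric pairs a (1,0) covector with its conjugate, so
  \<open>om\<close> has type (1,1) only.\<close>

lemma om_typed:
  assumes "us \<in> lists (t10 (2 * 4))" "ws \<in> lists (t01 (2 * 4))" "length us \<noteq> 1"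
  shows "KT.om x (us @ ws) = 0"
proof (cases "length (us @ ws) = 2")
  case True
  then obtain v w where vw: "us @ ws = [v, w]" unfolding length_2_conv by blast
  then have CN: "v \<in> CN (2 * 4)" "w \<in> CN (2 * 4)"
    using lists_t10 [OF assms(1)] lists_t01 [OF assms(2)] by (metis append_in_lists_conv Cons_in_lists_iff)+
  consider "v \<in> t10 (2 * 4)" "w \<in> t10 (2 * 4)" | "v \<in> t01 (2 * 4)" "w \<in> t01 (2 * 4)"
    using vw assms by (cases us; cases ws) (auto simp: append_eq_Cons_conv Cons_eq_append_conv)
  then have "cf k x v * cfb k x w = 0 \<and> cfb k x v * cf k x w = 0" for k
    by cases (simp_all add: cf_t01 cfb_t10)
  then have z: "cf k x v * cfb k x w = 0" "cfb k x v * cf k x w = 0" for k by blast+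
  show ?thesis
    unfolding vw KT.fundamental_form_pair [OF CN(1)] metric_gKT [OF Jv_CN [OF CN(1)] CN(2)]
    by (rule sum.neutral) (simp only: cf_Jv mult.assoc z, simp)
qed (simp add: fundamental_form_def)

lemma om_mixed:
  assumes "u \<in> t10 (2 * 4)" "w \<in> t01 (2 * 4)"
  shows "KT.om x [u, w] = (\<Sum>k<4. (\<i> / 2) * (cf k x u * cfb k x w))"
  unfolding KT.fundamental_form_pair [OF t10_CN [OF assms(1)]]
    metric_gKT [OF Jv_CN [OF t10_CN [OF assms(1)]] t01_CN [OF assms(2)]]
  using assms by (intro sum.cong refl) (simp add: cf_Jv cf_t01 cfb_t10)

lemma differential_om:
  assumes u: "u \<in> t10 (2 * 4)" and w: "w \<in> t01 (2 * 4)" "w' \<in> t01 (2 * 4)" and y: "y \<in> RN (2 * 4)"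
  shows "differential (2 * 4) (\<lambda>z. KT.om z [u, w]) y w' =
    (\<Sum>k<4. (if 2 \<le> k then - (\<i> / 2) * zbar (k - 2) w' * zeta (k - 2) u else 0) * cfb k y w)"
proof -
  have "differential (2 * 4) (\<lambda>z. KT.om z [u, w]) y w' = differential (2 * 4) (\<lambda>z. \<Sum>k<4. (\<i> / 2) * (cf k z u * cfb k z w)) y w'"
    by (rule differential_cong [OF om_mixed [OF u w(1)] y])
  also have "\<dots> = (\<Sum>k<4. differential (2 * 4) (\<lambda>z. (\<i> / 2) * (cf k z u * cfb k z w)) y w')"
    using y by (intro differential_sum smooth_mult smooth_const smooth_cf) auto
  also have "\<dots> = (\<Sum>k<4. (if 2 \<le> k then - (\<i> / 2) * zbar (k - 2) w' * zeta (k - 2) u else 0) * cfb k y w)"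
  proof (rule sum.cong [OF refl])
    fix k :: nat assume "k \<in> {..<4}"
    then have k: "k < 4" by simp
    show "differential (2 * 4) (\<lambda>z. (\<i> / 2) * (cf k z u * cfb k z w)) y w' =
        (if 2 \<le> k then - (\<i> / 2) * zbar (k - 2) w' * zeta (k - 2) u else 0) * cfb k y w"
      unfolding differential_cmult [OF smooth_mult [OF smooth_cf] y] differential_mult [OF smooth_cf y] differential_cf [OF k y]
      by (simp add: zeta_t01 [OF w(2)])
  qed
  finally show ?thesis .
qed

text \<open>A summand survives both derivatives only through its variable coefficients conj(z) and
  z, each differentiated once. The result is symmetric in \<open>w\<close> and
  \<open>w'\<close>.\<close>

lemma differential_differential_om:
  assumes u: "u \<in> t10 (2 * 4)" and w: "w \<in> t01 (2 * 4)" "w' \<in> t01 (2 * 4)" and x: "x \<in> RN (2 * 4)"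
  shows "differential (2 * 4) (\<lambda>y. differential (2 * 4) (\<lambda>z. KT.om z [u, w]) y w') x u' =
    (\<Sum>k<4. if 2 \<le> k then (\<i> / 2) * zbar (k - 2) w' * zbar (k - 2) w * zeta (k - 2) u * zeta (k - 2) u' else 0)"
proof -
  have "differential (2 * 4) (\<lambda>y. differential (2 * 4) (\<lambda>z. KT.om z [u, w]) y w') x u' =
      differential (2 * 4) (\<lambda>y. \<Sum>k<4. (if 2 \<le> k then - (\<i> / 2) * zbar (k - 2) w' * zeta (k - 2) u else 0) * cfb k y w) x u'"
    by (rule differential_cong [OF differential_om [OF u w] x])
  also have "\<dots> = (\<Sum>k<4. differential (2 * 4) (\<lambda>y. (if 2 \<le> k then - (\<i> / 2) * zbar (k - 2) w' * zeta (k - 2) u else 0) * cfb k y w) x u')"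
    using x by (intro differential_sum smooth_mult smooth_const smooth_cf) auto
  also have "\<dots> = (\<Sum>k<4. if 2 \<le> k then (\<i> / 2) * zbar (k - 2) w' * zbar (k - 2) w * zeta (k - 2) u * zeta (k - 2) u' else 0)"
  proof (rule sum.cong [OF refl])
    fix k :: nat assume "k \<in> {..<4}"
    then have k: "k < 4" by simp
    show "differential (2 * 4) (\<lambda>y. (if 2 \<le> k then - (\<i> / 2) * zbar (k - 2) w' * zeta (k - 2) u else 0) * cfb k y w) x u' =
        (if 2 \<le> k then (\<i> / 2) * zbar (k - 2) w' * zbar (k - 2) w * zeta (k - 2) u * zeta (k - 2) u' else 0)"
      unfolding differential_cmult [OF smooth_cf(2) x] differential_cf [OF k x] by simp
  qed
  finally show ?thesis .
qed

text \<open>Delbar antisymmetrises in the two (0,1) arguments, while the second derivatives are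
  symmetric in them. In terms of forms, the summands of del delbar \<open>om\<close> are multiples
  of the squares of dz_k wedge conj(dz_k).\<close>

lemma SKT_gKT: "SKT 4 stdJ gKT"
  unfolding SKT_def Let_def form_eq_def
proof (intro ballI)
  fix x vs assume x: "x \<in> RN (2 * 4)" and vs: "vs \<in> lists (CN (2 * 4))"
  let ?db = "delbar (2 * 4) stdJ KT.om"
  have db: "is_form (2 * 4) 3 ?db" using is_form_delbar [OF KT.is_form_fundamental_form] by (simp add: numeral_3_eq_3 numeral_2_eq_2)
  then have ddb: "is_form (2 * 4) (Suc 3) (del (2 * 4) stdJ ?db)" by (rule is_form_del)
  show "del (2 * 4) stdJ ?db x vs = 0"
  proof (rule alt_zero_of_typed [OF _ _ vs])
    show "alt (2 * 4) (del (2 * 4) stdJ ?db x)" using ddb x unfolding is_form_iff sform_def by blast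
    fix us ws assume us: "us \<in> lists (t10 (2 * 4))" and ws: "ws \<in> lists (t01 (2 * 4))"
    show "del (2 * 4) stdJ ?db x (us @ ws) = 0"
    proof (cases "length us + length ws = Suc 3")
      case False
      then show ?thesis
        using ddb x lists_t10 [OF us] lists_t01 [OF ws] unfolding is_form_iff has_degree_def by simp
    next
      case len: True
      have inner: "?db y (us' @ ws) = (\<Sum>j<length ws. (-1) ^ (length us' + j) *
          differential (2 * 4) (\<lambda>z. KT.om z (us' @ take j ws @ drop (Suc j) ws)) y (ws ! j))"
        if "us' \<in> lists (t10 (2 * 4))" "length us' + length ws = 3" "y \<in> RN (2 * 4)" for us' y
        using that ws by (intro delbar_typed [OF KT.is_form_fundamental_form]) auto
      have "differential (2 * 4) (\<lambda>y. ?db y ((take i us @ drop (Suc i) us) @ ws)) x (us ! i) = 0" if i: "i < length us" for i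
      proof -
        let ?us = "take i us @ drop (Suc i) us"
        have us': "?us \<in> lists (t10 (2 * 4))" by (rule nth_removed_CN [OF us])
        have len': "length ?us + length ws = 3" using i len by simp
        show ?thesis
        proof (cases "length ?us = 1")
          case False
          have "?db y (?us @ ws) = 0" if "y \<in> RN (2 * 4)" for y
          proof -
            have "differential (2 * 4) (\<lambda>z. KT.om z (?us @ take j ws @ drop (Suc j) ws)) y (ws ! j) = 0" for j
              by (simp only: om_typed [OF us' nth_removed_CN [OF ws] False] differential_const)
            then show ?thesis unfolding inner [OF us' len' that] by simp
          qed
          then have "differential (2 * 4) (\<lambda>y. ?db y (?us @ ws)) x (us ! i) = differential (2 * 4) (\<lambda>y. 0) x (us ! i)"
            by (rule differential_cong [OF _ x])
          then show ?thesis by (simp only: differential_const)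
        next
          case True
          then obtain u where u: "?us = [u]" unfolding length_1_conv by blast
          have "length ws = 2" using True len' by simp
          then obtain w0 w1 where w: "ws = [w0, w1]" unfolding length_2_conv by blast
          have t: "u \<in> t10 (2 * 4)" "w0 \<in> t01 (2 * 4)" "w1 \<in> t01 (2 * 4)" using us' ws u w by auto
          have sm: "smooth (2 * 4) (\<lambda>y. differential (2 * 4) (\<lambda>z. KT.om z [u, w]) y w')" if "w \<in> t01 (2 * 4)" for w w'
            using KT.is_form_fundamental_form t10_CN [OF t(1)] t01_CN [OF that]
            by (intro smooth_differential sform_smooth) (auto simp: is_form_iff)
          have "differential (2 * 4) (\<lambda>y. ?db y (?us @ ws)) x (us ! i) =
              differential (2 * 4) (\<lambda>y. (-1) * differential (2 * 4) (\<lambda>z. KT.om z [u, w1]) y w0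
                + 1 * differential (2 * 4) (\<lambda>z. KT.om z [u, w0]) y w1) x (us ! i)"
          proof (rule differential_cong [OF _ x])
            fix y assume "y \<in> RN (2 * 4)"
            from inner [OF us' len' this]
            show "?db y (?us @ ws) = (-1) * differential (2 * 4) (\<lambda>z. KT.om z [u, w1]) y w0
                + 1 * differential (2 * 4) (\<lambda>z. KT.om z [u, w0]) y w1"
              unfolding u w by (simp add: numeral_2_eq_2)
          qed
          also have "\<dots> = (-1) * differential (2 * 4) (\<lambda>y. differential (2 * 4) (\<lambda>z. KT.om z [u, w1]) y w0) x (us ! i)
                + 1 * differential (2 * 4) (\<lambda>y. differential (2 * 4) (\<lambda>z. KT.om z [u, w0]) y w1) x (us ! i)"
            by (rule differential_lin [OF sm [OF t(3)] sm [OF t(2)] x])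
          also have "\<dots> = 0"
            unfolding differential_differential_om [OF t(1,3,2) x] differential_differential_om [OF t(1,2,3) x]
            by (simp add: mult_ac cong: if_cong)
          finally show ?thesis .
        qed
      qed
      then show ?thesis unfolding del_typed [OF db us ws x len] by simp
    qed
  qed
qed

section \<open>Basic lattice translations on the coordinate fields\<close>

lemma runit_lattice: "l < 8 \<Longrightarrow> runit l \<in> KT_lattice"
  unfolding KT_lattice_def by (simp add: RN_iff runit_def)

lemma pl_runit_fibre: "4 \<le> l \<Longrightarrow> pl (runit l) v = v"
  by (rule ext) (simp add: pl_def kap_def complexify_def runit_def)

lemma kap_runit_fibre: "4 \<le> l \<Longrightarrow> kap i (runit l) x = 0"
  by (simp add: kap_def runit_def)

lemma pl_cpl_fibre: "2 \<le> k \<Longrightarrow> pl a (cpl k) = cpl k"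
  by (rule ext) (simp add: pl_def kap_def cpl_def basis_vec_def)

lemma pl_conj_cpl_fibre: "2 \<le> k \<Longrightarrow> pl a (conj_vec (cpl k)) = conj_vec (cpl k)"
  by (simp only: pl_conj [symmetric] pl_cpl_fibre)

lemma pl_cpl:
  assumes "k < 2" shows "pl a (cpl k) = (\<lambda>i. 1 * cpl k i + zbar k (complexify a) * cpl (k + 2) i)"
proof -
  consider "k = 0" | "k = 1" using assms by linarith
  then show ?thesis
    by (cases, auto simp: fun_eq_iff pl_def kap_def cpl_def basis_vec_def zbar_def complexify_def algebra_simps,
        simp_all add: eval_nat_numeral)
qed

lemma pl_conj_cpl:
  assumes "k < 2"
  shows "pl a (conj_vec (cpl k)) = (\<lambda>i. 1 * conj_vec (cpl k) i + zeta k (complexify a) * conj_vec (cpl (k + 2)) i)"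
proof -
  have "zeta k (complexify a) = cnj (zbar k (complexify a))" by (simp add: cnj_zeta)
  then show ?thesis unfolding pl_conj [symmetric] pl_cpl [OF assms] by (simp add: conj_vec_def)
qed

lemma cpl_nz: "cpl k l \<noteq> 0 \<Longrightarrow> l = 2 * k \<or> l = 2 * k + 1" "conj_vec (cpl k) l \<noteq> 0 \<Longrightarrow> l = 2 * k \<or> l = 2 * k + 1"
  by (auto simp: cpl_def conj_vec_def basis_vec_def split: if_splits)

lemma zbar_runit: "zbar k (complexify (runit l)) = (if l = 2 * k then 1 else if l = 2 * k + 1 then - \<i> else 0)"
  by (auto simp: zbar_def complexify_def runit_def)

lemma zeta_runit: "zeta k (complexify (runit l)) = (if l = 2 * k then 1 else if l = 2 * k + 1 then \<i> else 0)"
  by (auto simp: zeta_def complexify_def runit_def)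

lemma pl_runit_cpl: "k < 2 \<Longrightarrow> l \<noteq> 2 * k \<Longrightarrow> l \<noteq> 2 * k + 1 \<Longrightarrow> pl (runit l) (cpl k) = cpl k"
  "k < 2 \<Longrightarrow> l \<noteq> 2 * k \<Longrightarrow> l \<noteq> 2 * k + 1 \<Longrightarrow> pl (runit l) (conj_vec (cpl k)) = conj_vec (cpl k)"
  by (simp_all add: pl_cpl pl_conj_cpl zbar_runit zeta_runit)

section \<open>Bott-Chern harmonic products for an arbitrary metric\<close>

locale KT_metric =
  fixes g :: tensor2
  assumes H: "hermitian_metric 4 KT KT_lattice stdJ g"

sublocale KT_metric \<subseteq> herm 4 g
  by (rule hermI [OF H])

context KT_metric
begin

lemma ext_deriv_conj_eta:
  assumes "j < 2" shows "form_eq N (ext_deriv N (conj_form (eta j))) zero_form"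
  unfolding form_eq_def
proof (intro ballI)
  fix x vs assume x: "x \<in> RN N" and vs: "vs \<in> lists (CN N)"
  show "ext_deriv N (conj_form (eta j)) x vs = 0"
  proof (cases "length vs = 2")
    case True
    then obtain u v where vs_eq: "vs = [u, v]" unfolding length_2_conv by blast
    have "cfb j y w = zbar j w" for y w using assms by (simp add: cfb_def)
    then show ?thesis
      unfolding vs_eq ext_deriv_pair conj_eta by (simp add: differential_const)
  next
    case False
    then show ?thesis
      using is_form_ext_deriv [OF is_form_conj_eta] x vs unfolding is_form_iff has_degree_def by (simp add: numeral_2_eq_2)
  qed
qed

lemma bc_eta:
  assumes "j < 2" shows "bott_chern_harmonic 4 KT KT_lattice stdJ g 1 0 (eta j)"
  unfolding bott_chern_harmonic_def Let_def
proof (intro conjI)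
  show "is_pq_form N stdJ 1 0 (eta j)" by (rule is_pq_eta)
  show "invariant_form N KT KT_lattice (eta j)" using assms by (intro invariant_eta) simp
  show "form_eq N (ext_deriv N (eta j)) zero_form"
    using ext_deriv_eta [of j] assms by (simp add: form_eq_def)
  show "form_eq N (del N stdJ (delbar N stdJ (hodge_star 4 stdJ g (eta j)))) zero_form"
    by (rule del_delbar_star_1form [OF is_form_eta]) simp
qed

lemma bc_conj_eta:
  assumes "j < 2" shows "bott_chern_harmonic 4 KT KT_lattice stdJ g 0 1 (conj_form (eta j))"
  unfolding bott_chern_harmonic_def Let_def
proof (intro conjI)
  show "is_pq_form N stdJ 0 1 (conj_form (eta j))" by (rule is_pq_conj_eta)
  show "invariant_form N KT KT_lattice (conj_form (eta j))" using assms by (intro invariant_conj_eta) simp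
  show "form_eq N (ext_deriv N (conj_form (eta j))) zero_form" by (rule ext_deriv_conj_eta [OF assms])
  show "form_eq N (del N stdJ (delbar N stdJ (hodge_star 4 stdJ g (conj_form (eta j))))) zero_form"
    by (rule del_delbar_star_1form [OF is_form_conj_eta]) simp
qed

text \<open>\<open>psi\<close> is the Hodge star of $dz_1 \wedge dz_2 \wedge d\bar z_1 \wedge d\bar z_2$.\<close>

definition psi :: form where
  "psi x vs = vol x (sharp (eta 0) x # sharp (eta 1) x # sharp (conj_form (eta 0)) x # sharp (conj_form (eta 1)) x # vs)"

lemma is_form_psi: "is_form N 4 psi"
proof -
  have s: "sform N (eta j)" "sform N (conj_form (eta j))" for j
    using is_form_eta is_form_conj_eta by (auto simp: is_form_iff)
  have "is_form N (Suc (Suc (Suc (Suc 4)))) vol" using is_form_vol by simp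
  from is_form_insert_sharp [OF is_form_insert_sharp [OF is_form_insert_sharp [OF is_form_insert_sharp
      [OF this s(1) [of 0]] s(1) [of 1]] s(2) [of 0]] s(2) [of 1]]
  show ?thesis by (simp only: psi_def [abs_def])
qed

lemma del_delbar_psi:
  assumes "geometrically_BC_formal 4 KT KT_lattice stdJ g"
  shows "form_eq N (del N stdJ (delbar N stdJ psi)) zero_form"
proof -
  have step: "bott_chern_harmonic 4 KT KT_lattice stdJ g (p + p') (q + q') (wedge \<alpha> \<beta>)"
    if "bott_chern_harmonic 4 KT KT_lattice stdJ g p q \<alpha>" "bott_chern_harmonic 4 KT KT_lattice stdJ g p' q' \<beta>"
    for p q p' q' \<alpha> \<beta>
    using assms that unfolding geometrically_BC_formal_def by blast
  let ?\<Omega> = "wedge (eta 0) (wedge (eta 1) (wedge (conj_form (eta 0)) (conj_form (eta 1))))"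
  have "bott_chern_harmonic 4 KT KT_lattice stdJ g (1 + (1 + (0 + 0))) (0 + (0 + (1 + 1))) ?\<Omega>"
    by (intro step bc_eta bc_conj_eta) auto
  then have 1: "form_eq N (del N stdJ (delbar N stdJ (hodge_star 4 stdJ g ?\<Omega>))) zero_form"
    unfolding bott_chern_harmonic_def Let_def by blast
  have "form_eq N (hodge_star 4 stdJ g ?\<Omega>) psi"
    unfolding form_eq_def psi_def
    by (intro ballI star_wedge4 is_form_eta is_form_conj_eta)
  from form_eq_sym [OF del_cong [OF delbar_cong [OF this]]] 1 show ?thesis
    unfolding form_eq_def by simp
qed

lemma m_inv:
  assumes "a \<in> KT_lattice" "x \<in> RN N" "v \<in> CN N" "w \<in> CN N"
  shows "m (a \<otimes>\<^bsub>KT\<^esub> x) (pl a v) (pl a w) = m x v w"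
proof -
  have "\<forall>a\<in>KT_lattice. \<forall>x\<in>RN N. \<forall>v\<in>CN N. \<forall>w\<in>CN N.
      m (a \<otimes>\<^bsub>KT\<^esub> x) (push_left N KT a x v) (push_left N KT a x w) = m x v w"
    using H unfolding hermitian_metric_def Let_def by (elim conjE)
  from this [THEN bspec, OF assms(1), THEN bspec, OF assms(2), THEN bspec, OF assms(3), THEN bspec, OF assms(4)]
  show ?thesis unfolding push_left_KT [OF assms(3)] push_left_KT [OF assms(4)] .
qed

lemma lattice_RN: "a \<in> KT_lattice \<Longrightarrow> x \<in> RN N \<Longrightarrow> a \<otimes>\<^bsub>KT\<^esub> x \<in> RN N"
  unfolding KT_simps by (rule KT_mult_RN) (simp_all add: KT_lattice_def)

lemma om_inv:
  assumes "a \<in> KT_lattice" "x \<in> RN N" "us \<in> lists (CN N)"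
  shows "om (a \<otimes>\<^bsub>KT\<^esub> x) (map (pl a) us) = om x us"
proof (cases "length us = 2")
  case True
  then obtain v w where us: "us = [v, w]" unfolding length_2_conv by blast
  then have "v \<in> CN N" "w \<in> CN N" using assms(3) by auto
  then show ?thesis
    using m_inv [OF assms(1,2) Jv_CN] by (simp only: us list.map fundamental_form_pair pl_CN Jv_pl)
qed (simp add: fundamental_form_def)

lemma wedge_power_inv:
  assumes "a \<in> KT_lattice" "x \<in> RN N"
  shows "us \<in> lists (CN N) \<Longrightarrow> wedge_power om k (a \<otimes>\<^bsub>KT\<^esub> x) (map (pl a) us) = wedge_power om k x us"
proof (induction k arbitrary: us)
  case (Suc k)
  show ?case
    unfolding wedge_power.simps wedge_wdg wdg_map
    by (rule wdg_cong [OF Suc.prems om_inv [OF assms] Suc.IH])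
qed simp

lemma vol_inv:
  "a \<in> KT_lattice \<Longrightarrow> x \<in> RN N \<Longrightarrow> us \<in> lists (CN N) \<Longrightarrow> vol (a \<otimes>\<^bsub>KT\<^esub> x) (map (pl a) us) = vol x us"
  unfolding volume_form_def by (simp only: wedge_power_inv)

text \<open>The frames at \<open>x\<close> and at its translate are chosen independently of each
  other, so invariance is deduced from the metric characterisation of the dual vector, in which
  every ingredient is lattice invariant.\<close>

lemma sharp_inv:
  assumes a: "a \<in> KT_lattice" and x: "x \<in> RN N" and \<theta>: "sform N \<theta>"
    and inv: "\<And>v. v \<in> CN N \<Longrightarrow> \<theta> (a \<otimes>\<^bsub>KT\<^esub> x) [pl a v] = \<theta> x [v]"
  shows "sharp \<theta> (a \<otimes>\<^bsub>KT\<^esub> x) = pl a (sharp \<theta> x)"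
proof (rule sharp_unique [where \<theta> = \<theta>, OF lattice_RN [OF a x] sform_alt [OF \<theta> lattice_RN [OF a x]]])
  show "pl a (sharp \<theta> x) \<in> CN N" by (rule pl_CN [OF sharp_CN [OF x]])
  fix v assume v: "v \<in> CN N"
  obtain u where u: "u \<in> CN N" "pl a u = v" using pl_surj [OF v] by blast
  have "m (a \<otimes>\<^bsub>KT\<^esub> x) (pl a (sharp \<theta> x)) (pl a u) = cnj (\<theta> x [conj_vec u])"
    unfolding m_inv [OF a x sharp_CN [OF x] u(1)] by (rule m_sharp [where \<theta> = \<theta>, OF x sform_alt [OF \<theta> x] u(1)])
  also have "\<dots> = cnj (\<theta> (a \<otimes>\<^bsub>KT\<^esub> x) [conj_vec (pl a u)])"
    unfolding pl_conj inv [OF conj_vec_CN [OF u(1)]] ..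
  finally show "m (a \<otimes>\<^bsub>KT\<^esub> x) (pl a (sharp \<theta> x)) v = cnj (\<theta> (a \<otimes>\<^bsub>KT\<^esub> x) [conj_vec v])"
    unfolding u(2) .
qed

lemma psi_inv:
  assumes a: "a \<in> KT_lattice" and x: "x \<in> RN N" and vs: "vs \<in> lists (CN N)"
  shows "psi (a \<otimes>\<^bsub>KT\<^esub> x) (map (pl a) vs) = psi x vs"
proof -
  have e: "sharp (eta j) (a \<otimes>\<^bsub>KT\<^esub> x) = pl a (sharp (eta j) x)" if "j < 2" for j
    by (rule sharp_inv [OF a x]) (use is_form_eta that in \<open>auto simp: is_form_iff eta_def cf_pl\<close>)
  have c: "sharp (conj_form (eta j)) (a \<otimes>\<^bsub>KT\<^esub> x) = pl a (sharp (conj_form (eta j)) x)" if "j < 2" for j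
    by (rule sharp_inv [OF a x]) (use is_form_conj_eta that in \<open>auto simp: is_form_iff conj_eta cfb_pl\<close>)
  have "vol (a \<otimes>\<^bsub>KT\<^esub> x) (map (pl a) (sharp (eta 0) x # sharp (eta 1) x # sharp (conj_form (eta 0)) x #
      sharp (conj_form (eta 1)) x # vs)) = psi x vs"
    unfolding psi_def by (rule vol_inv [OF a x]) (use sharp_CN [OF x] vs in auto)
  then show ?thesis unfolding psi_def by (simp add: e c)
qed

lemma m_sharp_eta:
  assumes x: "x \<in> RN N" and v: "v \<in> CN N" and j: "j < 2"
  shows "m x (sharp (eta j) x) v = zbar j v" "m x (sharp (conj_form (eta j)) x) v = zeta j v"
proof -
  have a: "alt N (eta j x)" "alt N (conj_form (eta j) x)"
    using is_form_eta is_form_conj_eta x by (auto simp: is_form_iff sform_def)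
  have "cnj (cf j x (conj_vec v)) = zbar j v" "cnj (cfb j x (conj_vec v)) = zeta j v"
    unfolding cnj_cf using j by (simp_all add: cf_def cfb_def)
  then show "m x (sharp (eta j) x) v = zbar j v" "m x (sharp (conj_form (eta j)) x) v = zeta j v"
    using m_sharp [where \<theta> = "eta j", OF x a(1) v] m_sharp [where \<theta> = "conj_form (eta j)", OF x a(2) v]
    by (simp_all add: conj_eta) (simp_all add: eta_def)
qed

lemma sharp_conj_eta:
  assumes x: "x \<in> RN N" and j: "j < 2"
  shows "sharp (conj_form (eta j)) x = conj_vec (sharp (eta j) x)"
proof (rule m_nondeg [OF x sharp_CN [OF x] conj_vec_CN [OF sharp_CN [OF x]]])
  fix v assume v: "v \<in> CN N"
  have "m x (conj_vec (sharp (eta j) x)) v = cnj (m x (sharp (eta j) x) (conj_vec v))"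
    by (simp add: metric_conj)
  also have "\<dots> = zeta j v" unfolding m_sharp_eta(1) [OF x conj_vec_CN [OF v] j] by (simp add: cnj_zeta)
  finally show "m x (sharp (conj_form (eta j)) x) v = m x (conj_vec (sharp (eta j) x)) v"
    unfolding m_sharp_eta(2) [OF x v j] ..
qed

text \<open>The dual vector represents the conjugate covector, of type (0,1), and the bilinear
  metric pairs (0,1) vectors only with (1,0) vectors.\<close>

lemma sharp_eta_t10:
  assumes x: "x \<in> RN N" and j: "j < 2"
  shows "sharp (eta j) x \<in> t10 N"
proof -
  let ?s = "sharp (eta j) x"
  have "Jv ?s = (\<lambda>i. \<i> * ?s i)"
  proof (rule m_nondeg [OF x Jv_CN [OF sharp_CN [OF x]] CN_scale [OF sharp_CN [OF x]]])
    fix v assume v: "v \<in> CN N"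
    have "m x (Jv ?s) (Jv (Jv v)) = m x ?s (Jv v)" by (rule J_g [OF x sharp_CN [OF x] Jv_CN [OF v]])
    then have "- m x (Jv ?s) v = zbar j (Jv v)"
      unfolding m_sharp_eta(1) [OF x Jv_CN [OF v] j] by (simp add: Jv_Jv metric_def sum_negf)
    then have "m x (Jv ?s) v = \<i> * zbar j v" by (simp add: zeta_Jv)
    moreover have "m x (\<lambda>i. \<i> * ?s i) v = \<i> * zbar j v"
      using metric_lin_left [of N g x \<i> ?s 0 ?s v] m_sharp_eta(1) [OF x v j] by simp
    ultimately show "m x (Jv ?s) v = m x (\<lambda>i. \<i> * ?s i) v" by simp
  qed
  then show ?thesis using sharp_CN [OF x] by (simp add: t10_def)
qed

text \<open>Up to conjugation this is the Gram determinant of dz_1, dz_2 in the metric on covectors.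
  A combination of the two dual vectors on which both dz_1 and dz_2 vanish has Hermitian square 0,
  hence is trivial.\<close>

lemma sharp_det:
  assumes x: "x \<in> RN N"
  shows "zeta 0 (sharp (eta 0) x) * zeta 1 (sharp (eta 1) x) \<noteq> zeta 1 (sharp (eta 0) x) * zeta 0 (sharp (eta 1) x)"
proof
  let ?s = "sharp (eta 0) x" and ?t = "sharp (eta 1) x"
  assume eq: "zeta 0 ?s * zeta 1 ?t = zeta 1 ?s * zeta 0 ?t"
  have indep: "p = 0 \<and> q = 0" if "p * zeta 0 ?s + q * zeta 0 ?t = 0" "p * zeta 1 ?s + q * zeta 1 ?t = 0" for p q
  proof -
    define z where "z = (\<lambda>i. p * ?s i + q * ?t i)"
    have z: "z \<in> CN N" unfolding z_def by (intro CN_lincomb sharp_CN x)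
    have mz: "m x z v = p * zbar 0 v + q * zbar 1 v" if v: "v \<in> CN N" for v
    proof -
      have "m x ?s v = zbar 0 v" "m x ?t v = zbar 1 v" by (rule m_sharp_eta(1) [OF x v]; simp)+
      then show ?thesis unfolding z_def metric_lin_left by (simp only:)
    qed
    have "zeta 0 z = 0" "zeta 1 z = 0" using that unfolding z_def zeta_lin by auto
    then have "m x z (conj_vec z) = 0"
      unfolding mz [OF conj_vec_CN [OF z]] cnj_zeta(1) [symmetric] by simp
    then have "z = (\<lambda>i. 0)" using m_pos [OF x z] by blast
    then have 0: "p * zbar 0 v + q * zbar 1 v = 0" if "v \<in> CN N" for v
      using mz [OF that] by (simp add: metric_def)
    have c: "conj_vec (cpl 0) \<in> CN N" "conj_vec (cpl 1) \<in> CN N" by (intro conj_vec_CN cpl_CN; simp)+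
    show ?thesis
      using 0 [OF c(1)] 0 [OF c(2)] unfolding cnj_zeta(1) [symmetric] zeta_cpl by simp
  qed
  \<comment> \<open>If the determinant vanished, the rows of the adjugate matrix would be kernel
    vectors, hence 0 by \<open>indep\<close>. Then all entries vanish and (1, 0) is a kernel vector
    too, which \<open>indep\<close> forbids.\<close>
  have "zeta 1 ?t = 0 \<and> - zeta 1 ?s = 0"
    using eq by (intro indep) (auto simp: algebra_simps)
  moreover have "zeta 0 ?t = 0 \<and> - zeta 0 ?s = 0"
    using eq by (intro indep) (auto simp: algebra_simps)
  ultimately have "(1::complex) = 0 \<and> (0::complex) = 0"
    by (intro indep) auto
  then show False by simp
qed

lemma sum_4: "(\<Sum>j\<in>{..<4}. h j) = h 0 + h 1 + h 2 + (h 3 :: complex)" for h :: "nat \<Rightarrow> complex"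
  by (simp add: numeral_eq_Suc)

text \<open>Since W_1 and W_2 already occur among the later arguments, only the components of
  \<open>v\<close> along Z_1 and Z_2 count.\<close>

lemma alt_mod_cpl:
  assumes f: "alt N f" and v: "v \<in> t10 N" and us: "us \<in> lists (CN N)" and ws: "ws \<in> lists (CN N)"
    and W: "cpl 2 \<in> set ws" "cpl 3 \<in> set ws"
  shows "f (us @ v # ws) = zeta 0 v / 2 * f (us @ cpl 0 # ws) + zeta 1 v / 2 * f (us @ cpl 1 # ws)"
proof -
  have c: "cpl k \<in> CN N" if "k \<in> {..<4}" for k by (rule cpl_CN) (use that in simp)
  have e: "v = (\<lambda>i. \<Sum>j\<in>{..<4}. (zeta j v / 2) * cpl j i)"
    by (rule trans [OF p10_id(1) [OF v, symmetric] p10_expand [OF t10_CN [OF v]]])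
  have "f (us @ v # ws) = f (us @ (\<lambda>i. \<Sum>j\<in>{..<4}. (zeta j v / 2) * cpl j i) # ws)"
    by (rule arg_cong [OF e])
  also have "\<dots> = (\<Sum>j\<in>{..<4}. (zeta j v / 2) * f (us @ cpl j # ws))"
    by (rule alt_sum [OF f us ws _ c]) simp_all
  also have "\<dots> = zeta 0 v / 2 * f (us @ cpl 0 # ws) + zeta 1 v / 2 * f (us @ cpl 1 # ws)"
    unfolding sum_4 alt_repeated [OF f us ws W(1)] alt_repeated [OF f us ws W(2)] by simp
  finally show ?thesis .
qed

lemma alt_mod_conj_cpl:
  assumes f: "alt N f" and v: "v \<in> t10 N" and us: "us \<in> lists (CN N)" and ws: "ws \<in> lists (CN N)"
    and W: "conj_vec (cpl 2) \<in> set ws" "conj_vec (cpl 3) \<in> set ws"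
  shows "f (us @ conj_vec v # ws) =
    cnj (zeta 0 v / 2) * f (us @ conj_vec (cpl 0) # ws) + cnj (zeta 1 v / 2) * f (us @ conj_vec (cpl 1) # ws)"
proof -
  have c: "conj_vec (cpl k) \<in> CN N" if "k \<in> {..<4}" for k by (rule conj_vec_CN [OF cpl_CN]) (use that in simp)
  have "v = (\<lambda>i. \<Sum>j\<in>{..<4}. (zeta j v / 2) * cpl j i)"
    by (rule trans [OF p10_id(1) [OF v, symmetric] p10_expand [OF t10_CN [OF v]]])
  then have "conj_vec v = conj_vec (\<lambda>i. \<Sum>j\<in>{..<4}. (zeta j v / 2) * cpl j i)" by (rule arg_cong)
  also have "\<dots> = (\<lambda>i. \<Sum>j\<in>{..<4}. cnj (zeta j v / 2) * conj_vec (cpl j) i)"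
    unfolding conj_vec_def cnj_sum complex_cnj_mult ..
  finally have e: "conj_vec v = (\<lambda>i. \<Sum>j\<in>{..<4}. cnj (zeta j v / 2) * conj_vec (cpl j) i)" .
  have "f (us @ conj_vec v # ws) = f (us @ (\<lambda>i. \<Sum>j\<in>{..<4}. cnj (zeta j v / 2) * conj_vec (cpl j) i) # ws)"
    by (rule arg_cong [OF e])
  also have "\<dots> = (\<Sum>j\<in>{..<4}. cnj (zeta j v / 2) * f (us @ conj_vec (cpl j) # ws))"
    by (rule alt_sum [OF f us ws _ c]) simp_all
  also have "\<dots> = cnj (zeta 0 v / 2) * f (us @ conj_vec (cpl 0) # ws) + cnj (zeta 1 v / 2) * f (us @ conj_vec (cpl 1) # ws)"
    unfolding sum_4 alt_repeated [OF f us ws W(1)] alt_repeated [OF f us ws W(2)] by simp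
  finally show ?thesis .
qed

text \<open>Against the four fibre vectors, the two dual vectors act like Z_1, Z_2 times a
  determinant \<open>D\<close>, and their conjugates like conj Z_1, conj Z_2 times its conjugate.
  What remains is the volume of the complex frame, positive since (2 i)^4 = 16, up to the sign of a
  permutation.\<close>

lemma psi_fibre:
  assumes x: "x \<in> RN N"
  shows "Re (psi x [cpl 2, cpl 3, conj_vec (cpl 3), conj_vec (cpl 2)]) < 0"
proof -
  let ?s = "sharp (eta 0) x" and ?t = "sharp (eta 1) x"
  let ?W = "[cpl 2, cpl 3, conj_vec (cpl 3), conj_vec (cpl 2)]"
  let ?c = "\<lambda>k. conj_vec (cpl k)"
  \<comment> \<open>The components along \<open>cpl 0\<close> and \<open>cpl 1\<close> are halves of
    the values of \<open>zeta\<close>, whence the 4.\<close>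
  define D where "D = (zeta 0 ?s * zeta 1 ?t - zeta 1 ?s * zeta 0 ?t) / 4"
  have D: "D \<noteq> 0" using sharp_det [OF x] by (simp add: D_def)
  have f: "alt N (vol x)" by (rule vol_alt [OF x])
  have t: "?s \<in> t10 N" "?t \<in> t10 N" using sharp_eta_t10 [OF x] by simp_all
  have C: "cpl k \<in> CN N" "?c k \<in> CN N" if "k < 4" for k using cpl_CN [OF that] conj_vec_CN [OF cpl_CN [OF that]] .
  have CN: "?s \<in> CN N" "?t \<in> CN N" "conj_vec ?s \<in> CN N" "conj_vec ?t \<in> CN N"
    "cpl 0 \<in> CN N" "cpl 1 \<in> CN N" "?W \<in> lists (CN N)" "?c 0 \<in> CN N" "?c 1 \<in> CN N"
    using C [of 0] C [of 1] C [of 2] C [of 3] t10_CN [OF t(1)] t10_CN [OF t(2)]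
      conj_vec_CN [OF t10_CN [OF t(1)]] conj_vec_CN [OF t10_CN [OF t(2)]] by simp_all
  have z2: "vol x (us @ v # v # ws) = 0" if "us \<in> lists (CN N)" "v \<in> CN N" "ws \<in> lists (CN N)" for us v ws
    using alt_eq0 [OF f] that by blast
  let ?R = "conj_vec ?s # conj_vec ?t # ?W"
  have R: "?R \<in> lists (CN N)" using CN by simp
  have "vol x (?s # ?t # ?R) = zeta 0 ?s / 2 * vol x (cpl 0 # ?t # ?R) + zeta 1 ?s / 2 * vol x (cpl 1 # ?t # ?R)"
    using alt_mod_cpl [OF f t(1), of "[]" "?t # ?R"] CN R by simp
  also have "vol x (cpl 0 # ?t # ?R) = zeta 1 ?t / 2 * vol x (cpl 0 # cpl 1 # ?R)"
    using alt_mod_cpl [OF f t(2), of "[cpl 0]" "?R"] z2 [of "[]" "cpl 0" "?R"] CN R by simp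
  also have "vol x (cpl 1 # ?t # ?R) = - (zeta 0 ?t / 2 * vol x (cpl 0 # cpl 1 # ?R))"
    using alt_mod_cpl [OF f t(2), of "[cpl 1]" "?R"] z2 [of "[]" "cpl 1" "?R"]
      alt_swap [OF f, of "[]" "?R" "cpl 1" "cpl 0"] CN R by simp
  finally have 1: "vol x (?s # ?t # ?R) = D * vol x (cpl 0 # cpl 1 # ?R)"
    by (simp add: D_def algebra_simps diff_divide_distrib)
  let ?U = "[cpl 0, cpl 1]"
  have U: "?U \<in> lists (CN N)" using CN by simp
  have "vol x (?U @ ?R) = cnj (zeta 0 ?s / 2) * vol x (?U @ ?c 0 # conj_vec ?t # ?W)
      + cnj (zeta 1 ?s / 2) * vol x (?U @ ?c 1 # conj_vec ?t # ?W)"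
    by (rule alt_mod_conj_cpl [OF f t(1) U]) (use CN in auto)
  also have "vol x (?U @ ?c 0 # conj_vec ?t # ?W) = cnj (zeta 1 ?t / 2) * vol x (?U @ ?c 0 # ?c 1 # ?W)"
    using alt_mod_conj_cpl [OF f t(2), of "?U @ [?c 0]" "?W"] z2 [of ?U "?c 0" "?W"] CN by simp
  also have "vol x (?U @ ?c 1 # conj_vec ?t # ?W) = - (cnj (zeta 0 ?t / 2) * vol x (?U @ ?c 0 # ?c 1 # ?W))"
    using alt_mod_conj_cpl [OF f t(2), of "?U @ [?c 1]" "?W"] z2 [of ?U "?c 1" "?W"]
      alt_swap [OF f, of ?U "?W" "?c 1" "?c 0"] CN by simp
  finally have 2: "vol x (?U @ ?R) = cnj D * vol x (?U @ ?c 0 # ?c 1 # ?W)"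
    by (simp add: D_def algebra_simps diff_divide_distrib)
  define V where "V = vol x (flat (map (\<lambda>k. (cpl k, ?c k)) [0..<4]))"
  have V: "V = complex_of_real (16 * (\<Prod>k<4. q k x))"
    unfolding V_def vol_cpl [OF x] by (simp add: power4_eq_xxxx)
  have "[0..<4] = [0, 1, 2, 3::nat]" by (simp add: upt_rec)
  then have V': "V = vol x [cpl 0, ?c 0, cpl 1, ?c 1, cpl 2, ?c 2, cpl 3, ?c 3]"
    by (simp add: V_def)
  \<comment> \<open>Three transpositions lead from the frame in pairs to the order needed here;
    their odd number is the origin of the minus sign.\<close>
  have "vol x ([cpl 0] @ ?c 0 # cpl 1 # [?c 1, cpl 2, ?c 2, cpl 3, ?c 3]) =
      - vol x ([cpl 0] @ cpl 1 # ?c 0 # [?c 1, cpl 2, ?c 2, cpl 3, ?c 3])"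
    by (rule alt_swap [OF f]) (use C in auto)
  moreover have "vol x ([cpl 0, cpl 1, ?c 0, ?c 1, cpl 2] @ ?c 2 # cpl 3 # [?c 3]) =
      - vol x ([cpl 0, cpl 1, ?c 0, ?c 1, cpl 2] @ cpl 3 # ?c 2 # [?c 3])"
    by (rule alt_swap [OF f]) (use C in auto)
  moreover have "vol x ([cpl 0, cpl 1, ?c 0, ?c 1, cpl 2, cpl 3] @ ?c 2 # ?c 3 # []) =
      - vol x ([cpl 0, cpl 1, ?c 0, ?c 1, cpl 2, cpl 3] @ ?c 3 # ?c 2 # [])"
    by (rule alt_swap [OF f]) (use C in auto)
  ultimately have 3: "vol x (?U @ ?c 0 # ?c 1 # ?W) = - V"
    unfolding V' by simp
  have "psi x ?W = D * (cnj D * (- V))"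
    using 1 2 3 unfolding psi_def by (simp add: sharp_conj_eta [OF x, of 0] sharp_conj_eta [OF x, of 1, simplified])
  also have "\<dots> = complex_of_real (- ((cmod D)\<^sup>2 * (16 * (\<Prod>k<4. q k x))))"
    unfolding V mult.assoc [symmetric] complex_norm_square [symmetric] by simp
  finally have "psi x ?W = complex_of_real (- ((cmod D)\<^sup>2 * (16 * (\<Prod>k<4. q k x))))" .
  then have "Re (psi x ?W) = Re (complex_of_real (- ((cmod D)\<^sup>2 * (16 * (\<Prod>k<4. q k x)))))" by (rule arg_cong)
  then have "Re (psi x ?W) = - ((cmod D)\<^sup>2 * (16 * (\<Prod>k<4. q k x)))" unfolding Re_complex_of_real .
  moreover have "0 < (\<Prod>k<4. q k x)" using q_pos [OF x] by (intro prod_pos) auto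
  ultimately show ?thesis using D by simp
qed

section \<open>Fibre averages of the components of psi\<close>

definition psi_avg :: "cvec list \<Rightarrow> pt \<Rightarrow> complex" where
  "psi_avg vs = avgs [4, 5, 6, 7] (\<lambda>z. psi z vs)"

lemma js: "[0, 1, 2, 3] \<in> lists {..<N}" "[4, 5, 6, 7] \<in> lists {..<N}"
  by simp_all

lemma smooth_psi: "vs \<in> lists (CN N) \<Longrightarrow> smooth N (\<lambda>z. psi z vs)"
  using is_form_psi by (simp add: is_form_iff sform_smooth)

lemma smooth_psi_avg: "vs \<in> lists (CN N) \<Longrightarrow> smooth N (psi_avg vs)"
  unfolding psi_avg_def by (rule smooth_avgs [OF smooth_psi js(2)])

lemma per_psi:
  assumes l: "l \<in> set [4, 5, 6, 7]" and vs: "vs \<in> lists (CN N)" shows "per N l (\<lambda>z. psi z vs)"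
  unfolding per_def
proof
  fix x assume x: "x \<in> RN N"
  have l': "4 \<le> l" "l < 8" using l by auto
  have "runit l \<otimes>\<^bsub>KT\<^esub> x = x(l := x l + 1)"
    unfolding KT_simps kap_runit_fibre [OF l'(1)] by (auto simp: runit_def)
  moreover have "map (pl (runit l)) vs = vs"
    by (rule map_idI) (rule pl_runit_fibre [OF l'(1)])
  ultimately show "psi (x(l := x l + 1)) vs = psi x vs"
    using psi_inv [OF runit_lattice [OF l'(2)] x vs] by (simp only:)
qed

text \<open>Translation by a basic lattice vector also shifts the fibre coordinates, by amounts depending on the base
  point; the fibre average does not see this.\<close>

lemma psi_avg_shift:
  assumes l: "l < 4" and x: "x \<in> RN N" and vs: "vs \<in> lists (CN N)"
  shows "psi_avg (map (pl (runit l)) vs) (x(l := x l + 1)) = psi_avg vs x"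
proof -
  let ?a = "runit l" and ?F = "[4, 5, 6, 7::nat]"
  let ?K = "\<lambda>z. psi z (map (pl ?a) vs)"
  let ?k = "\<lambda>z. ?K (z(l := z l + 1))"
  let ?y = "\<lambda>z i. if i \<in> set ?F then z i + kap i ?a z else z i"
  have vs': "map (pl ?a) vs \<in> lists (CN N)" using vs pl_CN by (auto simp: in_lists_conv_set)
  have lN: "l < N" "l \<notin> set ?F" using l by auto
  have ck: "continuous_on (RN N) ?k"
    by (rule continuous_on_upd [where p = "\<lambda>z. z", OF smooth_continuous [OF smooth_psi [OF vs']] lN(1) continuous_on_id])
       (auto intro!: continuous_intros continuous_on_subset [OF continuous_on_product_coordinates])
  have pk: "per N j ?k" if j: "j \<in> set ?F" for j
    unfolding per_def
  proof
    fix z assume z: "z \<in> RN N"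
    have jl: "j \<noteq> l" using j lN by auto
    have e: "(z(j := z j + 1))(l := (z(j := z j + 1)) l + 1) = (z(l := z l + 1))(j := (z(l := z l + 1)) j + 1)"
      using jl by (simp add: fun_upd_twist [OF jl])
    show "?k (z(j := z j + 1)) = ?k z"
      unfolding e by (rule bspec [OF per_psi [OF j vs', unfolded per_def] RN_upd [OF z lN(1)]])
  qed
  have kc: "continuous_on (RN N) (kap i ?a)" for i
    using smooth_continuous [OF smooth_kap [OF smooth_const smooth_coord, of N i ?a]] .
  have ku: "kap i ?a (z(j := t)) = kap i ?a z" if "j \<in> set ?F" for i j z t
    using that by (auto simp: kap_def)
  have e: "avgs ?F (\<lambda>x. ?k (?y x)) x = avgs ?F ?k x"
    using avgs_fibre_shift [where s = "\<lambda>i. kap i ?a" and h = ?k and js = ?F and ks = ?F, OF ck pk js(2) x kc ku] by simp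
  have "?k (?y z) = psi z vs" if z: "z \<in> RN N" for z
  proof -
    have "(?y z)(l := ?y z l + 1) = ?a \<otimes>\<^bsub>KT\<^esub> z"
      unfolding KT_simps using l by (auto simp: fun_eq_iff runit_def kap_def)
    then show ?thesis using psi_inv [OF runit_lattice z vs] l by simp
  qed
  then have "psi_avg vs x = avgs ?F (\<lambda>x. ?k (?y x)) x"
    unfolding psi_avg_def by (intro avgs_cong [OF js(2) _ x]) simp
  also have "\<dots> = avgs ?F ?K (x(l := x l + 1))"
    unfolding e by (rule avgs_upd_outside [OF lN(2)])
  finally show ?thesis unfolding psi_avg_def ..
qed

lemma psi_avg_lin:
  assumes "us \<in> lists (CN N)" "ws \<in> lists (CN N)" "v \<in> CN N" "w \<in> CN N" and x: "x \<in> RN N"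
  shows "psi_avg (us @ (\<lambda>i. a * v i + b * w i) # ws) x = a * psi_avg (us @ v # ws) x + b * psi_avg (us @ w # ws) x"
proof -
  have a: "alt N (psi y)" if "y \<in> RN N" for y
    using is_form_psi that unfolding is_form_iff by (blast intro: sform_alt)
  have "psi_avg (us @ (\<lambda>i. a * v i + b * w i) # ws) x =
      avgs [4, 5, 6, 7] (\<lambda>y. a * psi y (us @ v # ws) + b * psi y (us @ w # ws)) x"
    unfolding psi_avg_def by (rule avgs_cong [OF js(2) alt_lin [OF a assms(1-4)] x])
  also have "\<dots> = a * psi_avg (us @ v # ws) x + b * psi_avg (us @ w # ws) x"
    unfolding psi_avg_def
    by (rule avgs_lin [OF smooth_continuous [OF smooth_psi] smooth_continuous [OF smooth_psi] js(2) x])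
       (use assms in \<open>simp_all only: append_in_lists_conv Cons_in_lists_iff simp_thms\<close>)
  finally show ?thesis .
qed

lemma psi_avg_repeated:
  assumes "us \<in> lists (CN N)" "ws \<in> lists (CN N)" "v \<in> set ws" and x: "x \<in> RN N"
  shows "psi_avg (us @ v # ws) x = 0"
proof -
  have "psi y (us @ v # ws) = 0" if "y \<in> RN N" for y
    using is_form_psi that unfolding is_form_iff by (intro alt_repeated [OF sform_alt assms(1-3)]) auto
  then have "psi_avg (us @ v # ws) x = avgs [4, 5, 6, 7] (\<lambda>y. 0) x"
    unfolding psi_avg_def by (rule avgs_cong [OF js(2) _ x])
  then show ?thesis by (simp only: avgs_zero [OF js(2) x])
qed

text \<open>Along a fibre coordinate the component itself is periodic, which disposes of a fibre
  derivative in either position. Two base derivatives pass outside the fibre average, and then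
  periodicity of that average along the outer one suffices.\<close>

lemma psi_avg_second_deriv_zero:
  assumes vs: "vs \<in> lists (CN N)" and lk: "l < N" "k < N" and x: "x \<in> RN N"
    and z: "4 \<le> l \<or> 4 \<le> k \<or> per N l (psi_avg vs)"
  shows "avgs ([0, 1, 2, 3] @ [4, 5, 6, 7]) (partial_deriv l (partial_deriv k (\<lambda>z. psi z vs))) x = 0"
proof -
  let ?h = "\<lambda>z. psi z vs" and ?B = "[0, 1, 2, 3::nat]" and ?F = "[4, 5, 6, 7::nat]"
  have h: "smooth N ?h" by (rule smooth_psi [OF vs])
  have BF: "?B @ ?F \<in> lists {..<N}" by simp
  have F: "j \<in> set ?F" if "4 \<le> j" "j < N" for j using that by auto
  consider "4 \<le> l" | "l < 4" "4 \<le> k" | "l < 4" "k < 4" "per N l (psi_avg vs)" using z by linarith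
  then show ?thesis
  proof cases
    case 1
    then have l: "l \<in> set ?F" using F lk by blast
    then have "l \<in> set (?B @ ?F)" by simp
    with avgs_second_deriv_outer [OF h per_psi [OF l vs] _ lk(2) BF x] show ?thesis by blast
  next
    case 2
    then have k: "k \<in> set ?F" and l: "l \<notin> set ?F" using F lk by auto
    show ?thesis by (rule avgs_second_deriv_inner [OF h per_psi [OF k vs] lk(1) l k js x])
  next
    case 3
    then have l: "l \<notin> set ?F" "l \<in> set ?B" and k: "k \<notin> set ?F" by auto
    have "avgs (?B @ ?F) (partial_deriv l (partial_deriv k ?h)) x = avgs ?B (partial_deriv l (partial_deriv k (psi_avg vs))) x"
      unfolding psi_avg_def by (rule avgs_second_deriv_append [OF h lk(1) l(1) lk(2) k js x])
    also have "\<dots> = 0"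
      by (rule avgs_second_deriv_outer [OF smooth_psi_avg [OF vs] 3(3) l(2) lk(2) js(1) x])
    finally show ?thesis .
  qed
qed

text \<open>All eight coordinates are averaged, the fibre innermost, so the origin is only a default
  point of evaluation.\<close>

definition avg_DD :: "cvec \<Rightarrow> cvec \<Rightarrow> cvec list \<Rightarrow> complex" where
  "avg_DD v w vs = avgs ([0, 1, 2, 3] @ [4, 5, 6, 7])
     (\<lambda>x. differential N (\<lambda>y. differential N (\<lambda>z. psi z vs) y w) x v) (\<lambda>i. 0)"

lemma avg_DD_expand:
  assumes "vs \<in> lists (CN N)"
  shows "avg_DD v w vs = (\<Sum>k<N. w k * (\<Sum>l<N. v l *
    avgs ([0, 1, 2, 3] @ [4, 5, 6, 7]) (partial_deriv l (partial_deriv k (\<lambda>z. psi z vs))) (\<lambda>i. 0)))"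
  unfolding avg_DD_def by (rule avgs_differential_differential [OF smooth_psi [OF assms] _ zero_RN]) simp

lemma avg_DD_zero:
  assumes vs: "vs \<in> lists (CN N)"
    and z: "\<And>l k. v l \<noteq> 0 \<Longrightarrow> w k \<noteq> 0 \<Longrightarrow> 4 \<le> l \<or> 4 \<le> k \<or> per N l (psi_avg vs)"
  shows "avg_DD v w vs = 0"
  unfolding avg_DD_expand [OF vs]
proof (rule sum.neutral, rule ballI)
  fix k assume k: "k \<in> {..<N}"
  show "w k * (\<Sum>l<N. v l *
    avgs ([0, 1, 2, 3] @ [4, 5, 6, 7]) (partial_deriv l (partial_deriv k (\<lambda>z. psi z vs))) (\<lambda>i. 0)) = 0"
  proof (cases "w k = 0")
    case False
    have "(\<Sum>l<N. v l *
      avgs ([0, 1, 2, 3] @ [4, 5, 6, 7]) (partial_deriv l (partial_deriv k (\<lambda>z. psi z vs))) (\<lambda>i. 0)) = 0"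
    proof (rule sum.neutral, rule ballI)
      fix l assume l: "l \<in> {..<N}"
      show "v l * avgs ([0, 1, 2, 3] @ [4, 5, 6, 7]) (partial_deriv l (partial_deriv k (\<lambda>z. psi z vs))) (\<lambda>i. 0) = 0"
      proof (cases "v l = 0")
        case nz: False
        have "avgs ([0, 1, 2, 3] @ [4, 5, 6, 7]) (partial_deriv l (partial_deriv k (\<lambda>z. psi z vs))) (\<lambda>i. 0) = 0"
          by (rule psi_avg_second_deriv_zero [OF vs _ _ zero_RN z [OF nz False]]) (use l k in \<open>simp_all only: lessThan_iff\<close>)
        then show ?thesis by (simp only: mult_zero_right)
      qed (simp only: mult_zero_left)
    qed
    then show ?thesis by (simp only: mult_zero_right)
  qed (simp only: mult_zero_left)
qed

text \<open>\<open>psi_avg_shift\<close> reduces periodicity in a base coordinate to a condition on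
  the arguments at a fixed point.\<close>

lemma psi_avg_per:
  assumes l: "l < 4" and vs: "vs \<in> lists (CN N)"
    and e: "\<And>x. x \<in> RN N \<Longrightarrow> psi_avg (map (pl (runit l)) vs) x = psi_avg vs x"
  shows "per N l (psi_avg vs)"
  unfolding per_def
proof
  fix x assume x: "x \<in> RN N"
  have "x(l := x l + 1) \<in> RN N" by (rule RN_upd [OF x]) (use l in simp)
  from e [OF this] psi_avg_shift [OF l x vs] show "psi_avg vs (x(l := x l + 1)) = psi_avg vs x" by simp
qed

lemma sum_cpl_1: "(\<Sum>l<N. cpl 1 l * f l) = f 2 - \<i> * f 3"
  unfolding lessThan_8 by (simp add: cpl_def basis_vec_def)

lemma sum_conj_cpl_0: "(\<Sum>k<N. conj_vec (cpl 0) k * f k) = f 0 + \<i> * f 1"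
  unfolding lessThan_8 conj_cpl by (simp add: basis_vec_def)

text \<open>An instance of \<open>avgs_second_deriv\<close> with the chain \<open>?H\<close>,
  \<open>?S\<close>, \<open>?W\<close>: a step along \<open>l\<close> replaces conj Z_2 by conj W_2,
  and a step along \<open>k\<close> replaces Z_1 by W_1.\<close>

lemma psi_avg_second_deriv:
  assumes l: "l \<in> {2, 3}" and k: "k \<in> {0, 1}"
  shows "avgs ([0, 1, 2, 3] @ [4, 5, 6, 7]) (partial_deriv l (partial_deriv k
      (\<lambda>z. psi z [cpl 0, cpl 3, conj_vec (cpl 1), conj_vec (cpl 2)]))) (\<lambda>i. 0) =
    zeta 1 (complexify (runit l)) * zbar 0 (complexify (runit k)) *
    avgs (remove1 k (remove1 l [0, 1, 2, 3]))
      (\<lambda>y. psi_avg [cpl 2, cpl 3, conj_vec (cpl 3), conj_vec (cpl 2)] (y(l := 0, k := 0))) (\<lambda>i. 0)"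
proof -
  let ?c = "\<lambda>k. conj_vec (cpl k)"
  let ?H = "[cpl 0, cpl 3, ?c 1, ?c 2]" and ?S = "[cpl 0, cpl 3, ?c 3, ?c 2]" and ?W = "[cpl 2, cpl 3, ?c 3, ?c 2]"
  let ?B = "[0, 1, 2, 3::nat]" and ?F = "[4, 5, 6, 7::nat]"
  let ?d = "zeta 1 (complexify (runit l))" and ?b = "zbar 0 (complexify (runit k))"
  have C: "cpl k \<in> CN N" "?c k \<in> CN N" if "k < 4" for k using cpl_CN [OF that] conj_vec_CN [OF cpl_CN [OF that]] .
  have CN: "?H \<in> lists (CN N)" "?S \<in> lists (CN N)" "?W \<in> lists (CN N)"
    using C [of 0] C [of 1] C [of 2] C [of 3] by simp_all
  have l': "l < 4" "l < N" "l \<notin> set ?F" "l \<in> set ?B" "l \<noteq> 0" "l \<noteq> 1" using l by auto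
  have k': "k < 4" "k < N" "k \<notin> set ?F" "k \<in> set ?B" using k by auto
  have lk: "l \<noteq> k" using l k by auto
  \<comment> \<open>\<open>?S\<close> contains neither Z_2 nor conj Z_2, so a step along
    \<open>l\<close> leaves its arguments alone.\<close>
  have pS: "map (pl (runit l)) ?S = ?S"
    using l' by (simp only: list.map pl_cpl_fibre pl_conj_cpl_fibre pl_runit_cpl)
  \<comment> \<open>Invariance expresses the old value by the shifted ones; solving for the shifted
    value gives \<open>- ?d\<close>. The same happens for \<open>?b\<close>, and the two signs
    cancel in the product.\<close>
  have 1: "psi_avg ?H (y(l := y l + 1)) = psi_avg ?H y + (- ?d) * psi_avg ?S y" if y: "y \<in> RN N" for y
  proof -
    let ?y = "y(l := y l + 1)"
    have y': "?y \<in> RN N" by (rule RN_upd [OF y l'(2)])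
    have "map (pl (runit l)) ?H = [cpl 0, cpl 3] @ (\<lambda>i. 1 * ?c 1 i + ?d * ?c 3 i) # [?c 2]"
      using l' pl_conj_cpl [of 1 "runit l"] by (simp add: pl_runit_cpl pl_cpl_fibre pl_conj_cpl_fibre del: One_nat_def)
    then have "psi_avg ?H y = psi_avg ([cpl 0, cpl 3] @ (\<lambda>i. 1 * ?c 1 i + ?d * ?c 3 i) # [?c 2]) ?y"
      using psi_avg_shift [OF l'(1) y CN(1)] by (simp only:)
    also have "\<dots> = 1 * psi_avg ([cpl 0, cpl 3] @ ?c 1 # [?c 2]) ?y + ?d * psi_avg ([cpl 0, cpl 3] @ ?c 3 # [?c 2]) ?y"
      by (rule psi_avg_lin [OF _ _ C(2) C(2) y']) (use C [of 0] C [of 2] C [of 3] in simp_all)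
    also have "psi_avg ([cpl 0, cpl 3] @ ?c 3 # [?c 2]) ?y = psi_avg ?S y"
      using psi_avg_shift [OF l'(1) y CN(2)] pS by simp
    finally have "psi_avg ?H y = psi_avg ?H ?y + ?d * psi_avg ?S y" by (simp only: append.simps mult_1_left)
    then show ?thesis by (simp only: minus_mult_left [symmetric] add_uminus_conv_diff eq_diff_eq)
  qed
  have 2: "psi_avg ?S (y(k := y k + 1)) = psi_avg ?S y + (- ?b) * psi_avg ?W y" if y: "y \<in> RN N" for y
  proof -
    let ?y = "y(k := y k + 1)"
    have y': "?y \<in> RN N" by (rule RN_upd [OF y k'(2)])
    have "map (pl (runit k)) ?S = [] @ (\<lambda>i. 1 * cpl 0 i + ?b * cpl 2 i) # [cpl 3, ?c 3, ?c 2]"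
      using pl_cpl [of 0 "runit k"] by (simp add: pl_cpl_fibre pl_conj_cpl_fibre numeral_2_eq_2 del: One_nat_def)
    then have "psi_avg ?S y = psi_avg ([] @ (\<lambda>i. 1 * cpl 0 i + ?b * cpl 2 i) # [cpl 3, ?c 3, ?c 2]) ?y"
      using psi_avg_shift [OF k'(1) y CN(2)] by (simp only:)
    also have "\<dots> = 1 * psi_avg ([] @ cpl 0 # [cpl 3, ?c 3, ?c 2]) ?y + ?b * psi_avg ([] @ cpl 2 # [cpl 3, ?c 3, ?c 2]) ?y"
      by (rule psi_avg_lin [OF _ _ C(1) C(1) y']) (use C [of 0] C [of 2] C [of 3] in simp_all)
    also have "psi_avg ([] @ cpl 2 # [cpl 3, ?c 3, ?c 2]) ?y = psi_avg ?W y"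
      using psi_avg_shift [OF k'(1) y CN(3)] by (simp add: pl_cpl_fibre pl_conj_cpl_fibre)
    finally have "psi_avg ?S y = psi_avg ?S ?y + ?b * psi_avg ?W y" by (simp only: append.simps mult_1_left)
    then show ?thesis by (simp only: minus_mult_left [symmetric] add_uminus_conv_diff eq_diff_eq)
  qed
  have "avgs (?B @ ?F) (partial_deriv l (partial_deriv k (\<lambda>z. psi z ?H))) (\<lambda>i. 0) =
      avgs ?B (partial_deriv l (partial_deriv k (psi_avg ?H))) (\<lambda>i. 0)"
    unfolding psi_avg_def by (rule avgs_second_deriv_append [OF smooth_psi [OF CN(1)] l'(2,3) k'(2,3) js zero_RN])
  also have "\<dots> = (- ?d) * (- ?b) * avgs (remove1 k (remove1 l ?B)) (\<lambda>y. psi_avg ?W (y(l := 0, k := 0))) (\<lambda>i. 0)"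
    by (rule avgs_second_deriv [where F = "psi_avg ?H" and S = "psi_avg ?S" and W = "psi_avg ?W" and d = "- ?d" and b = "- ?b",
          OF smooth_psi_avg [OF CN(1)] smooth_psi_avg [OF CN(2)] smooth_psi_avg [OF CN(3)]
          l'(4) k'(4) lk js(1) zero_RN 1 2])
  finally show ?thesis by (simp only: minus_mult_minus)
qed

text \<open>The coefficients 1, -i of Z_2 and 1, i of conj Z_1 are the conjugates of the
  corresponding shift factors. All four pairs of coordinates therefore enter with coefficient 1, and
  four negative real parts cannot cancel.\<close>

lemma avg_DD_main:
  "Re (avg_DD (cpl 1) (conj_vec (cpl 0)) [cpl 0, cpl 3, conj_vec (cpl 1), conj_vec (cpl 2)]) < 0"
proof -
  let ?c = "\<lambda>k. conj_vec (cpl k)"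
  let ?H = "[cpl 0, cpl 3, ?c 1, ?c 2]" and ?W = "[cpl 2, cpl 3, ?c 3, ?c 2]" and ?B = "[0, 1, 2, 3::nat]"
  define A where "A l k = avgs (remove1 k (remove1 l ?B)) (\<lambda>y. psi_avg ?W (y(l := 0, k := 0))) (\<lambda>i. 0)" for l k
  have C: "cpl k \<in> CN N" "?c k \<in> CN N" if "k < 4" for k using cpl_CN [OF that] conj_vec_CN [OF cpl_CN [OF that]] .
  have CN: "?H \<in> lists (CN N)" "?W \<in> lists (CN N)" using C [of 0] C [of 1] C [of 2] C [of 3] by simp_all
  have neg: "Re (A l k) < 0" if "l < N" "k < N" for l k
    unfolding A_def
  proof (rule avgs_neg [OF _ _ remove1_lists [OF remove1_lists [OF js(1)]] zero_RN])
    have c: "continuous_on (RN N) (psi_avg ?W)" by (rule smooth_continuous [OF smooth_psi_avg [OF CN(2)]])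
    show "continuous_on (RN N) (\<lambda>y. psi_avg ?W (y(l := 0, k := 0)))"
      by (rule continuous_on_upd [where h = "\<lambda>y. psi_avg ?W (y(k := 0))" and p = "\<lambda>y. y",
            OF continuous_on_upd [where p = "\<lambda>y. y", OF c that(2) continuous_on_id continuous_on_const]
              that(1) continuous_on_id continuous_on_const])
    fix y assume y: "y \<in> RN N"
    show "Re (psi_avg ?W (y(l := 0, k := 0))) < 0"
      unfolding psi_avg_def
      by (rule avgs_neg [OF smooth_continuous [OF smooth_psi [OF CN(2)]] psi_fibre js(2)], assumption, intro RN_upd y that)
  qed
  have d: "zeta 1 (complexify (runit 2)) = 1" "zeta 1 (complexify (runit 3)) = \<i>"
    "zbar 0 (complexify (runit 0)) = 1" "zbar 0 (complexify (runit 1)) = - \<i>"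
    by (simp_all add: zeta_runit zbar_runit)
  have "avg_DD (cpl 1) (?c 0) ?H =
      (zeta 1 (complexify (runit 2)) * zbar 0 (complexify (runit 0)) * A 2 0 - \<i> * (zeta 1 (complexify (runit 3)) * zbar 0 (complexify (runit 0)) * A 3 0))
      + \<i> * (zeta 1 (complexify (runit 2)) * zbar 0 (complexify (runit 1)) * A 2 1 - \<i> * (zeta 1 (complexify (runit 3)) * zbar 0 (complexify (runit 1)) * A 3 1))"
    unfolding avg_DD_expand [OF CN(1)] sum_cpl_1 sum_conj_cpl_0 A_def
    by (intro arg_cong2 [where f = "(+)"] arg_cong2 [where f = "(-)"] arg_cong2 [where f = "(*)"] refl psi_avg_second_deriv) simp_all
  also have "\<dots> = A 2 0 + A 3 0 + A 2 1 + A 3 1"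
    unfolding d by (simp add: algebra_simps)
  finally have "avg_DD (cpl 1) (?c 0) ?H = A 2 0 + A 3 0 + A 2 1 + A 3 1" .
  moreover have "Re (A 2 0) < 0" "Re (A 3 0) < 0" "Re (A 2 1) < 0" "Re (A 3 1) < 0" by (rule neg; simp)+
  ultimately show ?thesis by simp
qed

lemma not_BC_formal: "\<not> geometrically_BC_formal 4 KT KT_lattice stdJ g"
proof
  assume formal: "geometrically_BC_formal 4 KT KT_lattice stdJ g"
  let ?c = "\<lambda>k. conj_vec (cpl k)"
  have t: "cpl k \<in> t10 N" "?c k \<in> t01 N" if "k < 4" for k using cpl_t10 [OF that] conj_t01 [OF cpl_t10 [OF that]] .
  have C: "cpl k \<in> CN N" "?c k \<in> CN N" if "k < 4" for k using cpl_CN [OF that] conj_vec_CN [OF cpl_CN [OF that]] .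
  let ?us = "[cpl 0, cpl 1, cpl 3]" and ?ws = "[?c 0, ?c 1, ?c 2]"
  have us: "?us \<in> lists (t10 N)" using t(1) [of 0] t(1) [of 1] t(1) [of 3] by simp
  have ws: "?ws \<in> lists (t01 N)" using t(2) [of 0] t(2) [of 1] t(2) [of 2] by simp
  have js': "[0, 1, 2, 3] @ [4, 5, 6, 7] \<in> lists {..<N}" by simp
  have sum: "(\<Sum>i<length ?us. (-1) ^ i * (\<Sum>j<length ?ws. (-1) ^ (length ?us - 1 + j) *
      avg_DD (?us ! i) (?ws ! j) ((take i ?us @ drop (Suc i) ?us) @ take j ?ws @ drop (Suc j) ?ws))) = 0"
    unfolding avg_DD_def
    by (rule avgs_del_delbar [OF is_form_psi us ws _ del_delbar_psi [OF formal] js' zero_RN]) simp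
  note nz = cpl_nz(1) [of 0, simplified] cpl_nz(1) [of 1, simplified] cpl_nz(1) [of 3, simplified]
    cpl_nz(2) [of 0, simplified] cpl_nz(2) [of 1, simplified] cpl_nz(2) [of 2, simplified]
  have CN: "[cpl i, cpl j, ?c k, ?c l] \<in> lists (CN N)" if "i < 4" "j < 4" "k < 4" "l < 4" for i j k l
    using C(1) [OF that(1)] C(1) [OF that(2)] C(2) [OF that(3)] C(2) [OF that(4)] by simp
  \<comment> \<open>A derivative along conj W_1, and likewise along W_2 below, involves fibre
    coordinates only.\<close>
  have w: "avg_DD v (?c 2) [cpl i, cpl j, ?c k, ?c l] = 0" if "i < 4" "j < 4" "k < 4" "l < 4" for v i j k l
  proof (rule avg_DD_zero [OF CN [OF that]])
    fix l' k' assume "?c 2 k' \<noteq> 0"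
    from cpl_nz(2) [OF this] show "4 \<le> l' \<or> 4 \<le> k' \<or> per N l' (psi_avg [cpl i, cpl j, ?c k, ?c l])" by auto
  qed
  have v: "avg_DD (cpl 3) w [cpl i, cpl j, ?c k, ?c l] = 0" if "i < 4" "j < 4" "k < 4" "l < 4" for w i j k l
  proof (rule avg_DD_zero [OF CN [OF that]])
    fix l' k' assume "cpl 3 l' \<noteq> 0"
    from cpl_nz(1) [OF this] show "4 \<le> l' \<or> 4 \<le> k' \<or> per N l' (psi_avg [cpl i, cpl j, ?c k, ?c l])" by auto
  qed
  \<comment> \<open>Neither Z_1 nor conj Z_1 is among the remaining arguments, so translations along
    the coordinates of z_1 fix all of them.\<close>
  have z00: "avg_DD (cpl 0) w [cpl 1, cpl 3, ?c 1, ?c 2] = 0" for w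
  proof (rule avg_DD_zero [OF CN])
    fix l k assume "cpl 0 l \<noteq> 0"
    then have l: "l = 0 \<or> l = 1" using cpl_nz(1) by fastforce
    have "per N l (psi_avg [cpl 1, cpl 3, ?c 1, ?c 2])"
      by (rule psi_avg_per [OF _ CN], use l in auto)
         (auto simp: pl_runit_cpl pl_cpl_fibre pl_conj_cpl_fibre simp del: One_nat_def)
    then show "4 \<le> l \<or> 4 \<le> k \<or> per N l (psi_avg [cpl 1, cpl 3, ?c 1, ?c 2])" by blast
  qed simp_all
  \<comment> \<open>Here conj Z_1 remains and picks up a multiple of conj W_1, but conj W_1 is
    already an argument, so the extra term has a repeated entry.\<close>
  have z01: "avg_DD (cpl 0) w [cpl 1, cpl 3, ?c 0, ?c 2] = 0" for w
  proof (rule avg_DD_zero [OF CN])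
    fix l k assume "cpl 0 l \<noteq> 0"
    then have l: "l = 0 \<or> l = 1" using cpl_nz(1) by fastforce
    have "per N l (psi_avg [cpl 1, cpl 3, ?c 0, ?c 2])"
    proof (rule psi_avg_per [OF _ CN])
      fix x assume x: "x \<in> RN N"
      let ?d = "zeta 0 (complexify (runit l))"
      have l': "l \<noteq> 2 * 1" "l \<noteq> 2 * 1 + 1" using l by auto
      have p: "pl (runit l) (cpl 1) = cpl 1" by (rule pl_runit_cpl(1) [OF _ l']) simp
      have "pl (runit l) (?c 0) = (\<lambda>i. 1 * ?c 0 i + ?d * ?c 2 i)"
        using pl_conj_cpl [of 0 "runit l"] by (simp add: numeral_2_eq_2 del: One_nat_def)
      then have "map (pl (runit l)) [cpl 1, cpl 3, ?c 0, ?c 2] = [cpl 1, cpl 3] @ (\<lambda>i. 1 * ?c 0 i + ?d * ?c 2 i) # [?c 2]"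
        by (simp only: list.map p append.simps) (simp add: pl_cpl_fibre pl_conj_cpl_fibre)
      then have "psi_avg (map (pl (runit l)) [cpl 1, cpl 3, ?c 0, ?c 2]) x =
          psi_avg ([cpl 1, cpl 3] @ (\<lambda>i. 1 * ?c 0 i + ?d * ?c 2 i) # [?c 2]) x" by (simp only:)
      also have "\<dots> = 1 * psi_avg ([cpl 1, cpl 3] @ ?c 0 # [?c 2]) x + ?d * psi_avg ([cpl 1, cpl 3] @ ?c 2 # [?c 2]) x"
        by (rule psi_avg_lin [OF _ _ C(2) C(2) x]) (use C [of 1] C [of 2] C [of 3] in simp_all)
      also have "psi_avg ([cpl 1, cpl 3] @ ?c 2 # [?c 2]) x = 0"
        by (rule psi_avg_repeated [OF _ _ _ x]) (use C [of 1] C [of 2] C [of 3] in simp_all)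
      finally show "psi_avg (map (pl (runit l)) [cpl 1, cpl 3, ?c 0, ?c 2]) x = psi_avg [cpl 1, cpl 3, ?c 0, ?c 2] x"
        by simp
    qed (use l in auto)
    then show "4 \<le> l \<or> 4 \<le> k \<or> per N l (psi_avg [cpl 1, cpl 3, ?c 0, ?c 2])" by blast
  qed simp_all
  \<comment> \<open>Both Z_2 and conj Z_2 have been removed, so translations along the coordinates
    of z_2 fix the remaining arguments.\<close>
  have z11: "avg_DD (cpl 1) w [cpl 0, cpl 3, ?c 0, ?c 2] = 0" for w
  proof (rule avg_DD_zero [OF CN])
    fix l k assume "cpl 1 l \<noteq> 0"
    then have l: "l = 2 \<or> l = 3" using cpl_nz(1) by fastforce
    have "per N l (psi_avg [cpl 0, cpl 3, ?c 0, ?c 2])"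
      by (rule psi_avg_per [OF _ CN], use l in auto)
         (auto simp: pl_runit_cpl pl_cpl_fibre pl_conj_cpl_fibre simp del: One_nat_def)
    then show "4 \<le> l \<or> 4 \<le> k \<or> per N l (psi_avg [cpl 0, cpl 3, ?c 0, ?c 2])" by blast
  qed simp_all
  \<comment> \<open>Of the nine terms, five contain a fibre derivative and three more vanish by the
    periodicity just shown. The one left, with del along Z_2 and delbar along conj Z_1, has a
    nonzero sign as its factor.\<close>
  have "avg_DD (cpl 1) (?c 0) [cpl 0, cpl 3, ?c 1, ?c 2] = 0"
    using sum by (simp add: w v z00 z01 z11 del: One_nat_def)
  with avg_DD_main show False by simp
qed

end

theorem proposition4p8:
  shows "\<exists>(n :: nat) (G :: pt monoid) (\<Gamma> :: pt set) (J :: tensor2).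
    nilmanifold (2 * n) G \<Gamma> \<and>
    invariant_complex_structure n G J \<and>
    nilpotent_complex_structure n G J \<and>
    (\<exists>g. hermitian_metric n G \<Gamma> J g \<and> SKT n J g) \<and>
    \<not> (\<exists>g. hermitian_metric n G \<Gamma> J g \<and> geometrically_BC_formal n G \<Gamma> J g)"
proof (intro exI conjI notI)
  show "nilmanifold (2 * 4) KT KT_lattice" by (rule nilmanifold_KT)
  show "invariant_complex_structure 4 KT stdJ" by (rule invariant_complex_structure_KT)
  show "nilpotent_complex_structure 4 KT stdJ" by (rule nilpotent_complex_structure_KT)
  show "hermitian_metric 4 KT KT_lattice stdJ gKT" by (rule hermitian_gKT)
  show "SKT 4 stdJ gKT" by (rule SKT_gKT)
  assume "\<exists>g. hermitian_metric 4 KT KT_lattice stdJ g \<and> geometrically_BC_formal 4 KT KT_lattice stdJ g"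
  then obtain g where g: "hermitian_metric 4 KT KT_lattice stdJ g" "geometrically_BC_formal 4 KT KT_lattice stdJ g" by blast
  from g(1) interpret KT_metric g by (rule KT_metric.intro)
  from not_BC_formal g(2) show False by blast
qed

end
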